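(* Let $d_0 \geq 2$ and let $\mathcal{T}_{[d_0]}$ be the rooted tree in which every vertex has exactly $d_0-1$ offspring (so every non-root vertex has $d_0$ neighbours). If $d_0 \geq 1287$ then $\big[ d_0^{-1} + 3 d_0^{-2}, \infty\big) \subseteq \mathscr{T}^{\mathcal{T}_{[d_0]}}$. Moreover, for any $\epsilon > 0$ there exists $d_0' \in \mathbb{N}$ such that if $d_0 \geq d_0'$ then $\big[ d_0^{-1} + (\tfrac{13}{6} + \epsilon) d_0^{-2}, \infty\big) \subseteq \mathscr{T}^{\mathcal{T}_{[d_0]}}$.
   Context: For a graph $G$, $\mathscr{T}^G$ denotes the set of $T>0$ such that the random stirring model on $G$ with parameter $T$ has infinite cycles (cycles with infinitely many elements) almost surely. The random stirring model with parameter $T$ is the random permutation $\sigma_T$ of $V(G)$, where $(\sigma_t)_{t\ge0}$ starts at the identity and, independently for each edge $e$, the transposition of the endpoints of $e$ is composed at each point of a rate-one Poisson process on $[0,\infty)$. *)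

theory Defs
  imports "HOL-Probability.Probability"
begin

text \<open>The rooted tree in which every vertex has exactly d-1 offspring: vertices are
  finite words over the alphabet {0..<d-1}; the root is the empty word and the
  children of v are v @ [i] for i < d-1.  Each edge is labelled by its lower endpoint
  (a non-root vertex c), joining butlast c and c.\<close>

type_synonym vert = "nat list"

definition tree_verts :: "nat \<Rightarrow> vert set" where
  "tree_verts d = {v. \<forall>i\<in>set v. i < d - 1}"

definition tree_edges :: "nat \<Rightarrow> vert set" where
  "tree_edges d = {c \<in> tree_verts d. c \<noteq> []}"

definition incident :: "nat \<Rightarrow> vert \<Rightarrow> vert set" where
  "incident d v = {c \<in> tree_edges d. v = c \<or> v = butlast c}"

definition across :: "vert \<Rightarrow> vert \<Rightarrow> vert" where
  "across c v = (if v = c then butlast c else c)"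

text \<open>Sample point: omega (c, k) is the k-th interarrival time of the rate-one Poisson
  process attached to edge c; the ring times are the partial sums.\<close>

definition ring_time :: "(vert \<times> nat \<Rightarrow> real) \<Rightarrow> vert \<Rightarrow> nat \<Rightarrow> real" where
  "ring_time \<omega> c k = (\<Sum>j\<le>k. \<omega> (c, j))"

definition candidates :: "nat \<Rightarrow> (vert \<times> nat \<Rightarrow> real) \<Rightarrow> real \<Rightarrow> vert \<Rightarrow> real \<Rightarrow> (vert \<times> nat) set" where
  "candidates d \<omega> T v s =
     {(c, k). c \<in> incident d v \<and> s < ring_time \<omega> c k \<and> ring_time \<omega> c k \<le> T}"

definition stir_step :: "nat \<Rightarrow> (vert \<times> nat \<Rightarrow> real) \<Rightarrow> real \<Rightarrow> vert \<times> real \<Rightarrow> vert \<times> real" where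
  "stir_step d \<omega> T vs =
     (let C = candidates d \<omega> T (fst vs) (snd vs);
          isfirst = (\<lambda>p. p \<in> C \<and> (\<forall>q\<in>C. ring_time \<omega> (fst p) (snd p) \<le> ring_time \<omega> (fst q) (snd q)))
      in if \<exists>p. isfirst p
         then (let p = (SOME p. isfirst p) in (across (fst p) (fst vs), ring_time \<omega> (fst p) (snd p)))
         else vs)"

text \<open>sigma_T(x): the position at time T of the particle started at x, i.e. the image of x
  under the composition of all transpositions rung in [0,T] in time order.  (Well defined
  almost surely; on the null set where the particle makes infinitely many jumps we put x.)\<close>
definition stir_perm :: "nat \<Rightarrow> (vert \<times> nat \<Rightarrow> real) \<Rightarrow> real \<Rightarrow> vert \<Rightarrow> vert" where
  "stir_perm d \<omega> T x =
     (if \<exists>n. (stir_step d \<omega> T ^^ Suc n) (x, 0) = (stir_step d \<omega> T ^^ n) (x, 0)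
      then fst ((stir_step d \<omega> T ^^ (LEAST n. (stir_step d \<omega> T ^^ Suc n) (x, 0) = (stir_step d \<omega> T ^^ n) (x, 0))) (x, 0))
      else x)"

definition has_infinite_cycle :: "vert set \<Rightarrow> (vert \<Rightarrow> vert) \<Rightarrow> bool" where
  "has_infinite_cycle V \<sigma> \<longleftrightarrow> (\<exists>x\<in>V. infinite (range (\<lambda>n. (\<sigma> ^^ n) x)))"

definition stirring_space :: "nat \<Rightarrow> (vert \<times> nat \<Rightarrow> real) measure" where
  "stirring_space d = PiM (tree_edges d \<times> UNIV) (\<lambda>_. density lborel (exponential_density 1))"

definition inf_cycle_params :: "nat \<Rightarrow> real set" where
  "inf_cycle_params d = {T. T > 0 \<and>
      (AE \<omega> in stirring_space d. has_infinite_cycle (tree_verts d) (stir_perm d \<omega> T))}"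

end

theory Submission
  imports Defs
begin

text \<open>
Let \<open>m = d0 - 1\<close> and call the Poisson points in \<open>(0, T)\<close> of an edge its bars.  Following the cycle of
\<open>x\<close> means letting time run around the circle of length \<open>T\<close>, crossing every bar one meets.  Almost
surely one lap around the circle visits only finitely many vertices (in a short time slot the edges
that ring percolate subcritically), so the cycle is infinite as soon as this walk gets arbitrarily far
from the root.

By independence of the subtrees hanging off one ray it suffices that the walk started at a
vertex without bar above it reaches every depth \<open>n\<close> with probability at least some \<open>\<beta> > 0\<close> not
depending on \<open>n\<close>, and this is shown by induction on \<open>n\<close>.

If \<open>m T \<le> 30\<close>, consider the children joined by a single bar \<open>x\<close> such that no sibling has bars both
before and after \<open>x\<close>.  A walk cannot come back to its entry time without using \<open>x\<close>, so it escapes if one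
of these children lets it escape.  Their expected number is at least
\<open>m exp (-T) (T - (m - 1) T\<^sup>3 / 6)\<close>, which exceeds \<open>1\<close> since \<open>T > 1/d0 + (13/6) / d0\<^sup>2\<close>
up to lower order: a supercritical branching bound.

If \<open>m T \<ge> 30\<close>, the walk finds a bar to some child within time \<open>h = 5/m\<close> with probability close to \<open>1\<close>,
and after a return it finds a bar to a different child within another time \<open>h\<close>.  Two attempts with
success probability \<open>1/4\<close> each, minus small errors, again succeed with probability at least \<open>1/4\<close>.
\<close>

section \<open>Poisson point sets on an interval\<close>

text \<open>The constant 13/6 is 1 + 1 + 1/6. Put M = m and y = m T. A good bar is alone on its
  edge, which costs exp (-T), about 1 - y/M; a sibling straddles a bar at distance u with
  probability about u (T - u), and integrating over u and summing over siblings costs y^2 / (6 M).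
  Near y = 1 the mean exceeds 1 once M (y - 1) > 1 + 1/6, and passing from 1/m to 1/d0 supplies the
  other 1.

  The obstacle is that the time of a return from a subtree depends on the whole subtree.
  Conditioning is therefore done by resampling edges (\<open>mrg\<close>), by Mecke's formula, which
  singles out the bar used and deletes it, and by monotonicity: deleting exits of a subtree never
  destroys an escape. Reversibility of the motion makes return times injective and so rules out a
  walk that circles for ever at one vertex. The threshold 30 is not critical: long times need room
  for two windows of length 5/m, short times need M to dominate y + y^2/6.\<close>

text \<open>The void events generate too few sets to decide membership of a point in an infinite
  configuration, which is why many definitions below carry a \<open>finite\<close> guard.\<close>
definition pts :: "real set measure" where
  "pts = sigma UNIV {{B. B \<inter> A = {}} | A. A \<in> sets borel}"

lemma space_pts [simp]: "space pts = UNIV"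
  unfolding pts_def by (simp add: space_measure_of_conv)

lemma sets_pts: "sets pts = sigma_sets UNIV {{B. B \<inter> A = {}} | A. A \<in> sets borel}"
  unfolding pts_def by (simp add: sets_measure_of_conv)

lemma measurable_ptsI:
  assumes "\<And>A. A \<in> sets borel \<Longrightarrow> {x \<in> space M. f x \<inter> A = {}} \<in> sets M"
  shows "f \<in> measurable M pts"
  unfolding pts_def
proof (rule measurable_measure_of)
  fix y assume "y \<in> {{B. B \<inter> A = {}} | A. A \<in> sets (borel :: real measure)}"
  then obtain A where A: "A \<in> sets borel" "y = {B. B \<inter> A = {}}" by auto
  show "f -` y \<inter> space M \<in> sets M"
    using assms[OF A(1)] unfolding A(2) vimage_def Int_def[of _ "space M"] mem_Collect_eq
    by (simp add: conj_commute Int_def del: disjoint_iff)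
qed auto

lemma pred_void [measurable (raw)]:
  assumes f: "f \<in> measurable M pts" and A: "A \<in> sets borel"
  shows "Measurable.pred M (\<lambda>x. f x \<inter> A = {})"
proof -
  have "{B. B \<inter> A = {}} \<in> sets pts"
    unfolding sets_pts using A by (intro sigma_sets.Basic) auto
  from measurable_sets[OF f this] show ?thesis
    by (simp add: pred_def vimage_def Int_def[of _ "space M"] conj_commute)
qed

text \<open>The endpoints are random, so this is no generator. An open interval is the union of its
  rational subintervals, which reduces the claim to countably many fixed void events.\<close>

lemma pred_void_interval [measurable (raw)]:
  fixes a b :: "'a \<Rightarrow> real"
  assumes [measurable]: "f \<in> measurable M pts" "a \<in> borel_measurable M" "b \<in> borel_measurable M"
  shows "Measurable.pred M (\<lambda>x. f x \<inter> {a x <..< b x} = {})"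
proof -
  have "f x \<inter> {a x <..< b x} = {} \<longleftrightarrow>
      (\<forall>p\<in>\<rat>. \<forall>q\<in>\<rat>. a x \<le> p \<longrightarrow> q \<le> b x \<longrightarrow> f x \<inter> {p<..<q} = {})" for x
  proof safe
    fix y assume *: "\<forall>p\<in>\<rat>. \<forall>q\<in>\<rat>. a x \<le> p \<longrightarrow> q \<le> b x \<longrightarrow> f x \<inter> {p<..<q} = {}"
      "y \<in> f x" "y \<in> {a x <..< b x}"
    obtain p where "p \<in> \<rat>" "a x < p" "p < y" using Rats_dense_in_real[of "a x" y] * by auto
    moreover obtain q where "q \<in> \<rat>" "y < q" "q < b x" using Rats_dense_in_real[of y "b x"] * by auto
    ultimately show "y \<in> {}" using * by fastforce
  qed fastforce
  then show ?thesis
    using countable_rat by (simp only:) measurable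
qed

lemma pred_void_greaterThan [measurable (raw)]:
  fixes a :: "'a \<Rightarrow> real"
  assumes [measurable]: "f \<in> measurable M pts" "a \<in> borel_measurable M"
  shows "Measurable.pred M (\<lambda>x. f x \<inter> {a x <..} = {})"
proof -
  have "f x \<inter> {a x <..} = {} \<longleftrightarrow> (\<forall>n::nat. f x \<inter> {a x <..< real n} = {})" for x
    by (auto simp: set_eq_iff) (meson reals_Archimedean2)
  then show ?thesis by simp
qed

lemma pred_void_lessThan [measurable (raw)]:
  fixes a :: "'a \<Rightarrow> real"
  assumes [measurable]: "f \<in> measurable M pts" "a \<in> borel_measurable M"
  shows "Measurable.pred M (\<lambda>x. f x \<inter> {..< a x} = {})"
proof -
  have "f x \<inter> {..< a x} = {} \<longleftrightarrow> (\<forall>n::nat. f x \<inter> {- real n <..< a x} = {})" for x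
    by (auto simp: set_eq_iff) (metis neg_less_iff_less minus_minus reals_Archimedean2)
  then show ?thesis by simp
qed

lemma measurable_pts_Int [measurable (raw)]:
  assumes [measurable]: "f \<in> measurable M pts" "A \<in> sets borel"
  shows "(\<lambda>x. f x \<inter> A) \<in> measurable M pts"
  by (rule measurable_ptsI) (simp add: Int_assoc)

lemma measurable_pts_Diff [measurable (raw)]:
  assumes [measurable]: "f \<in> measurable M pts" "A \<in> sets borel"
  shows "(\<lambda>x. f x - A) \<in> measurable M pts"
  using measurable_pts_Int[OF assms(1), of "- A"] by (simp add: Diff_eq)

lemma measurable_pts_Un [measurable (raw)]:
  assumes [measurable]: "f \<in> measurable M pts" "g \<in> measurable M pts"
  shows "(\<lambda>x. f x \<union> g x) \<in> measurable M pts"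
  by (rule measurable_ptsI) (simp add: Int_Un_distrib2)

lemma measurable_pts_UN [measurable (raw)]:
  assumes "countable I" and [measurable]: "\<And>i. i \<in> I \<Longrightarrow> f i \<in> measurable M pts"
  shows "(\<lambda>x. \<Union>i\<in>I. f i x) \<in> measurable M pts"
proof (rule measurable_ptsI)
  fix A :: "real set" assume [measurable]: "A \<in> sets borel"
  have "{x \<in> space M. (\<Union>i\<in>I. f i x) \<inter> A = {}} = {x \<in> space M. \<forall>i\<in>I. f i x \<inter> A = {}}"
    by auto
  also have "\<dots> \<in> sets M" using assms(1) by simp
  finally show "{x \<in> space M. (\<Union>i\<in>I. f i x) \<inter> A = {}} \<in> sets M" .
qed

lemma measurable_pts_insert [measurable (raw)]:
  assumes [measurable]: "f \<in> measurable M pts" "a \<in> borel_measurable M"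
  shows "(\<lambda>x. insert (a x) (f x)) \<in> measurable M pts"
proof (rule measurable_ptsI)
  fix A :: "real set" assume [measurable]: "A \<in> sets borel"
  have "{x \<in> space M. insert (a x) (f x) \<inter> A = {}} = {x \<in> space M. a x \<notin> A \<and> f x \<inter> A = {}}"
    by auto
  also have "\<dots> \<in> sets M" by simp
  finally show "{x \<in> space M. insert (a x) (f x) \<inter> A = {}} \<in> sets M" .
qed

text \<open>A hit of \<open>A\<close> other than \<open>a x\<close> lies strictly to its left or
  strictly to its right; cutting down to \<open>A\<close> first leaves only rays with a random
  endpoint to be void.\<close>

lemma measurable_pts_remove [measurable (raw)]:
  assumes [measurable]: "f \<in> measurable M pts" "a \<in> borel_measurable M"
  shows "(\<lambda>x. f x - {a x}) \<in> measurable M pts"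
proof (rule measurable_ptsI)
  fix A :: "real set" assume [measurable]: "A \<in> sets borel"
  have "{x \<in> space M. (f x - {a x}) \<inter> A = {}} =
      {x \<in> space M. (f x \<inter> A) \<inter> {..<a x} = {} \<and> (f x \<inter> A) \<inter> {a x<..} = {}}"
    by (auto simp: set_eq_iff) (metis not_less_iff_gr_or_eq)
  also have "\<dots> \<in> sets M" by simp
  finally show "{x \<in> space M. (f x - {a x}) \<inter> A = {}} \<in> sets M" .
qed

section \<open>Enumerating a finite point set from left to right\<close>

definition after :: "real set \<Rightarrow> real \<Rightarrow> real" where
  "after B t = (if B \<inter> {t<..} = {} then t else Inf (B \<inter> {t<..}))"

lemma measurable_after [measurable (raw)]:
  assumes [measurable]: "f \<in> measurable M pts" "g \<in> borel_measurable M"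
  shows "(\<lambda>x. after (f x) (g x)) \<in> borel_measurable M"
proof (rule borel_measurableI_less)
  fix u :: real
  have *: "after (f x) (g x) < u \<longleftrightarrow>
     (if f x \<inter> {g x <..} = {} then g x < u else f x \<inter> {g x <..< u} \<noteq> {})" for x
  proof (cases "f x \<inter> {g x <..} = {}")
    case False
    then have "after (f x) (g x) < u \<longleftrightarrow> (\<exists>b\<in>f x \<inter> {g x <..}. b < u)"
      unfolding after_def if_not_P[OF False]
      by (intro cInf_less_iff) (auto intro!: bdd_belowI[of _ "g x"])
    then show ?thesis using False by auto
  qed (auto simp: after_def)
  show "{x \<in> space M. after (f x) (g x) < u} \<in> sets M"
    unfolding * by measurable
qed

lemma after_props:
  assumes "finite B" "B \<inter> {a<..} \<noteq> {}"
  shows "after B a \<in> B" "a < after B a" "B \<inter> {a<..} = insert (after B a) (B \<inter> {after B a<..})"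
proof -
  have "after B a = Min (B \<inter> {a<..})" using assms by (simp add: after_def cInf_eq_Min)
  then have *: "after B a \<in> B \<inter> {a<..}" "\<And>b. b \<in> B \<inter> {a<..} \<Longrightarrow> after B a \<le> b"
    using assms by (auto intro: Min_le Min_in simp del: disjoint_iff) (use Min_in[of "B \<inter> {a<..}"] assms in blast)+
  then show "after B a \<in> B" "a < after B a" by auto
  then show "B \<inter> {a<..} = insert (after B a) (B \<inter> {after B a<..})"
    using *(2) by force
qed

lemma after_least: "b \<in> B \<Longrightarrow> a < b \<Longrightarrow> after B a \<le> b"
  unfolding after_def by (auto intro!: cInf_lower bdd_belowI[of _ a])

text \<open>Expresses finiteness by countably many measurable conditions: bounded below, and
  exhausted by finitely many successor steps. The start \<open>- real n - 1\<close> lies strictly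
  below \<open>- real n\<close>, so that a point at \<open>- real n\<close> itself is
  enumerated.\<close>

lemma finite_iff_after:
  "finite B \<longleftrightarrow> (\<exists>n k::nat. B \<inter> {..<- real n} = {} \<and> B \<inter> {(after B ^^ k) (- real n - 1)<..} = {})"
proof
  assume fin: "finite B"
  obtain n :: nat where n: "B \<inter> {..<- real n} = {}"
  proof -
    from fin have "bdd_below B" by simp
    then obtain c where c: "\<And>b. b \<in> B \<Longrightarrow> c \<le> b" by (auto simp: bdd_below_def)
    obtain n :: nat where "- c \<le> real n" using real_arch_simple by blast
    then show ?thesis using c by (intro that[of n]) force
  qed
  have "\<exists>k. B \<inter> {(after B ^^ k) a<..} = {}" for a
  proof (induction "card (B \<inter> {a<..})" arbitrary: a rule: less_induct)
    case less
    show ?case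
    proof (cases "B \<inter> {a<..} = {}")
      case False
      then have "card (B \<inter> {after B a<..}) < card (B \<inter> {a<..})"
        using fin after_props[OF fin False] by (intro psubset_card_mono) auto
      from less[OF this] obtain k where "B \<inter> {(after B ^^ k) (after B a)<..} = {}" by blast
      then show ?thesis by (intro exI[of _ "Suc k"]) (simp add: funpow_swap1)
    qed (auto intro!: exI[of _ 0])
  qed
  with n show "\<exists>n k::nat. B \<inter> {..<- real n} = {} \<and> B \<inter> {(after B ^^ k) (- real n - 1)<..} = {}"
    by blast
next
  assume "\<exists>n k::nat. B \<inter> {..<- real n} = {} \<and> B \<inter> {(after B ^^ k) (- real n - 1)<..} = {}"
  then obtain n k :: nat where *: "B \<inter> {..<- real n} = {}" "B \<inter> {(after B ^^ k) (- real n - 1)<..} = {}"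
    by blast
  let ?p = "\<lambda>j. (after B ^^ j) (- real n - 1)"
  have "B \<subseteq> ?p ` {..k}"
  proof
    fix b assume b: "b \<in> B"
    show "b \<in> ?p ` {..k}"
    proof (rule ccontr)
      assume nb: "b \<notin> ?p ` {..k}"
      have "j \<le> k \<Longrightarrow> ?p j < b" for j
      proof (induction j)
        case 0
        then show ?case using * b by (force simp: set_eq_iff not_less)
      next
        case (Suc j)
        then have "?p (Suc j) \<le> b" using b by (auto intro: after_least)
        moreover have "?p (Suc j) \<noteq> b" using nb Suc.prems by blast
        ultimately show ?case by simp
      qed
      from this[of k] show False using * b by auto
    qed
  qed
  then show "finite B" by (rule finite_subset) simp
qed

lemma measurable_after_funpow [measurable (raw)]:
  assumes [measurable]: "f \<in> measurable M pts" "a \<in> borel_measurable M"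
  shows "(\<lambda>x. (after (f x) ^^ k) (a x)) \<in> borel_measurable M"
  by (induction k) simp_all

lemma pred_finite_pts [measurable (raw)]:
  assumes [measurable]: "f \<in> measurable M pts"
  shows "Measurable.pred M (\<lambda>x. finite (f x))"
  unfolding finite_iff_after by measurable

lemma suminf_ennreal_head:
  fixes G :: "nat \<Rightarrow> ennreal"
  shows "(\<Sum>k. G k) = G 0 + (\<Sum>k. G (Suc k))"
  using suminf_offset[of G 1] by (simp add: add.commute)

text \<open>Iterating \<open>after\<close> from \<open>a\<close> lists the points beyond
  \<open>a\<close>; once they are exhausted \<open>after\<close> returns its argument and the guard
  kills all further terms. The series has measurable terms, whereas the sum has a random index
  set.\<close>

lemma sum_after:
  fixes f :: "real \<Rightarrow> ennreal"
  assumes fin: "finite B"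
  shows "(\<Sum>y\<in>B \<inter> {a<..}. f y) =
    (\<Sum>k. if B \<inter> {(after B ^^ k) a<..} = {} then 0 else f ((after B ^^ Suc k) a))"
proof (induction "card (B \<inter> {a<..})" arbitrary: a rule: less_induct)
  case less
  let ?g = "\<lambda>a k. if B \<inter> {(after B ^^ k) a<..} = {} then 0 else f ((after B ^^ Suc k) a)"
  show ?case
  proof (cases "B \<inter> {a<..} = {}")
    case True
    then have "after B a = a" by (simp add: after_def)
    then have "(after B ^^ k) a = a" for k by (induction k) auto
    then show ?thesis using True by simp
  next
    case False
    note A = after_props[OF fin False]
    then have "card (B \<inter> {after B a<..}) < card (B \<inter> {a<..})"
      using fin by (intro psubset_card_mono) auto
    note IH = less[OF this]
    have "(\<Sum>y\<in>B \<inter> {a<..}. f y) = f (after B a) + (\<Sum>y\<in>B \<inter> {after B a<..}. f y)"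
      using fin by (subst A(3)) (subst sum.insert, auto)
    also have "\<dots> = ?g a 0 + (\<Sum>k. ?g a (Suc k))"
    proof -
      have "?g a (Suc k) = ?g (after B a) k" for k by (simp only: funpow_Suc_right o_apply)
      then show ?thesis unfolding IH using False by (simp del: disjoint_iff)
    qed
    also have "\<dots> = (\<Sum>k. ?g a k)"
      by (rule suminf_ennreal_head[symmetric])
    finally show ?thesis .
  qed
qed

text \<open>A random set has no deterministic lower bound, so the enumeration starts at
  \<open>- real n\<close> and the supremum over \<open>n\<close> is taken. Infinite sets contribute
  the default 0 of \<open>sum\<close>.\<close>

lemma measurable_sum_pts [measurable (raw)]:
  fixes f :: "'a \<Rightarrow> real \<Rightarrow> ennreal"
  assumes [measurable]: "g \<in> measurable M pts"
    and f [measurable]: "case_prod f \<in> borel_measurable (M \<Otimes>\<^sub>M borel)"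
  shows "(\<lambda>x. \<Sum>y\<in>g x. f x y) \<in> borel_measurable M"
proof -
  let ?S = "\<lambda>x n. \<Sum>k. if g x \<inter> {(after (g x) ^^ k) (- real n)<..} = {} then 0
      else f x ((after (g x) ^^ Suc k) (- real n))"
  have "(\<Sum>y\<in>g x. f x y) = (if finite (g x) then SUP n. ?S x n else 0)" for x
  proof (cases "finite (g x)")
    case True
    have "(SUP n::nat. \<Sum>y\<in>g x \<inter> {- real n<..}. f x y) = (\<Sum>y\<in>g x. f x y)"
    proof (rule antisym)
      show "(SUP n::nat. \<Sum>y\<in>g x \<inter> {- real n<..}. f x y) \<le> (\<Sum>y\<in>g x. f x y)"
        using True by (intro SUP_least sum_mono2) auto
      obtain c where c: "\<And>b. b \<in> g x \<Longrightarrow> c \<le> b"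
        using True bdd_below_finite[of "g x"] by (auto simp: bdd_below_def)
      obtain n :: nat where "- c < real n" using reals_Archimedean2 by blast
      then have "g x \<inter> {- real n<..} = g x" using c by force
      then show "(\<Sum>y\<in>g x. f x y) \<le> (SUP n::nat. \<Sum>y\<in>g x \<inter> {- real n<..}. f x y)"
        by (intro SUP_upper2[of n]) auto
    qed
    then show ?thesis using True by (simp add: sum_after del: disjoint_iff)
  qed simp
  then show ?thesis by (simp del: disjoint_iff)
qed

text \<open>Existence is the nonvanishing of a sum of indicators. The guard is there because that
  sum is 0 by default on an infinite set.\<close>

lemma pred_ex_pts [measurable (raw)]:
  assumes g [measurable]: "g \<in> measurable M pts"
    and P [measurable]: "Measurable.pred (M \<Otimes>\<^sub>M borel) (\<lambda>(x, y). P x y)"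
  shows "Measurable.pred M (\<lambda>x. finite (g x) \<and> (\<exists>y\<in>g x. P x y))"
proof -
  have "finite (g x) \<and> (\<exists>y\<in>g x. P x y) \<longleftrightarrow> finite (g x) \<and> (\<Sum>y\<in>g x. indicator {y. P x y} y :: ennreal) \<noteq> 0" for x
    by (auto simp: sum_eq_0_iff indicator_def)
  moreover have "(\<lambda>x. \<Sum>y\<in>g x. indicator {y. P x y} y :: ennreal) \<in> borel_measurable M"
    by (rule measurable_sum_pts) (auto simp: indicator_def)
  ultimately show ?thesis by simp
qed

lemma pred_all_pts [measurable (raw)]:
  assumes g [measurable]: "g \<in> measurable M pts"
    and P [measurable]: "Measurable.pred (M \<Otimes>\<^sub>M borel) (\<lambda>(x, y). P x y)"
  shows "Measurable.pred M (\<lambda>x. finite (g x) \<and> (\<forall>y\<in>g x. P x y))"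
proof -
  have "finite (g x) \<and> (\<forall>y\<in>g x. P x y) \<longleftrightarrow> finite (g x) \<and> \<not> (finite (g x) \<and> (\<exists>y\<in>g x. \<not> P x y))" for x
    by auto
  moreover have "Measurable.pred M (\<lambda>x. finite (g x) \<and> (\<exists>y\<in>g x. \<not> P x y))"
    by (rule pred_ex_pts) auto
  ultimately show ?thesis by (simp only:) measurable
qed

lemma pred_mem_pts [measurable (raw)]:
  assumes [measurable]: "g \<in> measurable M pts" "a \<in> borel_measurable M"
  shows "Measurable.pred M (\<lambda>x. finite (g x) \<and> a x \<in> g x)"
proof -
  have "finite (g x) \<and> a x \<in> g x \<longleftrightarrow> finite (g x) \<and> (\<exists>y\<in>g x. y = a x)" for x by auto
  moreover have "Measurable.pred M (\<lambda>x. finite (g x) \<and> (\<exists>y\<in>g x. y = a x))"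
    by (rule pred_ex_pts) auto
  ultimately show ?thesis by simp
qed

section \<open>The rate-one Poisson process as a Poisson number of uniform points\<close>

definition unif :: "real \<Rightarrow> real measure" where
  "unif T = uniform_measure lborel {0<..<T}"

definition PP :: "real \<Rightarrow> real set measure" where
  "PP T = distr (measure_pmf (poisson_pmf T) \<Otimes>\<^sub>M PiM (UNIV :: nat set) (\<lambda>_. unif T)) pts
     (\<lambda>(n, U). U ` {..<n})"

lemma sets_PP [simp, measurable_cong]: "sets (PP T) = sets pts"
  by (simp add: PP_def)

lemma space_PP [simp]: "space (PP T) = UNIV"
  by (simp add: PP_def)

lemma sets_unif [simp, measurable_cong]: "sets (unif T) = sets borel"
  by (simp add: unif_def)

lemma space_unif [simp]: "space (unif T) = UNIV"
  by (simp add: unif_def)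

lemma measurable_point_image [measurable]:
  "(\<lambda>U. U ` {..<n::nat}) \<in> measurable (PiM UNIV (\<lambda>_. unif T)) pts"
proof (rule measurable_ptsI)
  fix A :: "real set" assume [measurable]: "A \<in> sets borel"
  have "{U \<in> space (PiM UNIV (\<lambda>_. unif T)). U ` {..<n} \<inter> A = {}} =
     {U \<in> space (PiM UNIV (\<lambda>_. unif T)). \<forall>i<n. U i \<notin> A}" by auto
  also have "\<dots> \<in> sets (PiM UNIV (\<lambda>_. unif T))" by measurable
  finally show "{U \<in> space (PiM UNIV (\<lambda>_. unif T)). U ` {..<n} \<inter> A = {}} \<in> sets (PiM UNIV (\<lambda>_. unif T))" .
qed

lemma measurable_point_image_pair [measurable]:
  "(\<lambda>(n, U). U ` {..<n::nat}) \<in> measurable (measure_pmf p \<Otimes>\<^sub>M PiM UNIV (\<lambda>_. unif T)) pts"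
proof -
  have "(\<lambda>x. (\<lambda>n x. snd x ` {..<n::nat}) (fst x) x) \<in> measurable (measure_pmf p \<Otimes>\<^sub>M PiM UNIV (\<lambda>_. unif T)) pts"
    by (rule measurable_compose_countable) auto
  then show ?thesis by (simp add: case_prod_beta')
qed

context
  fixes T :: real
  assumes T: "0 < T"
begin

lemma prob_space_unif: "prob_space (unif T)"
  unfolding unif_def using T by (intro prob_space_uniform_measure) auto

interpretation U: prob_space "unif T" by (rule prob_space_unif)
interpretation S: sequence_space "unif T" ..

lemma nn_integral_unif:
  assumes [measurable]: "f \<in> borel_measurable borel"
  shows "(\<integral>\<^sup>+x. f x \<partial>unif T) = (\<integral>\<^sup>+x\<in>{0<..<T}. f x \<partial>lborel) / ennreal T"
  unfolding unif_def using T by (subst nn_integral_uniform_measure) auto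

lemma emeasure_unif:
  assumes [measurable]: "A \<in> sets borel"
  shows "emeasure (unif T) A = emeasure lborel ({0<..<T} \<inter> A) / ennreal T"
  unfolding unif_def using T by (subst emeasure_uniform_measure) auto

lemma AE_unif: "AE x in unif T. 0 < x \<and> x < T"
  unfolding unif_def using T by (intro AE_uniform_measureI) auto

lemma AE_unif_neq: "AE x in unif T. x \<noteq> y"
proof -
  have "emeasure (unif T) {y} = 0"
    by (subst emeasure_unif)
       (auto simp: Int_insert_right ennreal_divide_eq_0_iff)
  then show ?thesis by (subst AE_iff_measurable[OF _ refl]) auto
qed

lemma AE_points:
  assumes "AE x in unif T. P x"
  shows "AE U in S.S. \<forall>i. P (U i)"
  using assms by (intro AE_all_countable[THEN iffD2] allI AE_PiM_component[OF prob_space_unif]) auto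

text \<open>The first coordinate of an i.i.d. sequence is independent of the shifted sequence, which
  has the same law.\<close>

lemma nn_integral_points_Suc:
  fixes f :: "real set \<Rightarrow> ennreal"
  assumes [measurable]: "f \<in> borel_measurable pts"
  shows "(\<integral>\<^sup>+U. f (U ` {..<Suc n}) \<partial>S.S) =
    (\<integral>\<^sup>+x. (\<integral>\<^sup>+U. f (insert x (U ` {..<n})) \<partial>S.S) \<partial>unif T)"
proof -
  have "(\<integral>\<^sup>+U. f (U ` {..<Suc n}) \<partial>S.S) =
      (\<integral>\<^sup>+U. f (U ` {..<Suc n}) \<partial>distr (unif T \<Otimes>\<^sub>M S.S) S.S (\<lambda>(s, \<omega>). case_nat s \<omega>))"
    by (simp only: S.PiM_iter)
  also have "\<dots> = (\<integral>\<^sup>+p. f (insert (fst p) (snd p ` {..<n})) \<partial>(unif T \<Otimes>\<^sub>M S.S))"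
    by (subst nn_integral_distr, measurable)
       (auto intro!: nn_integral_cong simp: lessThan_Suc_eq_insert_0 image_image)
  also have "\<dots> = (\<integral>\<^sup>+x. (\<integral>\<^sup>+U. f (insert x (U ` {..<n})) \<partial>S.S) \<partial>unif T)"
    by (subst S.nn_integral_fst[symmetric]) auto
  finally show ?thesis .
qed

lemma nn_integral_PP:
  fixes f :: "real set \<Rightarrow> ennreal"
  assumes [measurable]: "f \<in> borel_measurable pts"
  shows "(\<integral>\<^sup>+B. f B \<partial>PP T) =
    (\<Sum>n. ennreal (pmf (poisson_pmf T) n) * (\<integral>\<^sup>+U. f (U ` {..<n}) \<partial>S.S))"
proof -
  have "(\<integral>\<^sup>+B. f B \<partial>PP T) = (\<integral>\<^sup>+p. f (snd p ` {..<fst p}) \<partial>(measure_pmf (poisson_pmf T) \<Otimes>\<^sub>M S.S))"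
    unfolding PP_def by (subst nn_integral_distr) (auto intro!: nn_integral_cong)
  also have "\<dots> = (\<integral>\<^sup>+n. (\<integral>\<^sup>+U. f (U ` {..<n}) \<partial>S.S) \<partial>measure_pmf (poisson_pmf T))"
  proof -
    have "(\<lambda>p. f (case p of (n, U) \<Rightarrow> U ` {..<n})) \<in> borel_measurable (measure_pmf (poisson_pmf T) \<Otimes>\<^sub>M S.S)"
      by measurable
    then show ?thesis by (subst S.nn_integral_fst[symmetric]) (auto simp: case_prod_beta')
  qed
  also have "\<dots> = (\<Sum>n. ennreal (pmf (poisson_pmf T) n) * (\<integral>\<^sup>+U. f (U ` {..<n}) \<partial>S.S))"
    by (simp add: nn_integral_measure_pmf nn_integral_count_space_nat)
  finally show ?thesis .
qed

lemma prob_space_PP: "prob_space (PP T)"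
proof -
  interpret P: pair_prob_space "measure_pmf (poisson_pmf T)" S.S ..
  show ?thesis unfolding PP_def by (intro P.prob_space_distr) measurable
qed

lemma AE_PP: "AE B in PP T. finite B \<and> B \<subseteq> {0<..<T}"
proof -
  have [measurable]: "Measurable.pred pts (\<lambda>B. finite B \<and> B \<subseteq> {0<..<T})"
  proof -
    have "(finite B \<and> B \<subseteq> {0<..<T}) \<longleftrightarrow> finite B \<and> B \<inter> - {0<..<T} = {}" for B by auto
    then show ?thesis by (simp only:) measurable
  qed
  have "(\<integral>\<^sup>+B. indicator {B. \<not> (finite B \<and> B \<subseteq> {0<..<T})} B \<partial>PP T) = 0"
  proof (subst nn_integral_PP)
    have "AE U in S.S. \<forall>i. 0 < U i \<and> U i < T" by (rule AE_points[OF AE_unif])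
    then have "(\<integral>\<^sup>+U. indicator {B. \<not> (finite B \<and> B \<subseteq> {0<..<T})} (U ` {..<n}) \<partial>S.S) =
       (\<integral>\<^sup>+U. 0 \<partial>S.S)" for n
      by (intro nn_integral_cong_AE) (auto simp: indicator_def)
    then show "(\<Sum>n. ennreal (pmf (poisson_pmf T) n) *
       (\<integral>\<^sup>+U. indicator {B. \<not> (finite B \<and> B \<subseteq> {0<..<T})} (U ` {..<n}) \<partial>S.S)) = 0"
      by simp
  qed measurable
  then show ?thesis
    by (subst (asm) nn_integral_0_iff_AE) (measurable, auto simp: indicator_def split: if_splits)
qed

text \<open>Given \<open>n\<close> points, each misses \<open>A\<close> independently with
  probability 1 - g/T, where g is the measure of \<open>A\<close> inside the interval; summing
  against the Poisson weights gives the exponential series of T - g.\<close>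

lemma emeasure_PP_void:
  assumes [measurable]: "A \<in> sets borel"
  shows "emeasure (PP T) {B. B \<inter> A = {}} = ennreal (exp (- measure lborel (A \<inter> {0<..<T})))"
proof -
  let ?g = "measure lborel (A \<inter> {0<..<T})"
  have le: "?g \<le> T"
  proof -
    have "?g \<le> measure lborel {0<..<T}" by (intro measure_mono_fmeasurable) (use T in \<open>auto simp: fmeasurable_def emeasure_lborel_Ioo\<close>)
    then show ?thesis using T by simp
  qed
  have fin: "emeasure lborel (A \<inter> {0<..<T}) < \<infinity>"
  proof -
    have "emeasure lborel (A \<inter> {0<..<T}) \<le> emeasure lborel {0<..<T}" by (intro emeasure_mono) auto
    also have "\<dots> < \<infinity>" using T by (simp add: emeasure_lborel_Ioo)
    finally show ?thesis .
  qed
  have u: "emeasure (unif T) (- A) = ennreal (1 - ?g / T)"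
  proof -
    have "emeasure (unif T) A = ennreal (?g / T)"
      using fin T by (subst emeasure_unif) (auto simp: emeasure_eq_ennreal_measure Int_commute divide_ennreal)
    then have "measure (unif T) A = ?g / T"
      unfolding measure_def[of "unif T"] using T by simp
    then have "measure (unif T) (- A) = 1 - ?g / T"
      using U.prob_compl[of A] by (simp add: Compl_eq_Diff_UNIV)
    then show ?thesis by (simp add: U.emeasure_eq_measure)
  qed
  have k: "(\<integral>\<^sup>+U. indicator {B. B \<inter> A = {}} (U ` {..<n}) \<partial>S.S) = ennreal ((1 - ?g / T) ^ n)" for n
  proof -
    have "(\<integral>\<^sup>+U. indicator {B. B \<inter> A = {}} (U ` {..<n}) \<partial>S.S) =
       (\<integral>\<^sup>+U. indicator {U \<in> space S.S. \<forall>i\<in>{..<n}. U i \<in> - A} U \<partial>S.S)"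
      by (intro nn_integral_cong) (auto simp: indicator_def)
    also have "\<dots> = emeasure S.S {U \<in> space S.S. \<forall>i\<in>{..<n}. U i \<in> - A}"
      by (rule nn_integral_indicator) measurable
    also have "\<dots> = (\<Prod>i\<in>{..<n}. emeasure (unif T) (- A))"
      by (rule S.emeasure_PiM_Collect) auto
    also have "\<dots> = ennreal ((1 - ?g / T) ^ n)"
      using le T by (simp add: u ennreal_power)
    finally show ?thesis .
  qed
  have [measurable]: "{B. B \<inter> A = {}} \<in> sets pts"
    using pred_void[of "\<lambda>x. x" pts A] by (simp add: pred_def)
  have "emeasure (PP T) {B. B \<inter> A = {}} = (\<integral>\<^sup>+B. indicator {B. B \<inter> A = {}} B \<partial>PP T)"
    by (rule nn_integral_indicator[symmetric]) measurable
  also have "\<dots> = (\<Sum>n. ennreal (pmf (poisson_pmf T) n) * ennreal ((1 - ?g / T) ^ n))"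
    by (subst nn_integral_PP) (measurable, simp only: k)
  also have "\<dots> = (\<Sum>n. ennreal (exp (- T) * ((T - ?g) ^ n /\<^sub>R fact n)))"
  proof (intro suminf_cong)
    fix n
    have "T ^ n / fact n * exp (- T) * (1 - ?g / T) ^ n = exp (- T) * ((T * (1 - ?g / T)) ^ n / fact n)"
      by (simp add: power_mult_distrib)
    also have "T * (1 - ?g / T) = T - ?g" using T by (simp add: field_simps)
    finally have eq: "pmf (poisson_pmf T) n * (1 - ?g / T) ^ n = exp (- T) * ((T - ?g) ^ n /\<^sub>R fact n)"
      using T by (simp add: divide_inverse mult_ac)
    have "0 \<le> (1 - ?g / T) ^ n" using le T by simp
    then show "ennreal (pmf (poisson_pmf T) n) * ennreal ((1 - ?g / T) ^ n) =
       ennreal (exp (- T) * ((T - ?g) ^ n /\<^sub>R fact n))"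
      by (simp only: ennreal_mult''[symmetric] eq)
  qed
  also have "\<dots> = ennreal (exp (- T) * exp (T - ?g))"
  proof (rule suminf_ennreal_eq)
    show "(\<lambda>n. exp (- T) * ((T - ?g) ^ n /\<^sub>R fact n)) sums (exp (- T) * exp (T - ?g))"
      by (intro sums_mult exp_converges)
  qed (use le in simp)
  also have "exp (- T) * exp (T - ?g) = exp (- ?g)" by (simp add: exp_add[symmetric])
  finally show ?thesis .
qed

text \<open>Mecke's formula for a fixed number of points, by induction: the point \<open>y\<close>
  peeled off is one choice of \<open>x\<close>, and the other choices fall under the induction
  hypothesis for the function that keeps \<open>y\<close> in the configuration.\<close>

lemma nn_integral_points_Mecke:
  fixes f :: "real \<Rightarrow> real set \<Rightarrow> ennreal"
  assumes [measurable]: "case_prod f \<in> borel_measurable (borel \<Otimes>\<^sub>M pts)"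
  shows "(\<integral>\<^sup>+U. (\<Sum>x\<in>U ` {..<n}. f x (U ` {..<n} - {x})) \<partial>S.S) =
    of_nat n * (\<integral>\<^sup>+x. (\<integral>\<^sup>+U. f x (U ` {..<n - 1}) \<partial>S.S) \<partial>unif T)"
  using assms
proof (induction n arbitrary: f)
  case (Suc n f)
  note [measurable] = Suc.prems
  have "(\<integral>\<^sup>+U. (\<Sum>x\<in>U ` {..<Suc n}. f x (U ` {..<Suc n} - {x})) \<partial>S.S) =
     (\<integral>\<^sup>+y. (\<integral>\<^sup>+U. (\<Sum>x\<in>insert y (U ` {..<n}). f x (insert y (U ` {..<n}) - {x})) \<partial>S.S) \<partial>unif T)"
    by (rule nn_integral_points_Suc[of "\<lambda>B. \<Sum>x\<in>B. f x (B - {x})"]) measurable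
  also have "\<dots> = (\<integral>\<^sup>+y. (\<integral>\<^sup>+U. f y (U ` {..<n}) +
      (\<Sum>x\<in>U ` {..<n}. f x (insert y (U ` {..<n} - {x}))) \<partial>S.S) \<partial>unif T)"
  proof (rule nn_integral_cong, rule nn_integral_cong_AE)
    fix y :: real
    \<comment> \<open>Coinciding points would merge in the image set; almost surely there are
      none.\<close>
    have "AE U in S.S. \<forall>i. U i \<noteq> y" by (rule AE_points[OF AE_unif_neq])
    then show "AE U in S.S. (\<Sum>x\<in>insert y (U ` {..<n}). f x (insert y (U ` {..<n}) - {x})) =
       f y (U ` {..<n}) + (\<Sum>x\<in>U ` {..<n}. f x (insert y (U ` {..<n} - {x})))"
    proof eventually_elim
      case (elim U)
      then have y: "y \<notin> U ` {..<n}" by auto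
      have "(\<Sum>x\<in>U ` {..<n}. f x (insert y (U ` {..<n}) - {x})) =
          (\<Sum>x\<in>U ` {..<n}. f x (insert y (U ` {..<n} - {x})))"
        using y by (intro sum.cong refl arg_cong2[where f=f]) auto
      then show ?case using y by (subst sum.insert) auto
    qed
  qed
  also have "\<dots> = (\<integral>\<^sup>+y. (\<integral>\<^sup>+U. f y (U ` {..<n}) \<partial>S.S) +
      (\<integral>\<^sup>+U. (\<Sum>x\<in>U ` {..<n}. f x (insert y (U ` {..<n} - {x}))) \<partial>S.S) \<partial>unif T)"
    by (intro nn_integral_cong nn_integral_add) measurable
  also have "\<dots> = (\<integral>\<^sup>+y. (\<integral>\<^sup>+U. f y (U ` {..<n}) \<partial>S.S) \<partial>unif T) +
      (\<integral>\<^sup>+y. (\<integral>\<^sup>+U. (\<Sum>x\<in>U ` {..<n}. f x (insert y (U ` {..<n} - {x}))) \<partial>S.S) \<partial>unif T)"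
    by (intro nn_integral_add) measurable
  also have "(\<integral>\<^sup>+y. (\<integral>\<^sup>+U. (\<Sum>x\<in>U ` {..<n}. f x (insert y (U ` {..<n} - {x}))) \<partial>S.S) \<partial>unif T) =
     (\<integral>\<^sup>+y. of_nat n * (\<integral>\<^sup>+x. (\<integral>\<^sup>+U. f x (insert y (U ` {..<n - 1})) \<partial>S.S) \<partial>unif T) \<partial>unif T)"
  proof (intro nn_integral_cong)
    fix y :: real
    show "(\<integral>\<^sup>+U. (\<Sum>x\<in>U ` {..<n}. f x (insert y (U ` {..<n} - {x}))) \<partial>S.S) =
      of_nat n * (\<integral>\<^sup>+x. (\<integral>\<^sup>+U. f x (insert y (U ` {..<n - 1})) \<partial>S.S) \<partial>unif T)"
      by (rule Suc.IH[of "\<lambda>x B. f x (insert y B)"]) measurable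
  qed
  also have "\<dots> = of_nat n * (\<integral>\<^sup>+x. (\<integral>\<^sup>+y. (\<integral>\<^sup>+U. f x (insert y (U ` {..<n - 1})) \<partial>S.S) \<partial>unif T) \<partial>unif T)"
  proof -
    interpret UU: pair_sigma_finite "unif T" "unif T" ..
    show ?thesis
      by (subst nn_integral_cmult, measurable) (subst UU.Fubini', measurable)
  qed
  also have "\<dots> = of_nat n * (\<integral>\<^sup>+x. (\<integral>\<^sup>+U. f x (U ` {..<n}) \<partial>S.S) \<partial>unif T)"
  \<comment> \<open>For \<open>n = 0\<close> the factor 0 absorbs the truncated subtraction
    \<open>n - 1\<close>.\<close>
  proof (cases n)
    case (Suc k)
    have "(\<integral>\<^sup>+y. (\<integral>\<^sup>+U. f x (insert y (U ` {..<n - 1})) \<partial>S.S) \<partial>unif T) =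
       (\<integral>\<^sup>+U. f x (U ` {..<n}) \<partial>S.S)" for x
      unfolding Suc by (subst nn_integral_points_Suc) auto
    then show ?thesis by simp
  qed simp
  finally show ?case
    by (simp add: distrib_right)
qed simp

text \<open>The Poisson weights satisfy (n + 1) p (n + 1) = T p n. This turns the factor
  \<open>n\<close> of the fixed-size formula into the intensity \<open>T\<close> and restores the
  full process under the inner integral.\<close>

theorem PP_Mecke:
  fixes f :: "real \<Rightarrow> real set \<Rightarrow> ennreal"
  assumes [measurable]: "case_prod f \<in> borel_measurable (borel \<Otimes>\<^sub>M pts)"
  shows "(\<integral>\<^sup>+B. (\<Sum>x\<in>B. f x (B - {x})) \<partial>PP T) = (\<integral>\<^sup>+x\<in>{0<..<T}. (\<integral>\<^sup>+B. f x B \<partial>PP T) \<partial>lborel)"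
proof -
  let ?p = "\<lambda>n. ennreal (pmf (poisson_pmf T) n)"
  let ?k = "\<lambda>n x. \<integral>\<^sup>+U. f x (U ` {..<n}) \<partial>S.S"
  interpret P: prob_space "PP T" by (rule prob_space_PP)
  have "(\<integral>\<^sup>+B. (\<Sum>x\<in>B. f x (B - {x})) \<partial>PP T) = (\<Sum>n. ?p n * (of_nat n * (\<integral>\<^sup>+x. ?k (n - 1) x \<partial>unif T)))"
    by (subst nn_integral_PP) (measurable, simp add: nn_integral_points_Mecke)
  also have "\<dots> = (\<Sum>n. ?p (Suc n) * (of_nat (Suc n) * (\<integral>\<^sup>+x. ?k n x \<partial>unif T)))"
    by (subst suminf_ennreal_head) simp
  also have "\<dots> = (\<Sum>n. ennreal T * (\<integral>\<^sup>+x. ?p n * ?k n x \<partial>unif T))"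
  proof (intro suminf_cong)
    fix n
    have "pmf (poisson_pmf T) (Suc n) * real (Suc n) = T * pmf (poisson_pmf T) n"
      using T by (simp add: divide_simps del: of_nat_Suc)
    then have eq: "?p (Suc n) * of_nat (Suc n) = ennreal T * ?p n"
      using T by (simp add: ennreal_of_nat_eq_real_of_nat ennreal_mult'[symmetric] ennreal_mult''[symmetric] del: of_nat_Suc pmf_poisson)
    have "(\<integral>\<^sup>+x. ?p n * ?k n x \<partial>unif T) = ?p n * (\<integral>\<^sup>+x. ?k n x \<partial>unif T)"
      by (rule nn_integral_cmult) measurable
    then show "?p (Suc n) * (of_nat (Suc n) * (\<integral>\<^sup>+x. ?k n x \<partial>unif T)) = ennreal T * (\<integral>\<^sup>+x. ?p n * ?k n x \<partial>unif T)"
      by (simp only: mult.assoc[symmetric] eq)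
  qed
  also have "\<dots> = ennreal T * (\<integral>\<^sup>+x. (\<Sum>n. ?p n * ?k n x) \<partial>unif T)"
    by (subst nn_integral_suminf) auto
  also have "\<dots> = ennreal T * (\<integral>\<^sup>+x. (\<integral>\<^sup>+B. f x B \<partial>PP T) \<partial>unif T)"
    by (intro arg_cong2[where f="(*)"] nn_integral_cong refl nn_integral_PP[symmetric]) measurable
  also have "\<dots> = (\<integral>\<^sup>+x\<in>{0<..<T}. (\<integral>\<^sup>+B. f x B \<partial>PP T) \<partial>lborel)"
    by (subst nn_integral_unif)
       (measurable, use T in \<open>simp add: ennreal_times_divide mult_divide_eq_ennreal mult.commute[of "ennreal T"]\<close>)
  finally show ?thesis .
qed

end

lemma void_in_sets [measurable]: "A \<in> sets borel \<Longrightarrow> {B. B \<inter> A = {}} \<in> sets pts"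
  using pred_void[of "\<lambda>x. x" pts A] by (simp add: pred_def)

text \<open>Avoiding \<open>A\<close> and \<open>A'\<close> is avoiding their union, so the void
  events form an intersection-stable generator and void probabilities determine a law.\<close>

lemma pts_measure_eqI:
  assumes M: "sets M = sets pts" and N: "sets N = sets pts"
    and fin: "emeasure M UNIV \<noteq> \<infinity>"
    and eq: "\<And>A. A \<in> sets borel \<Longrightarrow> emeasure M {B. B \<inter> A = {}} = emeasure N {B. B \<inter> A = {}}"
  shows "M = N"
proof (rule measure_eqI_generator_eq)
  let ?E = "{{B. B \<inter> A = {}} | A. A \<in> sets (borel :: real measure)}"
  show "Int_stable ?E"
  proof (rule Int_stableI)
    fix a b assume "a \<in> ?E" "b \<in> ?E"
    then obtain A A' where A: "A \<in> sets borel" "A' \<in> sets borel" "a = {B. B \<inter> A = {}}" "b = {B. B \<inter> A' = {}}"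
      by auto
    then have "a \<inter> b = {B. B \<inter> (A \<union> A') = {}}" by auto
    then show "a \<inter> b \<in> ?E" using A(1,2) by blast
  qed
  show "range (\<lambda>i::nat. UNIV) \<subseteq> ?E" by (auto intro!: exI[of _ "{}"])
  show "\<And>X. X \<in> ?E \<Longrightarrow> emeasure M X = emeasure N X" using eq by auto
qed (use fin in \<open>auto simp: M N sets_pts\<close>)

lemma UNIV_in_sets_pts [simp]: "UNIV \<in> sets pts"
  using sets.top[of pts] by simp

definition vol :: "real \<Rightarrow> real set \<Rightarrow> real" where
  "vol T A = measure lborel (A \<inter> {0<..<T})"

lemma fmeasurable_vol:
  fixes T :: real
  assumes "A \<in> sets borel"
  shows "A \<inter> {0<..<T} \<in> fmeasurable lborel"
proof (rule fmeasurableI)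
  have "emeasure lborel (A \<inter> {0<..<T}) \<le> emeasure lborel {0..T}"
    by (intro emeasure_mono) (auto simp: less_imp_le)
  also have "\<dots> < \<infinity>" by (simp add: emeasure_lborel_Icc_eq)
  finally show "emeasure lborel (A \<inter> {0<..<T}) < \<infinity>" .
qed (use assms in auto)

lemma vol_mono: "A \<subseteq> A' \<Longrightarrow> A \<in> sets borel \<Longrightarrow> A' \<in> sets borel \<Longrightarrow> vol T A \<le> vol T A'"
  unfolding vol_def by (intro measure_mono_fmeasurable fmeasurable_vol) auto

lemma vol_Un:
  assumes "A \<in> sets borel" "A' \<in> sets borel" "A \<inter> A' = {}"
  shows "vol T (A \<union> A') = vol T A + vol T A'"
proof -
  have "measure lborel ((A \<inter> {0<..<T}) \<union> (A' \<inter> {0<..<T})) =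
    measure lborel (A \<inter> {0<..<T}) + measure lborel (A' \<inter> {0<..<T})"
    using assms by (intro measure_Un2[THEN trans] fmeasurable_vol)
      (auto intro!: arg_cong2[where f="(+)"] arg_cong2[where f=measure])
  then show ?thesis by (simp add: vol_def Int_Un_distrib2)
qed

lemma vol_Diff_Un:
  assumes "A \<in> sets borel" "A' \<in> sets borel"
  shows "vol T (A \<union> A') = vol T A + vol T (A' - A)"
  using vol_Un[of A "A' - A" T] assms by (simp add: Un_Diff_cancel)

context
  fixes T :: real
  assumes T: "0 < T"
begin

interpretation P: prob_space "PP T" by (rule prob_space_PP[OF T])

lemma PP_void: "A \<in> sets borel \<Longrightarrow> emeasure (PP T) {B. B \<inter> A = {}} = ennreal (exp (- vol T A))"
  unfolding vol_def by (rule emeasure_PP_void[OF T])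

text \<open>Independence of the parts inside and outside \<open>A\<close>. Viewed as measures for
  the outside part, the two sides agree on void events because exp (- vol) is multiplicative over
  disjoint sets, hence they agree everywhere.\<close>

lemma PP_void_rest:
  assumes [measurable]: "A \<in> sets borel" "f \<in> borel_measurable pts"
  shows "(\<integral>\<^sup>+B. indicator {B. B \<inter> A = {}} B * f (B - A) \<partial>PP T) =
    ennreal (exp (- vol T A)) * (\<integral>\<^sup>+B. f (B - A) \<partial>PP T)"
proof -
  let ?V = "{B. B \<inter> A = {}}"
  let ?M = "distr (density (PP T) (indicator ?V)) pts (\<lambda>B. B - A)"
  let ?N = "scale_measure (ennreal (exp (- vol T A))) (distr (PP T) pts (\<lambda>B. B - A))"
  have "?M = ?N"
  proof (rule pts_measure_eqI)
    show "emeasure ?M UNIV \<noteq> \<infinity>"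
    proof -
      have "emeasure ?M UNIV = emeasure (density (PP T) (indicator ?V)) UNIV"
        by (subst emeasure_distr) auto
      also have "\<dots> = (\<integral>\<^sup>+B. indicator ?V B * indicator UNIV B \<partial>PP T)"
        by (rule emeasure_density) auto
      also have "\<dots> = emeasure (PP T) ?V" by simp
      finally show ?thesis by (simp add: P.emeasure_eq_measure)
    qed
  next
    fix A' :: "real set" assume [measurable]: "A' \<in> sets borel"
    have "emeasure ?M {B. B \<inter> A' = {}} = (\<integral>\<^sup>+B. indicator ?V B * indicator {B. (B - A) \<inter> A' = {}} B \<partial>PP T)"
    proof -
      have [measurable]: "{B. (B - A) \<inter> A' = {}} \<in> sets pts"
        using pred_void[of "\<lambda>B. B - A" pts A'] by (simp add: pred_def)
      have "emeasure ?M {B. B \<inter> A' = {}} = emeasure (density (PP T) (indicator ?V)) {B. (B - A) \<inter> A' = {}}"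
        by (subst emeasure_distr) (auto intro!: arg_cong2[where f=emeasure])
      also have "\<dots> = (\<integral>\<^sup>+B. indicator ?V B * indicator {B. (B - A) \<inter> A' = {}} B \<partial>PP T)"
        by (rule emeasure_density) measurable
      finally show ?thesis .
    qed
    also have "\<dots> = (\<integral>\<^sup>+B. indicator {B. B \<inter> (A \<union> A') = {}} B \<partial>PP T)"
      by (intro nn_integral_cong) (auto simp: indicator_def)
    also have "\<dots> = emeasure (PP T) {B. B \<inter> (A \<union> A') = {}}"
      by (intro nn_integral_indicator) measurable
    also have "\<dots> = ennreal (exp (- vol T A)) * ennreal (exp (- vol T (A' - A)))"
      by (subst PP_void) (auto simp: vol_Diff_Un ennreal_mult'[symmetric] exp_add[symmetric])
    also have "ennreal (exp (- vol T (A' - A))) = emeasure (PP T) {B. B \<inter> (A' - A) = {}}"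
      by (subst PP_void) auto
    also have "{B. B \<inter> (A' - A) = {}} = {B. (B - A) \<inter> A' = {}}" by auto
    also have "emeasure (PP T) \<dots> = emeasure (distr (PP T) pts (\<lambda>B. B - A)) {B. B \<inter> A' = {}}"
      by (subst emeasure_distr) (auto simp: vimage_def)
    finally show "emeasure ?M {B. B \<inter> A' = {}} = emeasure ?N {B. B \<inter> A' = {}}"
      by simp
  qed auto
  then have "(\<integral>\<^sup>+B. f B \<partial>?M) = (\<integral>\<^sup>+B. f B \<partial>?N)" by simp
  then show ?thesis
    by (simp add: nn_integral_distr nn_integral_density nn_integral_scale_measure)
qed

text \<open>Conditioning on the first point shows that the void probabilities of both \<open>PP T\<close> and the
  process with exponential gaps are fixed points of \<open>renewal\<close>, which has only one.\<close>
definition renewal :: "real set \<Rightarrow> (real \<Rightarrow> ennreal) \<Rightarrow> real \<Rightarrow> ennreal" where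
  "renewal A F x = ennreal (exp (- (T - x))) +
     (\<integral>\<^sup>+y. indicator ({x<..<T} - A) y * (ennreal (exp (- (y - x))) * F y) \<partial>lborel)"

lemma nn_integral_exp_Icc:
  assumes "x \<le> T"
  shows "(\<integral>\<^sup>+y. ennreal (exp (- (y - x))) * indicator {x..T} y \<partial>lborel) = ennreal (1 - exp (- (T - x)))"
  by (subst nn_integral_FTC_Icc[where F="\<lambda>y. - exp (- (y - x))"])
     (use assms in \<open>auto intro!: derivative_eq_intros\<close>)

text \<open>A contraction argument: one application of \<open>renewal\<close> multiplies an error
  bound by at most 1 - exp (-T) < 1, so the error tends to 0. Adding the error on the larger side
  keeps the induction within \<open>ennreal\<close>; equality comes from using the lemma in both
  directions.\<close>

lemma renewal_le:
  assumes [measurable]: "A \<in> sets borel" "F \<in> borel_measurable borel" "G \<in> borel_measurable borel"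
    and F: "\<And>x. 0 \<le> x \<Longrightarrow> x \<le> T \<Longrightarrow> F x = renewal A F x" "\<And>x. F x \<le> 1"
    and G: "\<And>x. 0 \<le> x \<Longrightarrow> x \<le> T \<Longrightarrow> G x = renewal A G x"
    and x: "0 \<le> x" "x \<le> T"
  shows "F x \<le> G x"
proof -
  have step: "F x \<le> G x + ennreal ((1 - exp (- T)) ^ n)" if "0 \<le> x" "x \<le> T" for n x
    using that
  proof (induction n arbitrary: x)
    case 0
    show ?case using F(2)[of x] by (simp add: add_increasing)
  next
    case (Suc n)
    let ?c = "ennreal ((1 - exp (- T)) ^ n)"
    have "F x \<le> ennreal (exp (- (T - x))) +
      (\<integral>\<^sup>+y. indicator ({x<..<T} - A) y * (ennreal (exp (- (y - x))) * G y)
         + ?c * (ennreal (exp (- (y - x))) * indicator {x..T} y) \<partial>lborel)"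
      unfolding F(1)[OF Suc.prems] renewal_def
    proof (intro add_left_mono nn_integral_mono)
      fix y
      show "indicator ({x<..<T} - A) y * (ennreal (exp (- (y - x))) * F y) \<le>
        indicator ({x<..<T} - A) y * (ennreal (exp (- (y - x))) * G y) +
         ?c * (ennreal (exp (- (y - x))) * indicator {x..T} y)"
      proof (cases "y \<in> {x<..<T} - A")
        case True
        then have "F y \<le> G y + ?c" using Suc.IH[of y] Suc.prems by auto
        then have "ennreal (exp (- (y - x))) * F y \<le> ennreal (exp (- (y - x))) * (G y + ?c)"
          by (intro mult_left_mono) auto
        then show ?thesis using True by (simp add: distrib_left mult.commute)
      qed simp
    qed
    also have "\<dots> = renewal A G x + ?c * ennreal (1 - exp (- (T - x)))"
      unfolding renewal_def nn_integral_exp_Icc[OF Suc.prems(2), symmetric]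
      by (subst nn_integral_add, simp, simp) (subst nn_integral_cmult, simp, simp add: add.assoc)
    also have "?c * ennreal (1 - exp (- (T - x))) \<le> ?c * ennreal (1 - exp (- T))"
      using Suc.prems by (intro mult_left_mono ennreal_leI) auto
    also have "?c * ennreal (1 - exp (- T)) = ennreal ((1 - exp (- T)) ^ Suc n)"
      using T by (subst ennreal_mult''[symmetric]) (auto simp: mult.commute)
    finally show ?case using G[OF Suc.prems] by (simp add: add_left_mono)
  qed
  have "(\<lambda>n. G x + ennreal ((1 - exp (- T)) ^ n)) \<longlonglongrightarrow> G x + ennreal 0"
    using T by (intro tendsto_add tendsto_const tendsto_ennrealI LIMSEQ_realpow_zero) auto
  then show ?thesis
    by (intro LIMSEQ_le_const) (auto intro: step[OF x])
qed

text \<open>Decomposition by the first point \<open>y\<close> after \<open>x\<close>: either there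
  is none before \<open>T\<close>, or \<open>y\<close> lies outside \<open>A\<close> and the points
  beyond \<open>y\<close> avoid \<open>A\<close>. Mecke's formula integrates out
  \<open>y\<close>.\<close>

lemma PP_renewal:
  assumes [measurable]: "A \<in> sets borel" and x: "0 \<le> x" "x \<le> T"
  shows "emeasure (PP T) {B. B \<inter> (A \<inter> {x<..<T}) = {}} =
    renewal A (\<lambda>y. emeasure (PP T) {B. B \<inter> (A \<inter> {y<..<T}) = {}}) x"
proof -
  let ?f = "\<lambda>y B. indicator ({x<..<T} - A) y *
    indicator {B. B \<inter> {x<..<y} = {} \<and> (B \<inter> A) \<inter> {y<..<T} = {}} B :: ennreal"
  have [measurable]: "case_prod ?f \<in> borel_measurable (borel \<Otimes>\<^sub>M pts)"
    by (simp add: indicator_def case_prod_beta')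
  have "(\<integral>\<^sup>+B. indicator {B. B \<inter> (A \<inter> {x<..<T}) = {}} B \<partial>PP T) =
     (\<integral>\<^sup>+B. indicator {B. B \<inter> {x<..<T} = {}} B + (\<Sum>y\<in>B. ?f y (B - {y})) \<partial>PP T)"
  proof (rule nn_integral_cong_AE)
    show "AE B in PP T. indicator {B. B \<inter> (A \<inter> {x<..<T}) = {}} B =
       indicator {B. B \<inter> {x<..<T} = {}} B + (\<Sum>y\<in>B. ?f y (B - {y}))"
      using AE_PP[OF T]
    proof eventually_elim
      case (elim B)
      then have fin: "finite B" and sub: "B \<subseteq> {0<..<T}" by auto
      show ?case
      proof (cases "B \<inter> {x<..<T} = {}")
        case True
        then have "B \<inter> (A \<inter> {x<..<T}) = {}" by auto
        moreover have "(\<Sum>y\<in>B. ?f y (B - {y})) = 0"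
          using True by (intro sum.neutral ballI) (auto simp: indicator_def)
        ultimately show ?thesis using True by simp
      next
        case False
        then have ne: "B \<inter> {x<..} \<noteq> {}" by auto
        note a = after_props(1,2)[OF fin ne]
        let ?a = "after B x"
        \<comment> \<open>Every other point beyond \<open>x\<close> has \<open>after B x\<close>
          strictly between \<open>x\<close> and itself, so only the first point contributes.\<close>
        have "(\<Sum>y\<in>B. ?f y (B - {y})) = (\<Sum>y\<in>B. if y = ?a then ?f ?a (B - {?a}) else 0)"
        proof (intro sum.cong refl)
          fix y assume y: "y \<in> B"
          show "?f y (B - {y}) = (if y = ?a then ?f ?a (B - {?a}) else 0)"
          proof (cases "y = ?a \<or> y \<le> x")
            case True
            then show ?thesis using a by (auto simp: indicator_def)
          next
            case False
            then have "?a \<in> (B - {y}) \<inter> {x<..<y}"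
              using a y after_least[of y B x] by auto
            then show ?thesis using False by (auto simp: indicator_def)
          qed
        qed
        also have "\<dots> = ?f ?a (B - {?a})" using fin a by simp
        also have "\<dots> = indicator {B. B \<inter> (A \<inter> {x<..<T}) = {}} B"
        proof -
          have "(B - {?a}) \<inter> {x<..<?a} = {}" using a by (auto dest: after_least)
          moreover have "(B \<inter> (A \<inter> {x<..<T}) = {}) \<longleftrightarrow>
             ?a \<notin> A \<and> ((B - {?a}) \<inter> A) \<inter> {?a<..<T} = {}"
          proof -
            have "?a \<in> B \<inter> {x<..<T}" using a sub by auto
            moreover have "\<And>b. b \<in> B \<inter> {x<..<T} \<Longrightarrow> b = ?a \<or> ?a < b"
              using after_least[of _ B x] by force
            ultimately show ?thesis using a(2) by fastforce
          qed
          moreover have "x < ?a" "?a < T" using a sub by auto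
          ultimately show ?thesis by (auto simp: indicator_def)
        qed
        finally show ?thesis using False by simp
      qed
    qed
  qed
  also have "\<dots> = emeasure (PP T) {B. B \<inter> {x<..<T} = {}} + (\<integral>\<^sup>+B. (\<Sum>y\<in>B. ?f y (B - {y})) \<partial>PP T)"
    by (subst nn_integral_add) measurable
  also have "emeasure (PP T) {B. B \<inter> {x<..<T} = {}} = ennreal (exp (- (T - x)))"
  proof -
    have "{x<..<T} \<inter> {0<..<T} = {x<..<T}" using x by auto
    then show ?thesis using x by (simp add: PP_void vol_def)
  qed
  also have "(\<integral>\<^sup>+B. (\<Sum>y\<in>B. ?f y (B - {y})) \<partial>PP T) = (\<integral>\<^sup>+y\<in>{0<..<T}. (\<integral>\<^sup>+B. ?f y B \<partial>PP T) \<partial>lborel)"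
    by (rule PP_Mecke[OF T]) measurable
  also have "\<dots> = (\<integral>\<^sup>+y. indicator ({x<..<T} - A) y * (ennreal (exp (- (y - x))) *
      emeasure (PP T) {B. B \<inter> (A \<inter> {y<..<T}) = {}}) \<partial>lborel)"
  proof (intro nn_integral_cong)
    fix y
    have "(\<integral>\<^sup>+B. ?f y B \<partial>PP T) = indicator ({x<..<T} - A) y *
        emeasure (PP T) {B. B \<inter> ({x<..<y} \<union> (A \<inter> {y<..<T})) = {}}"
    proof -
      have "(\<integral>\<^sup>+B. ?f y B \<partial>PP T) = indicator ({x<..<T} - A) y *
        (\<integral>\<^sup>+B. indicator {B. B \<inter> ({x<..<y} \<union> (A \<inter> {y<..<T})) = {}} B \<partial>PP T)"
        by (subst nn_integral_cmult[symmetric])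
           (auto intro!: nn_integral_cong simp: indicator_def)
      then show ?thesis by (subst (asm) nn_integral_indicator) auto
    qed
    also have "\<dots> = indicator ({x<..<T} - A) y * (ennreal (exp (- (y - x))) *
      emeasure (PP T) {B. B \<inter> (A \<inter> {y<..<T}) = {}})"
    proof (cases "y \<in> {x<..<T} - A")
      case True
      then have "vol T {x<..<y} = y - x"
        using x by (simp add: vol_def Int_absorb2 greaterThanLessThan_subseteq_greaterThanLessThan)
      then have "vol T ({x<..<y} \<union> (A \<inter> {y<..<T})) = (y - x) + vol T (A \<inter> {y<..<T})"
        by (subst vol_Un) auto
      then show ?thesis
        by (simp add: PP_void ennreal_mult'[symmetric] exp_add[symmetric])
    qed simp
    finally show "(\<integral>\<^sup>+B. ?f y B \<partial>PP T) * indicator {0<..<T} y =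
       indicator ({x<..<T} - A) y * (ennreal (exp (- (y - x))) *
      emeasure (PP T) {B. B \<inter> (A \<inter> {y<..<T}) = {}})"
      using x by (auto simp: indicator_def)
  qed
  finally show ?thesis by (simp add: renewal_def)
qed

end

section \<open>Ring times as partial sums of exponential gaps\<close>

definition expo :: "real measure" where
  "expo = density lborel (exponential_density 1)"

lemma sets_expo [simp, measurable_cong]: "sets expo = sets borel"
  by (simp add: expo_def)

lemma prob_space_expo: "prob_space expo"
  unfolding expo_def by (rule prob_space_exponential_density) simp

definition ringset :: "real \<Rightarrow> (nat \<Rightarrow> real) \<Rightarrow> real set" where
  "ringset T U = {t. 0 < t \<and> t \<le> T \<and> (\<exists>k. t = (\<Sum>j\<le>k. U j))}"

lemma measurable_ringset [measurable]: "ringset T \<in> measurable (PiM UNIV (\<lambda>_. expo)) pts"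
proof (rule measurable_ptsI)
  fix A :: "real set" assume [measurable]: "A \<in> sets borel"
  have "{U \<in> space (PiM UNIV (\<lambda>_. expo)). ringset T U \<inter> A = {}} =
    {U \<in> space (PiM UNIV (\<lambda>_. expo)). \<forall>k. (\<Sum>j\<le>k. U j) \<notin> A \<inter> {0<..T}}"
    unfolding ringset_def by auto
  also have "\<dots> \<in> sets (PiM UNIV (\<lambda>_. expo))" by measurable
  finally show "{U \<in> space (PiM UNIV (\<lambda>_. expo)). ringset T U \<inter> A = {}} \<in> sets (PiM UNIV (\<lambda>_. expo))" .
qed

lemma nn_integral_expo:
  assumes [measurable]: "f \<in> borel_measurable borel"
  shows "(\<integral>\<^sup>+u. f (x + u) \<partial>expo) =
    (\<integral>\<^sup>+y. ennreal (exp (- (y - x))) * f y * indicator {x..} y \<partial>lborel)"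
proof -
  have "(\<integral>\<^sup>+y. ennreal (exp (- (y - x))) * f y * indicator {x..} y \<partial>lborel) =
    (\<integral>\<^sup>+u. ennreal (exp (- u)) * f (x + u) * indicator {0..} u \<partial>lborel)"
    by (subst nn_integral_real_affine[where t=x and c=1]) (auto simp: indicator_def intro!: nn_integral_cong)
  also have "\<dots> = (\<integral>\<^sup>+u. f (x + u) \<partial>expo)"
    unfolding expo_def
    by (subst nn_integral_density)
       (auto intro!: nn_integral_cong simp: exponential_density_def indicator_def)
  finally show ?thesis by simp
qed

lemma nn_integral_exp_atLeast:
  "(\<integral>\<^sup>+y. ennreal (exp (- (y - x))) * indicator {T..} y \<partial>lborel) = ennreal (exp (- (T - x)))"
proof -
  have "((\<lambda>y::real. - exp (- (y - x))) \<longlongrightarrow> - 0) at_top"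
    by (intro tendsto_minus filterlim_compose[OF exp_at_bot]
          filterlim_compose[OF filterlim_uminus_at_bot_at_top])
       (use filterlim_tendsto_add_at_top[OF tendsto_const filterlim_ident, of "-x"] in simp)
  then have "((\<lambda>y::real. - exp (- (y - x))) \<longlongrightarrow> 0) at_top" by simp
  then show ?thesis
    by (subst nn_integral_FTC_atLeast[where F="\<lambda>y. - exp (- (y - x))" and T=0])
       (auto intro!: derivative_eq_intros)
qed

context
  fixes T :: real
  assumes T: "0 < T"
begin

interpretation E: prob_space expo by (rule prob_space_expo)
interpretation S: sequence_space expo ..

lemma AE_expo_pos: "AE x in expo. 0 < x"
proof -
  have "AE x in lborel. x \<noteq> (0::real)" by (rule AE_lborel_singleton)
  then show ?thesis unfolding expo_def
    by (subst AE_density) (auto simp: exponential_density_def elim!: eventually_mono)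
qed

lemma AE_partial_sums_pos: "AE U in S.S. \<forall>k. 0 < (\<Sum>j\<le>k. U j)"
proof -
  have "AE U in S.S. \<forall>i. 0 < U i"
    using AE_expo_pos by (intro AE_all_countable[THEN iffD2] allI AE_PiM_component[OF prob_space_expo]) auto
  then show ?thesis by eventually_elim (auto intro!: sum_pos)
qed

text \<open>Condition on the first gap: it passes \<open>T\<close>, with probability exp (-(T - x)),
  or ends at some \<open>y\<close> outside \<open>A\<close>, where the process starts afresh. From
  \<open>T\<close> onwards \<open>F\<close> is 1, since the gaps are positive and only ring times up
  to \<open>T\<close> count.\<close>

lemma ring_renewal:
  fixes A :: "real set"
  assumes [measurable]: "A \<in> sets borel"
  defines "F \<equiv> \<lambda>x. emeasure S.S {U \<in> space S.S. \<forall>k. x + (\<Sum>j\<le>k. U j) \<notin> A \<inter> {0<..T}}"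
  shows "F \<in> borel_measurable borel" "\<And>x. 0 \<le> x \<Longrightarrow> x \<le> T \<Longrightarrow> F x = renewal T A F x"
proof -
  let ?A = "A \<inter> {0<..T}"
  have F: "F x = (\<integral>\<^sup>+U. indicator {U. \<forall>k. x + (\<Sum>j\<le>k. U j) \<notin> ?A} U \<partial>S.S)" for x
  proof -
    have "(\<integral>\<^sup>+U. indicator {U. \<forall>k. x + (\<Sum>j\<le>k. U j) \<notin> ?A} U \<partial>S.S) =
      (\<integral>\<^sup>+U. indicator {U \<in> space S.S. \<forall>k. x + (\<Sum>j\<le>k. U j) \<notin> ?A} U \<partial>S.S)"
      by (intro nn_integral_cong) (simp only: indicator_def mem_Collect_eq simp_thms)
    also have "\<dots> = F x" unfolding F_def by (rule nn_integral_indicator) measurable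
    finally show ?thesis by simp
  qed
  show meas [measurable]: "F \<in> borel_measurable borel"
    unfolding F by (auto simp: indicator_def)
  have high: "F x = 1" if "T \<le> x" for x
  proof -
    have "F x = (\<integral>\<^sup>+U. 1 \<partial>S.S)"
      unfolding F using AE_partial_sums_pos
      by (intro nn_integral_cong_AE) (use that in \<open>auto elim!: eventually_mono simp: indicator_def\<close>,
        smt (verit))
    then show ?thesis by (simp add: S.P.emeasure_space_1)
  qed
  have rec: "F x = (\<integral>\<^sup>+y. ennreal (exp (- (y - x))) * (indicator (- ?A) y * F y) * indicator {x..} y \<partial>lborel)" for x
  proof -
    have sum_Suc: "(\<Sum>j\<le>k. case_nat s U j) = s + (if k = 0 then 0 else \<Sum>j\<le>k - 1. U j)" for k s and U :: "nat \<Rightarrow> real"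
      by (cases k) (auto simp: sum.atMost_Suc_shift simp del: sum.atMost_Suc)
    have "F x = (\<integral>\<^sup>+U. indicator {U. \<forall>k. x + (\<Sum>j\<le>k. U j) \<notin> ?A} U
        \<partial>distr (expo \<Otimes>\<^sub>M S.S) S.S (\<lambda>(s, \<omega>). case_nat s \<omega>))"
      unfolding F by (simp only: S.PiM_iter)
    also have "\<dots> = (\<integral>\<^sup>+p. indicator {U. \<forall>k. x + (\<Sum>j\<le>k. U j) \<notin> ?A} (case p of (s, \<omega>) \<Rightarrow> case_nat s \<omega>)
        \<partial>(expo \<Otimes>\<^sub>M S.S))"
    proof (rule nn_integral_distr)
      have "(\<lambda>U. indicator {U. \<forall>k. x + (\<Sum>j\<le>k. U j) \<notin> ?A} U :: ennreal) \<in> borel_measurable S.S"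
        unfolding indicator_def mem_Collect_eq by measurable
      then show "(\<lambda>U. indicator {U. \<forall>k. x + (\<Sum>j\<le>k. U j) \<notin> ?A} U :: ennreal)
          \<in> borel_measurable (distr (expo \<Otimes>\<^sub>M S.S) S.S (\<lambda>(s, \<omega>). case_nat s \<omega>))"
        by simp
    qed measurable
    also have "\<dots> = (\<integral>\<^sup>+p. indicator (- ?A) (x + fst p) *
        indicator {U. \<forall>k. (x + fst p) + (\<Sum>j\<le>k. U j) \<notin> ?A} (snd p) \<partial>(expo \<Otimes>\<^sub>M S.S))"
    proof (intro nn_integral_cong)
      fix p :: "real \<times> (nat \<Rightarrow> real)"
      obtain s U where p: "p = (s, U)" by (cases p)
      have "(\<forall>k. x + (\<Sum>j\<le>k. case_nat s U j) \<notin> ?A) \<longleftrightarrow>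
        x + s \<notin> ?A \<and> (\<forall>k. (x + s) + (\<Sum>j\<le>k. U j) \<notin> ?A)" (is "?L \<longleftrightarrow> ?R")
      proof
        assume L: ?L
        show ?R using L[rule_format, of 0] L[rule_format, of "Suc _"] unfolding sum_Suc
          by (auto simp: add.assoc)
      next
        assume ?R then show ?L unfolding sum_Suc by (auto simp: add.assoc)
      qed
      then show "indicator {U. \<forall>k. x + (\<Sum>j\<le>k. U j) \<notin> ?A} (case p of (s, \<omega>) \<Rightarrow> case_nat s \<omega>) =
        (indicator (- ?A) (x + fst p) * indicator {U. \<forall>k. (x + fst p) + (\<Sum>j\<le>k. U j) \<notin> ?A} (snd p) :: ennreal)"
        by (simp only: p prod.case fst_conv snd_conv) (simp only: indicator_def mem_Collect_eq Compl_iff, simp)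
    qed
    also have "\<dots> = (\<integral>\<^sup>+s. (\<integral>\<^sup>+U. indicator (- ?A) (x + s) *
        indicator {U. \<forall>k. (x + s) + (\<Sum>j\<le>k. U j) \<notin> ?A} U \<partial>S.S) \<partial>expo)"
      by (subst S.nn_integral_fst[symmetric]) (auto simp: indicator_def)
    also have "\<dots> = (\<integral>\<^sup>+s. indicator (- ?A) (x + s) * F (x + s) \<partial>expo)"
      unfolding F by (intro nn_integral_cong nn_integral_cmult) (auto simp: indicator_def)
    also have "\<dots> = (\<integral>\<^sup>+y. ennreal (exp (- (y - x))) * (indicator (- ?A) y * F y) * indicator {x..} y \<partial>lborel)"
      by (rule nn_integral_expo) measurable
    finally show ?thesis .
  qed
  fix x assume x: "0 \<le> x" "x \<le> T"
  have "F x = (\<integral>\<^sup>+y. ennreal (exp (- (y - x))) * indicator {T..} y +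
      indicator ({x<..<T} - A) y * (ennreal (exp (- (y - x))) * F y) \<partial>lborel)"
    unfolding rec[of x]
  proof (rule nn_integral_cong_AE)
    show "AE y in lborel. ennreal (exp (- (y - x))) * (indicator (- ?A) y * F y) * indicator {x..} y =
      ennreal (exp (- (y - x))) * indicator {T..} y +
      indicator ({x<..<T} - A) y * (ennreal (exp (- (y - x))) * F y)"
      using AE_lborel_singleton[of x] AE_lborel_singleton[of T]
      by eventually_elim (use x high in \<open>auto simp: indicator_def\<close>)
  qed
  also have "\<dots> = renewal T A F x"
    unfolding renewal_def[OF T]
    by (subst nn_integral_exp_atLeast[symmetric], rule nn_integral_add) measurable
  finally show "F x = renewal T A F x" .
qed

theorem distr_ringset: "distr S.S pts (ringset T) = PP T"
proof (rule pts_measure_eqI)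
  show "emeasure (distr S.S pts (ringset T)) UNIV \<noteq> \<infinity>"
    by (subst emeasure_distr) (auto simp: S.P.emeasure_eq_measure)
next
  fix A :: "real set" assume [measurable]: "A \<in> sets borel"
  let ?F = "\<lambda>x. emeasure S.S {U \<in> space S.S. \<forall>k. x + (\<Sum>j\<le>k. U j) \<notin> A \<inter> {0<..T}}"
  let ?G = "\<lambda>x. emeasure (PP T) {B. B \<inter> (A \<inter> {x<..<T}) = {}}"
  interpret P: prob_space "PP T" by (rule prob_space_PP[OF T])
  have G: "?G \<in> borel_measurable borel"
  proof -
    have "?G x = (\<integral>\<^sup>+B. indicator {B. (B \<inter> A) \<inter> {x<..<T} = {}} B \<partial>PP T)" for x
      by (subst nn_integral_indicator[symmetric]) (auto simp: Int_assoc)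
    moreover have "(\<lambda>x. \<integral>\<^sup>+B. indicator {B. (B \<inter> A) \<inter> {x<..<T} = {}} B \<partial>PP T) \<in> borel_measurable borel"
      unfolding indicator_def by measurable
    ultimately show ?thesis by simp
  qed
  note F = ring_renewal[of A]
  have "?F 0 \<le> ?G 0"
    by (rule renewal_le[OF T _ F(1) G F(2) _ PP_renewal[OF T]]) (use T in \<open>auto simp: S.P.emeasure_le_1\<close>)
  moreover have "?G 0 \<le> ?F 0"
    by (rule renewal_le[OF T _ G F(1) PP_renewal[OF T] _ F(2)]) (use T in \<open>auto simp: P.emeasure_le_1\<close>)
  ultimately have "?F 0 = ?G 0" by simp
  have "emeasure (distr S.S pts (ringset T)) {B. B \<inter> A = {}} = ?F 0"
    by (subst emeasure_distr) (auto intro!: arg_cong2[where f=emeasure] simp: ringset_def)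
  also note \<open>?F 0 = ?G 0\<close>
  also have "?G 0 = emeasure (PP T) {B. B \<inter> A = {}}"
    by (simp add: PP_void[OF T] vol_def Int_assoc)
  finally show "emeasure (distr S.S pts (ringset T)) {B. B \<inter> A = {}} = emeasure (PP T) {B. B \<inter> A = {}}" .
qed auto

end

section \<open>The walk through a finite tree\<close>

text \<open>The cyclic successor: past the last point it wraps around to the least one, obtained as
  the successor of -1 because all times are nonnegative.\<close>

definition nxt :: "real set \<Rightarrow> real \<Rightarrow> real" where
  "nxt S t = (if S \<inter> {t<..} = {} then after S (-1) else after S t)"

text \<open>The waiting time from \<open>s\<close> to \<open>x\<close> on the circle of length \<open>T\<close>; note \<open>cd T s s = T\<close>.\<close>
definition cd :: "real \<Rightarrow> real \<Rightarrow> real \<Rightarrow> real" where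
  "cd T s x = (if s < x then x - s else x - s + T)"

lemma nxt_props:
  assumes "finite S" "S \<subseteq> {0..<T}" "S \<noteq> {}" "0 \<le> t" "t < T"
  shows "nxt S t \<in> S" "\<And>b. b \<in> S \<Longrightarrow> cd T t (nxt S t) \<le> cd T t b"
proof -
  have "nxt S t \<in> S \<and> (\<forall>b\<in>S. cd T t (nxt S t) \<le> cd T t b)"
  proof (cases "S \<inter> {t<..} = {}")
    case True
    have *: "S \<inter> {-1<..} \<noteq> {}" using assms by force
    note a = after_props(1,2)[OF assms(1) *]
    show ?thesis
    proof (intro conjI ballI)
      show "nxt S t \<in> S" using True a by (simp add: nxt_def)
    next
      fix b assume b: "b \<in> S"
      then have "after S (-1) \<le> b" using assms by (intro after_least) force+
      moreover have "b \<le> t" "after S (-1) \<le> t" using True b a by force+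
      ultimately show "cd T t (nxt S t) \<le> cd T t b" using True by (simp add: nxt_def cd_def)
    qed
  next
    case False
    note a = after_props(1,2)[OF assms(1) False]
    show ?thesis
    proof (intro conjI ballI)
      show "nxt S t \<in> S" using False a by (simp add: nxt_def)
    next
      fix b assume b: "b \<in> S"
      have n: "nxt S t = after S t" using False by (auto simp: nxt_def)
      have "after S t < T" "0 \<le> b" using a b assms by auto
      moreover have "after S t \<le> b" if "t < b" using that b by (intro after_least)
      ultimately show "cd T t (nxt S t) \<le> cd T t b" using a(2) by (auto simp: n cd_def)
    qed
  qed
  then show "nxt S t \<in> S" "\<And>b. b \<in> S \<Longrightarrow> cd T t (nxt S t) \<le> cd T t b" by auto
qed

lemma cd_inj:
  assumes "cd T t b = cd T t b'" "0 \<le> b" "b < T" "0 \<le> b'" "b' < T"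
  shows "b = b'"
  using assms by (auto simp: cd_def split: if_splits)

lemma nxt_eqI:
  assumes "finite S" "S \<subseteq> {0..<T}" "b \<in> S" "0 \<le> t" "t < T"
    and "\<And>b'. b' \<in> S \<Longrightarrow> cd T t b \<le> cd T t b'"
  shows "nxt S t = b"
proof -
  have ne: "S \<noteq> {}" using assms by auto
  note n = nxt_props[OF assms(1,2) ne assms(4,5)]
  show ?thesis
    by (rule cd_inj[of T t]) (use n assms in \<open>auto intro!: antisym\<close>)
qed

text \<open>A common successor of two different points \<open>t\<close> and \<open>t'\<close> would
  lie in the arc from \<open>t\<close> to \<open>t'\<close> and also in the arc from
  \<open>t'\<close> to \<open>t\<close>, but these are disjoint.\<close>

lemma nxt_inj:
  assumes S: "finite S" "S \<subseteq> {0..<T}" and t: "t \<in> S" "t' \<in> S" and eq: "nxt S t = nxt S t'"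
  shows "t = t'"
proof -
  have ne: "S \<noteq> {}" using t by auto
  have r: "0 \<le> t" "t < T" "0 \<le> t'" "t' < T" using t S by auto
  note n = nxt_props[OF S ne r(1,2)] nxt_props[OF S ne r(3,4)]
  have "cd T t (nxt S t) \<le> cd T t t'" "cd T t' (nxt S t) \<le> cd T t' t"
    using n(2)[OF t(2)] n(4)[OF t(1)] eq by auto
  moreover have "0 \<le> nxt S t" "nxt S t < T" using n(1) S by auto
  ultimately show ?thesis using r by (auto simp: cd_def split: if_splits)
qed

lemma nxt_subset:
  assumes "finite S" "S \<subseteq> {0..<T}" "S' \<subseteq> S" "0 \<le> t" "t < T" "nxt S t \<in> S'"
  shows "nxt S' t = nxt S t"
proof (rule nxt_eqI)
  show "finite S'" using assms finite_subset by blast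
  show "\<And>b'. b' \<in> S' \<Longrightarrow> cd T t (nxt S t) \<le> cd T t b'"
    using nxt_props(2)[OF assms(1,2) _ assms(4,5)] assms by blast
qed (use assms in auto)

text \<open>A stay at one vertex: \<open>S\<close> are the times of its bars, \<open>E\<close> those of the bars leading up, and
  \<open>\<rho> b\<close> is the time at which the excursion through \<open>b\<close> comes back, or \<open>-1\<close> if it does not.\<close>
definition pstep :: "real set \<Rightarrow> real set \<Rightarrow> (real \<Rightarrow> real) \<Rightarrow> real \<Rightarrow> real" where
  "pstep E S \<rho> t = (if t < 0 \<or> finite E \<and> nxt S t \<in> E then t else \<rho> (nxt S t))"

text \<open>\<open>pstep\<close> is absorbing after an escape and just before an exit, so its
  iterates reveal the outcome. With neither outcome the \<open>LEAST\<close> would be unspecified;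
  \<open>exit_exists\<close> excludes this.\<close>

definition pexit :: "real set \<Rightarrow> real set \<Rightarrow> (real \<Rightarrow> real) \<Rightarrow> real \<Rightarrow> real" where
  "pexit E S \<rho> s = (if \<exists>k. (pstep E S \<rho> ^^ k) s < 0 then -1
     else nxt S ((pstep E S \<rho> ^^ (LEAST k. finite E \<and> nxt S ((pstep E S \<rho> ^^ k) s) \<in> E)) s))"

lemma pexit_first:
  assumes "0 \<le> s" "nxt S s \<notin> E" "\<rho> (nxt S s) < 0"
  shows "pexit E S \<rho> s = -1"
proof -
  have "(pstep E S \<rho> ^^ 1) s < 0" using assms by (simp add: pstep_def)
  then show ?thesis unfolding pexit_def by metis
qed

lemma pexit_second:
  assumes "0 \<le> s" "nxt S s \<notin> E" "\<rho> (nxt S s) = r" "0 \<le> r" "nxt S r \<notin> E" "\<rho> (nxt S r) < 0"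
  shows "pexit E S \<rho> s = -1"
proof -
  have "(pstep E S \<rho> ^^ 2) s < 0" using assms by (simp add: pstep_def numeral_2_eq_2)
  then show ?thesis unfolding pexit_def by metis
qed

text \<open>One vertex in isolation: \<open>E\<close> holds the exits, \<open>B i\<close> the bars
  to child \<open>i\<close>. Of the subtrees it is only assumed that an excursion comes back on its
  own child edge and that different excursions come back at different times.
  \<open>pexit_range\<close> and \<open>pexit_inj\<close> reproduce these two facts for the vertex
  itself, which closes the recursion.\<close>

locale pole =
  fixes T :: real and E :: "real set" and I :: "'i set" and B :: "'i \<Rightarrow> real set" and \<rho> :: "real \<Rightarrow> real"
  assumes fin: "finite E" "finite I" "\<And>i. i \<in> I \<Longrightarrow> finite (B i)"
    and range: "E \<subseteq> {0..<T}" "\<And>i. i \<in> I \<Longrightarrow> B i \<subseteq> {0..<T}"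
    and disjE: "\<And>i. i \<in> I \<Longrightarrow> E \<inter> B i = {}"
    and disjB: "\<And>i j. i \<in> I \<Longrightarrow> j \<in> I \<Longrightarrow> i \<noteq> j \<Longrightarrow> B i \<inter> B j = {}"
    and rho: "\<And>i b. i \<in> I \<Longrightarrow> b \<in> B i \<Longrightarrow> \<rho> b = -1 \<or> \<rho> b \<in> B i"
    and rho_inj: "\<And>i b b'. i \<in> I \<Longrightarrow> b \<in> B i \<Longrightarrow> b' \<in> B i \<Longrightarrow> \<rho> b = \<rho> b' \<Longrightarrow> \<rho> b \<noteq> -1 \<Longrightarrow> b = b'"
begin

definition "S = E \<union> (\<Union>i\<in>I. B i)"
definition "u s k = (pstep E S \<rho> ^^ k) s"
definition "moving s k \<longleftrightarrow> (\<forall>j<k. 0 \<le> u s j \<and> nxt S (u s j) \<notin> E)"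

lemma finS: "finite S" and rangeS: "S \<subseteq> {0..<T}"
  using fin range by (auto simp: S_def)

lemma S_cases: "b \<in> S \<Longrightarrow> b \<notin> E \<Longrightarrow> \<exists>i\<in>I. b \<in> B i"
  unfolding S_def by blast

lemma u_0 [simp]: "u s 0 = s" by (simp add: u_def)

lemma u_Suc: "u s (Suc k) = (if u s k < 0 \<or> nxt S (u s k) \<in> E then u s k else \<rho> (nxt S (u s k)))"
  using fin by (simp add: u_def pstep_def)

lemma nxtS: "t \<in> S \<Longrightarrow> nxt S t \<in> S" "t \<in> S \<Longrightarrow> b \<in> S \<Longrightarrow> cd T t (nxt S t) \<le> cd T t b"
  using nxt_props[OF finS rangeS] rangeS by (auto simp: subset_eq)

lemma rho_S: "b \<in> S \<Longrightarrow> b \<notin> E \<Longrightarrow> \<rho> b = -1 \<or> \<rho> b \<in> (\<Union>i\<in>I. B i)"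
  using rho by (auto simp: S_def)

lemma u_cases: "s \<in> E \<Longrightarrow> u s k = -1 \<or> u s k \<in> S"
proof (induction k)
  case (Suc k)
  then show ?case using rho_S[OF nxtS(1), of "u s k"] by (auto simp: u_Suc S_def)
qed (simp add: S_def)

lemma u_nonneg: "s \<in> E \<Longrightarrow> 0 \<le> u s k \<Longrightarrow> u s k \<in> S"
  using u_cases[of s k] by auto

lemma moving_mono: "moving s k \<Longrightarrow> j \<le> k \<Longrightarrow> moving s j"
  by (auto simp: moving_def)

lemma moving_Suc: "moving s (Suc k) \<Longrightarrow> u s (Suc k) = \<rho> (nxt S (u s k))"
  by (auto simp: moving_def u_Suc)

lemma moving_B: "s \<in> E \<Longrightarrow> moving s (Suc k) \<Longrightarrow> u s (Suc k) \<noteq> -1 \<Longrightarrow> u s (Suc k) \<in> (\<Union>i\<in>I. B i)"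
  using rho_S[OF nxtS(1), of "u s k"] u_nonneg[of s k] by (auto simp: moving_Suc moving_def)

lemma step_inj:
  assumes "t \<in> S" "t' \<in> S" "nxt S t \<notin> E" "nxt S t' \<notin> E" "\<rho> (nxt S t) = \<rho> (nxt S t')" "\<rho> (nxt S t) \<noteq> -1"
  shows "t = t'"
proof -
  obtain i j where i: "i \<in> I" "nxt S t \<in> B i" and j: "j \<in> I" "nxt S t' \<in> B j"
    using assms nxtS(1)[of t] nxtS(1)[of t'] S_cases by blast
  then have "i = j" using rho[OF i] rho[OF j] disjB[of i j] assms by auto
  then have "nxt S t = nxt S t'" using rho_inj[of i] i j assms by auto
  then show ?thesis using nxt_inj[OF finS rangeS] assms by auto
qed

text \<open>The walk is reversible: by \<open>step_inj\<close> its present time determines the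
  previous one. Tracing two coinciding walks back, the shorter one arrives at its entry in
  \<open>E\<close>, whereas every later state of the other lies in some \<open>B i\<close>, disjoint
  from \<open>E\<close>.\<close>

lemma trace_back:
  assumes "s \<in> E" "s' \<in> E" "moving s k" "moving s' (k + d)" "u s k = u s' (k + d)" "u s k \<noteq> -1"
  shows "d = 0 \<and> s = s'"
  using assms(3-6)
proof (induction k)
  case 0
  show ?case
  proof (cases d)
    case (Suc d')
    then have "u s' d \<in> (\<Union>i\<in>I. B i)" using 0 moving_B[OF assms(2), of d'] by auto
    then show ?thesis using 0 disjE assms(1) by auto
  qed (use 0 in simp)
next
  case (Suc k)
  have m: "moving s k" "moving s' (k + d)" using Suc.prems by (auto simp: moving_def)
  have *: "0 \<le> u s k" "0 \<le> u s' (k + d)" "nxt S (u s k) \<notin> E" "nxt S (u s' (k + d)) \<notin> E"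
    using Suc.prems by (auto simp: moving_def)
  have "u s k = u s' (k + d)"
  proof (rule step_inj[OF u_nonneg[OF assms(1) *(1)] u_nonneg[OF assms(2) *(2)] *(3,4)])
    have e: "u s (Suc k) = \<rho> (nxt S (u s k))" "u s' (Suc (k + d)) = \<rho> (nxt S (u s' (k + d)))"
      using moving_Suc[OF Suc.prems(1)] moving_Suc[OF Suc.prems(2)[unfolded add_Suc]] by simp_all
    show "\<rho> (nxt S (u s k)) = \<rho> (nxt S (u s' (k + d)))" "\<rho> (nxt S (u s k)) \<noteq> -1"
      using Suc.prems by (simp_all only: e[symmetric] add_Suc not_False_eq_True)
  qed
  moreover have "u s k \<noteq> -1" using *(1) by linarith
  ultimately show ?case using Suc.IH m by blast
qed

text \<open>There are finitely many states, so a walk without end repeats one of them, which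
  \<open>trace_back\<close> with \<open>s = s'\<close> forbids.\<close>

lemma exit_exists:
  assumes s: "s \<in> E"
  obtains k where "moving s k" "u s k = -1" | k where "moving s k" "0 \<le> u s k" "nxt S (u s k) \<in> E"
proof (cases "\<exists>k. u s k < 0 \<or> nxt S (u s k) \<in> E")
  case True
  define k where "k = (LEAST k. u s k < 0 \<or> nxt S (u s k) \<in> E)"
  have k: "u s k < 0 \<or> nxt S (u s k) \<in> E" unfolding k_def using True by (rule LeastI_ex)
  have "\<not> (u s j < 0 \<or> nxt S (u s j) \<in> E)" if "j < k" for j
    using that unfolding k_def by (rule not_less_Least)
  then have mov: "moving s k" by (auto simp: moving_def not_less)
  have "u s k = -1 \<or> 0 \<le> u s k" using u_cases[OF s, of k] rangeS by auto
  then show ?thesis using k mov that by fastforce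
next
  case False
  then have mov: "moving s k" for k by (auto simp: moving_def not_less)
  have pos: "0 \<le> u s k" for k using False by (auto simp: not_less)
  have "range (u s) \<subseteq> S" using u_nonneg[OF s pos] by auto
  then have "finite (range (u s))" using finS finite_subset by blast
  then have "\<not> inj (u s)" by (meson finite_imageD infinite_UNIV_nat)
  then obtain i j where "u s i = u s j" "i < j"
    unfolding inj_def by (metis linorder_neqE_nat)
  then have "u s i = u s (i + (j - i))" "j - i \<noteq> 0" by auto
  moreover have "u s i \<noteq> -1" using pos[of i] by auto
  ultimately have False using trace_back[OF s s mov mov, of i "j - i"] by auto
  then show ?thesis ..
qed

lemma u_stay: "0 \<le> u s k \<Longrightarrow> nxt S (u s k) \<in> E \<Longrightarrow> u s (k + j) = u s k"
  by (induction j) (auto simp: u_Suc)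

lemma pexit_success:
  assumes "u s k < 0" shows "pexit E S \<rho> s = -1"
  using assms unfolding pexit_def u_def by auto

lemma pexit_fail: "u s k = -1 \<Longrightarrow> pexit E S \<rho> s = -1"
  using pexit_success[of s k] by simp

lemma pexit_return:
  assumes s: "s \<in> E" and k: "moving s k" "0 \<le> u s k" "nxt S (u s k) \<in> E"
  shows "pexit E S \<rho> s = nxt S (u s k)"
proof -
  have "\<not> u s j < 0" for j
  proof (cases "j \<le> k")
    case True
    then show ?thesis using k by (cases "j = k") (auto simp: moving_def not_less)
  next
    case False
    then show ?thesis using u_stay[OF k(2,3), of "j - k"] k(2) by auto
  qed
  moreover have "(LEAST k. nxt S (u s k) \<in> E) = k"
    using k by (intro Least_equality) (auto simp: moving_def not_less[symmetric])
  ultimately show ?thesis using fin unfolding pexit_def u_def by auto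
qed

lemma pexit_range: "s \<in> E \<Longrightarrow> pexit E S \<rho> s = -1 \<or> pexit E S \<rho> s \<in> E"
proof -
  assume s: "s \<in> E"
  show ?thesis
    by (rule exit_exists[OF s]) (simp_all add: pexit_fail pexit_return[OF s])
qed

lemma pexit_returnE:
  assumes "s \<in> E" "pexit E S \<rho> s \<noteq> -1"
  obtains k where "moving s k" "0 \<le> u s k" "nxt S (u s k) = pexit E S \<rho> s" "u s k \<in> S" "pexit E S \<rho> s \<in> E"
proof (rule exit_exists[OF assms(1)])
  fix k assume "moving s k" "u s k = -1"
  then show thesis using assms(2) pexit_fail by simp
next
  fix k assume k: "moving s k" "0 \<le> u s k" "nxt S (u s k) \<in> E"
  then show thesis
    using that[of k] pexit_return[OF assms(1) k] u_nonneg[OF assms(1) k(2)] by simp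
qed

text \<open>Walks with the same exit have the same last state by \<open>nxt_inj\<close>, and
  \<open>trace_back\<close> then identifies their entries.\<close>

lemma pexit_inj:
  assumes "s \<in> E" "s' \<in> E" "pexit E S \<rho> s = pexit E S \<rho> s'" "pexit E S \<rho> s \<noteq> -1"
  shows "s = s'"
proof -
  obtain k where k: "moving s k" "0 \<le> u s k" "nxt S (u s k) = pexit E S \<rho> s" "u s k \<in> S"
    using pexit_returnE[of s] assms by metis
  obtain k' where k': "moving s' k'" "0 \<le> u s' k'" "nxt S (u s' k') = pexit E S \<rho> s" "u s' k' \<in> S"
    using pexit_returnE[of s'] assms by metis
  have eq: "u s k = u s' k'" using nxt_inj[OF finS rangeS] k k' by auto
  show ?thesis
  proof (cases "k \<le> k'")
    case True
    then show ?thesis using trace_back[OF assms(1,2) k(1), of "k' - k"] k' k eq by auto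
  next
    case False
    then show ?thesis using trace_back[OF assms(2,1) k'(1), of "k - k'"] k' k eq by auto
  qed
qed

lemma pexit_success_iff: "s \<in> E \<Longrightarrow> pexit E S \<rho> s = -1 \<longleftrightarrow> (\<exists>k. moving s k \<and> u s k = -1)"
proof
  assume s: "s \<in> E" and ex: "pexit E S \<rho> s = -1"
  show "\<exists>k. moving s k \<and> u s k = -1"
  proof (rule exit_exists[OF s])
    fix k assume "moving s k" "0 \<le> u s k" "nxt S (u s k) \<in> E"
    then have "-1 \<in> E" using pexit_return[OF s] ex by metis
    then show ?thesis using range by auto
  qed auto
qed (auto simp: pexit_fail)

text \<open>A lone bar \<open>x\<close> that no sibling edge straddles (as seen from the entry \<open>s\<close>) cannot be
  jumped over, so a walk that gets back to \<open>s\<close> must have used it.\<close>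
lemma pexit_uncovered:
  assumes E: "E = {s}" and i: "i \<in> I" "B i = {x}" "\<rho> x = -1"
    and unc: "\<And>j. j \<in> I \<Longrightarrow> j \<noteq> i \<Longrightarrow> (\<forall>b\<in>B j. cd T s b < cd T s x) \<or> (\<forall>b\<in>B j. cd T s x < cd T s b)"
  shows "pexit E S \<rho> s = -1"
proof (rule ccontr)
  assume ne: "pexit E S \<rho> s \<noteq> -1"
  have s: "s \<in> E" "0 \<le> s" "s < T" using E range(1) by auto
  have x: "0 \<le> x" "x < T" "x \<noteq> s" using i range(2)[OF i(1)] disjE[OF i(1)] E by auto
  have xS: "x \<in> S" unfolding S_def using i by blast
  obtain k where k: "moving s k" "0 \<le> u s k" "nxt S (u s k) = pexit E S \<rho> s" "u s k \<in> S" "pexit E S \<rho> s \<in> E"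
    by (rule pexit_returnE[OF s(1) ne])
  \<comment> \<open>Invariant: measured from \<open>s\<close>, the walk stays strictly before
    \<open>x\<close>. The entry is a separate alternative because
    \<open>cd T s s = T\<close>.\<close>
  have "j \<le> k \<Longrightarrow> u s j = s \<or> cd T s (u s j) < cd T s x" for j
  proof (induction j)
    case (Suc j)
    let ?t = "u s j"
    have mv: "moving s (Suc j)" using moving_mono[OF k(1) Suc.prems] .
    then have t: "?t \<in> S" "nxt S ?t \<notin> E" using u_nonneg[OF s(1)] by (auto simp: moving_def)
    have eq: "u s (Suc j) = \<rho> (nxt S ?t)" using mv by (rule moving_Suc)
    have n1: "u s (Suc j) \<noteq> -1"
    proof (cases "Suc j = k")
      case False
      then have "0 \<le> u s (Suc j)" using k(1) Suc.prems by (auto simp: moving_def)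
      then show ?thesis by auto
    qed (use k in auto)
    then have nx: "nxt S ?t \<noteq> x" using eq i by auto
    have r: "0 \<le> ?t" "?t < T" "0 \<le> nxt S ?t" "nxt S ?t < T"
      using t rangeS nxtS(1)[OF t(1)] by auto
    have "cd T ?t (nxt S ?t) < cd T ?t x"
      using nxtS(2)[OF t(1) xS] nx cd_inj[of T ?t "nxt S ?t" x] r x by linarith
    moreover have "?t = s \<or> cd T s ?t < cd T s x" using Suc by auto
    ultimately have lt: "cd T s (nxt S ?t) < cd T s x"
      using r x s t(2) E by (auto simp: cd_def split: if_splits)
    obtain l where l: "l \<in> I" "nxt S ?t \<in> B l" using S_cases[OF nxtS(1)[OF t(1)] t(2)] by blast
    then have "l \<noteq> i" using nx i by auto
    \<comment> \<open>The child edge just used has a bar before \<open>x\<close>, hence by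
      \<open>unc\<close> only such bars, and the excursion returns through one of them.\<close>
    then have "\<forall>b\<in>B l. cd T s b < cd T s x" using unc[OF l(1)] l(2) lt by force
    moreover have "u s (Suc j) \<in> B l" using rho[OF l] n1 eq by auto
    ultimately show ?case by auto
  qed simp
  from this[of k] have inv: "u s k = s \<or> cd T s (u s k) < cd T s x" by simp
  \<comment> \<open>To be back at \<open>s\<close> the last step would have to pass over
    \<open>x\<close>.\<close>
  have "nxt S (u s k) = s" using k E by auto
  then have "cd T (u s k) s \<le> cd T (u s k) x" using nxtS(2)[OF k(4) xS] by simp
  moreover have "0 \<le> u s k" "u s k < T" using k(4) rangeS by auto
  ultimately show False using inv x s by (auto simp: cd_def split: if_splits)
qed

end

section \<open>Removing exits from a vertex\<close>

locale pole_sub = P: pole T E I B \<rho> + P': pole T E' I B \<rho>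
  for T :: real and E E' :: "real set" and I :: "'i set" and B \<rho> +
  assumes sub: "E' \<subseteq> E"
begin

lemma S_sub: "P'.S \<subseteq> P.S"
  unfolding P.S_def P'.S_def using sub by blast

lemma S_rest: "b \<in> P.S \<Longrightarrow> b \<notin> E \<or> b \<in> E' \<Longrightarrow> b \<in> P'.S"
  unfolding P.S_def P'.S_def by blast

lemma nxt_sub: "t \<in> P.S \<Longrightarrow> nxt P.S t \<notin> E \<or> nxt P.S t \<in> E' \<Longrightarrow> nxt P'.S t = nxt P.S t"
  using P.rangeS S_rest[OF P.nxtS(1)] by (intro nxt_subset[OF P.finS P.rangeS S_sub]) auto

text \<open>A next bar outside \<open>E\<close> survives the removal of exits and remains the
  successor, so both walks agree until the one with more exits leaves.\<close>

lemma moving_sub: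
  assumes s: "s \<in> E'" and mv: "P.moving s k"
  shows "P'.moving s k \<and> P'.u s k = P.u s k"
  using mv
proof (induction k)
  case (Suc k)
  have sE: "s \<in> E" using s sub by auto
  have IH: "P'.moving s k" "P'.u s k = P.u s k"
    using Suc.IH P.moving_mono[OF Suc.prems, of k] by auto
  have u: "0 \<le> P.u s k" "nxt P.S (P.u s k) \<notin> E" using Suc.prems by (auto simp: P.moving_def)
  have eq: "nxt P'.S (P.u s k) = nxt P.S (P.u s k)"
    using u P.u_nonneg[OF sE u(1)] by (intro nxt_sub) auto
  have "nxt P.S (P.u s k) \<notin> E'" using u sub by auto
  then show ?case using IH u eq P.moving_Suc[OF Suc.prems]
    by (simp add: P'.moving_def P'.u_Suc less_Suc_eq all_conj_distrib)
qed (simp add: P'.moving_def)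

lemma success_sub:
  assumes s: "s \<in> E'" and ex: "pexit E P.S \<rho> s = -1"
  shows "pexit E' P'.S \<rho> s = -1"
proof -
  have "s \<in> E" using s sub by auto
  then obtain k where "P.moving s k" "P.u s k = -1" using ex P.pexit_success_iff by blast
  then show ?thesis using moving_sub[OF s, of k] P'.pexit_fail[of s k] by simp
qed

lemma return_sub:
  assumes s: "s \<in> E'" and y: "y \<in> E'" and ex: "pexit E P.S \<rho> s = y"
  shows "pexit E' P'.S \<rho> s = y"
proof -
  have "0 \<le> y" using subsetD[OF P'.range(1) y] by simp
  then have ne: "pexit E P.S \<rho> s \<noteq> -1" using ex by linarith
  have sE: "s \<in> E" using s sub by auto
  obtain k where k: "P.moving s k" "0 \<le> P.u s k" "nxt P.S (P.u s k) = pexit E P.S \<rho> s" "P.u s k \<in> P.S"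
    by (rule P.pexit_returnE[OF sE ne])
  note m = moving_sub[OF s k(1)]
  have "nxt P'.S (P.u s k) = y" using nxt_sub[OF k(4)] k(3) y ex by simp
  then show ?thesis using P'.pexit_return[OF s, of k] m k(2) y by simp
qed

end

section \<open>The recursive walk through a subtree\<close>

definition child_at :: "(vert \<Rightarrow> real set) \<Rightarrow> vert \<Rightarrow> real \<Rightarrow> vert" where
  "child_at \<omega> v b = v @ [LEAST i. finite (\<omega> (v @ [i])) \<and> b \<in> \<omega> (v @ [i])]"

text \<open>\<open>ret m n \<omega> v E s\<close> follows the walk that enters the subtree of \<open>v\<close> at time \<open>s\<close>, where
  \<open>E\<close> are the times of the bars leading out of that subtree.  Its value is the time of the bar
  through which the walk leaves, or \<open>-1\<close> if it first reaches depth \<open>n\<close> below \<open>v\<close>.\<close>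
primrec ret :: "nat \<Rightarrow> nat \<Rightarrow> (vert \<Rightarrow> real set) \<Rightarrow> vert \<Rightarrow> real set \<Rightarrow> real \<Rightarrow> real" where
  "ret m 0 \<omega> v E s = -1"
| "ret m (Suc n) \<omega> v E s = pexit E (E \<union> (\<Union>i<m. \<omega> (v @ [i])))
     (\<lambda>b. ret m n \<omega> (child_at \<omega> v b) (\<omega> (child_at \<omega> v b)) b) s"

text \<open>The exits are a separate argument of \<open>ret\<close>, so it reads only edges strictly
  below \<open>v\<close>; the independence of different subtrees rests on this.\<close>

lemma ret_cong:
  "(\<And>u. u \<noteq> [] \<Longrightarrow> \<omega> (v @ u) = \<omega>' (v @ u)) \<Longrightarrow> ret m n \<omega> v E s = ret m n \<omega>' v E s"
proof (induction n arbitrary: v E s)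
  case (Suc n)
  have w: "\<omega> (v @ [i]) = \<omega>' (v @ [i])" for i using Suc.prems by simp
  have c: "child_at \<omega> v b = child_at \<omega>' v b" for b by (simp add: child_at_def w)
  have "ret m n \<omega> (child_at \<omega>' v b) (\<omega>' (child_at \<omega>' v b)) b =
     ret m n \<omega>' (child_at \<omega>' v b) (\<omega>' (child_at \<omega>' v b)) b" for b
    using Suc.prems by (intro Suc.IH) (auto simp: child_at_def)
  moreover have "\<omega> (child_at \<omega>' v b) = \<omega>' (child_at \<omega>' v b)" for b
    by (simp add: child_at_def w)
  ultimately show ?case by (simp add: w c)
qed simp

definition sub :: "nat \<Rightarrow> vert \<Rightarrow> vert set" where
  "sub m v = {v @ u | u. u \<noteq> [] \<and> set u \<subseteq> {..<m}}"

definition reg :: "nat \<Rightarrow> real \<Rightarrow> (vert \<Rightarrow> real set) \<Rightarrow> vert \<Rightarrow> bool" where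
  "reg m T \<omega> v \<longleftrightarrow> (\<forall>w\<in>sub m v. finite (\<omega> w) \<and> \<omega> w \<subseteq> {0<..<T}) \<and>
     (\<forall>w\<in>sub m v. \<forall>w'\<in>sub m v. w \<noteq> w' \<longrightarrow> \<omega> w \<inter> \<omega> w' = {})"

definition entry :: "nat \<Rightarrow> real \<Rightarrow> (vert \<Rightarrow> real set) \<Rightarrow> vert \<Rightarrow> real set \<Rightarrow> bool" where
  "entry m T \<omega> v E \<longleftrightarrow> finite E \<and> E \<subseteq> {0..<T} \<and> (\<forall>i<m. E \<inter> \<omega> (v @ [i]) = {})"

lemma sub_child: "i < m \<Longrightarrow> v @ [i] \<in> sub m v"
  by (auto simp: sub_def)

lemma sub_child_subset: "i < m \<Longrightarrow> sub m (v @ [i]) \<subseteq> sub m v"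
  unfolding sub_def by force

lemma
  assumes "reg m T \<omega> v" "w \<in> sub m v"
  shows reg_finite: "finite (\<omega> w)" and reg_range: "\<omega> w \<subseteq> {0<..<T}"
    and reg_disj: "w' \<in> sub m v \<Longrightarrow> w \<noteq> w' \<Longrightarrow> \<omega> w \<inter> \<omega> w' = {}"
  using assms by (simp_all add: reg_def)

lemma reg_child:
  assumes "reg m T \<omega> v" "i < m"
  shows "reg m T \<omega> (v @ [i])" "entry m T \<omega> (v @ [i]) (\<omega> (v @ [i]))"
proof -
  show "reg m T \<omega> (v @ [i])"
    using assms(1) subsetD[OF sub_child_subset[OF assms(2), of v]] unfolding reg_def by simp
  have "\<omega> (v @ [i]) \<inter> \<omega> (v @ [i] @ [j]) = {}" if "j < m" for j
  proof -
    have "v @ [i] @ [j] \<in> sub m v" using assms that by (auto simp: sub_def)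
    moreover have "v @ [i] \<noteq> v @ [i] @ [j]" by simp
    ultimately show ?thesis using reg_disj[OF assms(1) sub_child[OF assms(2)]] by simp
  qed
  moreover have "finite (\<omega> (v @ [i]))" "\<omega> (v @ [i]) \<subseteq> {0<..<T}"
    using reg_finite[OF assms(1) sub_child[OF assms(2)]] reg_range[OF assms(1) sub_child[OF assms(2)]] by auto
  moreover have "{0<..<T} \<subseteq> {0..<T}" by auto
  ultimately show "entry m T \<omega> (v @ [i]) (\<omega> (v @ [i]))" unfolding entry_def by auto
qed

lemma child_at_eq:
  assumes "reg m T \<omega> v" "i < m" "b \<in> \<omega> (v @ [i])"
  shows "child_at \<omega> v b = v @ [i]"
proof -
  have "finite (\<omega> (v @ [i]))" by (rule reg_finite[OF assms(1) sub_child[OF assms(2)]])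
  moreover have "i \<le> j" if "finite (\<omega> (v @ [j])) \<and> b \<in> \<omega> (v @ [j])" for j
  proof (rule ccontr)
    assume "\<not> i \<le> j"
    then have "j < m" "v @ [j] \<noteq> v @ [i]" using assms by auto
    then show False
      using reg_disj[OF assms(1) sub_child sub_child[OF assms(2)], of j] assms(3) that by blast
  qed
  ultimately have "(LEAST i. finite (\<omega> (v @ [i])) \<and> b \<in> \<omega> (v @ [i])) = i"
    using assms(3) by (intro Least_equality) auto
  then show ?thesis by (simp add: child_at_def)
qed

abbreviation crho :: "nat \<Rightarrow> nat \<Rightarrow> (vert \<Rightarrow> real set) \<Rightarrow> vert \<Rightarrow> real \<Rightarrow> real" where
  "crho m n \<omega> v b \<equiv> ret m n \<omega> (child_at \<omega> v b) (\<omega> (child_at \<omega> v b)) b"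

text \<open>The claims need each other: what \<open>pole\<close> assumes about the excursions from
  \<open>v\<close> is the range and injectivity of \<open>ret\<close> at the children, and these
  come from the poles at the children with one level less.\<close>

lemma ret_pole_induct:
  assumes "reg m T \<omega> v" "entry m T \<omega> v E"
  shows "pole T E {..<m} (\<lambda>i. \<omega> (v @ [i])) (crho m n \<omega> v) \<and>
    (\<forall>s\<in>E. ret m n \<omega> v E s = -1 \<or> ret m n \<omega> v E s \<in> E) \<and>
    (\<forall>s\<in>E. \<forall>s'\<in>E. ret m n \<omega> v E s = ret m n \<omega> v E s' \<longrightarrow> ret m n \<omega> v E s \<noteq> -1 \<longrightarrow> s = s')"
  using assms
proof (induction n arbitrary: v E)
  case 0
  have "pole T E {..<m} (\<lambda>i. \<omega> (v @ [i])) (crho m 0 \<omega> v)"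
  proof
    fix i assume i: "i \<in> {..<m}"
    show "\<omega> (v @ [i]) \<subseteq> {0..<T}" "finite (\<omega> (v @ [i]))"
      using reg_child(2)[OF 0(1)] i unfolding entry_def by auto
    show "E \<inter> \<omega> (v @ [i]) = {}" using 0(2) i unfolding entry_def by auto
    fix j assume "j \<in> {..<m}" "i \<noteq> j"
    then show "\<omega> (v @ [i]) \<inter> \<omega> (v @ [j]) = {}"
      using i by (intro reg_disj[OF 0(1)] sub_child) auto
  qed (use 0(2) in \<open>auto simp: entry_def\<close>)
  then show ?case by simp
next
  case (Suc n)
  note prev = Suc.IH[OF Suc.prems]
  interpret pole T E "{..<m}" "\<lambda>i. \<omega> (v @ [i])" "crho m n \<omega> v" using prev by blast
  have "pole T E {..<m} (\<lambda>i. \<omega> (v @ [i])) (crho m (Suc n) \<omega> v)"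
  proof
    fix i b assume i: "i \<in> {..<m}" and b: "b \<in> \<omega> (v @ [i])"
    then have im: "i < m" by simp
    have c: "child_at \<omega> v b = v @ [i]" by (rule child_at_eq[OF Suc.prems(1) im b])
    note r = reg_child[OF Suc.prems(1) im]
    have p: "pole T (\<omega> (v @ [i])) {..<m} (\<lambda>j. \<omega> ((v @ [i]) @ [j])) (crho m n \<omega> (v @ [i]))"
      using Suc.IH[OF r] by blast
    interpret c: pole T "\<omega> (v @ [i])" "{..<m}" "\<lambda>j. \<omega> ((v @ [i]) @ [j])" "crho m n \<omega> (v @ [i])"
      by (rule p)
    have e: "crho m (Suc n) \<omega> v b' = pexit (\<omega> (v @ [i])) c.S (crho m n \<omega> (v @ [i])) b'" if "b' \<in> \<omega> (v @ [i])" for b'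
      by (simp only: child_at_eq[OF Suc.prems(1) im that] ret.simps c.S_def)
    show "crho m (Suc n) \<omega> v b = -1 \<or> crho m (Suc n) \<omega> v b \<in> \<omega> (v @ [i])"
      unfolding e[OF b] by (rule c.pexit_range[OF b])
    fix b' assume b': "b' \<in> \<omega> (v @ [i])" and "crho m (Suc n) \<omega> v b = crho m (Suc n) \<omega> v b'"
      "crho m (Suc n) \<omega> v b \<noteq> -1"
    then show "b = b'" unfolding e[OF b] e[OF b'] using c.pexit_inj[OF b b'] by blast
  qed (fact fin range disjE disjB)+
  moreover have eq: "ret m (Suc n) \<omega> v E s = pexit E S (crho m n \<omega> v) s" for s
    by (simp add: S_def)
  ultimately show ?case
    unfolding eq using pexit_range pexit_inj by blast
qed

lemma
  assumes "reg m T \<omega> v" "entry m T \<omega> v E"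
  shows ret_pole: "pole T E {..<m} (\<lambda>i. \<omega> (v @ [i])) (crho m n \<omega> v)"
    and ret_range: "s \<in> E \<Longrightarrow> ret m n \<omega> v E s = -1 \<or> ret m n \<omega> v E s \<in> E"
  using ret_pole_induct[OF assms, of n] by blast+

lemma entry_subset: "entry m T \<omega> v E \<Longrightarrow> E' \<subseteq> E \<Longrightarrow> entry m T \<omega> v E'"
  unfolding entry_def by (auto intro: finite_subset)

text \<open>Where the walk with more exits would have left, the other one merely continues. Escape
  is therefore monotone under deleting bars of the edge above \<open>v\<close>, which the long-time
  estimates exploit.\<close>

lemma
  assumes r: "reg m T \<omega> v" and e: "entry m T \<omega> v E" and E': "E' \<subseteq> E" and s: "s \<in> E'"
  shows ret_subset_success: "ret m n \<omega> v E s = -1 \<Longrightarrow> ret m n \<omega> v E' s = -1"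
    and ret_subset_return: "ret m n \<omega> v E s = y \<Longrightarrow> y \<in> E' \<Longrightarrow> ret m n \<omega> v E' s = y"
proof -
  show "ret m n \<omega> v E s = -1 \<Longrightarrow> ret m n \<omega> v E' s = -1"
  proof (cases n)
    case (Suc k)
    interpret pole_sub T E E' "{..<m}" "\<lambda>i. \<omega> (v @ [i])" "crho m k \<omega> v"
      by (intro pole_sub.intro pole_sub_axioms.intro ret_pole r e E' entry_subset[OF e E'])
    show "ret m n \<omega> v E s = -1 \<Longrightarrow> ret m n \<omega> v E' s = -1"
      using success_sub[OF s] by (simp add: Suc P.S_def P'.S_def)
  qed simp
  show "ret m n \<omega> v E s = y \<Longrightarrow> y \<in> E' \<Longrightarrow> ret m n \<omega> v E' s = y"
  proof (cases n)
    case (Suc k)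
    interpret pole_sub T E E' "{..<m}" "\<lambda>i. \<omega> (v @ [i])" "crho m k \<omega> v"
      by (intro pole_sub.intro pole_sub_axioms.intro ret_pole r e E' entry_subset[OF e E'])
    show "ret m n \<omega> v E s = y \<Longrightarrow> y \<in> E' \<Longrightarrow> ret m n \<omega> v E' s = y"
      using return_sub[OF s] by (simp add: Suc P.S_def P'.S_def)
  qed simp
qed

section \<open>Measurability of the walk\<close>

lemma measurable_nxt [measurable (raw)]:
  assumes [measurable]: "f \<in> measurable M pts" "g \<in> borel_measurable M"
  shows "(\<lambda>x. nxt (f x) (g x)) \<in> borel_measurable M"
  unfolding nxt_def by measurable

lemma measurable_pexit:
  assumes [measurable]: "e \<in> measurable M pts" "S \<in> measurable M pts" "s \<in> borel_measurable M"
    and r [measurable]: "case_prod \<rho> \<in> borel_measurable (M \<Otimes>\<^sub>M borel)"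
  shows "(\<lambda>x. pexit (e x) (S x) (\<rho> x) (s x)) \<in> borel_measurable M"
proof -
  have [measurable]: "(\<lambda>x. (pstep (e x) (S x) (\<rho> x) ^^ k) (s x)) \<in> borel_measurable M" for k
  proof (induction k)
    case (Suc k)
    note [measurable] = Suc
    have [measurable]: "(\<lambda>x. \<rho> x (nxt (S x) ((pstep (e x) (S x) (\<rho> x) ^^ k) (s x)))) \<in> borel_measurable M"
      using measurable_compose[OF measurable_Pair[OF measurable_ident
          measurable_nxt[OF assms(2) Suc]] r] by (simp add: id_def)
    have "(pstep (e x) (S x) (\<rho> x) ^^ Suc k) (s x) =
      (let t = (pstep (e x) (S x) (\<rho> x) ^^ k) (s x) in
        if t < 0 \<or> finite (e x) \<and> nxt (S x) t \<in> e x then t else \<rho> x (nxt (S x) t))" for x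
      by (simp only: funpow.simps o_apply Let_def
          pstep_def[of "e x" "S x" "\<rho> x" "(pstep (e x) (S x) (\<rho> x) ^^ k) (s x)"])
    then show ?case unfolding Let_def by (simp only:) measurable
  qed simp
  have [measurable]: "(\<lambda>x. (pstep (e x) (S x) (\<rho> x) ^^
     (LEAST k. finite (e x) \<and> nxt (S x) ((pstep (e x) (S x) (\<rho> x) ^^ k) (s x)) \<in> e x)) (s x)) \<in> borel_measurable M"
    by (rule measurable_compose_countable[where f="\<lambda>k x. (pstep (e x) (S x) (\<rho> x) ^^ k) (s x)"])
       measurable
  show ?thesis unfolding pexit_def by measurable
qed

lemma measurable_edge [measurable]: "(\<lambda>\<omega>. \<omega> c) \<in> measurable (PiM I (\<lambda>_. pts)) pts"
proof (cases "c \<in> I")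
  case True
  then show ?thesis by (rule measurable_component_singleton)
next
  case False
  then have "\<omega> c = undefined" if "\<omega> \<in> space (PiM I (\<lambda>_. pts))" for \<omega> :: "'a \<Rightarrow> real set"
    using that by (auto simp: space_PiM)
  then have "(\<lambda>\<omega>. \<omega> c) \<in> measurable (PiM I (\<lambda>_. pts)) pts \<longleftrightarrow>
      (\<lambda>\<omega>::'a \<Rightarrow> real set. undefined) \<in> measurable (PiM I (\<lambda>_. pts)) pts"
    by (intro measurable_cong)
  then show ?thesis by simp
qed

text \<open>The recursion evaluates \<open>ret\<close> at a random child, at its random bars and at
  a random time. This forces joint measurability in all arguments; the child ranges over a countable
  set and is handled by composition.\<close>

lemma measurable_ret_joint:
  "(\<lambda>(\<omega>, E, s). ret m n \<omega> v E s) \<in> borel_measurable (PiM I (\<lambda>_. pts) \<Otimes>\<^sub>M pts \<Otimes>\<^sub>M borel)"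
proof (induction n arbitrary: v)
  case (Suc n)
  let ?M = "PiM I (\<lambda>_. pts) \<Otimes>\<^sub>M pts \<Otimes>\<^sub>M (borel :: real measure)"
  have e [measurable]: "(\<lambda>p. fst (fst p) c) \<in> measurable (?M \<Otimes>\<^sub>M borel) pts" for c
    by (rule measurable_compose[OF measurable_compose[OF measurable_fst measurable_fst] measurable_edge])
  have "(\<lambda>p. LEAST i. finite (fst (fst p) (v @ [i])) \<and> snd p \<in> fst (fst p) (v @ [i]))
      \<in> measurable (?M \<Otimes>\<^sub>M borel) (count_space UNIV)"
    by (intro measurable_Least pred_mem_pts e measurable_snd)
  moreover have "(\<lambda>p. ret m n (fst (fst p)) (v @ [i]) (fst (fst p) (v @ [i])) (snd p)) \<in> borel_measurable (?M \<Otimes>\<^sub>M borel)" for i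
  proof -
    have "(\<lambda>p. (fst (fst p), fst (fst p) (v @ [i]), snd p)) \<in> measurable (?M \<Otimes>\<^sub>M borel) ?M"
      by (intro measurable_Pair e measurable_snd measurable_compose[OF measurable_fst measurable_fst])
    from measurable_compose[OF this Suc.IH[of "v @ [i]"]] show ?thesis by simp
  qed
  ultimately have "(\<lambda>p. ret m n (fst (fst p)) (child_at (fst (fst p)) v (snd p))
      (fst (fst p) (child_at (fst (fst p)) v (snd p))) (snd p)) \<in> borel_measurable (?M \<Otimes>\<^sub>M borel)"
    unfolding child_at_def by (rule measurable_compose_countable[rotated])
  then have r: "(\<lambda>(x, b). crho m n (fst x) v b) \<in> borel_measurable (?M \<Otimes>\<^sub>M borel)"
    by (simp add: case_prod_beta')
  have "(\<lambda>x. pexit (fst (snd x)) (fst (snd x) \<union> (\<Union>i<m. fst x (v @ [i]))) (crho m n (fst x) v) (snd (snd x)))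
      \<in> borel_measurable ?M"
  proof (rule measurable_pexit[OF _ _ _ r])
    have "(\<lambda>x. fst x c) \<in> measurable ?M pts" for c
      by (rule measurable_compose[OF measurable_fst measurable_edge])
    then show "(\<lambda>x. fst (snd x) \<union> (\<Union>i<m. fst x (v @ [i]))) \<in> measurable ?M pts"
      by (intro measurable_pts_Un measurable_pts_UN) auto
  qed measurable
  then show ?case by (simp add: case_prod_beta')
qed (simp add: case_prod_beta')

lemma measurable_ret [measurable (raw)]:
  assumes [measurable]: "f \<in> measurable M (PiM I (\<lambda>_. pts))" "e \<in> measurable M pts" "s \<in> borel_measurable M"
  shows "(\<lambda>x. ret m n (f x) v (e x) (s x)) \<in> borel_measurable M"
proof -
  have "(\<lambda>x. (f x, e x, s x)) \<in> measurable M (PiM I (\<lambda>_. pts) \<Otimes>\<^sub>M pts \<Otimes>\<^sub>M borel)"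
    by measurable
  from measurable_compose[OF this measurable_ret_joint[of m n v I]] show ?thesis by simp
qed

section \<open>The random environment\<close>

definition Om :: "nat \<Rightarrow> real \<Rightarrow> (vert \<Rightarrow> real set) measure" where
  "Om d T = PiM (tree_edges d) (\<lambda>_. PP T)"

text \<open>A pointwise substitute for measurability with respect to the edges in
  \<open>K\<close>.\<close>

definition dep :: "vert set \<Rightarrow> ((vert \<Rightarrow> real set) \<Rightarrow> 'b) \<Rightarrow> bool" where
  "dep K f \<longleftrightarrow> (\<forall>w w'. (\<forall>i\<in>K. w i = w' i) \<longrightarrow> f w = f w')"

lemma sets_Om [measurable_cong]: "sets (Om d T) = sets (PiM (tree_edges d) (\<lambda>_. pts))"
  unfolding Om_def by (intro sets_PiM_cong) auto

lemma space_Om: "space (Om d T) = tree_edges d \<rightarrow>\<^sub>E UNIV"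
  unfolding Om_def by (simp add: space_PiM)

lemma measurable_edge_Om [measurable]: "(\<lambda>w. w c) \<in> measurable (Om d T) pts"
  using measurable_edge[of c "tree_edges d"] by (simp cong: measurable_cong_sets[OF sets_Om refl])

lemma measurable_upd_Om [measurable (raw)]:
  assumes "f \<in> measurable M (Om d T)" "g \<in> measurable M pts" "c \<in> tree_edges d"
  shows "(\<lambda>x. (f x)(c := g x)) \<in> measurable M (Om d T)"
proof -
  have f: "f \<in> measurable M (PiM (tree_edges d) (\<lambda>_. pts))"
    using assms(1) by (simp cong: measurable_cong_sets[OF refl sets_Om])
  have "(\<lambda>x. (f x)(c := g x)) \<in> measurable M (PiM (tree_edges d) (\<lambda>_. pts))"
    by (rule measurable_fun_upd[OF _ f assms(2)]) (use assms(3) in auto)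
  then show ?thesis by (simp cong: measurable_cong_sets[OF refl sets_Om])
qed

lemma measurable_ret_Om [measurable (raw)]:
  assumes "f \<in> measurable M (Om d T)" "e \<in> measurable M pts" "s \<in> borel_measurable M"
  shows "(\<lambda>x. ret m n (f x) v (e x) (s x)) \<in> borel_measurable M"
  by (rule measurable_ret[of _ _ "tree_edges d"])
     (use assms in \<open>simp_all cong: measurable_cong_sets[OF refl sets_Om]\<close>)

section \<open>Independence by resampling edges\<close>

definition mrg :: "vert set \<Rightarrow> (vert \<Rightarrow> real set) \<Rightarrow> (vert \<Rightarrow> real set) \<Rightarrow> vert \<Rightarrow> real set" where
  "mrg K w w' = (\<lambda>i. if i \<in> K then w i else w' i)"

lemma measurable_mrg [measurable (raw)]:
  assumes f: "f \<in> measurable M (Om d T)" and g: "g \<in> measurable M (Om d T)"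
  shows "(\<lambda>x. mrg K (f x) (g x)) \<in> measurable M (Om d T)"
proof -
  have "(\<lambda>x. mrg K (f x) (g x)) \<in> measurable M (PiM (tree_edges d) (\<lambda>_. pts))"
  proof (rule measurable_PiM_single')
    fix i assume "i \<in> tree_edges d"
    show "(\<lambda>x. mrg K (f x) (g x) i) \<in> measurable M pts"
      using measurable_compose[OF f measurable_edge_Om[of i]] measurable_compose[OF g measurable_edge_Om[of i]]
      by (auto simp: mrg_def)
  next
    show "(\<lambda>x. mrg K (f x) (g x)) \<in> space M \<rightarrow> (\<Pi>\<^sub>E i\<in>tree_edges d. space pts)"
      using measurable_space[OF f] measurable_space[OF g]
      by (auto simp: space_Om mrg_def PiE_def extensional_def)
  qed
  then show ?thesis by (simp cong: measurable_cong_sets[OF refl sets_Om])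
qed

locale stirring =
  fixes d :: nat and T :: real
  assumes T: "0 < T"
begin

lemma prob_space_Om: "prob_space (Om d T)"
  unfolding Om_def using prob_space_PP[OF T] by (intro prob_space_PiM)

sublocale PP: prob_space "PP T" by (rule prob_space_PP[OF T])
sublocale Om: prob_space "Om d T" by (rule prob_space_Om)
sublocale OmOm: pair_prob_space "Om d T" "Om d T" ..

text \<open>On a finite-dimensional rectangle over \<open>J\<close>, merging asks for a rectangle
  over \<open>J \<inter> K\<close> in the first copy and one over \<open>J - K\<close> in the
  second, and the two probabilities multiply to the right product.\<close>

lemma distr_mrg: "distr (Om d T \<Otimes>\<^sub>M Om d T) (Om d T) (\<lambda>(w, w'). mrg K w w') = Om d T"
proof -
  interpret P: product_prob_space "\<lambda>_. PP T" "tree_edges d" ..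
  let ?I = "tree_edges d"
  let ?D = "distr (Om d T \<Otimes>\<^sub>M Om d T) (Om d T) (\<lambda>(w, w'). mrg K w w')"
  have "?D = PiM ?I (\<lambda>_. PP T)"
  proof (rule P.PiM_eq)
    show "sets ?D = sets (PiM ?I (\<lambda>_. PP T))" by (simp add: Om_def)
    fix J F assume J: "finite J" "J \<subseteq> ?I" "\<And>j. j \<in> J \<Longrightarrow> F j \<in> sets (PP T)"
    let ?X = "\<lambda>J. prod_emb ?I (\<lambda>_. PP T) J (\<Pi>\<^sub>E j\<in>J. F j)"
    have X: "?X J' \<in> sets (Om d T)" if "J' \<subseteq> J" for J'
      unfolding Om_def using J that finite_subset[OF that] by (intro sets_PiM_I) auto
    have mem: "w \<in> ?X J' \<longleftrightarrow> (\<forall>j\<in>J'. w j \<in> F j)" if "J' \<subseteq> J" "w \<in> space (Om d T)" for J' w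
      using that J by (auto simp: prod_emb_def space_Om PiE_def Pi_def extensional_def restrict_def)
    have "(\<lambda>(w, w'). mrg K w w') -` ?X J \<inter> space (Om d T \<Otimes>\<^sub>M Om d T) = ?X (J \<inter> K) \<times> ?X (J - K)"
    proof -
      have "mrg K w w' \<in> ?X J \<longleftrightarrow> w \<in> ?X (J \<inter> K) \<and> w' \<in> ?X (J - K)"
        if w: "w \<in> space (Om d T)" "w' \<in> space (Om d T)" for w w'
      proof -
        have "mrg K w w' \<in> space (Om d T)" using w by (auto simp: space_Om mrg_def PiE_def extensional_def)
        then show ?thesis using w by (subst (1 2 3) mem) (auto simp: mrg_def)
      qed
      moreover have "?X J' \<subseteq> space (Om d T)" if "J' \<subseteq> J" for J'
        using X[OF that] sets.sets_into_space by blast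
      ultimately show ?thesis
        by (auto simp: space_pair_measure) blast+
    qed
    then have "emeasure ?D (?X J) = emeasure (Om d T \<Otimes>\<^sub>M Om d T) (?X (J \<inter> K) \<times> ?X (J - K))"
      by (subst emeasure_distr) (auto intro!: X simp: case_prod_beta')
    also have "\<dots> = emeasure (Om d T) (?X (J \<inter> K)) * emeasure (Om d T) (?X (J - K))"
      by (intro Om.emeasure_pair_measure_Times X) auto
    also have "\<dots> = (\<Prod>j\<in>J \<inter> K. emeasure (PP T) (F j)) * (\<Prod>j\<in>J - K. emeasure (PP T) (F j))"
      unfolding Om_def using J by (intro arg_cong2[where f="(*)"] P.emeasure_PiM_emb) auto
    also have "\<dots> = (\<Prod>j\<in>J. emeasure (PP T) (F j))"
      using J(1) by (subst prod.union_disjoint[symmetric]) (auto intro!: prod.cong)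
    finally show "emeasure ?D (?X J) = (\<Prod>j\<in>J. emeasure (PP T) (F j))" .
  qed
  then show ?thesis by (simp add: Om_def)
qed

text \<open>Fubini for the split environment: the inner integral is the conditional expectation
  given the edges in \<open>K\<close>.\<close>

lemma nn_integral_mrg:
  assumes [measurable]: "f \<in> borel_measurable (Om d T)"
  shows "(\<integral>\<^sup>+w. f w \<partial>Om d T) = (\<integral>\<^sup>+w. (\<integral>\<^sup>+w'. f (mrg K w w') \<partial>Om d T) \<partial>Om d T)"
proof -
  have "(\<integral>\<^sup>+w. f w \<partial>Om d T) = (\<integral>\<^sup>+w. f w \<partial>distr (Om d T \<Otimes>\<^sub>M Om d T) (Om d T) (\<lambda>(w, w'). mrg K w w'))"
    by (simp only: distr_mrg)
  also have "\<dots> = (\<integral>\<^sup>+p. f (mrg K (fst p) (snd p)) \<partial>(Om d T \<Otimes>\<^sub>M Om d T))"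
    by (subst nn_integral_distr) (auto simp: case_prod_beta')
  also have "\<dots> = (\<integral>\<^sup>+w. (\<integral>\<^sup>+w'. f (mrg K w w') \<partial>Om d T) \<partial>Om d T)"
    by (subst Om.nn_integral_fst[symmetric]) auto
  finally show ?thesis .
qed

text \<open>After merging along \<open>K\<close>, \<open>f\<close> sees only the first copy and
  \<open>g\<close> only the second.\<close>

lemma nn_integral_indep:
  fixes f g :: "(vert \<Rightarrow> real set) \<Rightarrow> ennreal"
  assumes [measurable]: "f \<in> borel_measurable (Om d T)" "g \<in> borel_measurable (Om d T)"
    and f: "dep K f" and g: "dep K' g" and K: "K \<inter> K' = {}"
  shows "(\<integral>\<^sup>+w. f w * g w \<partial>Om d T) = (\<integral>\<^sup>+w. f w \<partial>Om d T) * (\<integral>\<^sup>+w. g w \<partial>Om d T)"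
proof -
  have "f (mrg K w w') = f w" for w w' using f by (auto simp: dep_def mrg_def)
  moreover have "g (mrg K w w') = g w'" for w w'
  proof -
    have "\<forall>i\<in>K'. mrg K w w' i = w' i" using K by (auto simp: mrg_def)
    then show ?thesis using g by (auto simp: dep_def)
  qed
  ultimately have "(\<integral>\<^sup>+w. f w * g w \<partial>Om d T) = (\<integral>\<^sup>+w. (\<integral>\<^sup>+w'. f w * g w' \<partial>Om d T) \<partial>Om d T)"
    by (subst nn_integral_mrg[where K=K]) simp_all
  also have "\<dots> = (\<integral>\<^sup>+w. f w \<partial>Om d T) * (\<integral>\<^sup>+w. g w \<partial>Om d T)"
    by (simp add: nn_integral_cmult nn_integral_multc)
  finally show ?thesis .
qed

lemma dep_prod:
  fixes f :: "'j \<Rightarrow> (vert \<Rightarrow> real set) \<Rightarrow> ennreal"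
  assumes "\<And>j. j \<in> J \<Longrightarrow> dep (K j) (f j)"
  shows "dep (\<Union>j\<in>J. K j) (\<lambda>w. \<Prod>j\<in>J. f j w)"
  using assms unfolding dep_def by (fastforce intro!: prod.cong)

lemma nn_integral_indep_prod:
  fixes f :: "'j \<Rightarrow> (vert \<Rightarrow> real set) \<Rightarrow> ennreal"
  assumes "finite J" and m: "\<And>j. j \<in> J \<Longrightarrow> f j \<in> borel_measurable (Om d T)"
    and dep: "\<And>j. j \<in> J \<Longrightarrow> dep (K j) (f j)"
    and K: "\<And>i j. i \<in> J \<Longrightarrow> j \<in> J \<Longrightarrow> i \<noteq> j \<Longrightarrow> K i \<inter> K j = {}"
  shows "(\<integral>\<^sup>+w. (\<Prod>j\<in>J. f j w) \<partial>Om d T) = (\<Prod>j\<in>J. \<integral>\<^sup>+w. f j w \<partial>Om d T)"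
  using assms
proof (induction J rule: finite_induct)
  case empty
  then show ?case by (simp add: Om.emeasure_space_1)
next
  case (insert j J)
  have "(\<integral>\<^sup>+w. f j w * (\<Prod>j\<in>J. f j w) \<partial>Om d T) =
      (\<integral>\<^sup>+w. f j w \<partial>Om d T) * (\<integral>\<^sup>+w. (\<Prod>j\<in>J. f j w) \<partial>Om d T)"
  proof (rule nn_integral_indep[where K="K j" and K'="\<Union>i\<in>J. K i"])
    show "K j \<inter> (\<Union>i\<in>J. K i) = {}" using insert by blast
    show "dep (\<Union>i\<in>J. K i) (\<lambda>w. \<Prod>j\<in>J. f j w)" using insert by (intro dep_prod) auto
    show "(\<lambda>w. \<Prod>j\<in>J. f j w) \<in> borel_measurable (Om d T)"
      using insert by (intro borel_measurable_prod_ennreal) auto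
  qed (use insert in auto)
  also have "(\<integral>\<^sup>+w. (\<Prod>j\<in>J. f j w) \<partial>Om d T) = (\<Prod>j\<in>J. \<integral>\<^sup>+w. f j w \<partial>Om d T)"
    using insert by (intro insert.IH) auto
  finally show ?case using insert by simp
qed

section \<open>Single edges: Mecke's formula and null events\<close>

lemma nn_integral_edge:
  assumes c: "c \<in> tree_edges d" and [measurable]: "f \<in> borel_measurable pts"
  shows "(\<integral>\<^sup>+w. f (w c) \<partial>Om d T) = (\<integral>\<^sup>+B. f B \<partial>PP T)"
proof -
  have "distr (Om d T) (PP T) (\<lambda>w. w c) = PP T"
    unfolding Om_def by (rule distr_PiM_component) (use c prob_space_PP[OF T] in auto)
  then have "(\<integral>\<^sup>+B. f B \<partial>PP T) = (\<integral>\<^sup>+B. f B \<partial>distr (Om d T) (PP T) (\<lambda>w. w c))" by simp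
  also have "\<dots> = (\<integral>\<^sup>+w. f (w c) \<partial>Om d T)" 
  proof (rule nn_integral_distr)
    show "(\<lambda>w. w c) \<in> measurable (Om d T) (PP T)"
      by (subst measurable_cong_sets[OF refl sets_PP]) (rule measurable_edge_Om)
    show "f \<in> borel_measurable (distr (Om d T) (PP T) (\<lambda>w. w c))"
      by (subst measurable_cong_sets[OF _ refl, of _ pts]) (simp_all add: assms)
  qed
  finally show ?thesis by simp
qed

lemma nn_integral_upd:
  assumes c: "c \<in> tree_edges d" and [measurable]: "f \<in> borel_measurable (Om d T)"
  shows "(\<integral>\<^sup>+w. f w \<partial>Om d T) = (\<integral>\<^sup>+w. (\<integral>\<^sup>+B. f (w(c := B)) \<partial>PP T) \<partial>Om d T)"
proof -
  have "(\<integral>\<^sup>+w. f w \<partial>Om d T) = (\<integral>\<^sup>+w. (\<integral>\<^sup>+w'. f (w(c := w' c)) \<partial>Om d T) \<partial>Om d T)"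
  proof -
    have "mrg (- {c}) w w' = w(c := w' c)" for w w' by (auto simp: mrg_def fun_eq_iff)
    then show ?thesis by (subst nn_integral_mrg[where K="- {c}"]) simp_all
  qed
  also have "\<dots> = (\<integral>\<^sup>+w. (\<integral>\<^sup>+B. f (w(c := B)) \<partial>PP T) \<partial>Om d T)"
  proof (rule nn_integral_cong)
    fix w assume [measurable]: "w \<in> space (Om d T)"
    show "(\<integral>\<^sup>+w'. f (w(c := w' c)) \<partial>Om d T) = (\<integral>\<^sup>+B. f (w(c := B)) \<partial>PP T)"
      by (rule nn_integral_edge[OF c]) (use c in measurable)
  qed
  finally show ?thesis .
qed

lemma Om_Mecke:
  assumes c: "c \<in> tree_edges d" and [measurable]: "case_prod f \<in> borel_measurable (borel \<Otimes>\<^sub>M Om d T)"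
  shows "(\<integral>\<^sup>+w. (\<Sum>x\<in>w c. f x (w(c := w c - {x}))) \<partial>Om d T) =
    (\<integral>\<^sup>+x\<in>{0<..<T}. (\<integral>\<^sup>+w. f x w \<partial>Om d T) \<partial>lborel)"
proof -
  note [measurable] = c
  interpret L: pair_sigma_finite "Om d T" lborel ..
  have "(\<integral>\<^sup>+w. (\<Sum>x\<in>w c. f x (w(c := w c - {x}))) \<partial>Om d T) =
    (\<integral>\<^sup>+w. (\<integral>\<^sup>+B. (\<Sum>x\<in>B. f x (w(c := B - {x}))) \<partial>PP T) \<partial>Om d T)"
    by (subst nn_integral_upd[OF c]) simp_all
  also have "\<dots> = (\<integral>\<^sup>+w. (\<integral>\<^sup>+x\<in>{0<..<T}. (\<integral>\<^sup>+B. f x (w(c := B)) \<partial>PP T) \<partial>lborel) \<partial>Om d T)"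
  proof (rule nn_integral_cong)
    fix w assume [measurable]: "w \<in> space (Om d T)"
    show "(\<integral>\<^sup>+B. (\<Sum>x\<in>B. f x (w(c := B - {x}))) \<partial>PP T) =
      (\<integral>\<^sup>+x\<in>{0<..<T}. (\<integral>\<^sup>+B. f x (w(c := B)) \<partial>PP T) \<partial>lborel)"
      by (rule PP_Mecke[OF T]) measurable
  qed
  also have "\<dots> = (\<integral>\<^sup>+x. (\<integral>\<^sup>+w. (\<integral>\<^sup>+B. f x (w(c := B)) \<partial>PP T) * indicator {0<..<T} x \<partial>Om d T) \<partial>lborel)"
    by (rule L.Fubini'[symmetric]) measurable
  also have "\<dots> = (\<integral>\<^sup>+x\<in>{0<..<T}. (\<integral>\<^sup>+w. f x w \<partial>Om d T) \<partial>lborel)"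
  proof (rule nn_integral_cong)
    fix x :: real
    have "(\<integral>\<^sup>+w. (\<integral>\<^sup>+B. f x (w(c := B)) \<partial>PP T) \<partial>Om d T) = (\<integral>\<^sup>+w. f x w \<partial>Om d T)"
      by (rule nn_integral_upd[OF c, symmetric]) measurable
    moreover have "(\<integral>\<^sup>+w. (\<integral>\<^sup>+B. f x (w(c := B)) \<partial>PP T) * indicator {0<..<T} x \<partial>Om d T) =
      (\<integral>\<^sup>+w. (\<integral>\<^sup>+B. f x (w(c := B)) \<partial>PP T) \<partial>Om d T) * indicator {0<..<T} x"
      by (rule nn_integral_multc) measurable
    ultimately show "(\<integral>\<^sup>+w. (\<integral>\<^sup>+B. f x (w(c := B)) \<partial>PP T) * indicator {0<..<T} x \<partial>Om d T) =
      (\<integral>\<^sup>+w. f x w \<partial>Om d T) * indicator {0<..<T} x"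
      by simp
  qed
  finally show ?thesis .
qed

lemma Om_void_rest:
  assumes c: "c \<in> tree_edges d" and [measurable]: "A \<in> sets borel" "f \<in> borel_measurable (Om d T)"
  shows "(\<integral>\<^sup>+w. indicator {w. w c \<inter> A = {}} w * f (w(c := w c - A)) \<partial>Om d T) =
    ennreal (exp (- vol T A)) * (\<integral>\<^sup>+w. f (w(c := w c - A)) \<partial>Om d T)"
proof -
  note [measurable] = c
  have [measurable]: "(\<lambda>w. indicator {w. w c \<inter> A = {}} w :: ennreal) \<in> borel_measurable (Om d T)"
    unfolding indicator_def by measurable
  have "(\<integral>\<^sup>+w. indicator {w. w c \<inter> A = {}} w * f (w(c := w c - A)) \<partial>Om d T) =
    (\<integral>\<^sup>+w. (\<integral>\<^sup>+B. indicator {B. B \<inter> A = {}} B * f (w(c := B - A)) \<partial>PP T) \<partial>Om d T)"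
    by (subst nn_integral_upd[OF c]) (simp_all add: indicator_def del: disjoint_iff)
  also have "\<dots> = (\<integral>\<^sup>+w. ennreal (exp (- vol T A)) * (\<integral>\<^sup>+B. f (w(c := B - A)) \<partial>PP T) \<partial>Om d T)"
  proof (rule nn_integral_cong)
    fix w assume [measurable]: "w \<in> space (Om d T)"
    show "(\<integral>\<^sup>+B. indicator {B. B \<inter> A = {}} B * f (w(c := B - A)) \<partial>PP T) =
      ennreal (exp (- vol T A)) * (\<integral>\<^sup>+B. f (w(c := B - A)) \<partial>PP T)"
      by (rule PP_void_rest[OF T]) measurable
  qed
  also have "\<dots> = ennreal (exp (- vol T A)) * (\<integral>\<^sup>+w. (\<integral>\<^sup>+B. f (w(c := B - A)) \<partial>PP T) \<partial>Om d T)"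
    by (rule nn_integral_cmult) measurable
  also have "(\<integral>\<^sup>+w. (\<integral>\<^sup>+B. f (w(c := B - A)) \<partial>PP T) \<partial>Om d T) = (\<integral>\<^sup>+w. f (w(c := w c - A)) \<partial>Om d T)"
    by (subst (2) nn_integral_upd[OF c]) simp_all
  finally show ?thesis .
qed

lemma AE_edge:
  assumes c: "c \<in> tree_edges d"
  shows "AE w in Om d T. finite (w c) \<and> w c \<subseteq> {0<..<T}"
  unfolding Om_def using AE_PP[OF T] c prob_space_PP[OF T] by (intro AE_PiM_component) auto

lemma emeasure_edge_void:
  assumes c: "c \<in> tree_edges d" and [measurable]: "A \<in> sets borel"
  shows "(\<integral>\<^sup>+w. indicator {w. w c \<inter> A = {}} w \<partial>Om d T) = ennreal (exp (- vol T A))"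
proof -
  have "(\<integral>\<^sup>+w. indicator {B. B \<inter> A = {}} (w c) \<partial>Om d T) = (\<integral>\<^sup>+B. indicator {B. B \<inter> A = {}} B \<partial>PP T)"
    by (rule nn_integral_edge[OF c]) measurable
  also have "\<dots> = ennreal (exp (- vol T A))"
    by (subst nn_integral_indicator) (auto simp: PP_void[OF T])
  finally show ?thesis by (simp add: indicator_def del: disjoint_iff)
qed

lemma AE_edge_notin:
  assumes c: "c \<in> tree_edges d"
  shows "AE w in Om d T. x \<notin> w c"
proof -
  have "AE B in PP T. B \<inter> {x} = {}"
  proof (subst PP.AE_iff_emeasure_eq_1)
    have "vol T {x} = 0" by (simp add: vol_def Int_insert_left)
    then show "emeasure (PP T) {B \<in> space (PP T). B \<inter> {x} = {}} = 1"
      using PP_void[OF T, of "{x}"] by (simp del: disjoint_iff)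
    show "Measurable.pred (PP T) (\<lambda>B. B \<inter> {x} = {})"
      by (rule pred_void) (simp_all add: measurable_ident_sets)
  qed
  then have "AE w in Om d T. w c \<inter> {x} = {}"
    unfolding Om_def using c prob_space_PP[OF T] by (intro AE_PiM_component) auto
  then show ?thesis by (auto elim!: eventually_mono)
qed

text \<open>By Mecke's formula the expected number of common points is an integral over
  \<open>x\<close> of the probability that \<open>x\<close> lies in \<open>w c'\<close>, which
  vanishes for every fixed \<open>x\<close>.\<close>

lemma AE_edges_disj:
  assumes c: "c \<in> tree_edges d" "c' \<in> tree_edges d" "c \<noteq> c'"
  shows "AE w in Om d T. w c \<inter> w c' = {}"
proof -
  let ?f = "\<lambda>x w. indicator {w. finite (w c') \<and> x \<in> w c'} w :: ennreal"
  have f [measurable]: "case_prod ?f \<in> borel_measurable (borel \<Otimes>\<^sub>M Om d T)"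
    unfolding indicator_def case_prod_beta' mem_Collect_eq by measurable
  have "(\<integral>\<^sup>+w. (\<Sum>x\<in>w c. ?f x (w(c := w c - {x}))) \<partial>Om d T) = (\<integral>\<^sup>+x\<in>{0<..<T}. (\<integral>\<^sup>+w. ?f x w \<partial>Om d T) \<partial>lborel)"
    by (rule Om_Mecke[OF c(1)]) measurable
  also have "\<dots> = (\<integral>\<^sup>+x\<in>{0<..<T}. 0 \<partial>lborel)"
  proof (intro nn_integral_cong arg_cong2[where f="(*)"] refl)
    fix x
    have "(\<integral>\<^sup>+w. ?f x w \<partial>Om d T) = (\<integral>\<^sup>+w. 0 \<partial>Om d T)"
      using AE_edge_notin[OF c(2), of x] by (intro nn_integral_cong_AE) (auto elim!: eventually_mono)
    then show "(\<integral>\<^sup>+w. ?f x w \<partial>Om d T) = 0" by simp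
  qed
  finally have "(\<integral>\<^sup>+w. (\<Sum>x\<in>w c. ?f x w) \<partial>Om d T) = 0"
    using c(3) by (simp add: indicator_def)
  then have "AE w in Om d T. (\<Sum>x\<in>w c. ?f x w) = 0"
    by (subst (asm) nn_integral_0_iff_AE) measurable
  with AE_edge[OF c(1)] AE_edge[OF c(2)] show ?thesis
  proof eventually_elim
    case (elim w)
    then have "\<forall>x\<in>w c. ?f x w = 0" by (simp add: sum_eq_0_iff)
    then show ?case using elim by (auto simp: indicator_def)
  qed
qed

definition regular :: "(vert \<Rightarrow> real set) \<Rightarrow> bool" where
  "regular w \<longleftrightarrow> (\<forall>c\<in>tree_edges d. finite (w c) \<and> w c \<subseteq> {0<..<T}) \<and>
     (\<forall>c\<in>tree_edges d. \<forall>c'\<in>tree_edges d. c \<noteq> c' \<longrightarrow> w c \<inter> w c' = {})"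

lemma AE_regular: "AE w in Om d T. regular w"
proof -
  have ct: "countable (tree_edges d)" by simp
  have "AE w in Om d T. \<forall>c\<in>tree_edges d. finite (w c) \<and> w c \<subseteq> {0<..<T}"
    using AE_edge by (subst AE_ball_countable[OF ct]) auto
  moreover have "AE w in Om d T. \<forall>c\<in>tree_edges d. \<forall>c'\<in>tree_edges d. c \<noteq> c' \<longrightarrow> w c \<inter> w c' = {}"
  proof (subst AE_ball_countable[OF ct], intro ballI, subst AE_ball_countable[OF ct], intro ballI)
    fix c c' assume "c \<in> tree_edges d" "c' \<in> tree_edges d"
    then show "AE w in Om d T. c \<noteq> c' \<longrightarrow> w c \<inter> w c' = {}"
      using AE_edges_disj[of c c'] by (cases "c = c'") auto
  qed
  ultimately show ?thesis unfolding regular_def by eventually_elim simp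
qed

lemma sub_edges: "v \<in> tree_verts d \<Longrightarrow> sub (d - 1) v \<subseteq> tree_edges d"
  by (auto simp: sub_def tree_edges_def tree_verts_def)

lemma regular_reg:
  assumes "regular w" "v \<in> tree_verts d"
  shows "reg (d - 1) T w v"
  using assms(1) subsetD[OF sub_edges[OF assms(2)]] unfolding reg_def regular_def by simp

end

section \<open>Short times: children met by a single bar\<close>

lemma measurable_of_bool [measurable (raw)]:
  "Measurable.pred M P \<Longrightarrow> (\<lambda>x. of_bool (P x) :: ennreal) \<in> borel_measurable M"
  unfolding of_bool_def by measurable

lemma measurable_cd [measurable (raw)]:
  assumes [measurable]: "s \<in> borel_measurable M" "x \<in> borel_measurable M"
  shows "(\<lambda>w. cd T (s w) (x w)) \<in> borel_measurable M"
  unfolding cd_def by measurable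

text \<open>Rotation invariance of Lebesgue measure on the circle: the parts of the interval after
  and before \<open>s\<close> are shifted separately.\<close>

lemma nn_integral_cd:
  assumes [measurable]: "g \<in> borel_measurable borel" and s: "0 \<le> s" "s < T"
  shows "(\<integral>\<^sup>+x\<in>{0<..<T}. g (cd T s x) \<partial>lborel) = (\<integral>\<^sup>+u\<in>{0<..<T}. g u \<partial>lborel)"
proof -
  have "(\<integral>\<^sup>+x\<in>{0<..<T}. g (cd T s x) \<partial>lborel) =
    (\<integral>\<^sup>+x. g (x - s) * indicator {s<..<T} x + g (x - s + T) * indicator {0<..<s} x \<partial>lborel)"
  proof (rule nn_integral_cong_AE)
    show "AE x in lborel. g (cd T s x) * indicator {0<..<T} x =
      g (x - s) * indicator {s<..<T} x + g (x - s + T) * indicator {0<..<s} x"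
      using AE_lborel_singleton[of s]
      by eventually_elim (use s in \<open>auto simp: cd_def indicator_def\<close>)
  qed
  also have "\<dots> = (\<integral>\<^sup>+x. g (x - s) * indicator {s<..<T} x \<partial>lborel) +
      (\<integral>\<^sup>+x. g (x - s + T) * indicator {0<..<s} x \<partial>lborel)"
    by (rule nn_integral_add) measurable
  also have "(\<integral>\<^sup>+x. g (x - s) * indicator {s<..<T} x \<partial>lborel) = (\<integral>\<^sup>+u. g u * indicator {0<..<T-s} u \<partial>lborel)"
    by (subst nn_integral_real_affine[where t=s and c=1])
       (auto intro!: nn_integral_cong simp: indicator_def)
  also have "(\<integral>\<^sup>+x. g (x - s + T) * indicator {0<..<s} x \<partial>lborel) = (\<integral>\<^sup>+u. g u * indicator {T-s<..<T} u \<partial>lborel)"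
    by (subst nn_integral_real_affine[where t="s-T" and c=1])
       (auto intro!: nn_integral_cong simp: indicator_def)
  also have "(\<integral>\<^sup>+u. g u * indicator {0<..<T-s} u \<partial>lborel) + (\<integral>\<^sup>+u. g u * indicator {T-s<..<T} u \<partial>lborel) =
     (\<integral>\<^sup>+u. g u * indicator {0<..<T-s} u + g u * indicator {T-s<..<T} u \<partial>lborel)"
    by (rule nn_integral_add[symmetric]) measurable
  also have "\<dots> = (\<integral>\<^sup>+u\<in>{0<..<T}. g u \<partial>lborel)"
  proof (rule nn_integral_cong_AE)
    show "AE u in lborel. g u * indicator {0<..<T-s} u + g u * indicator {T-s<..<T} u =
      g u * indicator {0<..<T} u"
      using AE_lborel_singleton[of "T - s"]
      by eventually_elim (use s in \<open>auto simp: indicator_def\<close>)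
  qed
  finally show ?thesis .
qed

lemma vol_cd:
  assumes s: "0 \<le> s" "s < T" and ab: "0 \<le> a" "a \<le> b" "b \<le> T" and J: "J = {a<..<b} \<or> J = {a..b}"
  shows "vol T {x. cd T s x \<in> J} = b - a"
proof -
  have [measurable]: "J \<in> sets borel" using J by auto
  have "emeasure lborel ({x. cd T s x \<in> J} \<inter> {0<..<T}) =
    (\<integral>\<^sup>+x\<in>{0<..<T}. indicator J (cd T s x) \<partial>lborel)"
  proof -
    have "(\<integral>\<^sup>+x\<in>{0<..<T}. indicator J (cd T s x) \<partial>lborel) =
       (\<integral>\<^sup>+x. indicator ({x. cd T s x \<in> J} \<inter> {0<..<T}) x \<partial>lborel)"
      by (intro nn_integral_cong) (auto simp: indicator_def)
    also have "\<dots> = emeasure lborel ({x. cd T s x \<in> J} \<inter> {0<..<T})"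
      by (rule nn_integral_indicator) measurable
    finally show ?thesis by simp
  qed
  also have "\<dots> = (\<integral>\<^sup>+u\<in>{0<..<T}. indicator J u \<partial>lborel)"
    by (rule nn_integral_cd[OF _ s]) measurable
  also have "\<dots> = (\<integral>\<^sup>+u. indicator {a<..<b} u \<partial>lborel)"
  proof (rule nn_integral_cong_AE)
    show "AE u in lborel. indicator J u * indicator {0<..<T} u = (indicator {a<..<b} u :: ennreal)"
      using AE_lborel_singleton[of a] AE_lborel_singleton[of b]
      by eventually_elim (use ab J in \<open>auto simp: indicator_def\<close>)
  qed
  also have "\<dots> = ennreal (b - a)" using ab by simp
  finally show ?thesis using ab by (simp add: vol_def measure_def)
qed

lemma integral_le_nn_integral:
  fixes f :: "'a \<Rightarrow> real"
  assumes int: "integrable M f"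
  shows "ennreal (\<integral>x. f x \<partial>M) \<le> (\<integral>\<^sup>+x. ennreal (f x) \<partial>M)"
proof -
  have int': "integrable M (\<lambda>x. max 0 (f x))" using int by simp
  have "ennreal (\<integral>x. f x \<partial>M) \<le> ennreal (\<integral>x. max 0 (f x) \<partial>M)"
    by (intro ennreal_leI integral_mono int int') auto
  also have "\<dots> = (\<integral>\<^sup>+x. ennreal (max 0 (f x)) \<partial>M)"
    by (rule nn_integral_eq_integral[symmetric, OF int']) auto
  also have "\<dots> = (\<integral>\<^sup>+x. ennreal (f x) \<partial>M)"
    by (intro nn_integral_cong) (auto simp: max_def ennreal_neg)
  finally show ?thesis .
qed

text \<open>Second-order Bonferroni: among \<open>k\<close> independent chances of size
  \<open>b\<close> one succeeds with probability at least k b - (k b)^2 / 2.\<close>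

lemma power_bonferroni:
  fixes b :: real
  assumes "0 \<le> b" "b \<le> 1"
  shows "(1 - b) ^ k \<le> 1 - real k * b + (real k)\<^sup>2 * b\<^sup>2 / 2"
proof (induction k)
  case (Suc k)
  have "(1 - b) ^ Suc k \<le> (1 - b) * (1 - real k * b + (real k)\<^sup>2 * b\<^sup>2 / 2)"
    using Suc assms by (auto intro: mult_left_mono)
  also have "\<dots> = 1 - real (Suc k) * b + (real (Suc k))\<^sup>2 * b\<^sup>2 / 2 - (b\<^sup>2 / 2 + (real k)\<^sup>2 * b^3 / 2)"
    by (simp add: field_simps power2_eq_square power3_eq_cube)
  also have "\<dots> \<le> 1 - real (Suc k) * b + (real (Suc k))\<^sup>2 * b\<^sup>2 / 2"
  proof -
    have "0 \<le> b\<^sup>2 / 2 + (real k)\<^sup>2 * b^3 / 2" using assms by (intro add_nonneg_nonneg) auto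
    then show ?thesis by simp
  qed
  finally show ?case .
qed simp

text \<open>The left side is the probability that one edge has bars in both of two disjoint arcs of
  lengths \<open>u\<close> and \<open>T - u\<close>, a product of factors 1 - exp (-
  length).\<close>

lemma cover_prob_le:
  fixes u :: real
  assumes "0 \<le> u" "u \<le> T"
  shows "1 - exp (-u) - exp (-(T-u)) + exp (-T) \<le> u * (T - u)"
proof -
  have "1 - exp (-u) - exp (-(T-u)) + exp (-T) = (1 - exp (-u)) * (1 - exp (-(T-u)))"
    by (simp add: algebra_simps exp_add[symmetric])
  also have "\<dots> \<le> u * (T - u)"
    using assms exp_ge_add_one_self[of "-u"] exp_ge_add_one_self[of "-(T-u)"]
    by (intro mult_mono) (auto simp del: exp_ge_add_one_self)
  finally show ?thesis .
qed

context stirring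
begin

abbreviation "m \<equiv> d - 1"

lemma edge_child: "v \<in> tree_verts d \<Longrightarrow> i < m \<Longrightarrow> v @ [i] \<in> tree_edges d"
  by (auto simp: tree_edges_def tree_verts_def)

lemma vert_child: "v \<in> tree_verts d \<Longrightarrow> i < m \<Longrightarrow> v @ [i] \<in> tree_verts d"
  by (auto simp: tree_verts_def)

lemma emeasure_of_bool:
  assumes [measurable]: "Measurable.pred (Om d T) P"
  shows "(\<integral>\<^sup>+w. of_bool (P w) \<partial>Om d T) = ennreal (Om.prob {w \<in> space (Om d T). P w})"
proof -
  have "(\<integral>\<^sup>+w. of_bool (P w) \<partial>Om d T) = (\<integral>\<^sup>+w. indicator {w \<in> space (Om d T). P w} w \<partial>Om d T)"
    by (intro nn_integral_cong) (auto simp: indicator_def)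
  also have "\<dots> = emeasure (Om d T) {w \<in> space (Om d T). P w}"
    by (rule nn_integral_indicator) measurable
  finally show ?thesis by (simp add: Om.emeasure_eq_measure)
qed

lemma prob_edge_void:
  assumes "c \<in> tree_edges d" "A \<in> sets borel"
  shows "(\<integral>\<^sup>+w. of_bool (w c \<inter> A = {}) \<partial>Om d T) = ennreal (exp (- vol T A))"
proof -
  have "of_bool (w c \<inter> A = {}) = (indicator {w. w c \<inter> A = {}} w :: ennreal)" for w
    by (simp add: indicator_def)
  then show ?thesis using emeasure_edge_void[OF assms] by simp
qed

section \<open>The expected number of uncovered single bars\<close>

definition beside :: "vert \<Rightarrow> real \<Rightarrow> real \<Rightarrow> (vert \<Rightarrow> real set) \<Rightarrow> vert \<Rightarrow> bool" where
  "beside v s x w c \<longleftrightarrow> (finite (w c) \<and> (\<forall>b\<in>w c. cd T s b < cd T s x)) \<or>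
     (finite (w c) \<and> (\<forall>b\<in>w c. cd T s x < cd T s b))"

text \<open>The bar \<open>x\<close> itself is absent here, since Mecke's formula adds it to the configuration.\<close>
definition lone :: "vert \<Rightarrow> real \<Rightarrow> nat \<Rightarrow> real \<Rightarrow> (vert \<Rightarrow> real set) \<Rightarrow> bool" where
  "lone v s i x w \<longleftrightarrow> w (v @ [i]) \<inter> UNIV = {} \<and> (\<forall>j\<in>{..<m} - {i}. beside v s x w (v @ [j]))"

lemma measurable_beside [measurable]:
  "Measurable.pred (borel \<Otimes>\<^sub>M Om d T) (\<lambda>p. beside v s (fst p) (snd p) c)"
  unfolding beside_def by measurable

lemma measurable_beside' [measurable]: "Measurable.pred (Om d T) (\<lambda>w. beside v s x w c)"
  unfolding beside_def by measurable

lemma measurable_lone [measurable]: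
  "Measurable.pred (borel \<Otimes>\<^sub>M Om d T) (\<lambda>p. lone v s i (fst p) (snd p))"
proof -
  have [measurable]: "(\<lambda>p. snd p c) \<in> measurable (borel \<Otimes>\<^sub>M Om d T) pts" for c
    by (rule measurable_compose[OF measurable_snd measurable_edge_Om])
  show ?thesis unfolding lone_def by measurable
qed

text \<open>Inclusion-exclusion: avoiding the arc after \<open>x\<close> or the arc before it
  suffices, and both are avoided only by an empty edge. The additive form keeps the bound within
  \<open>ennreal\<close>.\<close>

lemma prob_beside:
  assumes c: "c \<in> tree_edges d" and s: "0 \<le> s" "s < T" and x: "0 < x" "x < T" "x \<noteq> s"
  shows "1 \<le> (\<integral>\<^sup>+w. of_bool (beside v s x w c) \<partial>Om d T) + ennreal (cd T s x * (T - cd T s x))"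
proof -
  let ?u = "cd T s x"
  have u: "0 \<le> ?u" "?u \<le> T" using s x by (auto simp: cd_def)
  let ?A = "{b. cd T s b \<in> {?u..T}}" and ?B = "{b. cd T s b \<in> {0..?u}}"
  have m [measurable]: "?A \<in> sets borel" "?B \<in> sets borel" by measurable
  have vA: "vol T ?A = T - ?u" and vB: "vol T ?B = ?u"
    using vol_cd[OF s _ _ _ disjI2[OF refl], of ?u T] vol_cd[OF s _ _ _ disjI2[OF refl], of 0 ?u] u by auto
  let ?a = "\<lambda>w. of_bool (w c \<inter> ?A = {}) :: ennreal" and ?b = "\<lambda>w. of_bool (w c \<inter> ?B = {}) :: ennreal"
  have ia: "(\<integral>\<^sup>+w. ?a w \<partial>Om d T) = ennreal (exp (- (T - ?u)))"
    using prob_edge_void[OF c m(1)] vA by simp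
  have ib: "(\<integral>\<^sup>+w. ?b w \<partial>Om d T) = ennreal (exp (- ?u))"
    using prob_edge_void[OF c m(2)] vB by simp
  have i0: "(\<integral>\<^sup>+w. of_bool (w c \<inter> UNIV = {}) \<partial>Om d T) = ennreal (exp (- T))"
    using prob_edge_void[OF c, of UNIV] T by (simp add: vol_def)
  have ma: "?a \<in> borel_measurable (Om d T)" and mb: "?b \<in> borel_measurable (Om d T)"
    by (intro measurable_of_bool pred_void measurable_edge_Om m)+
  have "(\<integral>\<^sup>+w. ?a w + ?b w \<partial>Om d T) \<le>
    (\<integral>\<^sup>+w. of_bool (beside v s x w c) + of_bool (w c \<inter> UNIV = {}) \<partial>Om d T)"
  proof (rule nn_integral_mono_AE)
    show "AE w in Om d T. ?a w + ?b w \<le> of_bool (beside v s x w c) + of_bool (w c \<inter> UNIV = {})"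
      using AE_edge[OF c] AE_edge_notin[OF c, of s]
    proof eventually_elim
      case (elim w)
      have A: "beside v s x w c" if *: "w c \<inter> ?A = {}"
      proof -
        have "cd T s b < ?u" if "b \<in> w c" for b
        proof -
          have "0 < b" "b < T" "b \<noteq> s" using that elim by auto
          then have "cd T s b \<le> T" using s by (auto simp: cd_def)
          then show ?thesis using * that by force
        qed
        then show ?thesis using elim by (auto simp: beside_def)
      qed
      have B: "beside v s x w c" if *: "w c \<inter> ?B = {}"
      proof -
        have "?u < cd T s b" if "b \<in> w c" for b
        proof -
          have "0 < b" "b < T" "b \<noteq> s" using that elim by auto
          then have "0 \<le> cd T s b" using s by (auto simp: cd_def)
          then show ?thesis using * that by force
        qed
        then show ?thesis using elim by (auto simp: beside_def)
      qed
      have C: "w c \<inter> UNIV = {}" if *: "w c \<inter> ?A = {}" "w c \<inter> ?B = {}"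
      proof -
        have False if "b \<in> w c" for b
        proof -
          have "0 < b" "b < T" "b \<noteq> s" using that elim by auto
          then have "0 \<le> cd T s b" "cd T s b \<le> T" using s by (auto simp: cd_def)
          then show ?thesis using * that by force
        qed
        then show ?thesis by auto
      qed
      show ?case using A B C by (auto simp: of_bool_def simp del: disjoint_iff)
    qed
  qed
  moreover have "(\<integral>\<^sup>+w. ?a w + ?b w \<partial>Om d T) = ennreal (exp (- (T - ?u)) + exp (- ?u))"
    by (subst nn_integral_add[OF ma mb]) (simp only: ia ib ennreal_plus exp_ge_zero)
  moreover have "(\<integral>\<^sup>+w. of_bool (beside v s x w c) + of_bool (w c \<inter> UNIV = {}) \<partial>Om d T) =
     (\<integral>\<^sup>+w. of_bool (beside v s x w c) \<partial>Om d T) + ennreal (exp (- T))"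
    unfolding i0[symmetric]
    by (intro nn_integral_add measurable_of_bool measurable_beside' pred_void measurable_edge_Om) simp
  ultimately have "ennreal (exp (- (T - ?u)) + exp (- ?u)) \<le>
      (\<integral>\<^sup>+w. of_bool (beside v s x w c) \<partial>Om d T) + ennreal (exp (- T))" by simp
  then have "exp (- (T - ?u)) + exp (- ?u) \<le> Om.prob {w \<in> space (Om d T). beside v s x w c} + exp (- T)"
    by (simp add: emeasure_of_bool ennreal_plus[symmetric] del: ennreal_plus)
  then have "1 \<le> Om.prob {w \<in> space (Om d T). beside v s x w c} + ?u * (T - ?u)"
    using cover_prob_le[OF u] by linarith
  then show ?thesis
    using u by (simp add: emeasure_of_bool ennreal_plus[symmetric] ennreal_1[symmetric] del: ennreal_plus ennreal_1)
qed

text \<open>Emptiness of edge \<open>i\<close> is independent of its siblings; for these a union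
  bound is used, which leaves a polynomial in the distance from \<open>s\<close> to \<open>x\<close>
  to be integrated.\<close>

lemma prob_lone:
  assumes v: "v \<in> tree_verts d" and i: "i < m" and s: "0 \<le> s" "s < T" and x: "0 < x" "x < T" "x \<noteq> s"
  shows "ennreal (exp (- T) * (1 - real (m - 1) * (cd T s x * (T - cd T s x)))) \<le>
    (\<integral>\<^sup>+w. of_bool (lone v s i x w) \<partial>Om d T)"
proof -
  let ?u = "cd T s x"
  have u: "0 \<le> ?u" "?u \<le> T" using s x by (auto simp: cd_def)
  let ?f = "\<lambda>w. of_bool (w (v @ [i]) \<inter> UNIV = {}) :: ennreal"
  let ?P = "\<lambda>w. \<forall>j\<in>{..<m} - {i}. beside v s x w (v @ [j])"
  have "(\<integral>\<^sup>+w. of_bool (lone v s i x w) \<partial>Om d T) = (\<integral>\<^sup>+w. ?f w * of_bool (?P w) \<partial>Om d T)"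
    by (simp add: lone_def of_bool_conj del: disjoint_iff)
  also have "\<dots> = (\<integral>\<^sup>+w. ?f w \<partial>Om d T) * (\<integral>\<^sup>+w. of_bool (?P w) \<partial>Om d T)"
  proof (rule nn_integral_indep[where K="{v @ [i]}" and K'="(\<lambda>j. v @ [j]) ` ({..<m} - {i})"])
    show "dep {v @ [i]} ?f" by (auto simp: dep_def)
    show "dep ((\<lambda>j. v @ [j]) ` ({..<m} - {i})) (\<lambda>w. of_bool (?P w) :: ennreal)"
      by (auto simp: dep_def beside_def)
  qed (measurable, auto)
  also have "(\<integral>\<^sup>+w. ?f w \<partial>Om d T) = ennreal (exp (- T))"
    using prob_edge_void[OF edge_child[OF v i], of UNIV] T by (simp add: vol_def)
  finally have eq: "(\<integral>\<^sup>+w. of_bool (lone v s i x w) \<partial>Om d T) =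
     ennreal (exp (- T)) * (\<integral>\<^sup>+w. of_bool (?P w) \<partial>Om d T)" .
  have "1 - real (m - 1) * (?u * (T - ?u)) \<le> Om.prob {w \<in> space (Om d T). ?P w}"
  proof -
    let ?B = "\<lambda>j. {w \<in> space (Om d T). \<not> beside v s x w (v @ [j])}"
    have b: "Om.prob (?B j) \<le> ?u * (T - ?u)" if "j \<in> {..<m} - {i}" for j
    proof -
      have "ennreal 1 \<le> ennreal (Om.prob {w \<in> space (Om d T). beside v s x w (v @ [j])} + ?u * (T - ?u))"
        using prob_beside[OF edge_child[OF v] s x, of j v] that u
        by (simp add: emeasure_of_bool ennreal_plus[symmetric] del: ennreal_plus)
      then have "1 \<le> Om.prob {w \<in> space (Om d T). beside v s x w (v @ [j])} + ?u * (T - ?u)"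
        using u by (subst (asm) ennreal_le_iff) auto
      moreover have "Om.prob (?B j) = 1 - Om.prob {w \<in> space (Om d T). beside v s x w (v @ [j])}"
        by (rule Om.prob_neg) measurable
      ultimately show ?thesis by simp
    qed
    have "Om.prob {w \<in> space (Om d T). \<not> ?P w} \<le> Om.prob (\<Union>j\<in>{..<m} - {i}. ?B j)"
      by (rule Om.finite_measure_mono) (auto intro!: sets.finite_UN)
    also have "\<dots> \<le> (\<Sum>j\<in>{..<m} - {i}. Om.prob (?B j))"
      by (rule Om.finite_measure_subadditive_finite) auto
    also have "\<dots> \<le> (\<Sum>j\<in>{..<m} - {i}. ?u * (T - ?u))" using b by (intro sum_mono)
    also have "\<dots> = real (m - 1) * (?u * (T - ?u))" using i by simp
    finally have "Om.prob {w \<in> space (Om d T). \<not> ?P w} \<le> real (m - 1) * (?u * (T - ?u))" .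
    moreover have "Om.prob {w \<in> space (Om d T). \<not> ?P w} = 1 - Om.prob {w \<in> space (Om d T). ?P w}"
      by (rule Om.prob_neg) measurable
    ultimately show ?thesis by simp
  qed
  then have "ennreal (exp (- T) * (1 - real (m - 1) * (?u * (T - ?u)))) \<le>
     ennreal (exp (- T) * Om.prob {w \<in> space (Om d T). ?P w})"
    by (intro ennreal_leI mult_left_mono) auto
  then show ?thesis unfolding eq by (simp add: emeasure_of_bool ennreal_mult')
qed

text \<open>Each bar is tested in the configuration from which it has been deleted, the form that
  Mecke's formula integrates. \<open>Nlone_le\<close> compares the sum with the number of good
  children.\<close>

definition Nlone :: "vert \<Rightarrow> real \<Rightarrow> (vert \<Rightarrow> real set) \<Rightarrow> ennreal" where
  "Nlone v s w = (\<Sum>i<m. \<Sum>x\<in>w (v @ [i]). of_bool (lone v s i x (w(v @ [i] := w (v @ [i]) - {x}))))"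

text \<open>The integral of u (T - u) from 0 to T is T^3 / 6. Only an inequality is claimed, because
  \<open>ennreal\<close> cuts off negative values of the integrand.\<close>

lemma integral_quadratic:
  assumes "0 \<le> a"
  shows "ennreal (exp (- T) * (T - a * T^3 / 6)) \<le>
    (\<integral>\<^sup>+u\<in>{0<..<T}. ennreal (exp (- T) * (1 - a * (u * (T - u)))) \<partial>lborel)"
proof -
  let ?f = "\<lambda>u. 1 - a * (u * (T - u))"
  let ?F = "\<lambda>u. u - a * (T * u^2 / 2 - u^3 / 3)"
  have F: "(?F has_real_derivative ?f u) (at u)" for u
    by (auto intro!: derivative_eq_intros simp: field_simps power2_eq_square)
  have hb': "has_bochner_integral lborel (\<lambda>u. indicator {0..T} u *\<^sub>R ?f u) (?F T - ?F 0)"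
  proof (rule has_bochner_integral_FTC_Icc)
    show "0 \<le> T" using T by simp
    show "\<And>x. 0 \<le> x \<Longrightarrow> x \<le> T \<Longrightarrow> (?F has_vector_derivative ?f x) (at x within {0..T})"
      using F by (auto simp: has_real_derivative_iff_has_vector_derivative[symmetric] intro: has_field_derivative_at_within)
    show "continuous_on {0..T} ?f" by (intro continuous_intros)
  qed
  then have hb: "has_bochner_integral lborel (\<lambda>u. ?f u * indicator {0..T} u) (?F T - ?F 0)"
    by (simp add: mult.commute)
  have FT: "?F T - ?F 0 = T - a * T^3 / 6" by (simp add: field_simps power2_eq_square power3_eq_cube)
  have "(\<integral>u. ?f u * indicator {0..T} u \<partial>lborel) = T - a * T^3 / 6"
    using hb unfolding FT by (simp only: has_bochner_integral_iff)
  then have eq: "exp (- T) * (T - a * T^3 / 6) = (\<integral>u. exp (- T) * (?f u * indicator {0..T} u) \<partial>lborel)"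
    by simp
  have int: "integrable lborel (\<lambda>u. exp (- T) * (?f u * indicator {0..T} u))"
    using hb by (simp add: has_bochner_integral_iff)
  have "ennreal (\<integral>u. exp (- T) * (?f u * indicator {0..T} u) \<partial>lborel) \<le>
     (\<integral>\<^sup>+u. ennreal (exp (- T) * (?f u * indicator {0..T} u)) \<partial>lborel)"
    by (rule integral_le_nn_integral[OF int])
  also have "\<dots> = (\<integral>\<^sup>+u\<in>{0<..<T}. ennreal (exp (- T) * ?f u) \<partial>lborel)"
  proof (rule nn_integral_cong_AE)
    show "AE u in lborel. ennreal (exp (- T) * (?f u * indicator {0..T} u)) =
      ennreal (exp (- T) * ?f u) * indicator {0<..<T} u"
      using AE_lborel_singleton[of 0] AE_lborel_singleton[of T]
      by eventually_elim (auto simp: indicator_def)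
  qed
  finally show ?thesis unfolding eq .
qed

lemma measurable_lone_sum:
  assumes v: "v \<in> tree_verts d" and i: "i < m"
  shows "(\<lambda>w. \<Sum>x\<in>w (v @ [i]). of_bool (lone v s i x (w(v @ [i] := w (v @ [i]) - {x}))) :: ennreal)
    \<in> borel_measurable (Om d T)"
proof -
  have [measurable]: "v @ [i] \<in> tree_edges d" by (rule edge_child[OF v i])
  have [measurable]: "(\<lambda>p. fst p c) \<in> measurable (Om d T \<Otimes>\<^sub>M borel) pts" for c
    by (rule measurable_compose[OF measurable_fst measurable_edge_Om])
  have "(\<lambda>p. (snd p, (fst p)(v @ [i] := fst p (v @ [i]) - {snd p}))) \<in>
      measurable (Om d T \<Otimes>\<^sub>M borel) (borel \<Otimes>\<^sub>M Om d T)" by measurable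
  from measurable_compose[OF this measurable_lone[of v s i]]
  have "(\<lambda>p. of_bool (lone v s i (snd p) ((fst p)(v @ [i] := fst p (v @ [i]) - {snd p}))) :: ennreal)
      \<in> borel_measurable (Om d T \<Otimes>\<^sub>M borel)"
    by (intro measurable_of_bool) simp
  then show ?thesis
    by (intro measurable_sum_pts) (simp_all add: case_prod_beta' measurable_edge_Om)
qed

lemma measurable_Nlone: "v \<in> tree_verts d \<Longrightarrow> Nlone v s \<in> borel_measurable (Om d T)"
  unfolding Nlone_def using measurable_lone_sum[of v] by (intro borel_measurable_sum) auto

text \<open>Mecke's formula fixes the bar, \<open>prob_lone\<close> bounds the density of its being
  good, and rotation by \<open>s\<close> makes the result independent of the entry time.\<close>

lemma integral_Nlone:
  assumes v: "v \<in> tree_verts d" and s: "0 \<le> s" "s < T"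
  shows "ennreal (real m * exp (- T) * (T - real (m - 1) * T^3 / 6)) \<le> (\<integral>\<^sup>+w. Nlone v s w \<partial>Om d T)"
proof -
  have eq: "(\<integral>\<^sup>+w. Nlone v s w \<partial>Om d T) = (\<Sum>i<m. \<integral>\<^sup>+w. (\<Sum>x\<in>w (v @ [i]).
      of_bool (lone v s i x (w(v @ [i] := w (v @ [i]) - {x})))) \<partial>Om d T)"
    unfolding Nlone_def
    by (rule nn_integral_sum) (use measurable_lone_sum[OF v] in auto)
  have "(\<Sum>i<m. ennreal (exp (- T) * (T - real (m - 1) * T^3 / 6))) \<le> (\<integral>\<^sup>+w. Nlone v s w \<partial>Om d T)"
    unfolding eq
  proof (rule sum_mono)
    fix i assume "i \<in> {..<m}"
    then have i: "i < m" by simp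
    let ?g = "\<lambda>u. ennreal (exp (- T) * (1 - real (m - 1) * (u * (T - u))))"
    have 1: "(\<integral>\<^sup>+w. (\<Sum>x\<in>w (v @ [i]). of_bool (lone v s i x (w(v @ [i] := w (v @ [i]) - {x})))) \<partial>Om d T) =
      (\<integral>\<^sup>+x\<in>{0<..<T}. (\<integral>\<^sup>+w. of_bool (lone v s i x w) \<partial>Om d T) \<partial>lborel)"
    proof (rule Om_Mecke[OF edge_child[OF v i]])
      show "(\<lambda>(x, w). of_bool (lone v s i x w) :: ennreal) \<in> borel_measurable (borel \<Otimes>\<^sub>M Om d T)"
        unfolding case_prod_beta' by measurable
    qed
    have 2: "(\<integral>\<^sup>+x\<in>{0<..<T}. ?g (cd T s x) \<partial>lborel) \<le>
        (\<integral>\<^sup>+x\<in>{0<..<T}. (\<integral>\<^sup>+w. of_bool (lone v s i x w) \<partial>Om d T) \<partial>lborel)"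
    proof (rule nn_integral_mono_AE)
      show "AE x in lborel. ?g (cd T s x) * indicator {0<..<T} x \<le>
        (\<integral>\<^sup>+w. of_bool (lone v s i x w) \<partial>Om d T) * indicator {0<..<T} x"
        using AE_lborel_singleton[of s]
      proof eventually_elim
        case (elim x)
        then show ?case using prob_lone[OF v i s, of x] by (cases "x \<in> {0<..<T}") simp_all
      qed
    qed
    have 3: "(\<integral>\<^sup>+x\<in>{0<..<T}. ?g (cd T s x) \<partial>lborel) = (\<integral>\<^sup>+u\<in>{0<..<T}. ?g u \<partial>lborel)"
      by (rule nn_integral_cd[OF _ s]) measurable
    have "ennreal (exp (- T) * (T - real (m - 1) * T^3 / 6)) \<le> (\<integral>\<^sup>+u\<in>{0<..<T}. ?g u \<partial>lborel)"
      by (rule integral_quadratic) simp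
    then show "ennreal (exp (- T) * (T - real (m - 1) * T^3 / 6)) \<le> (\<integral>\<^sup>+w. (\<Sum>x\<in>w (v @ [i]).
      of_bool (lone v s i x (w(v @ [i] := w (v @ [i]) - {x})))) \<partial>Om d T)"
      using 2 unfolding 1 3 by (rule order_trans)
  qed
  then show ?thesis 
    by (simp only: sum_constant card_lessThan ennreal_of_nat_eq_real_of_nat mult.assoc
        ennreal_mult'[OF of_nat_0_le_iff, symmetric])
qed

section \<open>One generation of the branching\<close>

lemma AE_regular_mrg: "AE w in Om d T. AE w' in Om d T. regular (mrg K w w')"
proof -
  have "AE w in distr (Om d T \<Otimes>\<^sub>M Om d T) (Om d T) (\<lambda>(w, w'). mrg K w w'). regular w"
    unfolding distr_mrg by (rule AE_regular)
  then have "AE p in Om d T \<Otimes>\<^sub>M Om d T. regular (case p of (w, w') \<Rightarrow> mrg K w w')"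
    by (rule AE_distrD[rotated]) (simp add: case_prod_beta')
  from OmOm.AE_pair[OF this] show ?thesis by simp
qed

lemma dep_comp: "dep K f \<Longrightarrow> dep K (\<lambda>w. g (f w))"
  unfolding dep_def by metis

lemma ret_dep: "dep {v @ u | u. u \<noteq> []} (\<lambda>w. ret k n w v E s)"
  unfolding dep_def by (intro allI impI ret_cong) auto

lemma low_success:
  assumes reg: "regular w" and v: "v \<in> tree_verts d" and s: "0 \<le> s" "s < T"
    and ns: "\<forall>i<m. s \<notin> w (v @ [i])"
    and i: "i < m" "w (v @ [i]) = {x}" "\<forall>j\<in>{..<m} - {i}. beside v s x w (v @ [j])"
    and suc: "ret m n w (v @ [i]) {x} x = -1"
  shows "ret m (Suc n) w v {s} s = -1"
proof -
  have r: "reg m T w v" by (rule regular_reg[OF reg v])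
  have e: "entry m T w v {s}" using s ns by (auto simp: entry_def)
  interpret pole T "{s}" "{..<m}" "\<lambda>i. w (v @ [i])" "crho m n w v"
    by (rule ret_pole[OF r e])
  have "pexit {s} S (crho m n w v) s = -1"
  proof (rule pexit_uncovered[OF refl, of i x])
    have "child_at w v x = v @ [i]" using i by (intro child_at_eq[OF r]) auto
    then show "crho m n w v x = -1" using suc i by simp
    fix j assume "j \<in> {..<m}" "j \<noteq> i"
    then show "(\<forall>b\<in>w (v @ [j]). cd T s b < cd T s x) \<or> (\<forall>b\<in>w (v @ [j]). cd T s x < cd T s b)"
      using i(3) by (auto simp: beside_def)
  qed (use i in auto)
  then show ?thesis by (simp only: ret.simps S_def)
qed

lemma Nlone_le:
  fixes w :: "vert \<Rightarrow> real set" and v :: vert and s :: real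
  defines "G \<equiv> {i. i < m \<and> (\<exists>x. w (v @ [i]) = {x} \<and> (\<forall>j\<in>{..<m} - {i}. beside v s x w (v @ [j])))}"
  shows "Nlone v s w \<le> of_nat (card G)"
proof -
  have "Nlone v s w \<le> (\<Sum>i<m. of_bool (i \<in> G))"
    unfolding Nlone_def
  proof (rule sum_mono)
    fix i assume i: "i \<in> {..<m}"
    let ?f = "\<lambda>x. of_bool (lone v s i x (w(v @ [i] := w (v @ [i]) - {x}))) :: ennreal"
    have L: "w (v @ [i]) = {x} \<and> i \<in> G" if "x \<in> w (v @ [i])" "lone v s i x (w(v @ [i] := w (v @ [i]) - {x}))" for x
    proof -
      from that have eq: "w (v @ [i]) = {x}" by (auto simp: lone_def)
      have "\<forall>j\<in>{..<m} - {i}. beside v s x w (v @ [j])"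
        using that(2) by (auto simp: lone_def beside_def)
      then show ?thesis using eq i by (auto simp: G_def)
    qed
    show "(\<Sum>x\<in>w (v @ [i]). ?f x) \<le> of_bool (i \<in> G)"
    proof (cases "\<exists>x\<in>w (v @ [i]). lone v s i x (w(v @ [i] := w (v @ [i]) - {x}))")
      case True
      then obtain x where x: "x \<in> w (v @ [i])" "lone v s i x (w(v @ [i] := w (v @ [i]) - {x}))" by blast
      from L[OF x] have eq: "w (v @ [i]) = {x}" and G: "i \<in> G" by auto
      have "(\<Sum>x\<in>w (v @ [i]). ?f x) = ?f x" by (subst (1) eq) simp
      also have "\<dots> \<le> 1" by simp
      finally show ?thesis using G by simp
    next
      case False
      then have "(\<Sum>x\<in>w (v @ [i]). ?f x) = 0" by (intro sum.neutral) auto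
      then show ?thesis by simp
    qed
  qed
  also have "(\<Sum>i<m. of_bool (i \<in> G)) = (of_nat (card G) :: ennreal)"
  proof -
    have "{..<m} \<inter> G = G" by (auto simp: G_def)
    then show ?thesis by (simp add: sum_of_bool_eq Int_def)
  qed
  finally show ?thesis .
qed

text \<open>Condition on the bars of the edges to the children. If \<open>k\<close> children are
  good, their subtrees are independent and each lets the walk escape with probability at least
  \<open>b\<close>, so by Bonferroni the walk escapes with probability at least k b - C. Averaging
  over \<open>k\<close> leaves b (1 + \<delta>) - C, and \<open>b\<close> is small enough for C
  \<le> b \<delta>.\<close>

lemma low_step:
  fixes b \<delta> :: real
  assumes b: "0 \<le> b" "b \<le> 1"
    and mean: "1 + \<delta> \<le> real m * exp (- T) * (T - real (m - 1) * T^3 / 6)" "b * (real m)\<^sup>2 \<le> 2 * \<delta>"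
    and IH: "\<And>v s. v \<in> tree_verts d \<Longrightarrow> 0 \<le> s \<Longrightarrow> s < T \<Longrightarrow>
      ennreal b \<le> (\<integral>\<^sup>+w. of_bool (ret m n w v {s} s = -1) \<partial>Om d T)"
    and v: "v \<in> tree_verts d" and s: "0 \<le> s" "s < T"
  shows "ennreal b \<le> (\<integral>\<^sup>+w. of_bool (ret m (Suc n) w v {s} s = -1) \<partial>Om d T)"
proof -
  define K where "K = (\<lambda>i. v @ [i]) ` {..<m}"
  define C where "C = (real m)\<^sup>2 * b\<^sup>2 / 2"
  let ?in = "\<lambda>w. \<integral>\<^sup>+w'. of_bool (ret m (Suc n) (mrg K w w') v {s} s = -1) \<partial>Om d T"
  have ns: "AE w in Om d T. \<forall>i<m. s \<notin> w (v @ [i])"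
    using AE_edge_notin[OF edge_child[OF v]] by (simp add: AE_all_countable)
  have inner: "AE w in Om d T. ennreal b * Nlone v s w \<le> ?in w + ennreal C"
    using AE_regular_mrg[of K] ns AE_regular AE_space
  proof eventually_elim
    case (elim w)
    note [measurable] = elim(4)
    define G where "G = {i. i < m \<and> (\<exists>x. w (v @ [i]) = {x} \<and> (\<forall>j\<in>{..<m} - {i}. beside v s x w (v @ [j])))}"
    define X where "X i = the_elem (w (v @ [i]))" for i
    define k where "k = card G"
    have finG: "finite G" "k \<le> m"
    proof -
      have "G \<subseteq> {..<m}" by (auto simp: G_def)
      then show "finite G" "k \<le> m"
        using finite_subset card_mono[of "{..<m}" G] unfolding k_def by auto
    qed
    have X: "i < m" "w (v @ [i]) = {X i}" "\<forall>j\<in>{..<m} - {i}. beside v s (X i) w (v @ [j])" "0 < X i" "X i < T"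
      if "i \<in> G" for i
    proof -
      from that show im: "i < m" and Xi: "w (v @ [i]) = {X i}"
        and "\<forall>j\<in>{..<m} - {i}. beside v s (X i) w (v @ [j])" by (auto simp: G_def X_def)
      have "w (v @ [i]) \<subseteq> {0<..<T}"
        using elim(3) edge_child[OF v im] by (simp add: regular_def)
      then show "0 < X i" "X i < T" using Xi by auto
    qed
    let ?F = "\<lambda>i w'. of_bool (ret m n w' (v @ [i]) {X i} (X i) \<noteq> -1) :: ennreal"
    \<comment> \<open>Once the first generation is fixed, \<open>X i\<close> is a constant and the
      induction hypothesis applies with it as entry time.\<close>
    have F: "(\<integral>\<^sup>+w'. ?F i w' \<partial>Om d T) \<le> ennreal (1 - b)" if "i \<in> G" for i
    proof -
      have "ennreal b \<le> ennreal (Om.prob {w' \<in> space (Om d T). ret m n w' (v @ [i]) {X i} (X i) = -1})"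
        using IH[OF vert_child[OF v X(1)[OF that]], of "X i"] X(4,5)[OF that]
        by (simp add: emeasure_of_bool)
      then have "b \<le> Om.prob {w' \<in> space (Om d T). ret m n w' (v @ [i]) {X i} (X i) = -1}"
        by (subst (asm) ennreal_le_iff) auto
      moreover have "Om.prob {w' \<in> space (Om d T). ret m n w' (v @ [i]) {X i} (X i) \<noteq> -1} =
          1 - Om.prob {w' \<in> space (Om d T). ret m n w' (v @ [i]) {X i} (X i) = -1}"
        by (rule Om.prob_neg) measurable
      ultimately show ?thesis
        by (subst emeasure_of_bool) (auto intro!: ennreal_leI)
    qed
    have "(\<integral>\<^sup>+w'. (\<Prod>i\<in>G. ?F i w') \<partial>Om d T) = (\<Prod>i\<in>G. \<integral>\<^sup>+w'. ?F i w' \<partial>Om d T)"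
    proof (rule nn_integral_indep_prod[OF finG(1), where K="\<lambda>i. {(v @ [i]) @ u | u. u \<noteq> []}"])
      show "dep {(v @ [i]) @ u | u. u \<noteq> []} (?F i)" for i
        by (rule dep_comp[OF ret_dep, where g="\<lambda>x. of_bool (x \<noteq> -1)"])
      show "?F i \<in> borel_measurable (Om d T)" for i by measurable
    qed auto
    also have "\<dots> \<le> (\<Prod>i\<in>G. ennreal (1 - b))" using F by (intro prod_mono_ennreal)
    also have "\<dots> = ennreal ((1 - b) ^ k)" using b by (simp add: ennreal_power k_def)
    finally have fail: "(\<integral>\<^sup>+w'. (\<Prod>i\<in>G. ?F i w') \<partial>Om d T) \<le> ennreal ((1 - b) ^ k)" .
    \<comment> \<open>Either some good child lets the walk escape, or every factor of the product is
      1.\<close>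
    have "(\<integral>\<^sup>+w'. 1 \<partial>Om d T) \<le> (\<integral>\<^sup>+w'. of_bool (ret m (Suc n) (mrg K w w') v {s} s = -1) + (\<Prod>i\<in>G. ?F i w') \<partial>Om d T)"
    proof (rule nn_integral_mono_AE)
      show "AE w' in Om d T. 1 \<le> of_bool (ret m (Suc n) (mrg K w w') v {s} s = -1) + (\<Prod>i\<in>G. ?F i w')"
        using elim(1)
      proof eventually_elim
        case (elim w')
        show ?case
        proof (cases "\<exists>i\<in>G. ret m n w' (v @ [i]) {X i} (X i) = -1")
          case True
          then obtain i where i: "i \<in> G" "ret m n w' (v @ [i]) {X i} (X i) = -1" by blast
          let ?w = "mrg K w w'"
          have wK: "?w (v @ [j]) = w (v @ [j])" if "j < m" for j using that by (auto simp: mrg_def K_def)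
          have "ret m (Suc n) ?w v {s} s = -1"
          proof (rule low_success[OF elim v s])
            show "\<forall>i<m. s \<notin> ?w (v @ [i])" using \<open>\<forall>i<m. s \<notin> w (v @ [i])\<close> wK by auto
            show "i < m" by (rule X(1)[OF i(1)])
            then show "?w (v @ [i]) = {X i}" using X(2)[OF i(1)] wK by simp
            show "\<forall>j\<in>{..<m} - {i}. beside v s (X i) ?w (v @ [j])"
              using X(3)[OF i(1)] wK by (auto simp: beside_def)
            have "ret m n ?w (v @ [i]) {X i} (X i) = ret m n w' (v @ [i]) {X i} (X i)"
              by (rule ret_cong) (auto simp: mrg_def K_def)
            then show "ret m n ?w (v @ [i]) {X i} (X i) = -1" using i(2) by simp
          qed
          then show ?thesis by simp
        next
          case False
          then have "(\<Prod>i\<in>G. ?F i w') = 1" by (intro prod.neutral) auto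
          then show ?thesis by simp
        qed
      qed
    qed
    also have "\<dots> = ?in w + (\<integral>\<^sup>+w'. (\<Prod>i\<in>G. ?F i w') \<partial>Om d T)"
      by (rule nn_integral_add) measurable
    also have "\<dots> \<le> ?in w + ennreal ((1 - b) ^ k)" using fail by (intro add_left_mono)
    finally have one: "1 \<le> ?in w + ennreal ((1 - b) ^ k)" by (simp add: Om.emeasure_space_1)
    have "real k * b + (1 - b) ^ k \<le> 1 + (real k)\<^sup>2 * b\<^sup>2 / 2" using power_bonferroni[OF b, of k] by simp
    also have "(real k)\<^sup>2 \<le> (real m)\<^sup>2" using finG by (intro power_mono) auto
    then have "1 + (real k)\<^sup>2 * b\<^sup>2 / 2 \<le> 1 + C" unfolding C_def by (simp add: mult_right_mono)
    finally have "ennreal (real k * b + (1 - b) ^ k) \<le> ennreal (1 + C)" by (rule ennreal_leI)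
    also have "ennreal (1 + C) = 1 + ennreal C" by (simp add: C_def)
    also have "\<dots> \<le> ?in w + ennreal ((1 - b) ^ k) + ennreal C" using one by (intro add_right_mono)
    finally have "ennreal ((1 - b) ^ k) + ennreal (real k * b) \<le> ennreal ((1 - b) ^ k) + (?in w + ennreal C)"
      using b by (simp add: ac_simps)
    then have "ennreal (real k * b) \<le> ?in w + ennreal C"
      by (subst (asm) ennreal_add_left_cancel_le) auto
    moreover have "ennreal b * Nlone v s w \<le> ennreal b * of_nat k"
      unfolding k_def G_def by (intro mult_left_mono Nlone_le) auto
    moreover have "ennreal b * of_nat k = ennreal (real k * b)"
      using b by (simp add: ennreal_of_nat_eq_real_of_nat ennreal_mult'[symmetric] mult.commute)
    ultimately show ?case by simp
  qed
  \<comment> \<open>Averaging over the first generation; the surplus \<open>b * \<delta>\<close> of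
    the mean pays for \<open>C\<close>.\<close>
  have "ennreal (b * (1 + \<delta>)) \<le> ennreal b * (\<integral>\<^sup>+w. Nlone v s w \<partial>Om d T)"
    using b order_trans[OF ennreal_leI[OF mean(1)] integral_Nlone[OF v s]]
    by (simp add: ennreal_mult' mult_left_mono)
  also have "\<dots> = (\<integral>\<^sup>+w. ennreal b * Nlone v s w \<partial>Om d T)"
    by (rule nn_integral_cmult[symmetric]) (rule measurable_Nlone[OF v])
  also have "\<dots> \<le> (\<integral>\<^sup>+w. ?in w + ennreal C \<partial>Om d T)"
    using inner by (rule nn_integral_mono_AE)
  also have "\<dots> = (\<integral>\<^sup>+w. ?in w \<partial>Om d T) + ennreal C"
    by (subst nn_integral_add) (measurable, simp add: Om.emeasure_space_1)
  also have "(\<integral>\<^sup>+w. ?in w \<partial>Om d T) = (\<integral>\<^sup>+w. of_bool (ret m (Suc n) w v {s} s = -1) \<partial>Om d T)"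
    by (rule nn_integral_mrg[symmetric]) measurable
  also have "ennreal C \<le> ennreal (b * \<delta>)"
  proof (rule ennreal_leI)
    have "b * (b * (real m)\<^sup>2) \<le> b * (2 * \<delta>)" using mean(2) b by (intro mult_left_mono)
    then show "C \<le> b * \<delta>" by (simp add: C_def power2_eq_square mult_ac)
  qed
  finally have "ennreal (b * (1 + \<delta>)) \<le> (\<integral>\<^sup>+w. of_bool (ret m (Suc n) w v {s} s = -1) \<partial>Om d T) + ennreal (b * \<delta>)"
    by (simp add: add_left_mono)
  moreover have "0 \<le> \<delta>" using mean(2) b by (smt (verit) mult_nonneg_nonneg zero_le_power2)
  then have "ennreal (b * (1 + \<delta>)) = ennreal (b * \<delta>) + ennreal b"
    using b by (subst ennreal_plus[symmetric]) (auto simp: algebra_simps)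
  ultimately have "ennreal (b * \<delta>) + ennreal b \<le> ennreal (b * \<delta>) + (\<integral>\<^sup>+w. of_bool (ret m (Suc n) w v {s} s = -1) \<partial>Om d T)"
    by (simp add: add.commute)
  then show ?thesis by (subst (asm) ennreal_add_left_cancel_le) auto
qed

theorem low_regime:
  fixes b \<delta> :: real
  assumes b: "0 \<le> b" "b \<le> 1"
    and mean: "1 + \<delta> \<le> real m * exp (- T) * (T - real (m - 1) * T^3 / 6)" "b * (real m)\<^sup>2 \<le> 2 * \<delta>"
    and v: "v \<in> tree_verts d" and s: "0 \<le> s" "s < T"
  shows "ennreal b \<le> (\<integral>\<^sup>+w. of_bool (ret m n w v {s} s = -1) \<partial>Om d T)"
  using v s
proof (induction n arbitrary: v s)
  case 0
  then show ?case using b by (simp add: Om.emeasure_space_1 ennreal_le_1)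
next
  case (Suc n)
  show ?case by (rule low_step[OF b mean Suc.IH Suc.prems])
qed

end

section \<open>Long times: two attempts\<close>

text \<open>A void event whose forbidden set may itself depend on the configuration.\<close>

definition avoids :: "real set \<Rightarrow> (real \<Rightarrow> bool) \<Rightarrow> bool" where
  "avoids B Q \<longleftrightarrow> finite B \<and> (\<forall>b\<in>B. \<not> Q b)"

lemma pred_avoids [measurable (raw)]:
  assumes [measurable]: "g \<in> measurable M pts" "Measurable.pred (M \<Otimes>\<^sub>M borel) (\<lambda>(x, y). Q x y)"
  shows "Measurable.pred M (\<lambda>x. avoids (g x) (Q x))"
  unfolding avoids_def by (rule pred_all_pts) (use assms in auto)

lemma prod_of_bool:
  "finite A \<Longrightarrow> (\<Prod>i\<in>A. of_bool (P i) :: 'a :: comm_semiring_1) = of_bool (\<forall>i\<in>A. P i)"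
  by (induction A rule: finite_induct) auto

lemma nn_integral_exp_less:
  fixes C \<kappa> h T :: real
  assumes "0 \<le> C" "0 < \<kappa>" "0 \<le> h" "h \<le> T"
  shows "ennreal (C * (1 - exp (- \<kappa> * h)) / \<kappa>) =
    (\<integral>\<^sup>+u\<in>{0<..<T}. ennreal (C * exp (- \<kappa> * u)) * of_bool (u < h) \<partial>lborel)"
proof -
  have "(\<integral>\<^sup>+u. ennreal (C * exp (- \<kappa> * u)) * indicator {0..h} u \<partial>lborel) =
      ennreal (- C / \<kappa> * exp (- \<kappa> * h) - - C / \<kappa> * exp (- \<kappa> * 0))"
    by (rule nn_integral_FTC_Icc[where F="\<lambda>u. - C / \<kappa> * exp (- \<kappa> * u)"])
       (use assms in \<open>auto intro!: derivative_eq_intros\<close>)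
  also have "- C / \<kappa> * exp (- \<kappa> * h) - - C / \<kappa> * exp (- \<kappa> * 0) = C * (1 - exp (- \<kappa> * h)) / \<kappa>"
    using assms by (simp add: field_simps)
  finally have "ennreal (C * (1 - exp (- \<kappa> * h)) / \<kappa>) =
      (\<integral>\<^sup>+u. ennreal (C * exp (- \<kappa> * u)) * indicator {0..h} u \<partial>lborel)" by simp
  also have "\<dots> = (\<integral>\<^sup>+u\<in>{0<..<T}. ennreal (C * exp (- \<kappa> * u)) * of_bool (u < h) \<partial>lborel)"
  proof (rule nn_integral_cong_AE)
    show "AE u in lborel. ennreal (C * exp (- \<kappa> * u)) * indicator {0..h} u =
      ennreal (C * exp (- \<kappa> * u)) * of_bool (u < h) * indicator {0<..<T} u"
      using AE_lborel_singleton[of 0] AE_lborel_singleton[of h]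
      by eventually_elim (use assms in \<open>auto simp: indicator_def\<close>)
  qed
  finally show ?thesis .
qed

section \<open>The first bar met by the walk\<close>

context stirring
begin

lemma prob_avoids:
  assumes c: "c \<in> tree_edges d" and Q: "{b. Q b} \<in> sets borel"
  shows "(\<integral>\<^sup>+w. of_bool (avoids (w c) Q) \<partial>Om d T) = ennreal (exp (- vol T {b. Q b}))"
proof -
  have "(\<integral>\<^sup>+w. of_bool (avoids (w c) Q) \<partial>Om d T) = (\<integral>\<^sup>+w. of_bool (w c \<inter> {b. Q b} = {}) \<partial>Om d T)"
    using AE_edge[OF c] by (intro nn_integral_cong_AE) (auto elim!: eventually_mono simp: avoids_def)
  then show ?thesis using prob_edge_void[OF c Q] by simp
qed

lemma edge_vert: "c \<in> tree_edges d \<Longrightarrow> c \<in> tree_verts d"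
  by (simp add: tree_edges_def)

lemma
  assumes "regular w" "c \<in> tree_edges d"
  shows regular_finite: "finite (w c)" and regular_range: "b \<in> w c \<Longrightarrow> 0 < b \<and> b < T"
    and regular_disj: "c' \<in> tree_edges d \<Longrightarrow> c \<noteq> c' \<Longrightarrow> w c \<inter> w c' = {}"
proof -
  show "finite (w c)" "c' \<in> tree_edges d \<Longrightarrow> c \<noteq> c' \<Longrightarrow> w c \<inter> w c' = {}"
    using assms by (simp_all add: regular_def)
  have "w c \<subseteq> {0<..<T}" using assms by (simp add: regular_def)
  then show "b \<in> w c \<Longrightarrow> 0 < b \<and> b < T" by auto
qed

lemma entry_edge:
  assumes r: "regular w" and c: "c \<in> tree_edges d" and y: "0 \<le> y" "y < T" "\<forall>i<m. y \<notin> w (c @ [i])"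
  shows "entry m T w c (insert y (w c))"
proof -
  have "w c \<inter> w (c @ [i]) = {}" if "i < m" for i
    using r c edge_child[OF edge_vert[OF c] that] unfolding regular_def by auto
  moreover have "finite (w c)" "w c \<subseteq> {0<..<T}" using r c by (auto simp: regular_def)
  ultimately show ?thesis using y by (auto simp: entry_def)
qed

lemma AE_notin_children:
  "v \<in> tree_verts d \<Longrightarrow> AE w in Om d T. \<forall>i<m. y \<notin> w (v @ [i])"
  using AE_edge_notin[OF edge_child] by (simp add: AE_all_countable)

lemma ret_upd: "ret k n (w(c := B)) c E s = ret k n w c E s"
  by (rule ret_cong) auto

text \<open>Deleting the bars of \<open>c\<close> in the forbidden set can only help the escape
  (\<open>ret_subset_success\<close>), and after the deletion the escape is independent of whether
  that set was void. So the two events occur together at least as often as if they were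
  independent.\<close>

lemma avoids_success:
  assumes c: "c \<in> tree_edges d" and y: "0 \<le> y" "y < T" and Q [measurable]: "{b. Q b} \<in> sets borel"
    and a: "ennreal a \<le> (\<integral>\<^sup>+w. of_bool (ret m n w c (insert y (w c)) y = -1) \<partial>Om d T)" "0 \<le> a"
  shows "ennreal (exp (- vol T {b. Q b}) * a) \<le>
    (\<integral>\<^sup>+w. of_bool (avoids (w c) Q \<and> ret m n w c (insert y (w c)) y = -1) \<partial>Om d T)"
proof -
  let ?A = "{b. Q b}"
  let ?f = "\<lambda>w. of_bool (ret m n w c (insert y (w c)) y = -1) :: ennreal"
  have f [measurable]: "?f \<in> borel_measurable (Om d T)" by measurable
  have "ennreal a \<le> (\<integral>\<^sup>+w. ?f w \<partial>Om d T)" by fact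
  also have "\<dots> \<le> (\<integral>\<^sup>+w. ?f (w(c := w c - ?A)) \<partial>Om d T)"
  proof (rule nn_integral_mono_AE)
    show "AE w in Om d T. ?f w \<le> ?f (w(c := w c - ?A))"
      using AE_regular AE_notin_children[OF edge_vert[OF c], of y]
    proof eventually_elim
      case (elim w)
      have "ret m n w c (insert y (w c)) y = -1 \<Longrightarrow> ret m n w c (insert y (w c - ?A)) y = -1"
        by (rule ret_subset_success[OF regular_reg[OF elim(1) edge_vert[OF c]] entry_edge[OF elim(1) c y elim(2)]]) auto
      then show ?case by (simp add: ret_upd)
    qed
  qed
  finally have "ennreal (exp (- vol T ?A)) * ennreal a \<le>
      ennreal (exp (- vol T ?A)) * (\<integral>\<^sup>+w. ?f (w(c := w c - ?A)) \<partial>Om d T)"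
    by (intro mult_left_mono) auto
  also have "\<dots> = (\<integral>\<^sup>+w. indicator {w. w c \<inter> ?A = {}} w * ?f (w(c := w c - ?A)) \<partial>Om d T)"
    by (rule Om_void_rest[OF c, symmetric]) measurable
  also have "\<dots> = (\<integral>\<^sup>+w. of_bool (avoids (w c) Q \<and> ret m n w c (insert y (w c)) y = -1) \<partial>Om d T)"
  proof (rule nn_integral_cong_AE)
    show "AE w in Om d T. indicator {w. w c \<inter> ?A = {}} w * ?f (w(c := w c - ?A)) =
      of_bool (avoids (w c) Q \<and> ret m n w c (insert y (w c)) y = -1)"
      using AE_edge[OF c]
    proof eventually_elim
      case (elim w)
      show ?case
      proof (cases "w c \<inter> ?A = {}")
        case True
        then have "w c - ?A = w c" by auto
        then show ?thesis using True elim by (auto simp: avoids_def)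
      qed (use elim in \<open>auto simp: avoids_def\<close>)
    qed
  qed
  finally show ?thesis using a by (simp add: ennreal_mult')
qed

text \<open>The hypothesis makes \<open>y\<close> the earliest bar after \<open>t\<close>. Two
  earliest bars would be equally far from \<open>t\<close> and hence equal, so the double sum has at
  most one nonzero term.\<close>

lemma sum_first_le:
  fixes \<Phi> :: "nat \<Rightarrow> real \<Rightarrow> bool"
  assumes w: "regular w" and v: "v \<in> tree_verts d" and J: "J \<subseteq> {..<m}"
    and \<Phi>: "\<And>j y. j \<in> J \<Longrightarrow> y \<in> w (v @ [j]) \<Longrightarrow> \<Phi> j y \<Longrightarrow>
      P \<and> (\<forall>i\<in>J. \<forall>b\<in>w (v @ [i]). b \<noteq> y \<longrightarrow> \<not> cd T t b < cd T t y)"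
  shows "(\<Sum>j\<in>J. \<Sum>y\<in>w (v @ [j]). of_bool (\<Phi> j y)) \<le> (of_bool P :: ennreal)"
proof (cases "\<exists>j\<in>J. \<exists>y\<in>w (v @ [j]). \<Phi> j y")
  case True
  then obtain j y where jy: "j \<in> J" "y \<in> w (v @ [j])" "\<Phi> j y" by blast
  have fin: "finite J" using J finite_subset by blast
  have e: "v @ [i] \<in> tree_edges d" if "i \<in> J" for i using J that by (intro edge_child[OF v]) auto
  have range: "0 < b" "b < T" if "i \<in> J" "b \<in> w (v @ [i])" for i b
    using regular_range[OF w e[OF that(1)] that(2)] by simp_all
  have uniq: "i = j \<and> b = y" if i: "i \<in> J" "b \<in> w (v @ [i])" "\<Phi> i b" for i b
  proof -
    have "b = y"
    proof (rule ccontr)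
      assume ne: "b \<noteq> y"
      then have "\<not> cd T t b < cd T t y" "\<not> cd T t y < cd T t b"
        using \<Phi>[OF jy] \<Phi>[OF i] i jy by auto
      then have "cd T t b = cd T t y" by simp
      then show False using ne cd_inj[of T t b y] range[OF i(1,2)] range[OF jy(1,2)] by auto
    qed
    moreover have "i = j"
    proof (rule ccontr)
      assume "i \<noteq> j"
      then have "w (v @ [i]) \<inter> w (v @ [j]) = {}"
        by (intro regular_disj[OF w] e i(1) jy(1)) simp
      then show False using \<open>b = y\<close> i jy by auto
    qed
    ultimately show ?thesis by simp
  qed
  have "(\<Sum>i\<in>J. \<Sum>b\<in>w (v @ [i]). of_bool (\<Phi> i b)) = (\<Sum>i\<in>J. if i = j then 1 else (0::ennreal))"
  proof (rule sum.cong[OF refl])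
    fix i assume i: "i \<in> J"
    have "(\<Sum>b\<in>w (v @ [i]). of_bool (\<Phi> i b)) = (\<Sum>b\<in>w (v @ [i]). if i = j \<and> b = y then 1 else (0::ennreal))"
    proof (rule sum.cong[OF refl])
      fix b assume b: "b \<in> w (v @ [i])"
      have "\<Phi> i b \<longleftrightarrow> i = j \<and> b = y" using uniq[OF i b] jy(3) by blast
      then show "of_bool (\<Phi> i b) = (if i = j \<and> b = y then 1 else (0::ennreal))" by simp
    qed
    also have "\<dots> = (if i = j then 1 else 0)"
    proof -
      have "finite (w (v @ [j]))" by (rule regular_finite[OF w e[OF jy(1)]])
      then show ?thesis using jy(2) by (cases "i = j") simp_all
    qed
    finally show "(\<Sum>b\<in>w (v @ [i]). of_bool (\<Phi> i b)) = (if i = j then 1 else (0::ennreal))" .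
  qed
  also have "\<dots> = 1" using fin jy by simp
  finally show ?thesis using \<Phi>[OF jy] by simp
next
  case False
  then have "(\<Sum>j\<in>J. \<Sum>y\<in>w (v @ [j]). of_bool (\<Phi> j y)) = (0::ennreal)"
    by (intro sum.neutral ballI) auto
  then show ?thesis by simp
qed

text \<open>The event is decomposed by Mecke's formula over the bar that is met first;
  \<open>\<phi>\<close> speaks of the configuration without that bar. The lower bound is a multiple
  of an exponential waiting-time density with rate \<open>\<kappa>\<close>, integrated up to
  \<open>h\<close>.\<close>

lemma first_bound:
  fixes \<phi> :: "nat \<Rightarrow> real \<Rightarrow> (vert \<Rightarrow> real set) \<Rightarrow> bool" and C \<kappa> h t :: real
  assumes v: "v \<in> tree_verts d" and J: "J \<subseteq> {..<m}" and t: "0 \<le> t" "t < T"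
    and C: "0 \<le> C" "0 < \<kappa>" "0 \<le> h" "h \<le> T"
    and m\<phi>: "\<And>j. j \<in> J \<Longrightarrow> Measurable.pred (borel \<Otimes>\<^sub>M Om d T) (\<lambda>(y, w). \<phi> j y w)"
    and first: "AE w in Om d T. \<forall>j\<in>J. \<forall>y\<in>w (v @ [j]). \<phi> j y (w(v @ [j] := w (v @ [j]) - {y})) \<longrightarrow>
      P w \<and> (\<forall>i\<in>J. \<forall>b\<in>w (v @ [i]). b \<noteq> y \<longrightarrow> \<not> cd T t b < cd T t y)"
    and lower: "\<And>j y. j \<in> J \<Longrightarrow> 0 < y \<Longrightarrow> y < T \<Longrightarrow> y \<noteq> t \<Longrightarrow> cd T t y < h \<Longrightarrow>
      ennreal (C * exp (- \<kappa> * cd T t y)) \<le> (\<integral>\<^sup>+w. of_bool (\<phi> j y w) \<partial>Om d T)"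
  shows "ennreal (real (card J) * (C * (1 - exp (- \<kappa> * h)) / \<kappa>)) \<le> (\<integral>\<^sup>+w. of_bool (P w) \<partial>Om d T)"
proof -
  let ?g = "\<lambda>u. ennreal (C * exp (- \<kappa> * u)) * of_bool (u < h)"
  let ?s = "\<lambda>j w. \<Sum>y\<in>w (v @ [j]). of_bool (\<phi> j y (w(v @ [j] := w (v @ [j]) - {y}))) :: ennreal"
  have e: "v @ [j] \<in> tree_edges d" if "j \<in> J" for j using J that by (intro edge_child[OF v]) auto
  have sm: "?s j \<in> borel_measurable (Om d T)" if j: "j \<in> J" for j
  proof -
    note [measurable] = e[OF j]
    have [measurable]: "(\<lambda>p. fst p c) \<in> measurable (Om d T \<Otimes>\<^sub>M borel) pts" for c
      by (rule measurable_compose[OF measurable_fst measurable_edge_Om])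
    have "(\<lambda>p. (snd p, (fst p)(v @ [j] := fst p (v @ [j]) - {snd p}))) \<in>
        measurable (Om d T \<Otimes>\<^sub>M borel) (borel \<Otimes>\<^sub>M Om d T)" by measurable
    from measurable_compose[OF this m\<phi>[OF j]]
    have "(\<lambda>p. of_bool (\<phi> j (snd p) ((fst p)(v @ [j] := fst p (v @ [j]) - {snd p}))) :: ennreal)
        \<in> borel_measurable (Om d T \<Otimes>\<^sub>M borel)"
      by (intro measurable_of_bool) simp
    then show ?thesis
      by (intro measurable_sum_pts) (simp_all add: case_prod_beta' measurable_edge_Om)
  qed
  have one: "ennreal (C * (1 - exp (- \<kappa> * h)) / \<kappa>) \<le> (\<integral>\<^sup>+w. ?s j w \<partial>Om d T)" if j: "j \<in> J" for j
  proof -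
    have "ennreal (C * (1 - exp (- \<kappa> * h)) / \<kappa>) = (\<integral>\<^sup>+u\<in>{0<..<T}. ?g u \<partial>lborel)"
      by (rule nn_integral_exp_less) fact+
    also have "\<dots> = (\<integral>\<^sup>+y\<in>{0<..<T}. ?g (cd T t y) \<partial>lborel)"
      by (rule nn_integral_cd[OF _ t, symmetric]) measurable
    also have "\<dots> \<le> (\<integral>\<^sup>+y\<in>{0<..<T}. (\<integral>\<^sup>+w. of_bool (\<phi> j y w) \<partial>Om d T) \<partial>lborel)"
    proof (rule nn_integral_mono_AE)
      show "AE y in lborel. ?g (cd T t y) * indicator {0<..<T} y \<le>
        (\<integral>\<^sup>+w. of_bool (\<phi> j y w) \<partial>Om d T) * indicator {0<..<T} y"
        using AE_lborel_singleton[of t]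
      proof eventually_elim
        case (elim y)
        then show ?case using lower[OF j, of y] by (cases "y \<in> {0<..<T}") auto
      qed
    qed
    also have "\<dots> = (\<integral>\<^sup>+w. ?s j w \<partial>Om d T)"
    proof (rule Om_Mecke[OF e[OF j], symmetric])
      show "(\<lambda>(y, w). of_bool (\<phi> j y w) :: ennreal) \<in> borel_measurable (borel \<Otimes>\<^sub>M Om d T)"
        using measurable_of_bool[OF m\<phi>[OF j]] by (simp add: case_prod_beta')
    qed
    finally show ?thesis .
  qed
  have "ennreal (real (card J) * (C * (1 - exp (- \<kappa> * h)) / \<kappa>)) = (\<Sum>j\<in>J. ennreal (C * (1 - exp (- \<kappa> * h)) / \<kappa>))"
    by (simp only: sum_constant ennreal_of_nat_eq_real_of_nat ennreal_mult'[OF of_nat_0_le_iff])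
  also have "\<dots> \<le> (\<Sum>j\<in>J. \<integral>\<^sup>+w. ?s j w \<partial>Om d T)" using one by (rule sum_mono)
  also have "\<dots> = (\<integral>\<^sup>+w. (\<Sum>j\<in>J. ?s j w) \<partial>Om d T)" by (rule nn_integral_sum[symmetric]) (rule sm)
  also have "\<dots> \<le> (\<integral>\<^sup>+w. of_bool (P w) \<partial>Om d T)"
  proof (rule nn_integral_mono_AE)
    show "AE w in Om d T. (\<Sum>j\<in>J. ?s j w) \<le> of_bool (P w)"
      using first AE_regular
    proof eventually_elim
      case (elim w)
      show ?case by (rule sum_first_le[OF elim(2) v J]) (use elim(1) in blast)
    qed
  qed
  finally show ?thesis .
qed

text \<open>The walk at \<open>v\<close> at time \<open>t\<close> leaves through the bar \<open>y\<close> of a child in \<open>J\<close> within time \<open>h\<close> and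
  never returns; \<open>V\<close> marks the arc explored before, which has to be free of other bars.\<close>
definition attempt :: "nat \<Rightarrow> vert \<Rightarrow> nat set \<Rightarrow> (real \<Rightarrow> bool) \<Rightarrow> real \<Rightarrow> real \<Rightarrow> (vert \<Rightarrow> real set) \<Rightarrow> bool" where
  "attempt n v J V h t w \<longleftrightarrow> (\<exists>j\<in>J. finite (w (v @ [j])) \<and> (\<exists>y\<in>w (v @ [j]). cd T t y < h \<and>
     (\<forall>i\<in>J. avoids (w (v @ [i])) (\<lambda>b. b \<noteq> y \<and> (V b \<or> cd T t b < cd T t y))) \<and>
     ret m n w (v @ [j]) (w (v @ [j])) y = -1))"

text \<open>The three factors are the costs of keeping the old arc free on \<open>card J\<close>
  edges, of meeting a bar within time \<open>h\<close> at rate \<open>card J\<close>, and of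
  escaping through it.\<close>

lemma prob_attempt:
  fixes a h t l :: real
  assumes v: "v \<in> tree_verts d" and J: "J \<subseteq> {..<m}" "J \<noteq> {}" and t: "0 \<le> t" "t < T"
    and h: "0 \<le> h" "h \<le> T" and V [measurable]: "{b. V b} \<in> sets borel"
    and l: "vol T {b. V b} \<le> l" and a: "0 \<le> a"
    and IH: "\<And>c y. c \<in> tree_edges d \<Longrightarrow> 0 \<le> y \<Longrightarrow> y < T \<Longrightarrow>
      ennreal a \<le> (\<integral>\<^sup>+w. of_bool (ret m n w c (insert y (w c)) y = -1) \<partial>Om d T)"
  shows "ennreal (exp (- real (card J) * l) * (1 - exp (- real (card J) * h)) * a) \<le>
    (\<integral>\<^sup>+w. of_bool (attempt n v J V h t w) \<partial>Om d T)"
proof -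
  have fin: "finite J" using J(1) finite_subset by blast
  define k where "k = real (card J)"
  have k: "0 < k" using fin J(2) by (simp add: k_def card_gt_0_iff)
  let ?Q = "\<lambda>y b. V b \<or> cd T t b < cd T t y"
  \<comment> \<open>This is \<open>attempt\<close> with the chosen bar removed: child
    \<open>j\<close> too must avoid the arc, and \<open>insert\<close> restores \<open>y\<close> as
    entry.\<close>
  define \<phi> where "\<phi> j y w \<longleftrightarrow> cd T t y < h \<and> (\<forall>i\<in>J. avoids (w (v @ [i])) (?Q y)) \<and>
     ret m n w (v @ [j]) (insert y (w (v @ [j]))) y = -1" for j y w
  have e: "v @ [j] \<in> tree_edges d" if "j \<in> J" for j using J that by (intro edge_child[OF v]) auto
  have Vp [measurable]: "Measurable.pred borel V" using V by (simp add: pred_def)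
  have "ennreal (real (card J) * (exp (- k * l) * a * (1 - exp (- k * h)) / k)) \<le>
    (\<integral>\<^sup>+w. of_bool (attempt n v J V h t w) \<partial>Om d T)"
  proof (rule first_bound[OF v J(1) t _ k h])
    show "0 \<le> exp (- k * l) * a" using a by simp
    show "Measurable.pred (borel \<Otimes>\<^sub>M Om d T) (\<lambda>(y, w). \<phi> j y w)" for j
    proof -
      have [measurable]: "(\<lambda>p. snd p c) \<in> measurable (borel \<Otimes>\<^sub>M Om d T) pts" for c
        by (rule measurable_compose[OF measurable_snd measurable_edge_Om])
      have "(\<lambda>p. ret m n (snd p) (v @ [j]) (insert (fst p) (snd p (v @ [j]))) (fst p)) \<in> borel_measurable (borel \<Otimes>\<^sub>M Om d T)"
        by (rule measurable_ret_Om[of snd _ d T]) measurable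
      then show ?thesis unfolding \<phi>_def case_prod_beta' using fin by measurable
    qed
    show "AE w in Om d T. \<forall>j\<in>J. \<forall>y\<in>w (v @ [j]). \<phi> j y (w(v @ [j] := w (v @ [j]) - {y})) \<longrightarrow>
      attempt n v J V h t w \<and> (\<forall>i\<in>J. \<forall>b\<in>w (v @ [i]). b \<noteq> y \<longrightarrow> \<not> cd T t b < cd T t y)"
      using AE_regular
    proof eventually_elim
      case (elim w)
      show ?case
      proof (intro ballI impI)
        fix j y assume j: "j \<in> J" and y: "y \<in> w (v @ [j])" and p: "\<phi> j y (w(v @ [j] := w (v @ [j]) - {y}))"
        have first: "\<forall>i\<in>J. \<forall>b\<in>w (v @ [i]). b \<noteq> y \<longrightarrow> \<not> ?Q y b"
        proof (intro ballI impI)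
          fix i b assume i: "i \<in> J" and b: "b \<in> w (v @ [i])" "b \<noteq> y"
          then have "avoids ((w(v @ [j] := w (v @ [j]) - {y})) (v @ [i])) (?Q y)" using p by (simp add: \<phi>_def)
          moreover have "b \<in> (w(v @ [j] := w (v @ [j]) - {y})) (v @ [i])" using b by auto
          ultimately show "\<not> ?Q y b" unfolding avoids_def by blast
        qed
        have "ret m n w (v @ [j]) (w (v @ [j])) y = -1" "cd T t y < h"
          using p by (simp_all add: \<phi>_def ret_upd insert_absorb[OF y])
        then show "attempt n v J V h t w \<and> (\<forall>i\<in>J. \<forall>b\<in>w (v @ [i]). b \<noteq> y \<longrightarrow> \<not> cd T t b < cd T t y)"
          unfolding attempt_def avoids_def using j y first regular_finite[OF elim e] by blast
      qed
    qed
    fix j y assume j: "j \<in> J" and y: "0 < y" "y < T" "y \<noteq> t" "cd T t y < h"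
    let ?u = "cd T t y"
    let ?f = "\<lambda>w. of_bool (avoids (w (v @ [j])) (?Q y) \<and> ret m n w (v @ [j]) (insert y (w (v @ [j]))) y = -1) :: ennreal"
    let ?g = "\<lambda>i w. of_bool (avoids (w (v @ [i])) (?Q y)) :: ennreal"
    have u: "0 \<le> ?u" "?u \<le> T" using t y by (auto simp: cd_def)
    have Qm [measurable]: "{b. ?Q y b} \<in> sets borel" by measurable
    have vq: "vol T {b. ?Q y b} \<le> l + ?u"
    proof -
      have "{b. ?Q y b} \<inter> {0<..<T} = ({b. V b} \<union> {b. cd T t b \<in> {0<..<?u}}) \<inter> {0<..<T}"
        using t by (auto simp: cd_def split: if_splits)
      then have "vol T {b. ?Q y b} = vol T ({b. V b} \<union> {b. cd T t b \<in> {0<..<?u}})"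
        by (simp add: vol_def)
      also have "\<dots> = vol T {b. V b} + vol T ({b. cd T t b \<in> {0<..<?u}} - {b. V b})"
        by (rule vol_Diff_Un) measurable
      also have "vol T ({b. cd T t b \<in> {0<..<?u}} - {b. V b}) \<le> vol T {b. cd T t b \<in> {0<..<?u}}"
        by (rule vol_mono) (auto intro: measurable_sets)
      also have "\<dots> = ?u" using vol_cd[OF t _ _ _ disjI1[OF refl], of 0 ?u] u by simp
      finally show ?thesis using l by simp
    qed
    have vp: "Measurable.pred (Om d T) (\<lambda>w. avoids (w c) (?Q y))" for c
      by measurable
    have "(\<integral>\<^sup>+w. of_bool (\<phi> j y w) \<partial>Om d T) = (\<integral>\<^sup>+w. ?f w * (\<Prod>i\<in>J - {j}. ?g i w) \<partial>Om d T)"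
    proof (rule nn_integral_cong)
      fix w
      have "(\<Prod>i\<in>J - {j}. ?g i w) = of_bool (\<forall>i\<in>J - {j}. avoids (w (v @ [i])) (?Q y))"
        using fin by (simp add: prod_of_bool)
      then show "of_bool (\<phi> j y w) = ?f w * (\<Prod>i\<in>J - {j}. ?g i w)"
        using y(4) j by (auto simp: \<phi>_def)
    qed
    \<comment> \<open>The chosen child with its subtree is independent of the bars to the other
      children.\<close>
    also have "\<dots> = (\<integral>\<^sup>+w. ?f w \<partial>Om d T) * (\<integral>\<^sup>+w. (\<Prod>i\<in>J - {j}. ?g i w) \<partial>Om d T)"
    proof (rule nn_integral_indep[where K="{v @ [j] @ u | u. True}" and K'="\<Union>i\<in>J - {j}. {v @ [i]}"])
      show "dep (\<Union>i\<in>J - {j}. {v @ [i]}) (\<lambda>w. \<Prod>i\<in>J - {j}. ?g i w)"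
        by (rule dep_prod) (simp add: dep_def)
      have "?f w = ?f w'" if "\<forall>i\<in>{v @ [j] @ u | u. True}. w i = w' i" for w w'
      proof -
        have "w (v @ [j]) = w' (v @ [j])" using that[rule_format, of "v @ [j]"] by auto
        moreover have "ret m n w (v @ [j]) E y = ret m n w' (v @ [j]) E y" for E
          by (rule ret_cong) (use that in auto)
        ultimately show ?thesis by simp
      qed
      then show "dep {v @ [j] @ u | u. True} ?f" unfolding dep_def by blast
      show "(\<lambda>w. \<Prod>i\<in>J - {j}. ?g i w) \<in> borel_measurable (Om d T)"
        by (intro borel_measurable_prod_ennreal measurable_of_bool vp)
      show "?f \<in> borel_measurable (Om d T)"
      proof -
        have "(\<lambda>w. ret m n w (v @ [j]) (insert y (w (v @ [j]))) y) \<in> borel_measurable (Om d T)"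
          by (rule measurable_ret_Om[of "\<lambda>w. w" _ d T]) measurable
        then show ?thesis using vp by measurable
      qed
    qed auto
    also have "(\<integral>\<^sup>+w. (\<Prod>i\<in>J - {j}. ?g i w) \<partial>Om d T) = (\<Prod>i\<in>J - {j}. \<integral>\<^sup>+w. ?g i w \<partial>Om d T)"
    proof (rule nn_integral_indep_prod[where K="\<lambda>i. {v @ [i]}"])
      show "dep {v @ [i]} (?g i)" for i by (simp add: dep_def)
    qed (use fin vp in auto)
    also have "\<dots> = (\<Prod>i\<in>J - {j}. ennreal (exp (- vol T {b. ?Q y b})))"
      using e by (intro prod.cong refl prob_avoids[OF _ Qm]) auto
    also have "\<dots> = ennreal (exp (- vol T {b. ?Q y b}) ^ (card J - 1))"
      using j fin by (simp add: ennreal_power)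
    finally have eq: "(\<integral>\<^sup>+w. of_bool (\<phi> j y w) \<partial>Om d T) =
       (\<integral>\<^sup>+w. ?f w \<partial>Om d T) * ennreal (exp (- vol T {b. ?Q y b}) ^ (card J - 1))" .
    define X where "X = vol T {b. ?Q y b}"
    define q where "q = card J - 1"
    have "0 < card J" using j fin by (auto simp: card_gt_0_iff)
    then have kq: "k = 1 + real q" by (simp add: k_def q_def)
    have "exp (- k * l) * a * exp (- k * ?u) = exp (- k * (l + ?u)) * a"
      by (simp add: exp_add[symmetric] distrib_left)
    also have "\<dots> \<le> exp (- k * X) * a"
      using vq k a unfolding X_def[symmetric] by (intro mult_right_mono) simp_all
    also have "exp (- k * X) = exp (- X) * exp (- X) ^ q"
      by (simp add: kq exp_of_nat_mult[symmetric] exp_add[symmetric] algebra_simps)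
    finally have "ennreal (exp (- k * l) * a * exp (- k * ?u)) \<le> ennreal ((exp (- X) * a) * exp (- X) ^ q)"
      by (intro ennreal_leI) (simp add: mult_ac)
    also have "\<dots> = ennreal (exp (- X) * a) * ennreal (exp (- X) ^ q)"
      by (rule ennreal_mult'') simp
    finally have "ennreal (exp (- k * l) * a * exp (- k * ?u)) \<le>
        ennreal (exp (- vol T {b. ?Q y b}) * a) * ennreal (exp (- vol T {b. ?Q y b}) ^ (card J - 1))"
      unfolding X_def q_def .
    also have "\<dots> \<le> (\<integral>\<^sup>+w. ?f w \<partial>Om d T) * ennreal (exp (- vol T {b. ?Q y b}) ^ (card J - 1))"
      using y by (intro mult_right_mono avoids_success[OF e[OF j] _ _ Qm IH[OF e[OF j]] a]) auto
    finally show "ennreal (exp (- k * l) * a * exp (- k * ?u)) \<le> (\<integral>\<^sup>+w. of_bool (\<phi> j y w) \<partial>Om d T)"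
      unfolding eq .
  qed
  moreover have "real (card J) * (exp (- k * l) * a * (1 - exp (- k * h)) / k) =
      exp (- real (card J) * l) * (1 - exp (- real (card J) * h)) * a"
    using k by (simp add: k_def)
  ultimately show ?thesis by simp
qed

end

section \<open>Returns from a child\<close>

lemma measurable_cd_set [measurable]: "{b. u < cd T s b} \<in> sets borel"
  by measurable

context stirring
begin

lemma vol_cd_less:
  assumes "0 \<le> t" "t < T" "0 \<le> u" "u \<le> T"
  shows "vol T {b. cd T t b < u} = u"
proof -
  have "{b. cd T t b < u} \<inter> {0<..<T} = {b. cd T t b \<in> {0<..<u}} \<inter> {0<..<T}"
    using assms by (auto simp: cd_def split: if_splits)
  then show ?thesis using vol_cd[OF assms(1,2) _ _ _ disjI1[OF refl], of 0 u] assms by (simp add: vol_def)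
qed

lemma vol_cd_greater:
  assumes "0 \<le> t" "t < T" "0 \<le> u" "u \<le> T"
  shows "vol T {b. T - u < cd T t b} = u"
proof -
  have "AE b in lborel. b \<in> {b. T - u < cd T t b} \<inter> {0<..<T} \<longleftrightarrow> b \<in> {b. cd T t b \<in> {T - u<..<T}} \<inter> {0<..<T}"
    using AE_lborel_singleton[of t]
    by eventually_elim (use assms in \<open>auto simp: cd_def split: if_splits\<close>)
  then have "vol T {b. T - u < cd T t b} = vol T {b. cd T t b \<in> {T - u<..<T}}"
    unfolding vol_def by (intro measure_eq_AE) measurable
  then show ?thesis using vol_cd[OF assms(1,2) _ _ _ disjI1[OF refl], of "T - u" T] assms by simp
qed

lemma prob_hit:
  assumes c: "c \<in> tree_edges d" and Q: "{b. Q b} \<in> sets borel" and vQ: "vol T {b. Q b} = h"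
  shows "(\<integral>\<^sup>+w. of_bool (\<not> avoids (w c) Q) \<partial>Om d T) \<le> ennreal h"
proof -
  have [measurable]: "Measurable.pred borel Q" using Q by (simp add: pred_def)
  have h: "0 \<le> h" using vQ by (simp add: vol_def flip: vQ)
  have p [measurable]: "Measurable.pred (Om d T) (\<lambda>w. avoids (w c) Q)" by measurable
  have "Om.prob {w \<in> space (Om d T). avoids (w c) Q} = exp (- h)"
    using prob_avoids[OF c Q] vQ by (simp add: emeasure_of_bool[OF p])
  moreover have "Om.prob {w \<in> space (Om d T). \<not> avoids (w c) Q} = 1 - Om.prob {w \<in> space (Om d T). avoids (w c) Q}"
    by (rule Om.prob_neg) measurable
  moreover have "1 - exp (- h) \<le> h" using exp_ge_add_one_self[of "- h"] by linarith
  ultimately show ?thesis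
    using p by (subst emeasure_of_bool) (auto intro!: ennreal_leI)
qed

text \<open>Let \<open>i\<close> be the probability of returning at \<open>y\<close> once the bars
  of \<open>c\<close> in the window after \<open>y\<close> are deleted. Deletion keeps such a return
  (\<open>ret_subset_return\<close>) and makes it independent of the window. So the event on the
  left has probability at most i (1 - exp (-h)), while i exp (-h) is at most the probability of
  returning at \<open>y\<close>.\<close>

lemma first_return_resample:
  assumes c: "c \<in> tree_edges d" and x: "0 < x" "x < T" and y: "0 < y" "y < T" and h: "0 \<le> h" "h \<le> T"
  shows "(\<integral>\<^sup>+w. of_bool (ret m n w c (insert x (insert y (w c))) x = y \<and> \<not> avoids (w c) (\<lambda>b. cd T y b < h)) \<partial>Om d T)
    \<le> ennreal (exp h - 1) * (\<integral>\<^sup>+w. of_bool (ret m n w c (insert x (insert y (w c))) x = y) \<partial>Om d T)"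
proof -
  let ?A = "{b. cd T y b < h}"
  let ?F = "\<lambda>w. ret m n w c (insert x (insert y (w c))) x = y"
  let ?FA = "\<lambda>w. ret m n w c (insert x (insert y (w c - ?A))) x = y"
  let ?V = "\<lambda>w. avoids (w c) (\<lambda>b. cd T y b < h)"
  have rm [measurable]: "(\<lambda>w. ret m n w c (insert x (insert y (w c))) x) \<in> borel_measurable (Om d T)"
    "(\<lambda>w. ret m n w c (insert x (insert y (w c - ?A))) x) \<in> borel_measurable (Om d T)"
    by (rule measurable_ret_Om[of "\<lambda>w. w" _ d T]; measurable)+
  have Vm [measurable]: "Measurable.pred (Om d T) ?V" by measurable
  define p where "p = Om.prob {w \<in> space (Om d T). ?F w \<and> \<not> ?V w}"
  define q where "q = Om.prob {w \<in> space (Om d T). ?F w}"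
  define i where "i = Om.prob {w \<in> space (Om d T). ?FA w}"
  have nn: "0 \<le> p" "0 \<le> q" "0 \<le> i" by (auto simp: p_def q_def i_def)
  have P: "(\<integral>\<^sup>+w. of_bool (?F w \<and> \<not> ?V w) \<partial>Om d T) = ennreal p"
    unfolding p_def by (rule emeasure_of_bool) measurable
  have Q: "(\<integral>\<^sup>+w. of_bool (?F w) \<partial>Om d T) = ennreal q"
    unfolding q_def by (rule emeasure_of_bool) measurable
  have I: "(\<integral>\<^sup>+w. of_bool (?FA w) \<partial>Om d T) = ennreal i"
    unfolding i_def by (rule emeasure_of_bool) measurable
  have mono: "AE w in Om d T. ?F w \<longrightarrow> ?FA w"
    using AE_regular AE_notin_children[OF edge_vert[OF c], of x] AE_notin_children[OF edge_vert[OF c], of y]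
  proof eventually_elim
    case (elim w)
    have e: "entry m T w c (insert x (insert y (w c)))"
      using entry_edge[OF elim(1) c _ _ elim(3)] y x elim(2) by (auto simp: entry_def)
    show ?case
      using ret_subset_return[OF regular_reg[OF elim(1) edge_vert[OF c]] e, of "insert x (insert y (w c - ?A))" x n y]
      by auto
  qed
  have VV: "AE w in Om d T. (indicator {w. w c \<inter> ?A = {}} w :: ennreal) = of_bool (?V w) \<and> (?V w \<longrightarrow> w c - ?A = w c)"
    using AE_edge[OF c] by eventually_elim (auto simp: avoids_def indicator_def)
  have rest: "(\<integral>\<^sup>+w. of_bool (?V w) * of_bool (?FA w) \<partial>Om d T) = ennreal (exp (- h) * i)"
  proof -
    let ?f = "\<lambda>w. of_bool (?F w) :: ennreal"
    have "(\<integral>\<^sup>+w. of_bool (?V w) * of_bool (?FA w) \<partial>Om d T) =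
      (\<integral>\<^sup>+w. indicator {w. w c \<inter> ?A = {}} w * ?f (w(c := w c - ?A)) \<partial>Om d T)"
      using VV by (intro nn_integral_cong_AE) (auto elim!: eventually_mono simp: ret_upd)
    also have "\<dots> = ennreal (exp (- vol T ?A)) * (\<integral>\<^sup>+w. ?f (w(c := w c - ?A)) \<partial>Om d T)"
      by (rule Om_void_rest[OF c]) measurable
    also have "(\<integral>\<^sup>+w. ?f (w(c := w c - ?A)) \<partial>Om d T) = ennreal i" by (simp only: ret_upd fun_upd_same I)
    also have "vol T ?A = h" using y h by (intro vol_cd_less) auto
    finally show ?thesis by (simp add: ennreal_mult'[symmetric])
  qed
  have "ennreal p + ennreal (exp (- h) * i) \<le> ennreal i"
  proof -
    have "ennreal p + ennreal (exp (- h) * i) = (\<integral>\<^sup>+w. of_bool (?F w \<and> \<not> ?V w) + of_bool (?V w) * of_bool (?FA w) \<partial>Om d T)"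
      unfolding P[symmetric] rest[symmetric] by (rule nn_integral_add[symmetric]) measurable
    also have "\<dots> \<le> (\<integral>\<^sup>+w. of_bool (?FA w) \<partial>Om d T)"
      using mono by (intro nn_integral_mono_AE) (auto elim!: eventually_mono)
    finally show ?thesis unfolding I .
  qed
  then have 1: "p + exp (- h) * i \<le> i"
    using nn by (simp add: ennreal_plus[symmetric] del: ennreal_plus)
  have "ennreal (exp (- h) * i) \<le> ennreal q"
    unfolding rest[symmetric] Q[symmetric]
  proof (rule nn_integral_mono_AE)
    show "AE w in Om d T. of_bool (?V w) * of_bool (?FA w) \<le> (of_bool (?F w) :: ennreal)"
      using VV
    proof eventually_elim
      case (elim w)
      show ?case
      proof (cases "?V w")
        case True
        then have "w c - ?A = w c" using elim by blast
        then show ?thesis by simp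
      qed simp
    qed
  qed
  then have 2: "exp (- h) * i \<le> q" using nn by simp
  have "p \<le> (exp h - 1) * (exp (- h) * i)"
  proof -
    have "(exp h - 1) * (exp (- h) * i) = i - exp (- h) * i"
      by (simp add: left_diff_distrib mult.assoc[symmetric] exp_add[symmetric])
    then show ?thesis using 1 by linarith
  qed
  also have "\<dots> \<le> (exp h - 1) * q" using 2 h by (intro mult_left_mono) auto
  finally have "ennreal p \<le> ennreal ((exp h - 1) * q)" by (rule ennreal_leI)
  also have "\<dots> = ennreal (exp h - 1) * ennreal q" using h by (intro ennreal_mult') simp
  finally show ?thesis unfolding P Q .
qed

text \<open>After its return from the child \<open>c\<close> the walk meets no bar of \<open>c\<close> for time \<open>h\<close>, so that it has
  to try another child; the first clause keeps the already explored arc from \<open>s\<close> out of reach.\<close>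
definition good_return :: "nat \<Rightarrow> vert \<Rightarrow> real \<Rightarrow> real \<Rightarrow> real \<Rightarrow> (vert \<Rightarrow> real set) \<Rightarrow> bool" where
  "good_return n c s h x w \<longleftrightarrow> avoids (w c) (\<lambda>b. T - h < cd T s b) \<and>
     avoids (w c) (\<lambda>b. cd T (ret m n w c (insert x (w c)) x) b < h)"

lemma measurable_good_return [measurable]:
  "Measurable.pred (borel \<Otimes>\<^sub>M Om d T) (\<lambda>p. good_return n c s h (fst p) (snd p))"
proof -
  have e [measurable]: "(\<lambda>p. snd p c) \<in> measurable (borel \<Otimes>\<^sub>M Om d T) pts" for c
    by (rule measurable_compose[OF measurable_snd measurable_edge_Om])
  have [measurable]: "(\<lambda>p. ret m n (snd p) c (insert (fst p) (snd p c)) (fst p)) \<in> borel_measurable (borel \<Otimes>\<^sub>M Om d T)"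
    by (rule measurable_ret_Om[of snd _ d T]) measurable
  show ?thesis unfolding good_return_def by measurable
qed

lemma measurable_good_return' [measurable]: "Measurable.pred (Om d T) (good_return n c s h x)"
proof -
  have "(\<lambda>w. (x, w)) \<in> measurable (Om d T) (borel \<Otimes>\<^sub>M Om d T)" by measurable
  from measurable_compose[OF this measurable_good_return] show ?thesis by simp
qed

text \<open>A bad return has a bar in the window of length \<open>h\<close> before \<open>s\<close>,
  or in the window after \<open>x\<close>, or in the window after a return \<open>y\<close> other
  than \<open>x\<close>. The first two cost \<open>h\<close> each; for the third,
  \<open>first_return_resample\<close> is summed over \<open>y\<close> by Mecke's formula.\<close>

lemma prob_bad_return:
  assumes c: "c \<in> tree_edges d" and s: "0 \<le> s" "s < T" and x: "0 < x" "x < T" and h: "0 \<le> h" "h \<le> T"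
  shows "(\<integral>\<^sup>+w. of_bool (ret m n w c (insert x (w c)) x \<noteq> -1 \<and> \<not> good_return n c s h x w) \<partial>Om d T)
    \<le> ennreal (2 * h + (exp h - 1))"
proof -
  let ?r = "\<lambda>w. ret m n w c (insert x (w c)) x"
  let ?A = "\<lambda>w. \<not> avoids (w c) (\<lambda>b. T - h < cd T s b)" and ?B = "\<lambda>w. \<not> avoids (w c) (\<lambda>b. cd T x b < h)"
  let ?f = "\<lambda>y w. of_bool (ret m n w c (insert x (insert y (w c))) x = y \<and> \<not> avoids (w c) (\<lambda>b. cd T y b < h)) :: ennreal"
  let ?F = "\<lambda>y w. of_bool (ret m n w c (insert x (insert y (w c))) x = y) :: ennreal"
  have em [measurable]: "(\<lambda>p. snd p c) \<in> measurable (borel \<Otimes>\<^sub>M Om d T) pts" for c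
    by (rule measurable_compose[OF measurable_snd measurable_edge_Om])
  have rm [measurable]: "(\<lambda>p. ret m n (snd p) c (insert x (insert (fst p) (snd p c))) x) \<in> borel_measurable (borel \<Otimes>\<^sub>M Om d T)"
    by (rule measurable_ret_Om[of snd _ d T]) measurable
  have fm: "case_prod ?f \<in> borel_measurable (borel \<Otimes>\<^sub>M Om d T)"
    and Fm: "case_prod ?F \<in> borel_measurable (borel \<Otimes>\<^sub>M Om d T)"
    unfolding case_prod_beta' by measurable
  have ins: "?f y (w(c := w c - {y})) = of_bool (?r w = y \<and> \<not> avoids (w c - {y}) (\<lambda>b. cd T y b < h))"
    "?F y (w(c := w c - {y})) = of_bool (?r w = y)" if "y \<in> w c" for y w
    using that by (simp_all add: ret_upd insert_absorb)
  define S where "S w = (\<Sum>y\<in>w c. ?f y (w(c := w c - {y})))" for w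
  have Sm: "S \<in> borel_measurable (Om d T)"
  proof -
    have [measurable]: "(\<lambda>p. fst p c) \<in> measurable (Om d T \<Otimes>\<^sub>M borel) pts" for c
      by (rule measurable_compose[OF measurable_fst measurable_edge_Om])
    note [measurable] = c
    have "(\<lambda>p. (snd p, (fst p)(c := fst p c - {snd p}))) \<in> measurable (Om d T \<Otimes>\<^sub>M borel) (borel \<Otimes>\<^sub>M Om d T)"
      by measurable
    from measurable_compose[OF this fm] show ?thesis
      unfolding S_def by (intro measurable_sum_pts) (simp_all add: case_prod_beta' measurable_edge_Om)
  qed
  have "(\<integral>\<^sup>+w. of_bool (?r w \<noteq> -1 \<and> \<not> good_return n c s h x w) \<partial>Om d T) \<le>
      (\<integral>\<^sup>+w. (of_bool (?A w) + of_bool (?B w)) + S w \<partial>Om d T)"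
  proof (rule nn_integral_mono_AE)
    show "AE w in Om d T. of_bool (?r w \<noteq> -1 \<and> \<not> good_return n c s h x w) \<le> (of_bool (?A w) + of_bool (?B w)) + S w"
      using AE_regular AE_notin_children[OF edge_vert[OF c], of x]
    proof eventually_elim
      case (elim w)
      show ?case
      proof (cases "?r w \<noteq> -1 \<and> \<not> good_return n c s h x w \<and> \<not> ?A w \<and> \<not> ?B w")
        case True
        have "?r w \<in> insert x (w c)"
          using ret_range[OF regular_reg[OF elim(1) edge_vert[OF c]] entry_edge[OF elim(1) c _ _ elim(2)], of x n] True x by auto
        moreover have nv: "\<not> avoids (w c) (\<lambda>b. cd T (?r w) b < h)" using True by (auto simp: good_return_def)
        ultimately have r: "?r w \<in> w c" using True by auto
        \<comment> \<open>The return bar is not in its own window, since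
          \<open>cd T y y = T\<close>, so the window is still hit after its deletion.\<close>
        have "\<not> avoids (w c - {?r w}) (\<lambda>b. cd T (?r w) b < h)"
        proof -
          have "\<not> cd T (?r w) (?r w) < h" using h by (simp add: cd_def)
          then show ?thesis using nv unfolding avoids_def by auto
        qed
        then have "?f (?r w) (w(c := w c - {?r w})) = 1" using ins(1)[of "?r w" w, OF r] by simp
        moreover have "?f (?r w) (w(c := w c - {?r w})) \<le> S w"
          unfolding S_def by (rule member_le_sum[OF r]) (use regular_finite[OF elim(1) c] in auto)
        ultimately have "1 \<le> S w" by simp
        then show ?thesis by (simp add: add_increasing order_trans[OF of_bool_less_eq_one])
      next
        case False
        then show ?thesis by (auto simp: add_increasing add_increasing2)
      qed
    qed
  qed
  also have "\<dots> = ((\<integral>\<^sup>+w. of_bool (?A w) \<partial>Om d T) + (\<integral>\<^sup>+w. of_bool (?B w) \<partial>Om d T)) + (\<integral>\<^sup>+w. S w \<partial>Om d T)"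
  proof -
    have a: "(\<lambda>w. of_bool (?A w) :: ennreal) \<in> borel_measurable (Om d T)"
      and b: "(\<lambda>w. of_bool (?B w) :: ennreal) \<in> borel_measurable (Om d T)" by measurable
    show ?thesis
      by (subst nn_integral_add[OF borel_measurable_add[OF a b] Sm], subst nn_integral_add[OF a b]) (rule refl)
  qed
  also have "\<dots> \<le> (ennreal h + ennreal h) + ennreal (exp h - 1)"
  proof (intro add_mono)
    show "(\<integral>\<^sup>+w. of_bool (?A w) \<partial>Om d T) \<le> ennreal h"
      by (rule prob_hit[OF c]) (measurable, rule vol_cd_greater[OF s h])
    show "(\<integral>\<^sup>+w. of_bool (?B w) \<partial>Om d T) \<le> ennreal h"
      by (rule prob_hit[OF c]) (measurable, use x h in \<open>auto intro!: vol_cd_less\<close>)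
    have "(\<integral>\<^sup>+w. S w \<partial>Om d T) = (\<integral>\<^sup>+y\<in>{0<..<T}. (\<integral>\<^sup>+w. ?f y w \<partial>Om d T) \<partial>lborel)"
      unfolding S_def by (rule Om_Mecke[OF c fm])
    also have "\<dots> \<le> (\<integral>\<^sup>+y. ennreal (exp h - 1) * ((\<integral>\<^sup>+w. ?F y w \<partial>Om d T) * indicator {0<..<T} y) \<partial>lborel)"
    proof (rule nn_integral_mono)
      fix y
      show "(\<integral>\<^sup>+w. ?f y w \<partial>Om d T) * indicator {0<..<T} y \<le>
        ennreal (exp h - 1) * ((\<integral>\<^sup>+w. ?F y w \<partial>Om d T) * indicator {0<..<T} y)"
        using first_return_resample[OF c x _ _ h, of y n] by (cases "y \<in> {0<..<T}") simp_all
    qed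
    also have "\<dots> = ennreal (exp h - 1) * (\<integral>\<^sup>+y\<in>{0<..<T}. (\<integral>\<^sup>+w. ?F y w \<partial>Om d T) \<partial>lborel)"
    proof (rule nn_integral_cmult)
      have "(\<lambda>y. \<integral>\<^sup>+w. ?F y w \<partial>Om d T) \<in> borel_measurable borel"
        using Om.borel_measurable_nn_integral[OF Fm] by simp
      then show "(\<lambda>y. (\<integral>\<^sup>+w. ?F y w \<partial>Om d T) * indicator {0<..<T} y) \<in> borel_measurable lborel" by simp
    qed
    also have "(\<integral>\<^sup>+y\<in>{0<..<T}. (\<integral>\<^sup>+w. ?F y w \<partial>Om d T) \<partial>lborel) = (\<integral>\<^sup>+w. (\<Sum>y\<in>w c. ?F y (w(c := w c - {y}))) \<partial>Om d T)"
      by (rule Om_Mecke[OF c Fm, symmetric])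
    \<comment> \<open>The walk returns at one time only, so at most one summand is nonzero.\<close>
    also have "\<dots> \<le> (\<integral>\<^sup>+w. 1 \<partial>Om d T)"
    proof (rule nn_integral_mono_AE)
      show "AE w in Om d T. (\<Sum>y\<in>w c. ?F y (w(c := w c - {y}))) \<le> 1"
        using AE_regular
      proof eventually_elim
        case (elim w)
        have "(\<Sum>y\<in>w c. ?F y (w(c := w c - {y}))) = (\<Sum>y\<in>w c. if y = ?r w then 1 else 0)"
          using ins(2) by (intro sum.cong) auto
        also have "\<dots> \<le> 1" using regular_finite[OF elim c] by simp
        finally show ?case .
      qed
    qed
    also have "\<dots> = 1" by (simp add: Om.emeasure_space_1)
    finally show "(\<integral>\<^sup>+w. S w \<partial>Om d T) \<le> ennreal (exp h - 1)" by (simp add: mult_left_mono)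
  qed
  also have "\<dots> = ennreal (2 * h + (exp h - 1))" using h by (simp add: ennreal_plus[symmetric] del: ennreal_plus)
  finally show ?thesis .
qed

section \<open>Escape after one good return\<close>

lemma attempt_cong:
  assumes eq: "\<And>j u. j \<in> J \<Longrightarrow> w ((v @ [j]) @ u) = w' ((v @ [j]) @ u)"
  shows "attempt n v J V h t w \<longleftrightarrow> attempt n v J V h t w'"
proof -
  have A: "w (v @ [j]) = w' (v @ [j])" if "j \<in> J" for j using eq[OF that, of "[]"] by simp
  have R: "ret m n w (v @ [j]) E y = ret m n w' (v @ [j]) E y" if "j \<in> J" for j E y
    by (rule ret_cong) (rule eq[OF that])
  show ?thesis unfolding attempt_def by (simp add: A R del: One_nat_def cong: bex_cong ball_cong)
qed

lemma entry_children:
  assumes r: "regular w" and v: "v \<in> tree_edges d" and s: "0 \<le> s" "s < T" "\<forall>i<m. s \<notin> w (v @ [i])"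
  shows "pole T (insert s (w v)) {..<m} (\<lambda>i. w (v @ [i])) (crho m n w v)"
  by (rule ret_pole[OF regular_reg[OF r edge_vert[OF v]] entry_edge[OF r v s]])

text \<open>In the second case the return \<open>r\<close> lies, seen from \<open>s\<close>, between
  \<open>x\<close> and \<open>T - h\<close>. So both \<open>s\<close> and the used bar
  \<open>x\<close> are at least \<open>h\<close> ahead of \<open>r\<close>, the edge above and child
  \<open>i\<close> have no other bar in that window, and the next bar is the one of the
  attempt.\<close>

lemma high_success:
  assumes r: "regular w" and v: "v \<in> tree_edges d" and s: "0 \<le> s" "s < T" "\<forall>i<m. s \<notin> w (v @ [i])"
    and i: "i < m" "x \<in> w (v @ [i])" and h: "0 \<le> h" "2 * h \<le> T" and u: "cd T s x < h"
    and first: "\<forall>b\<in>w v. \<not> cd T s b < cd T s x" "\<forall>j<m. \<forall>b\<in>w (v @ [j]). b \<noteq> x \<longrightarrow> \<not> cd T s b < cd T s x"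
    and cases: "ret m n w (v @ [i]) (w (v @ [i])) x = -1 \<or>
      (\<exists>r. ret m n w (v @ [i]) (w (v @ [i])) x = r \<and> r \<noteq> -1 \<and>
        (\<forall>b\<in>w (v @ [i]). b \<noteq> x \<longrightarrow> \<not> T - h < cd T s b) \<and>
        (\<forall>b\<in>w (v @ [i]). b \<noteq> x \<longrightarrow> \<not> cd T r b < h) \<and> (\<forall>b\<in>w v. \<not> cd T r b < h) \<and>
        attempt n v ({..<m} - {i}) V h r w)"
  shows "ret m (Suc n) w v (insert s (w v)) s = -1"
proof -
  let ?E = "insert s (w v)" and ?\<rho> = "crho m n w v"
  interpret pole T ?E "{..<m}" "\<lambda>i. w (v @ [i])" ?\<rho>
    by (rule entry_children[OF r v s])
  have vt: "v \<in> tree_verts d" by (rule edge_vert[OF v])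
  note rg = regular_reg[OF r vt]
  have e: "v @ [j] \<in> tree_edges d" if "j < m" for j by (rule edge_child[OF vt that])
  have rho: "?\<rho> b = ret m n w (v @ [j]) (w (v @ [j])) b" if "j < m" "b \<in> w (v @ [j])" for j b
    by (simp only: child_at_eq[OF rg that])
  have mem: "b \<in> S" if "j < m" "b \<in> w (v @ [j])" for j b using that unfolding S_def by blast
  have notE: "b \<notin> ?E" if "j < m" "b \<in> w (v @ [j])" for j b using disjE[of j] that by auto
  have ran: "0 < b" "b < T" if "j < m" "b \<in> w (v @ [j])" for j b
    using regular_range[OF r e[OF that(1)] that(2)] by simp_all
  have ranv: "0 < b" "b < T" if "b \<in> w v" for b using regular_range[OF r v that] by simp_all
  have Scases: "b = s \<or> b \<in> w v \<or> (\<exists>j<m. b \<in> w (v @ [j]))" if "b \<in> S" for b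
    using that unfolding S_def by auto
  have x: "0 < x" "x < T" by (rule ran[OF i])+
  have xs: "x \<noteq> s" using s(3) i by auto
  have n1: "nxt S s = x"
  proof (rule nxt_eqI[OF finS rangeS mem[OF i] s(1,2)])
    fix b assume "b \<in> S"
    then consider "b = s" | "b \<in> w v" | j where "j < m" "b \<in> w (v @ [j])" using Scases by blast
    then show "cd T s x \<le> cd T s b"
    proof cases
      case 1
      then show ?thesis using x s xs by (auto simp: cd_def)
    next
      case 2
      then show ?thesis using first(1) by (simp add: not_less)
    next
      case 3
      then show ?thesis using first(2) by (cases "b = x") (auto simp: not_less)
    qed
  qed
  have xE: "nxt S s \<notin> ?E" using notE[OF i] n1 by simp
  have rx: "?\<rho> (nxt S s) = ret m n w (v @ [i]) (w (v @ [i])) x" using rho[OF i] n1 by simp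
  have "pexit ?E S ?\<rho> s = -1"
    using cases
  proof
    assume "ret m n w (v @ [i]) (w (v @ [i])) x = -1"
    then show ?thesis using rx xE s by (intro pexit_first) auto
  next
    assume "\<exists>r. ret m n w (v @ [i]) (w (v @ [i])) x = r \<and> r \<noteq> -1 \<and>
        (\<forall>b\<in>w (v @ [i]). b \<noteq> x \<longrightarrow> \<not> T - h < cd T s b) \<and>
        (\<forall>b\<in>w (v @ [i]). b \<noteq> x \<longrightarrow> \<not> cd T r b < h) \<and> (\<forall>b\<in>w v. \<not> cd T r b < h) \<and>
        attempt n v ({..<m} - {i}) V h r w"
    then obtain r where r': "ret m n w (v @ [i]) (w (v @ [i])) x = r" "r \<noteq> -1"
        and g1: "\<And>b. b \<in> w (v @ [i]) \<Longrightarrow> b \<noteq> x \<Longrightarrow> \<not> T - h < cd T s b"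
        and g2: "\<And>b. b \<in> w (v @ [i]) \<Longrightarrow> b \<noteq> x \<Longrightarrow> \<not> cd T r b < h"
        and g3: "\<And>b. b \<in> w v \<Longrightarrow> \<not> cd T r b < h"
        and att: "attempt n v ({..<m} - {i}) V h r w" by blast
    have ri: "r \<in> w (v @ [i])"
      using ret_range[OF reg_child[OF rg i(1)] i(2), of n] r' by auto
    have r0: "0 < r" "r < T" by (rule ran[OF i(1) ri])+
    obtain j y where j: "j < m" "j \<noteq> i" "y \<in> w (v @ [j])" and yh: "cd T r y < h"
      and yf: "\<And>k. k < m \<Longrightarrow> k \<noteq> i \<Longrightarrow> avoids (w (v @ [k])) (\<lambda>b. b \<noteq> y \<and> (V b \<or> cd T r b < cd T r y))"
      and ys: "ret m n w (v @ [j]) (w (v @ [j])) y = -1"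
      using att unfolding attempt_def by auto
    \<comment> \<open>If \<open>r = x\<close>, this is \<open>cd T s x < h\<close> together with
      \<open>2 * h \<le> T\<close>; otherwise \<open>x\<close> is the first bar and the window
      before \<open>s\<close> is free.\<close>
    have u_r: "cd T s x \<le> cd T s r" "cd T s r \<le> T - h"
    proof -
      show "cd T s x \<le> cd T s r" using first(2) i ri by (cases "r = x") (auto simp: not_less)
      show "cd T s r \<le> T - h" using g1[OF ri] u h by (cases "r = x") (auto simp: not_less)
    qed
    have rs: "r \<noteq> s" using s(3) i(1) ri by auto
    have s_far: "h \<le> cd T r s" using u_r rs s r0 h by (auto simp: cd_def split: if_splits)
    have x_far: "h \<le> cd T r x"
    proof (cases "r = x")
      case True
      then show ?thesis using h by (simp add: cd_def)
    next
      case False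
      then have "cd T s x \<noteq> cd T s r" using cd_inj[of T s x r] x r0 by auto
      then show ?thesis using u_r u rs xs s r0 x h False by (auto simp: cd_def split: if_splits)
    qed
    have n2: "nxt S r = y"
    proof (rule nxt_eqI[OF finS rangeS mem[OF j(1,3)]])
      show "0 \<le> r" "r < T" using r0 by simp_all
      fix b assume "b \<in> S"
      then consider "b = s" | "b \<in> w v" | "b \<in> w (v @ [i])" | k where "k < m" "k \<noteq> i" "b \<in> w (v @ [k])"
        using Scases by blast
      then show "cd T r y \<le> cd T r b"
      proof cases
        case 1
        then show ?thesis using s_far yh by simp
      next
        case 2
        then show ?thesis using g3[of b] yh by simp
      next
        case 3
        then show ?thesis using g2[of b] x_far yh by (cases "b = x") auto
      next
        case 4
        then show ?thesis using yf[of k] by (cases "b = y") (auto simp: avoids_def not_less)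
      qed
    qed
    show ?thesis
    proof (rule pexit_second[of s S ?E ?\<rho> r])
      show "0 \<le> s" "0 \<le> r" using s r0 by simp_all
      show "nxt S s \<notin> ?E" by (rule xE)
      show "?\<rho> (nxt S s) = r" using rx r' by simp
      show "nxt S r \<notin> ?E" using notE[OF j(1,3)] n2 by simp
      show "?\<rho> (nxt S r) < 0" using rho[OF j(1,3)] ys n2 by simp
    qed
  qed
  then show ?thesis by (simp only: ret.simps S_def)
qed

text \<open>The two ways of escaping: through the first bar \<open>x\<close>, or after a good return from it.\<close>
definition route :: "nat \<Rightarrow> vert \<Rightarrow> real \<Rightarrow> real \<Rightarrow> nat \<Rightarrow> real \<Rightarrow> (vert \<Rightarrow> real set) \<Rightarrow> bool" where
  "route n v s h i x w \<longleftrightarrow> cd T s x < h \<and> avoids (w (v @ [i])) (\<lambda>b. cd T s b < cd T s x) \<and>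
     avoids (w v) (\<lambda>b. cd T s b < cd T s x) \<and>
     (let r = ret m n w (v @ [i]) (insert x (w (v @ [i]))) x in
       r = -1 \<and> (\<forall>j\<in>{..<m} - {i}. avoids (w (v @ [j])) (\<lambda>b. cd T s b < cd T s x)) \<or>
       r \<noteq> -1 \<and> good_return n (v @ [i]) s h x w \<and> avoids (w v) (\<lambda>b. cd T r b < h) \<and>
         attempt n v ({..<m} - {i}) (\<lambda>b. cd T s b < cd T s x) h r w)"

lemma pred_ex_finite_pts:
  assumes g [measurable]: "g \<in> measurable M pts"
    and P: "Measurable.pred (M \<Otimes>\<^sub>M borel) (\<lambda>p. P (fst p) (snd p))"
  shows "Measurable.pred M (\<lambda>x. finite (g x) \<and> (\<exists>y\<in>g x. P x y))"
  by (rule pred_ex_pts[OF g]) (use P in \<open>simp add: case_prod_beta'\<close>)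

lemma measurable_attempt:
  assumes f: "f \<in> measurable M (Om d T)" and [measurable]: "t \<in> borel_measurable M"
    and [measurable]: "Measurable.pred (M \<Otimes>\<^sub>M borel) (\<lambda>p. V (fst p) (snd p))" and J: "finite J"
  shows "Measurable.pred M (\<lambda>x. attempt n v J (V x) h (t x) (f x))"
proof -
  have e [measurable]: "(\<lambda>x. f x c) \<in> measurable M pts" for c
    by (rule measurable_compose[OF f measurable_edge_Om])
  have e1 [measurable]: "(\<lambda>p. f (fst p) c) \<in> measurable (M \<Otimes>\<^sub>M (borel :: real measure)) pts" for c
    by (rule measurable_compose[OF measurable_fst e])
  have e2 [measurable]: "(\<lambda>p. f (fst (fst p)) c) \<in> measurable ((M \<Otimes>\<^sub>M (borel :: real measure)) \<Otimes>\<^sub>M (borel :: real measure)) pts" for c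
    by (rule measurable_compose[OF measurable_fst e1])
  have V2 [measurable]: "Measurable.pred ((M \<Otimes>\<^sub>M (borel :: real measure)) \<Otimes>\<^sub>M (borel :: real measure)) (\<lambda>p. V (fst (fst p)) (snd p))"
  proof -
    have "(\<lambda>p. (fst (fst p), snd p)) \<in> measurable ((M \<Otimes>\<^sub>M (borel :: real measure)) \<Otimes>\<^sub>M (borel :: real measure)) (M \<Otimes>\<^sub>M borel)"
      by measurable
    from measurable_compose[OF this assms(3)] show ?thesis by simp
  qed
  have f1: "(\<lambda>p. f (fst p)) \<in> measurable (M \<Otimes>\<^sub>M (borel :: real measure)) (Om d T)"
    by (rule measurable_compose[OF measurable_fst f])
  have [measurable]: "(\<lambda>p. ret m n (f (fst p)) (v @ [j]) (f (fst p) (v @ [j])) (snd p)) \<in> borel_measurable (M \<Otimes>\<^sub>M borel)" for j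
    by (rule measurable_ret_Om[OF f1]) measurable
  have "Measurable.pred M (\<lambda>x. finite (f x (v @ [j])) \<and> (\<exists>y\<in>f x (v @ [j]). cd T (t x) y < h \<and>
     (\<forall>i\<in>J. avoids (f x (v @ [i])) (\<lambda>b. b \<noteq> y \<and> (V x b \<or> cd T (t x) b < cd T (t x) y))) \<and>
     ret m n (f x) (v @ [j]) (f x (v @ [j])) y = -1))" for j
  proof (rule pred_ex_finite_pts[OF e])
    have "Measurable.pred (M \<Otimes>\<^sub>M borel) (\<lambda>p. avoids (f (fst p) (v @ [i]))
        (\<lambda>b. b \<noteq> snd p \<and> (V (fst p) b \<or> cd T (t (fst p)) b < cd T (t (fst p)) (snd p))))" for i
      by (rule pred_avoids[OF e1]) (simp only: case_prod_beta', measurable)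
    then show "Measurable.pred (M \<Otimes>\<^sub>M borel) (\<lambda>p. cd T (t (fst p)) (snd p) < h \<and>
     (\<forall>i\<in>J. avoids (f (fst p) (v @ [i])) (\<lambda>b. b \<noteq> snd p \<and> (V (fst p) b \<or> cd T (t (fst p)) b < cd T (t (fst p)) (snd p)))) \<and>
     ret m n (f (fst p)) (v @ [j]) (f (fst p) (v @ [j])) (snd p) = -1)"
      using J by measurable
  qed
  then show ?thesis unfolding attempt_def using J by measurable
qed

lemma measurable_route: "Measurable.pred (borel \<Otimes>\<^sub>M Om d T) (\<lambda>(x, w). route n v s h i x w)"
proof -
  have [measurable]: "(\<lambda>p. snd p c) \<in> measurable (borel \<Otimes>\<^sub>M Om d T) pts" for c
    by (rule measurable_compose[OF measurable_snd measurable_edge_Om])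
  have [measurable]: "(\<lambda>p. ret m n (snd p) (v @ [i]) (insert (fst p) (snd p (v @ [i]))) (fst p)) \<in> borel_measurable (borel \<Otimes>\<^sub>M Om d T)"
    by (rule measurable_ret_Om[of snd _ d T]) measurable
  have [measurable]: "Measurable.pred (borel \<Otimes>\<^sub>M Om d T) (\<lambda>p. attempt n v ({..<m} - {i}) (\<lambda>b. cd T s b < cd T s (fst p)) h
      (ret m n (snd p) (v @ [i]) (insert (fst p) (snd p (v @ [i]))) (fst p)) (snd p))"
    by (rule measurable_attempt) measurable
  show ?thesis unfolding route_def case_prod_beta' Let_def by measurable
qed

text \<open>Besides the escape, \<open>first_bound\<close> requires that \<open>x\<close> be the
  earliest bar, hence the second conclusion.\<close>

lemma route_success:
  assumes r: "regular w" and v: "v \<in> tree_edges d" and s: "0 \<le> s" "s < T" "\<forall>i<m. s \<notin> w (v @ [i])"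
    and h: "0 \<le> h" "2 * h \<le> T" and i: "i < m" "x \<in> w (v @ [i])"
    and rt: "route n v s h i x (w(v @ [i] := w (v @ [i]) - {x}))"
  shows "ret m (Suc n) w v (insert s (w v)) s = -1 \<and>
    (\<forall>j\<in>{..<m}. \<forall>b\<in>w (v @ [j]). b \<noteq> x \<longrightarrow> \<not> cd T s b < cd T s x)"
proof -
  let ?w = "w(v @ [i] := w (v @ [i]) - {x})"
  let ?r = "ret m n w (v @ [i]) (w (v @ [i])) x"
  have vt: "v \<in> tree_verts d" by (rule edge_vert[OF v])
  have wj: "?w (v @ [j]) = w (v @ [j])" if "j \<noteq> i" for j using that by simp
  have wv: "?w v = w v" by simp
  have wi: "?w (v @ [i]) = w (v @ [i]) - {x}" by simp
  have ins: "insert x (?w (v @ [i])) = w (v @ [i])" using i by auto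
  have rr: "ret m n ?w (v @ [i]) (insert x (?w (v @ [i]))) x = ?r" by (simp only: ret_upd ins)
  have rti: "cd T s x < h" "\<forall>b\<in>w (v @ [i]) - {x}. \<not> cd T s b < cd T s x" "\<forall>b\<in>w v. \<not> cd T s b < cd T s x"
    using rt unfolding route_def wi wv avoids_def by blast+
  have cs: "?r = -1 \<and> (\<forall>j\<in>{..<m} - {i}. avoids (w (v @ [j])) (\<lambda>b. cd T s b < cd T s x)) \<or>
       ?r \<noteq> -1 \<and> good_return n (v @ [i]) s h x ?w \<and> avoids (w v) (\<lambda>b. cd T ?r b < h) \<and>
         attempt n v ({..<m} - {i}) (\<lambda>b. cd T s b < cd T s x) h ?r ?w"
    using rt unfolding route_def Let_def rr using wj wv by simp
  have rg: "regular w" by fact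
  have att_eq: "attempt n v ({..<m} - {i}) V h t ?w \<longleftrightarrow> attempt n v ({..<m} - {i}) V h t w" for V t
    by (rule attempt_cong) auto
  from cs have "(\<forall>j<m. \<forall>b\<in>w (v @ [j]). b \<noteq> x \<longrightarrow> \<not> cd T s b < cd T s x) \<and>
      (?r = -1 \<or> (\<exists>r. ?r = r \<and> r \<noteq> -1 \<and>
        (\<forall>b\<in>w (v @ [i]). b \<noteq> x \<longrightarrow> \<not> T - h < cd T s b) \<and>
        (\<forall>b\<in>w (v @ [i]). b \<noteq> x \<longrightarrow> \<not> cd T r b < h) \<and> (\<forall>b\<in>w v. \<not> cd T r b < h) \<and>
        attempt n v ({..<m} - {i}) (\<lambda>b. cd T s b < cd T s x) h r w))"
  proof
    assume A: "?r = -1 \<and> (\<forall>j\<in>{..<m} - {i}. avoids (w (v @ [j])) (\<lambda>b. cd T s b < cd T s x))"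
    have "\<not> cd T s b < cd T s x" if "j < m" "b \<in> w (v @ [j])" "b \<noteq> x" for j b
      using A that rti(2) by (cases "j = i") (auto simp: avoids_def)
    then show ?thesis using A by blast
  next
    assume A: "?r \<noteq> -1 \<and> good_return n (v @ [i]) s h x ?w \<and> avoids (w v) (\<lambda>b. cd T ?r b < h) \<and>
         attempt n v ({..<m} - {i}) (\<lambda>b. cd T s b < cd T s x) h ?r ?w"
    have g: "\<forall>b\<in>w (v @ [i]). b \<noteq> x \<longrightarrow> \<not> T - h < cd T s b"
        "\<forall>b\<in>w (v @ [i]). b \<noteq> x \<longrightarrow> \<not> cd T ?r b < h"
      using A unfolding good_return_def rr unfolding wi avoids_def by blast+
    have att: "attempt n v ({..<m} - {i}) (\<lambda>b. cd T s b < cd T s x) h ?r w" using A att_eq by blast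
    have ri: "?r \<in> w (v @ [i])"
      using ret_range[OF reg_child[OF regular_reg[OF r vt] i(1)] i(2), of n] A by auto
    have e: "v @ [j] \<in> tree_edges d" if "j < m" for j by (rule edge_child[OF vt that])
    have x0: "0 < x" "x < T" using regular_range[OF r e[OF i(1)] i(2)] by simp_all
    have r0: "0 < ?r" "?r < T" using regular_range[OF r e[OF i(1)] ri] by simp_all
    have u_r: "cd T s x \<le> cd T s ?r" "cd T s ?r \<le> T - h"
    proof -
      show "cd T s x \<le> cd T s ?r" using rti(2) ri by (cases "?r = x") (auto simp: not_less)
      show "cd T s ?r \<le> T - h" using g(1) ri rti(1) h by (cases "?r = x") (auto simp: not_less)
    qed
    have "\<not> cd T s b < cd T s x" if j: "j < m" and b: "b \<in> w (v @ [j])" "b \<noteq> x" for j b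
    proof (cases "j = i")
      case True
      then show ?thesis using b rti(2) by auto
    next
      case False
      obtain y where yh: "cd T ?r y < h" and yf: "avoids (w (v @ [j])) (\<lambda>b. b \<noteq> y \<and> (cd T s b < cd T s x \<or> cd T ?r b < cd T ?r y))"
        using att j False unfolding attempt_def by auto
      show ?thesis
      \<comment> \<open>The attempt does not bar its own \<open>y\<close> from the explored arc. But
        \<open>y\<close> follows \<open>r\<close> within \<open>h\<close>, and \<open>r\<close>
        precedes \<open>s\<close> by at least \<open>h\<close>, so \<open>y\<close> does not lie
        before \<open>x\<close>.\<close>
      proof (cases "b = y")
        case True
        have "0 < b" "b < T" using regular_range[OF r e[OF j] b(1)] by simp_all
        then show ?thesis using True yh u_r r0 s x0 h rti(1) by (auto simp: cd_def split: if_splits)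
      qed (use yf b in \<open>auto simp: avoids_def\<close>)
    qed
    moreover have "\<forall>b\<in>w v. \<not> cd T ?r b < h" using A by (simp add: avoids_def)
    ultimately show ?thesis using A g att by blast
  qed
  then have f: "\<forall>j<m. \<forall>b\<in>w (v @ [j]). b \<noteq> x \<longrightarrow> \<not> cd T s b < cd T s x"
    and c: "?r = -1 \<or> (\<exists>r. ?r = r \<and> r \<noteq> -1 \<and>
        (\<forall>b\<in>w (v @ [i]). b \<noteq> x \<longrightarrow> \<not> T - h < cd T s b) \<and>
        (\<forall>b\<in>w (v @ [i]). b \<noteq> x \<longrightarrow> \<not> cd T r b < h) \<and> (\<forall>b\<in>w v. \<not> cd T r b < h) \<and>
        attempt n v ({..<m} - {i}) (\<lambda>b. cd T s b < cd T s x) h r w)" by blast+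
  have "ret m (Suc n) w v (insert s (w v)) s = -1"
    by (rule high_success[OF r v s i h rti(1,3) f c])
  then show ?thesis using f by simp
qed

text \<open>Separates the edge to child \<open>i\<close> and its subtree, read from
  \<open>w\<close>, from everything else, read from \<open>w'\<close>. Once \<open>w\<close> is
  fixed, the return time \<open>r\<close> is a constant for the remaining events.\<close>

lemma route_mrg:
  fixes w w' :: "vert \<Rightarrow> real set" and v :: vert and i :: nat
  defines "K \<equiv> {(v @ [i]) @ u | u. True}"
  shows "route n v s h i x (mrg K w w') \<longleftrightarrow> cd T s x < h \<and> avoids (w (v @ [i])) (\<lambda>b. cd T s b < cd T s x) \<and>
     avoids (w' v) (\<lambda>b. cd T s b < cd T s x) \<and>
     (let r = ret m n w (v @ [i]) (insert x (w (v @ [i]))) x in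
       r = -1 \<and> (\<forall>j\<in>{..<m} - {i}. avoids (w' (v @ [j])) (\<lambda>b. cd T s b < cd T s x)) \<or>
       r \<noteq> -1 \<and> good_return n (v @ [i]) s h x w \<and> avoids (w' v) (\<lambda>b. cd T r b < h) \<and>
         attempt n v ({..<m} - {i}) (\<lambda>b. cd T s b < cd T s x) h r w')"
proof -
  let ?w = "mrg K w w'"
  have wi: "?w (v @ [i]) = w (v @ [i])" by (auto simp: mrg_def K_def)
  have wv: "?w v = w' v" by (auto simp: mrg_def K_def)
  have wj: "?w (v @ [j]) = w' (v @ [j])" if "j \<in> {..<m} - {i}" for j
    using that by (auto simp: mrg_def K_def)
  have rr: "ret m n ?w (v @ [i]) E y = ret m n w (v @ [i]) E y" for E y
    by (rule ret_cong) (auto simp: mrg_def K_def)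
  have g: "good_return n (v @ [i]) s h x ?w \<longleftrightarrow> good_return n (v @ [i]) s h x w"
    unfolding good_return_def rr wi ..
  have att: "attempt n v ({..<m} - {i}) V h t ?w \<longleftrightarrow> attempt n v ({..<m} - {i}) V h t w'" for V t
    by (rule attempt_cong) (auto simp: mrg_def K_def)
  have B: "(\<forall>j\<in>{..<m} - {i}. avoids (?w (v @ [j])) Q) \<longleftrightarrow> (\<forall>j\<in>{..<m} - {i}. avoids (w' (v @ [j])) Q)" for Q
    by (intro ball_cong refl) (simp only: wj)
  show ?thesis unfolding route_def wi wv rr g att B ..
qed

section \<open>Probabilities of the two routes and the induction step\<close>

lemma prob_case1:
  assumes v: "v \<in> tree_edges d" and i: "i < m" and Q [measurable]: "{b. Q b} \<in> sets borel"
  shows "(\<integral>\<^sup>+w. of_bool (avoids (w v) Q \<and> (\<forall>j\<in>{..<m} - {i}. avoids (w (v @ [j])) Q)) \<partial>Om d T) =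
    ennreal (exp (- vol T {b. Q b}) * exp (- real (m - 1) * vol T {b. Q b}))"
proof -
  let ?J = "{..<m} - {i}" and ?X = "vol T {b. Q b}"
  have [measurable]: "Measurable.pred borel Q" using Q by (simp add: pred_def)
  have vp [measurable]: "Measurable.pred (Om d T) (\<lambda>w. avoids (w c) Q)" for c by measurable
  have vt: "v \<in> tree_verts d" by (rule edge_vert[OF v])
  have "(\<integral>\<^sup>+w. of_bool (avoids (w v) Q \<and> (\<forall>j\<in>?J. avoids (w (v @ [j])) Q)) \<partial>Om d T) =
    (\<integral>\<^sup>+w. of_bool (avoids (w v) Q) * (\<Prod>j\<in>?J. of_bool (avoids (w (v @ [j])) Q)) \<partial>Om d T)"
    by (simp add: prod_of_bool of_bool_conj)
  also have "\<dots> = (\<integral>\<^sup>+w. of_bool (avoids (w v) Q) \<partial>Om d T) * (\<integral>\<^sup>+w. (\<Prod>j\<in>?J. of_bool (avoids (w (v @ [j])) Q)) \<partial>Om d T)"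
  proof (rule nn_integral_indep[where K="{v}" and K'="\<Union>j\<in>?J. {v @ [j]}"])
    show "dep {v} (\<lambda>w. of_bool (avoids (w v) Q) :: ennreal)" by (simp add: dep_def)
    show "dep (\<Union>j\<in>?J. {v @ [j]}) (\<lambda>w. \<Prod>j\<in>?J. of_bool (avoids (w (v @ [j])) Q) :: ennreal)"
      by (rule dep_prod) (simp add: dep_def)
    show "(\<lambda>w. of_bool (avoids (w v) Q) :: ennreal) \<in> borel_measurable (Om d T)"
      by (rule measurable_of_bool[OF vp])
    show "(\<lambda>w. \<Prod>j\<in>?J. of_bool (avoids (w (v @ [j])) Q) :: ennreal) \<in> borel_measurable (Om d T)"
      by (intro borel_measurable_prod_ennreal measurable_of_bool vp)
  qed auto
  also have "(\<integral>\<^sup>+w. (\<Prod>j\<in>?J. of_bool (avoids (w (v @ [j])) Q)) \<partial>Om d T) =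
      (\<Prod>j\<in>?J. \<integral>\<^sup>+w. of_bool (avoids (w (v @ [j])) Q) \<partial>Om d T)"
  proof (rule nn_integral_indep_prod[where K="\<lambda>j. {v @ [j]}"])
    show "dep {v @ [j]} (\<lambda>w. of_bool (avoids (w (v @ [j])) Q) :: ennreal)" for j by (simp add: dep_def)
    show "(\<lambda>w. of_bool (avoids (w (v @ [j])) Q) :: ennreal) \<in> borel_measurable (Om d T)" for j
      by (rule measurable_of_bool[OF vp])
  qed auto
  also have "\<dots> = (\<Prod>j\<in>?J. ennreal (exp (- ?X)))"
    using edge_child[OF vt] by (intro prod.cong refl prob_avoids[OF _ Q]) auto
  also have "\<dots> = ennreal (exp (- ?X) ^ (m - 1))" using i by (simp add: ennreal_power)
  also have "exp (- ?X) ^ (m - 1) = exp (- real (m - 1) * ?X)"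
    by (simp add: exp_of_nat_mult[symmetric] del: One_nat_def)
  finally show ?thesis by (simp add: prob_avoids[OF v Q] ennreal_mult'[symmetric] del: One_nat_def)
qed

text \<open>The edge above \<open>v\<close> has to avoid two arcs of total length at most
  \<open>2 * h\<close>, independently of the attempt with the \<open>m - 1\<close> other children,
  for which an arc of length \<open>u\<close> is already explored.\<close>

lemma prob_case2:
  fixes a h r u :: real
  assumes v: "v \<in> tree_edges d" and i: "i < m" and m2: "2 \<le> m" and s: "0 \<le> s" "s < T" and r: "0 \<le> r" "r < T"
    and u: "0 \<le> u" "u \<le> h" and h: "h \<le> T" and a: "0 \<le> a"
    and IH: "\<And>c y. c \<in> tree_edges d \<Longrightarrow> 0 \<le> y \<Longrightarrow> y < T \<Longrightarrow>
      ennreal a \<le> (\<integral>\<^sup>+w. of_bool (ret m n w c (insert y (w c)) y = -1) \<partial>Om d T)"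
  shows "ennreal (exp (- 2 * h) * (exp (- real (m - 1) * u) * (1 - exp (- real (m - 1) * h)) * a)) \<le>
    (\<integral>\<^sup>+w. of_bool (avoids (w v) (\<lambda>b. cd T s b < u) \<and> avoids (w v) (\<lambda>b. cd T r b < h) \<and>
      attempt n v ({..<m} - {i}) (\<lambda>b. cd T s b < u) h r w) \<partial>Om d T)"
proof -
  let ?J = "{..<m} - {i}"
  let ?Q = "\<lambda>b. cd T s b < u \<or> cd T r b < h"
  let ?att = "attempt n v ?J (\<lambda>b. cd T s b < u) h r"
  have J: "card ?J = m - 1" using i by simp
  then have Jne: "?J \<noteq> {}" using m2 by (metis One_nat_def Suc_1 card.empty diff_is_0_eq not_less_eq_eq)
  have vt: "v \<in> tree_verts d" by (rule edge_vert[OF v])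
  have Qm [measurable]: "{b. ?Q b} \<in> sets borel" by measurable
  have am [measurable]: "Measurable.pred (Om d T) ?att"
    by (rule measurable_attempt) auto
  have vp: "Measurable.pred (Om d T) (\<lambda>w. avoids (w v) ?Q)" by measurable
  have vol: "vol T {b. ?Q b} \<le> 2 * h"
  proof -
    have "{b. ?Q b} = {b. cd T s b < u} \<union> {b. cd T r b < h}" by auto
    then have "vol T {b. ?Q b} = vol T {b. cd T s b < u} + vol T ({b. cd T r b < h} - {b. cd T s b < u})"
      by (simp add: vol_Diff_Un)
    also have "vol T ({b. cd T r b < h} - {b. cd T s b < u}) \<le> vol T {b. cd T r b < h}"
      by (rule vol_mono) auto
    finally show ?thesis using vol_cd_less[OF s, of u] vol_cd_less[OF r, of h] u h by simp
  qed
  have "ennreal (exp (- 2 * h) * (exp (- real (m - 1) * u) * (1 - exp (- real (m - 1) * h)) * a)) \<le>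
      ennreal (exp (- vol T {b. ?Q b})) * (\<integral>\<^sup>+w. of_bool (?att w) \<partial>Om d T)"
    (is "ennreal (?x * ?y) \<le> _")
  proof -
    have y0: "0 \<le> ?y" using a u by (intro mult_nonneg_nonneg) auto
    have "ennreal ?y \<le> (\<integral>\<^sup>+w. of_bool (?att w) \<partial>Om d T)"
      using prob_attempt[OF vt _ Jne r _ h _ _ a IH, of "\<lambda>b. cd T s b < u" u] vol_cd_less[OF s, of u] u h
      unfolding J by auto
    moreover have "ennreal ?x \<le> ennreal (exp (- vol T {b. ?Q b}))" using vol by (intro ennreal_leI) simp
    ultimately show ?thesis using y0 by (subst ennreal_mult'') (auto intro: mult_mono)
  qed
  also have "\<dots> = (\<integral>\<^sup>+w. of_bool (avoids (w v) ?Q) \<partial>Om d T) * (\<integral>\<^sup>+w. of_bool (?att w) \<partial>Om d T)"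
    by (simp only: prob_avoids[OF v Qm])
  also have "\<dots> = (\<integral>\<^sup>+w. of_bool (avoids (w v) ?Q) * of_bool (?att w) \<partial>Om d T)"
  proof (rule nn_integral_indep[symmetric, where K="{v}" and K'="{v @ [j] @ u | j u. True}"])
    show "dep {v} (\<lambda>w. of_bool (avoids (w v) ?Q) :: ennreal)" by (simp add: dep_def)
    have "?att w = ?att w'" if "\<forall>k\<in>{v @ [j] @ u | j u. True}. w k = w' k" for w w'
      by (rule attempt_cong) (use that in auto)
    then show "dep {v @ [j] @ u | j u. True} (\<lambda>w. of_bool (?att w) :: ennreal)" unfolding dep_def by (intro allI impI arg_cong[where f=of_bool]) blast
    show "(\<lambda>w. of_bool (avoids (w v) ?Q) :: ennreal) \<in> borel_measurable (Om d T)"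
      by (rule measurable_of_bool[OF vp])
    show "(\<lambda>w. of_bool (?att w) :: ennreal) \<in> borel_measurable (Om d T)"
      by (rule measurable_of_bool[OF am])
  qed auto
  also have "\<dots> = (\<integral>\<^sup>+w. of_bool (avoids (w v) (\<lambda>b. cd T s b < u) \<and> avoids (w v) (\<lambda>b. cd T r b < h) \<and> ?att w) \<partial>Om d T)"
    by (intro nn_integral_cong) (auto simp: avoids_def)
  finally show ?thesis .
qed

text \<open>Integrates out everything but \<open>c\<close> and its subtree. An immediate escape
  leaves the factor exp (-u) exp (-(m - 1) u), a good return the one of \<open>prob_case2\<close>;
  weakening exp (-u) to exp (- 2 h) gives both the same prefactor.\<close>

lemma route_lower:
  fixes a h :: real and n i :: nat and v :: vert and s x :: real
  defines "k \<equiv> 1 - exp (- real (m - 1) * h)" and "c \<equiv> v @ [i]" and "u \<equiv> cd T s x"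
  assumes v: "v \<in> tree_edges d" and i: "i < m" and m2: "2 \<le> m" and s: "0 \<le> s" "s < T"
    and x: "0 < x" "x < T" "x \<noteq> s" and uh: "u < h" and h: "h \<le> T" and a: "0 \<le> a"
    and IH: "\<And>c y. c \<in> tree_edges d \<Longrightarrow> 0 \<le> y \<Longrightarrow> y < T \<Longrightarrow>
      ennreal a \<le> (\<integral>\<^sup>+w. of_bool (ret m n w c (insert y (w c)) y = -1) \<partial>Om d T)"
  shows "ennreal (exp (- 2 * h) * exp (- real (m - 1) * u)) *
      (\<integral>\<^sup>+w. of_bool (avoids (w c) (\<lambda>b. cd T s b < u)) * (of_bool (ret m n w c (insert x (w c)) x = -1) +
        ennreal (k * a) * of_bool (ret m n w c (insert x (w c)) x \<noteq> -1 \<and> good_return n c s h x w)) \<partial>Om d T) \<le>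
    (\<integral>\<^sup>+w. of_bool (route n v s h i x w) \<partial>Om d T)"
proof -
  let ?r = "\<lambda>w. ret m n w c (insert x (w c)) x"
  let ?E = "\<lambda>w. of_bool (avoids (w c) (\<lambda>b. cd T s b < u)) * (of_bool (?r w = -1) +
        ennreal (k * a) * of_bool (?r w \<noteq> -1 \<and> good_return n c s h x w)) :: ennreal"
  define K where "K = {(v @ [i]) @ u | u. True}"
  let ?C = "exp (- 2 * h) * exp (- real (m - 1) * u)"
  have u0: "0 \<le> u" using s x by (auto simp: u_def cd_def)
  have k0: "0 \<le> k" using u0 uh by (simp add: k_def)
  have vt: "v \<in> tree_verts d" by (rule edge_vert[OF v])
  have c: "c \<in> tree_edges d" unfolding c_def by (rule edge_child[OF vt i])
  have Qm: "{b. cd T s b < u} \<in> sets borel" by measurable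
  have vm: "Measurable.pred (Om d T) (\<lambda>w. avoids (w c) (\<lambda>b. cd T s b < u))" by measurable
  have Em: "?E \<in> borel_measurable (Om d T)"
    using vm by measurable
  have rm: "(\<lambda>w. of_bool (route n v s h i x w) :: ennreal) \<in> borel_measurable (Om d T)"
  proof -
    have "(\<lambda>w. (x, w)) \<in> measurable (Om d T) (borel \<Otimes>\<^sub>M Om d T)" by measurable
    from measurable_compose[OF this measurable_route] show ?thesis by (intro measurable_of_bool) simp
  qed
  have "ennreal ?C * (\<integral>\<^sup>+w. ?E w \<partial>Om d T) = (\<integral>\<^sup>+w. ennreal ?C * ?E w \<partial>Om d T)"
    by (rule nn_integral_cmult[symmetric, OF Em])
  also have "\<dots> \<le> (\<integral>\<^sup>+w. (\<integral>\<^sup>+w'. of_bool (route n v s h i x (mrg K w w')) \<partial>Om d T) \<partial>Om d T)"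
  proof (rule nn_integral_mono_AE)
    show "AE w in Om d T. ennreal ?C * ?E w \<le> (\<integral>\<^sup>+w'. of_bool (route n v s h i x (mrg K w w')) \<partial>Om d T)"
      using AE_regular AE_notin_children[OF edge_vert[OF c], of x]
    proof eventually_elim
      case (elim w)
      have rr: "?r w = -1 \<or> 0 \<le> ?r w \<and> ?r w < T"
      proof -
        have e: "entry m T w c (insert x (w c))" using entry_edge[OF elim(1) c _ _ elim(2)] x by simp
        have "?r w = -1 \<or> ?r w \<in> insert x (w c)"
          by (rule ret_range[OF regular_reg[OF elim(1) edge_vert[OF c]] e]) simp
        then show ?thesis using regular_range[OF elim(1) c, of "?r w"] x by auto
      qed
      show ?case
      proof (cases "avoids (w c) (\<lambda>b. cd T s b < u)")
        case V: True
        show ?thesis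
        proof (cases "?r w = -1")
          case True
          have "(\<integral>\<^sup>+w'. of_bool (route n v s h i x (mrg K w w')) \<partial>Om d T) =
            (\<integral>\<^sup>+w'. of_bool (avoids (w' v) (\<lambda>b. cd T s b < u) \<and> (\<forall>j\<in>{..<m} - {i}. avoids (w' (v @ [j])) (\<lambda>b. cd T s b < u))) \<partial>Om d T)"
            unfolding K_def route_mrg using True V uh unfolding c_def u_def by (simp add: Let_def del: One_nat_def)
          also have "\<dots> = ennreal (exp (- u) * exp (- real (m - 1) * u))"
            using vol_cd_less[OF s u0] uh h by (subst prob_case1[OF v i Qm]) simp
          also have "\<dots> \<ge> ennreal ?C" using u0 uh by (intro ennreal_leI mult_right_mono) auto
          finally show ?thesis using True V by simp
        next
          case False
          show ?thesis
          proof (cases "good_return n c s h x w")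
            case G: True
            have r01: "0 \<le> ?r w" "?r w < T" using rr False by auto
            have "(\<integral>\<^sup>+w'. of_bool (route n v s h i x (mrg K w w')) \<partial>Om d T) =
              (\<integral>\<^sup>+w'. of_bool (avoids (w' v) (\<lambda>b. cd T s b < u) \<and> avoids (w' v) (\<lambda>b. cd T (?r w) b < h) \<and>
                attempt n v ({..<m} - {i}) (\<lambda>b. cd T s b < u) h (?r w) w') \<partial>Om d T)"
              unfolding K_def route_mrg using False V uh G unfolding c_def u_def by (simp add: Let_def del: One_nat_def)
            moreover have "ennreal (exp (- 2 * h) * (exp (- real (m - 1) * u) * (1 - exp (- real (m - 1) * h)) * a)) \<le> \<dots>"
              by (rule prob_case2[OF v i m2 s r01 u0 _ h a IH]) (use uh in auto)
            moreover have "exp (- 2 * h) * (exp (- real (m - 1) * u) * (1 - exp (- real (m - 1) * h)) * a) = ?C * (k * a)"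
              by (simp add: k_def)
            moreover have "ennreal ?C * ?E w = ennreal (?C * (k * a))"
              using V False G k0 a by (simp add: ennreal_mult' del: One_nat_def)
            ultimately show ?thesis by (simp only:)
          qed (use False in simp)
        qed
      qed simp
    qed
  qed
  also have "\<dots> = (\<integral>\<^sup>+w. of_bool (route n v s h i x w) \<partial>Om d T)"
    by (rule nn_integral_mrg[symmetric, OF rm])
  finally show ?thesis .
qed

text \<open>Here \<open>A\<close> is the value of a second attempt. Pointwise, the integrand plus
  \<open>A\<close> on bad returns dominates \<open>A\<close> on the void event plus
  \<open>1 - A\<close> on void and escape. The first is explicit, the second comes from
  \<open>avoids_success\<close>, and the bad returns cost at most \<open>A * g\<close>.\<close>

lemma escape_lower:
  fixes a h A :: real and n :: nat and c :: vert and s x :: real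
  defines "u \<equiv> cd T s x" and "g \<equiv> 2 * h + (exp h - 1)"
  assumes c: "c \<in> tree_edges d" and s: "0 \<le> s" "s < T"
    and x: "0 < x" "x < T" and uh: "u < h" and h: "h \<le> T" and a: "0 \<le> a" and A: "0 \<le> A" "A \<le> 1"
    and IH: "ennreal a \<le> (\<integral>\<^sup>+w. of_bool (ret m n w c (insert x (w c)) x = -1) \<partial>Om d T)"
    and pos: "0 \<le> exp (- h) * (A + (1 - A) * a) - A * g"
  shows "ennreal (exp (- h) * (A + (1 - A) * a) - A * g) \<le>
      (\<integral>\<^sup>+w. of_bool (avoids (w c) (\<lambda>b. cd T s b < u)) * (of_bool (ret m n w c (insert x (w c)) x = -1) +
        ennreal A * of_bool (ret m n w c (insert x (w c)) x \<noteq> -1 \<and> good_return n c s h x w)) \<partial>Om d T)"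
proof -
  let ?r = "\<lambda>w. ret m n w c (insert x (w c)) x"
  let ?V = "\<lambda>w. avoids (w c) (\<lambda>b. cd T s b < u)"
  let ?bad = "\<lambda>w. ?r w \<noteq> -1 \<and> \<not> good_return n c s h x w"
  let ?E = "\<lambda>w. of_bool (?V w) * (of_bool (?r w = -1) +
        ennreal A * of_bool (?r w \<noteq> -1 \<and> good_return n c s h x w)) :: ennreal"
  have u0: "0 \<le> u" using s x by (auto simp: u_def cd_def)
  have Qm [measurable]: "{b. cd T s b < u} \<in> sets borel" by measurable
  have vu: "vol T {b. cd T s b < u} = u" using u0 uh h s by (intro vol_cd_less) auto
  have vm [measurable]: "Measurable.pred (Om d T) ?V" by measurable
  have i1: "(\<integral>\<^sup>+w. of_bool (?V w) \<partial>Om d T) = ennreal (exp (- u))"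
    using prob_avoids[OF c Qm] vu by simp
  have i2: "ennreal (exp (- u) * a) \<le> (\<integral>\<^sup>+w. of_bool (?V w \<and> ?r w = -1) \<partial>Om d T)"
    using avoids_success[OF c _ _ Qm IH a] x vu by simp
  have g0: "0 \<le> g" using u0 uh by (simp add: g_def)
  have "ennreal (exp (- h) * (A + (1 - A) * a)) \<le> ennreal (A * exp (- u)) + ennreal ((1 - A) * (exp (- u) * a))"
  proof -
    have "exp (- h) * (A + (1 - A) * a) \<le> exp (- u) * (A + (1 - A) * a)"
      using uh A a by (intro mult_right_mono) auto
    also have "\<dots> = A * exp (- u) + (1 - A) * (exp (- u) * a)" by (simp add: algebra_simps)
    finally have "ennreal (exp (- h) * (A + (1 - A) * a)) \<le> ennreal (A * exp (- u) + (1 - A) * (exp (- u) * a))"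
      by (rule ennreal_leI)
    also have "\<dots> = ennreal (A * exp (- u)) + ennreal ((1 - A) * (exp (- u) * a))"
      using A a by (intro ennreal_plus) auto
    finally show ?thesis .
  qed
  also have "\<dots> \<le> ennreal A * (\<integral>\<^sup>+w. of_bool (?V w) \<partial>Om d T) + ennreal (1 - A) * (\<integral>\<^sup>+w. of_bool (?V w \<and> ?r w = -1) \<partial>Om d T)"
    using A a i2 by (intro add_mono) (simp_all add: i1 ennreal_mult' mult_left_mono)
  also have "\<dots> = (\<integral>\<^sup>+w. ennreal A * of_bool (?V w) + ennreal (1 - A) * of_bool (?V w \<and> ?r w = -1) \<partial>Om d T)"
    by (subst nn_integral_add) (measurable, simp add: nn_integral_cmult)
  also have "\<dots> \<le> (\<integral>\<^sup>+w. ?E w + ennreal A * of_bool (?bad w) \<partial>Om d T)"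
  proof (rule nn_integral_mono)
    fix w
    have "ennreal A + ennreal (1 - A) = 1" using A by (simp add: ennreal_plus[symmetric] del: ennreal_plus)
    then show "ennreal A * of_bool (?V w) + ennreal (1 - A) * of_bool (?V w \<and> ?r w = -1) \<le> ?E w + ennreal A * of_bool (?bad w)"
      by (cases "?V w"; cases "?r w = -1"; cases "good_return n c s h x w") simp_all
  qed
  also have "\<dots> = (\<integral>\<^sup>+w. ?E w \<partial>Om d T) + ennreal A * (\<integral>\<^sup>+w. of_bool (?bad w) \<partial>Om d T)"
    by (subst nn_integral_add) (measurable, simp add: nn_integral_cmult)
  also have "\<dots> \<le> (\<integral>\<^sup>+w. ?E w \<partial>Om d T) + ennreal A * ennreal g"
    unfolding g_def using u0 uh h by (intro add_left_mono mult_left_mono prob_bad_return[OF c s x]) auto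
  also have "ennreal A * ennreal g = ennreal (A * g)" using A by (simp add: ennreal_mult')
  finally have "ennreal (A * g) + ennreal (exp (- h) * (A + (1 - A) * a) - A * g) \<le> ennreal (A * g) + (\<integral>\<^sup>+w. ?E w \<partial>Om d T)"
    using pos A g0 by (simp add: ennreal_plus[symmetric] add.commute del: ennreal_plus)
  then show ?thesis by (subst (asm) ennreal_add_left_cancel_le) auto
qed

text \<open>The exits include the true bars of the edge above \<open>v\<close>, since they could cut
  off the walk between the entry and its second attempt. \<open>cond\<close> says that two attempts
  reproduce the bound \<open>a\<close>.\<close>

lemma high_step:
  fixes a h :: real and n :: nat
  defines "k \<equiv> 1 - exp (- real (m - 1) * h)" and "g \<equiv> 2 * h + (exp h - 1)"
  assumes m2: "2 \<le> m" and h: "0 \<le> h" "2 * h \<le> T" and a: "0 \<le> a" "a \<le> 1"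
    and cond: "a \<le> exp (- 2 * h) * (exp (- h) * (k * a + (1 - k * a) * a) - k * a * g) * k"
    and pos: "0 \<le> exp (- h) * (k * a + (1 - k * a) * a) - k * a * g"
    and IH: "\<And>c y. c \<in> tree_edges d \<Longrightarrow> 0 \<le> y \<Longrightarrow> y < T \<Longrightarrow>
      ennreal a \<le> (\<integral>\<^sup>+w. of_bool (ret m n w c (insert y (w c)) y = -1) \<partial>Om d T)"
    and v: "v \<in> tree_edges d" and s: "0 \<le> s" "s < T"
  shows "ennreal a \<le> (\<integral>\<^sup>+w. of_bool (ret m (Suc n) w v (insert s (w v)) s = -1) \<partial>Om d T)"
proof -
  have vt: "v \<in> tree_verts d" by (rule edge_vert[OF v])
  have k01: "0 \<le> k" "k \<le> 1" using h by (auto simp: k_def)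
  define C0 where "C0 = exp (- h) * (k * a + (1 - k * a) * a) - k * a * g"
  have ka: "0 \<le> k * a" "k * a \<le> 1" using k01 a by (auto intro: mult_le_one)
  have h1: "h \<le> T" using h T by linarith
  let ?P = "\<lambda>w. ret m (Suc n) w v (insert s (w v)) s = -1"
  have "ennreal (real (card {..<m}) * (exp (- 2 * h) * C0 * (1 - exp (- real (m - 1) * h)) / real (m - 1))) \<le>
    (\<integral>\<^sup>+w. of_bool (?P w) \<partial>Om d T)"
  proof (rule first_bound[OF vt subset_refl s _ _ h(1) h1])
    show "0 \<le> exp (- 2 * h) * C0" using pos by (simp add: C0_def)
    show "0 < real (m - 1)" using m2 by simp
    show "Measurable.pred (borel \<Otimes>\<^sub>M Om d T) (\<lambda>(x, w). route n v s h i x w)" for i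
      by (rule measurable_route)
    show "AE w in Om d T. \<forall>i\<in>{..<m}. \<forall>x\<in>w (v @ [i]). route n v s h i x (w(v @ [i] := w (v @ [i]) - {x})) \<longrightarrow>
      ?P w \<and> (\<forall>j\<in>{..<m}. \<forall>b\<in>w (v @ [j]). b \<noteq> x \<longrightarrow> \<not> cd T s b < cd T s x)"
      using AE_regular AE_notin_children[OF vt, of s]
    proof eventually_elim
      case (elim w)
      show ?case using route_success[OF elim(1) v s elim(2) h] by (auto simp del: ret.simps One_nat_def)
    qed
    fix i x assume i: "i \<in> {..<m}" and x: "0 < x" "x < T" "x \<noteq> s" "cd T s x < h"
    then have im: "i < m" by simp
    have c: "v @ [i] \<in> tree_edges d" by (rule edge_child[OF vt im])
    have "ennreal C0 \<le> (\<integral>\<^sup>+w. of_bool (avoids (w (v @ [i])) (\<lambda>b. cd T s b < cd T s x)) *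
       (of_bool (ret m n w (v @ [i]) (insert x (w (v @ [i]))) x = -1) +
        ennreal (k * a) * of_bool (ret m n w (v @ [i]) (insert x (w (v @ [i]))) x \<noteq> -1 \<and> good_return n (v @ [i]) s h x w)) \<partial>Om d T)"
      unfolding C0_def g_def
      by (rule escape_lower[OF c s x(1,2) x(4) h1 a(1) ka IH[OF c]]) (use x pos in \<open>auto simp: g_def\<close>)
    from mult_left_mono[OF this, of "ennreal (exp (- 2 * h) * exp (- real (m - 1) * cd T s x))"]
    have "ennreal (exp (- 2 * h) * exp (- real (m - 1) * cd T s x)) * ennreal C0 \<le>
        (\<integral>\<^sup>+w. of_bool (route n v s h i x w) \<partial>Om d T)"
    proof (rule order_trans[OF _ route_lower[OF v im m2 s x h1 a(1), of n, folded k_def]])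
      fix c' y assume "c' \<in> tree_edges d" "0 \<le> y" "y < T"
      then show "ennreal a \<le> (\<integral>\<^sup>+w. of_bool (ret m n w c' (insert y (w c')) y = -1) \<partial>Om d T)"
        by (rule IH)
    qed auto
    also have "ennreal (exp (- 2 * h) * exp (- real (m - 1) * cd T s x)) * ennreal C0 =
        ennreal (exp (- 2 * h) * C0 * exp (- real (m - 1) * cd T s x))"
      by (subst ennreal_mult'[symmetric]) (simp_all only: mult_ac mult_nonneg_nonneg exp_ge_zero)
    finally show "ennreal (exp (- 2 * h) * C0 * exp (- real (m - 1) * cd T s x)) \<le>
        (\<integral>\<^sup>+w. of_bool (route n v s h i x w) \<partial>Om d T)" .
  qed
  moreover have "a \<le> real (card {..<m}) * (exp (- 2 * h) * C0 * (1 - exp (- real (m - 1) * h)) / real (m - 1))"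
  proof -
    \<comment> \<open>There are \<open>m\<close> candidates for the first bar, while the density
      decays at rate \<open>m - 1\<close> only: avoidance on the candidate's own edge is accounted
      for in \<open>C0\<close>.\<close>
    have q: "1 \<le> real m / real (m - 1)" using m2 by (simp add: field_simps)
    have "a \<le> 1 * (exp (- 2 * h) * C0 * k)" using cond by (simp add: C0_def)
    also have "\<dots> \<le> real m / real (m - 1) * (exp (- 2 * h) * C0 * k)"
      using q pos k01 by (intro mult_right_mono) (auto simp: C0_def)
    finally show ?thesis by (simp add: k_def)
  qed
  ultimately show ?thesis using ennreal_leI order_trans by blast
qed

theorem high_regime:
  fixes a h :: real and n :: nat
  defines "k \<equiv> 1 - exp (- real (m - 1) * h)" and "g \<equiv> 2 * h + (exp h - 1)"
  assumes m2: "2 \<le> m" and h: "0 \<le> h" "2 * h \<le> T" and a: "0 \<le> a" "a \<le> 1"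
    and cond: "a \<le> exp (- 2 * h) * (exp (- h) * (k * a + (1 - k * a) * a) - k * a * g) * k"
    and pos: "0 \<le> exp (- h) * (k * a + (1 - k * a) * a) - k * a * g"
    and v: "v \<in> tree_edges d" and s: "0 \<le> s" "s < T"
  shows "ennreal a \<le> (\<integral>\<^sup>+w. of_bool (ret m n w v {s} s = -1) \<partial>Om d T)"
proof -
  have "ennreal a \<le> (\<integral>\<^sup>+w. of_bool (ret m n w v (insert s (w v)) s = -1) \<partial>Om d T)"
    using v s
  proof (induction n arbitrary: v s)
    case 0
    then show ?case using a by (simp add: Om.emeasure_space_1 ennreal_le_1)
  next
    case (Suc n)
    show ?case
      by (rule high_step[OF m2 h a cond[unfolded k_def g_def] pos[unfolded k_def g_def] Suc.IH Suc.prems])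
  qed
  also have "\<dots> \<le> (\<integral>\<^sup>+w. of_bool (ret m n w v {s} s = -1) \<partial>Om d T)"
  proof (rule nn_integral_mono_AE)
    show "AE w in Om d T. of_bool (ret m n w v (insert s (w v)) s = -1) \<le> (of_bool (ret m n w v {s} s = -1) :: ennreal)"
      using AE_regular AE_notin_children[OF edge_vert[OF v], of s]
    proof eventually_elim
      case (elim w)
      show ?case
        using ret_subset_success[OF regular_reg[OF elim(1) edge_vert[OF v]] entry_edge[OF elim(1) v s elim(2)], of "{s}" s n]
        by auto
    qed
  qed
  finally show ?thesis .
qed

end

section \<open>Almost sure escape and non-explosion\<close>

text \<open>Continuity from above along the tails. Escaping to infinitely many depths is enough, so
  no monotonicity of the escape events in the depth has to be established.\<close>

lemma (in prob_space) io_lower: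
  assumes [measurable]: "\<And>n :: nat. Measurable.pred M (R n)"
    and low: "\<And>n. ennreal \<beta> \<le> (\<integral>\<^sup>+w. of_bool (R n w) \<partial>M)"
  shows "ennreal \<beta> \<le> (\<integral>\<^sup>+w. of_bool (\<forall>N. \<exists>n\<ge>N. R n w) \<partial>M)"
proof -
  define A where "A N = {w \<in> space M. \<exists>n\<ge>N. R n w}" for N
  have A [measurable]: "A N \<in> sets M" for N unfolding A_def by measurable
  have dec: "decseq A" unfolding A_def decseq_def by (auto intro: order_trans)
  have "ennreal \<beta> \<le> emeasure M (A N)" for N
  proof -
    have "(\<integral>\<^sup>+w. of_bool (R N w) \<partial>M) \<le> (\<integral>\<^sup>+w. indicator (A N) w \<partial>M)"
      by (rule nn_integral_mono) (auto simp: A_def indicator_def)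
    then show ?thesis using low[of N] by simp
  qed
  then have "ennreal \<beta> \<le> (INF N. emeasure M (A N))" by (rule INF_greatest)
  also have "\<dots> = emeasure M (\<Inter>N. A N)"
    by (rule INF_emeasure_decseq[OF _ dec]) auto
  also have "\<dots> = (\<integral>\<^sup>+w. indicator (\<Inter>N. A N) w \<partial>M)" by simp
  also have "\<dots> = (\<integral>\<^sup>+w. of_bool (\<forall>N. \<exists>n\<ge>N. R n w) \<partial>M)"
    by (rule nn_integral_cong) (auto simp: A_def indicator_def)
  finally show ?thesis .
qed

context stirring
begin

text \<open>With no bar above \<open>x\<close>, the only exit is the entry time 0 itself, so a
  return would mean that the cycle of \<open>x\<close> has closed.\<close>

definition escapes :: "(vert \<Rightarrow> real set) \<Rightarrow> vert \<Rightarrow> bool" where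
  "escapes w x \<longleftrightarrow> w x \<inter> UNIV = {} \<and> (\<forall>N. \<exists>n\<ge>N. ret m n w x {0} 0 = -1)"

lemma measurable_escapes: "Measurable.pred (Om d T) (\<lambda>w. escapes w x)"
  unfolding escapes_def by measurable

lemma prob_escapes:
  assumes x: "x \<in> tree_edges d"
    and low: "\<And>n. ennreal \<beta> \<le> (\<integral>\<^sup>+w. of_bool (ret m n w x {0} 0 = -1) \<partial>Om d T)"
  shows "ennreal (exp (- T) * \<beta>) \<le> (\<integral>\<^sup>+w. of_bool (escapes w x) \<partial>Om d T)"
proof -
  let ?io = "\<lambda>w. \<forall>N. \<exists>n\<ge>N. ret m n w x {0} 0 = -1"
  have i: "ennreal \<beta> \<le> (\<integral>\<^sup>+w. of_bool (?io w) \<partial>Om d T)"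
    by (rule Om.io_lower[OF _ low]) measurable
  have V: "vol T UNIV = T" using T by (simp add: vol_def)
  have dio: "dep {x @ u | u. u \<noteq> []} ?io"
    using ret_dep[of x m] unfolding dep_def by (smt (verit))
  have "ennreal (exp (- T) * \<beta>) = ennreal (exp (- T)) * ennreal \<beta>" by (simp add: ennreal_mult')
  also have "\<dots> \<le> (\<integral>\<^sup>+w. of_bool (w x \<inter> UNIV = {}) \<partial>Om d T) * (\<integral>\<^sup>+w. of_bool (?io w) \<partial>Om d T)"
    using i prob_edge_void[OF x, of UNIV] by (simp add: V mult_left_mono del: One_nat_def)
  also have "\<dots> = (\<integral>\<^sup>+w. of_bool (w x \<inter> UNIV = {}) * of_bool (?io w) \<partial>Om d T)"
  proof (rule nn_integral_indep[symmetric, where K="{x}" and K'="{x @ u | u. u \<noteq> []}"])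
    show "dep {x} (\<lambda>w. of_bool (w x \<inter> UNIV = {}) :: ennreal)" by (simp add: dep_def)
    show "dep {x @ u | u. u \<noteq> []} (\<lambda>w. of_bool (?io w) :: ennreal)" by (rule dep_comp[OF dio])
    show "(\<lambda>w. of_bool (w x \<inter> UNIV = {}) :: ennreal) \<in> borel_measurable (Om d T)"
      by (intro measurable_of_bool) measurable
    show "(\<lambda>w. of_bool (?io w) :: ennreal) \<in> borel_measurable (Om d T)"
      by (intro measurable_of_bool) measurable
  qed auto
  also have "\<dots> = (\<integral>\<^sup>+w. of_bool (escapes w x) \<partial>Om d T)"
    by (simp add: escapes_def of_bool_conj)
  finally show ?thesis .
qed

lemma AE_escapes:
  assumes m2: "2 \<le> m" and b: "0 < \<beta>"
    and low: "\<And>n x. x \<in> tree_edges d \<Longrightarrow> ennreal \<beta> \<le> (\<integral>\<^sup>+w. of_bool (ret m n w x {0} 0 = -1) \<partial>Om d T)"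
  shows "AE w in Om d T. \<exists>x\<in>tree_edges d. escapes w x"
proof -
  \<comment> \<open>Vertices hanging off the ray of zeros: \<open>x j\<close> branches off at depth
    \<open>j\<close>, so their subtrees are disjoint. The digit 1 is where \<open>2 \<le> m\<close>
    enters.\<close>
  define x where "x j = replicate j (0::nat) @ [1]" for j
  have x: "x j \<in> tree_edges d" for j
    using m2 by (auto simp: x_def tree_edges_def tree_verts_def)
  let ?p = "exp (- T) * \<beta>"
  have p: "ennreal ?p \<le> (\<integral>\<^sup>+w. of_bool (escapes w (x j)) \<partial>Om d T)" for j
    by (rule prob_escapes[OF x low[OF x]])
  note [measurable] = measurable_escapes
  have one: "(\<integral>\<^sup>+w. of_bool (\<not> escapes w (x j)) \<partial>Om d T) \<le> ennreal (1 - ?p)" for j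
  proof -
    have "(\<integral>\<^sup>+w. of_bool (\<not> escapes w (x j)) \<partial>Om d T) = ennreal (Om.prob {w \<in> space (Om d T). \<not> escapes w (x j)})"
      by (rule emeasure_of_bool) measurable
    also have "Om.prob {w \<in> space (Om d T). \<not> escapes w (x j)} = 1 - Om.prob {w \<in> space (Om d T). escapes w (x j)}"
      by (rule Om.prob_neg) measurable
    also have "\<dots> \<le> 1 - ?p"
      using p[of j] emeasure_of_bool[of "\<lambda>w. escapes w (x j)"] by (simp add: measure_nonneg)
    finally show ?thesis by (simp add: ennreal_leI)
  qed
  have p1: "?p \<le> 1"
  proof -
    have "(\<integral>\<^sup>+w. of_bool (escapes w (x 0)) \<partial>Om d T) \<le> 1"
      by (subst emeasure_of_bool) (auto simp: Om.prob_le_1)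
    with p[of 0] have "ennreal ?p \<le> 1" by (rule order_trans)
    then show ?thesis by simp
  qed
  have pw: "(\<integral>\<^sup>+w. of_bool (\<forall>j. \<not> escapes w (x j)) \<partial>Om d T) \<le> ennreal ((1 - ?p) ^ n)" for n
  proof -
    have "(\<integral>\<^sup>+w. of_bool (\<forall>j. \<not> escapes w (x j)) \<partial>Om d T) \<le>
        (\<integral>\<^sup>+w. (\<Prod>j<n. of_bool (\<not> escapes w (x j))) \<partial>Om d T)"
      by (rule nn_integral_mono) (simp add: prod_of_bool)
    also have "\<dots> = (\<Prod>j<n. \<integral>\<^sup>+w. of_bool (\<not> escapes w (x j)) \<partial>Om d T)"
    proof (rule nn_integral_indep_prod[where K="\<lambda>j. {x j @ u | u. True}"])
      show "dep {x j @ u | u. True} (\<lambda>w. of_bool (\<not> escapes w (x j)) :: ennreal)" for j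
      proof (rule dep_comp[where g="\<lambda>b. of_bool (\<not> b)"])
        have "escapes w (x j) = escapes w' (x j)" if "\<forall>i\<in>{x j @ u | u. True}. w i = w' i" for w w'
        proof -
          have "ret m n w (x j) E s = ret m n w' (x j) E s" for n E s
            by (rule ret_cong) (use that in blast)
          moreover have "w (x j) = w' (x j)" using that by (metis (mono_tags, lifting) append_Nil2 mem_Collect_eq)
          ultimately show ?thesis by (simp add: escapes_def)
        qed
        then show "dep {x j @ u | u. True} (\<lambda>w. escapes w (x j))" unfolding dep_def by blast
      qed
      show "(\<lambda>w. of_bool (\<not> escapes w (x j)) :: ennreal) \<in> borel_measurable (Om d T)" for j
        by (intro measurable_of_bool) measurable
      have nle: False if "i < j" "x i @ u = x j @ u'" for i j u u'
      proof -
        have "(x i @ u) ! i = 1" "(x j @ u') ! i = 0" using that(1) by (auto simp: x_def nth_append)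
        then show False using that(2) by simp
      qed
      show "{x i @ u | u. True} \<inter> {x j @ u | u. True} = {}" if "i \<noteq> j" for i j
      proof (cases "i < j")
        case True
        then show ?thesis using nle[of i j] by blast
      next
        case False
        then have "j < i" using that by simp
        then have "x i @ u \<noteq> x j @ u'" for u u' using nle[of j i u' u] by metis
        then show ?thesis by blast
      qed
    qed auto
    also have "\<dots> \<le> (\<Prod>j<n. ennreal (1 - ?p))" by (intro prod_mono_ennreal one)
    also have "\<dots> = ennreal ((1 - ?p) ^ n)" using p1 by (simp add: ennreal_power)
    finally show ?thesis .
  qed
  have "(\<lambda>n. ennreal ((1 - ?p) ^ n)) \<longlonglongrightarrow> ennreal 0"
  proof (intro tendsto_ennrealI LIMSEQ_realpow_zero)
    show "0 \<le> 1 - ?p" "1 - ?p < 1" using p1 b by auto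
  qed
  then have "(\<integral>\<^sup>+w. of_bool (\<forall>j. \<not> escapes w (x j)) \<partial>Om d T) \<le> ennreal 0"
    by (rule LIMSEQ_le_const) (auto intro: pw)
  then have "(\<integral>\<^sup>+w. of_bool (\<forall>j. \<not> escapes w (x j)) \<partial>Om d T) = 0" by simp
  then have "AE w in Om d T. (of_bool (\<forall>j. \<not> escapes w (x j)) :: ennreal) = 0"
    by (subst (asm) nn_integral_0_iff_AE) (auto intro!: measurable_of_bool)
  then show ?thesis
  proof eventually_elim
    case (elim w)
    then show ?case using x by (auto simp: of_bool_def split: if_splits)
  qed
qed

section \<open>Finite clusters within a short time slot\<close>

definition slot :: "real \<Rightarrow> nat \<Rightarrow> real set" where
  "slot h i = {real i * h..<(real i + 1) * h}"

lemma sets_slot [measurable]: "slot h i \<in> sets borel"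
  by (simp add: slot_def)

text \<open>Within one time slot of length below \<open>1/m\<close> the edges that ring form subcritical
  percolation clusters.\<close>
lemma AE_slot_cluster:
  assumes v: "v \<in> tree_verts d" and h: "0 < h" "real m * h \<le> 1 / 2"
  shows "AE w in Om d T. \<exists>n. \<forall>u. length u = n \<and> set u \<subseteq> {..<m} \<longrightarrow>
    (\<exists>k\<in>{1..n}. w (v @ take k u) \<inter> slot h i = {})"
proof -
  define U where "U n = {u. set u \<subseteq> {..<m} \<and> length u = n}" for n
  let ?open = "\<lambda>w n u. \<forall>k\<in>{1..n}. \<not> w (v @ take k u) \<inter> slot h i = {}"
  have finU: "finite (U n)" and cardU: "card (U n) = m ^ n" for n
    unfolding U_def by (simp_all add: finite_lists_length_eq card_lists_length_eq)
  have mo: "Measurable.pred (Om d T) (\<lambda>w. w c \<inter> slot h i = {})" for c by measurable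
  have e1: "(\<integral>\<^sup>+w. of_bool (\<not> w c \<inter> slot h i = {}) \<partial>Om d T) \<le> ennreal h" if c: "c \<in> tree_edges d" for c
  proof -
    have "(\<integral>\<^sup>+w. of_bool (\<not> w c \<inter> slot h i = {}) \<partial>Om d T) = ennreal (Om.prob {w \<in> space (Om d T). \<not> w c \<inter> slot h i = {}})"
      by (rule emeasure_of_bool) (use mo in measurable)
    also have "Om.prob {w \<in> space (Om d T). \<not> w c \<inter> slot h i = {}} = 1 - Om.prob {w \<in> space (Om d T). w c \<inter> slot h i = {}}"
      by (rule Om.prob_neg) (use mo in measurable)
    also have "Om.prob {w \<in> space (Om d T). w c \<inter> slot h i = {}} = exp (- vol T (slot h i))"
      using prob_edge_void[OF c sets_slot, of h i] emeasure_of_bool[OF mo, of c] by (simp add: measure_nonneg)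
    also have "1 - exp (- vol T (slot h i)) \<le> vol T (slot h i)"
      using exp_ge_add_one_self[of "- vol T (slot h i)"] by simp
    also have "vol T (slot h i) \<le> h"
    proof -
      have "measure lborel (slot h i \<inter> {0<..<T}) \<le> measure lborel (slot h i)"
        using h by (intro measure_mono_fmeasurable) (auto simp: slot_def algebra_simps intro!: fmeasurableI)
      also have "\<dots> = h" using h by (simp add: slot_def algebra_simps)
      finally show ?thesis by (simp add: vol_def)
    qed
    finally show ?thesis by (simp add: ennreal_leI)
  qed
  have mop: "Measurable.pred (Om d T) (\<lambda>w. \<exists>u\<in>U n. ?open w n u)" for n
    using finU[of n] mo by measurable
  have pn: "(\<integral>\<^sup>+w. of_bool (\<exists>u\<in>U n. ?open w n u) \<partial>Om d T) \<le> ennreal ((1 / 2) ^ n)" for n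
  proof -
    \<comment> \<open>Union bound over the m^n descending paths; the edges of one path are
      independent, which gives (m h)^n.\<close>
    have "(\<integral>\<^sup>+w. of_bool (\<exists>u\<in>U n. ?open w n u) \<partial>Om d T) \<le>
       (\<integral>\<^sup>+w. (\<Sum>u\<in>U n. \<Prod>k\<in>{1..n}. of_bool (\<not> w (v @ take k u) \<inter> slot h i = {})) \<partial>Om d T)"
    proof (rule nn_integral_mono)
      fix w
      show "of_bool (\<exists>u\<in>U n. ?open w n u) \<le> (\<Sum>u\<in>U n. \<Prod>k\<in>{1..n}. of_bool (\<not> w (v @ take k u) \<inter> slot h i = {}) :: ennreal)"
      proof (cases "\<exists>u\<in>U n. ?open w n u")
        case True
        then obtain u where u: "u \<in> U n" "?open w n u" by blast
        have "(\<Prod>k\<in>{1..n}. of_bool (\<not> w (v @ take k u) \<inter> slot h i = {}) :: ennreal) = 1"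
          by (rule prod.neutral) (use u(2) in auto)
        then show ?thesis
          using member_le_sum[OF u(1) _ finU, of "\<lambda>u. \<Prod>k\<in>{1..n}. of_bool (\<not> w (v @ take k u) \<inter> slot h i = {}) :: ennreal"] True
          by simp
      next
        case False
        then show ?thesis by (simp only: of_bool_def if_False zero_le)
      qed
    qed
    also have "\<dots> = (\<Sum>u\<in>U n. \<integral>\<^sup>+w. (\<Prod>k\<in>{1..n}. of_bool (\<not> w (v @ take k u) \<inter> slot h i = {})) \<partial>Om d T)"
      using mo by (intro nn_integral_sum borel_measurable_prod_ennreal measurable_of_bool) measurable
    also have "\<dots> \<le> (\<Sum>u\<in>U n. ennreal (h ^ n))"
    proof (rule sum_mono)
      fix u assume u: "u \<in> U n"
      have "(\<integral>\<^sup>+w. (\<Prod>k\<in>{1..n}. of_bool (\<not> w (v @ take k u) \<inter> slot h i = {})) \<partial>Om d T) =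
        (\<Prod>k\<in>{1..n}. \<integral>\<^sup>+w. of_bool (\<not> w (v @ take k u) \<inter> slot h i = {}) \<partial>Om d T)"
      proof (rule nn_integral_indep_prod[where K="\<lambda>k. {v @ take k u}"])
        fix k l assume "k \<in> {1..n}" "l \<in> {1..n}" "k \<noteq> l"
        then have "length (take k u) \<noteq> length (take l u)" using u by (auto simp: U_def)
        then have "take k u \<noteq> take l u" by metis
        then show "{v @ take k u} \<inter> {v @ take l u} = {}" by simp
      next
        fix k
        show "(\<lambda>w. of_bool (\<not> w (v @ take k u) \<inter> slot h i = {}) :: ennreal) \<in> borel_measurable (Om d T)"
          using mo by (intro measurable_of_bool) measurable
      qed (auto simp: dep_def)
      also have "\<dots> \<le> (\<Prod>k\<in>{1..n}. ennreal h)"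
      proof (intro prod_mono_ennreal e1)
        fix k assume "k \<in> {1..n}"
        then have "take k u \<noteq> []" "set (take k u) \<subseteq> {..<m}" using u set_take_subset[of k u] by (auto simp: U_def)
        then show "v @ take k u \<in> tree_edges d" using v by (auto simp: tree_edges_def tree_verts_def)
      qed
      also have "\<dots> = ennreal (h ^ n)" using h by (simp add: ennreal_power)
      finally show "(\<integral>\<^sup>+w. (\<Prod>k\<in>{1..n}. of_bool (\<not> w (v @ take k u) \<inter> slot h i = {})) \<partial>Om d T) \<le> ennreal (h ^ n)" .
    qed
    also have "\<dots> = ennreal ((real m * h) ^ n)"
      using h by (simp add: cardU ennreal_of_nat_eq_real_of_nat ennreal_mult'[symmetric] power_mult_distrib del: One_nat_def)
    also have "\<dots> \<le> ennreal ((1 / 2) ^ n)" using h by (intro ennreal_leI power_mono) auto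
    finally show ?thesis .
  qed
  have "(\<lambda>n. ennreal ((1 / 2) ^ n)) \<longlonglongrightarrow> ennreal 0"
    by (intro tendsto_ennrealI LIMSEQ_realpow_zero) auto
  moreover have "(\<integral>\<^sup>+w. of_bool (\<forall>n. \<exists>u\<in>U n. ?open w n u) \<partial>Om d T) \<le> ennreal ((1 / 2) ^ n)" for n
    by (rule order_trans[OF nn_integral_mono pn[of n]]) auto
  ultimately have "(\<integral>\<^sup>+w. of_bool (\<forall>n. \<exists>u\<in>U n. ?open w n u) \<partial>Om d T) \<le> ennreal 0"
    by (intro LIMSEQ_le_const) auto
  then have "(\<integral>\<^sup>+w. of_bool (\<forall>n. \<exists>u\<in>U n. ?open w n u) \<partial>Om d T) = 0" by simp
  then have "AE w in Om d T. (of_bool (\<forall>n. \<exists>u\<in>U n. ?open w n u) :: ennreal) = 0"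
    using mop by (subst (asm) nn_integral_0_iff_AE) (auto intro!: measurable_of_bool)
  then show ?thesis
  proof eventually_elim
    case (elim w)
    then obtain n where "\<not> (\<exists>u\<in>U n. ?open w n u)" by (auto simp: of_bool_def split: if_splits)
    then show ?case unfolding U_def by blast
  qed
qed

end

section \<open>From the walk to the permutation\<close>

lemma (in pole) moving_SucD:
  "moving s (Suc k) \<Longrightarrow> moving s k \<and> 0 \<le> u s k \<and> nxt S (u s k) \<notin> E"
  by (auto simp: moving_def)

definition bars :: "nat \<Rightarrow> real \<Rightarrow> (vert \<times> nat \<Rightarrow> real) \<Rightarrow> vert \<Rightarrow> real set" where
  "bars d T \<omega>0 = (\<lambda>c\<in>tree_edges d. ringset T (\<lambda>k. \<omega>0 (c, k)))"

lemma mem_bars: "c \<in> tree_edges d \<Longrightarrow> b \<in> bars d T \<omega>0 c \<longleftrightarrow> 0 < b \<and> b \<le> T \<and> (\<exists>k. b = ring_time \<omega>0 c k)"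
  by (simp add: bars_def ringset_def ring_time_def)

lemma PiM_indep_coordinates:
  fixes I :: "'i set"
  assumes I: "I \<noteq> {}" and N: "\<And>i. prob_space (N i)"
  shows "prob_space.indep_vars (PiM I N) N (\<lambda>i x. x i) I"
proof -
  interpret prob_space "PiM I N" by (rule prob_space_PiM[OF N])
  have "distr (PiM I N) (PiM I N) (\<lambda>x. \<lambda>i\<in>I. x i) = distr (PiM I N) (PiM I N) (\<lambda>x. x)"
    by (rule distr_cong) (auto simp: space_PiM)
  also have "\<dots> = (\<Pi>\<^sub>M i\<in>I. distr (PiM I N) (N i) (\<lambda>x. x i))"
    by (auto simp: distr_id intro!: PiM_cong distr_PiM_component[symmetric] N)
  finally show ?thesis by (subst indep_vars_iff_distr_eq_PiM'[OF I]) auto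
qed

context stirring
begin

text \<open>Grouping the independent gaps by edge keeps the groups independent, so the law of the
  bars is the product of its marginals, each of which is \<open>PP T\<close> by
  \<open>distr_ringset\<close>.\<close>

lemma distr_bars:
  assumes m1: "1 \<le> m"
  shows "bars d T \<in> measurable (stirring_space d) (Om d T)"
    and "distr (stirring_space d) (Om d T) (bars d T) = Om d T"
proof -
  let ?E = "tree_edges d" and ?M = "stirring_space d"
  define K where "K c = {c} \<times> (UNIV :: nat set)" for c :: vert
  define Y where "Y c f = ringset T (\<lambda>k. f (c, k))" for c :: vert and f :: "vert \<times> nat \<Rightarrow> real"
  have M: "?M = PiM (?E \<times> UNIV) (\<lambda>_. expo)" by (simp add: stirring_space_def expo_def)
  have "[0] \<in> ?E" using m1 by (simp add: tree_edges_def tree_verts_def)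
  then have ne: "?E \<noteq> {}" by blast
  interpret M: prob_space ?M unfolding M by (rule prob_space_PiM[OF prob_space_expo])
  have cm: "(\<lambda>f k. f (c, k)) \<in> measurable (PiM J (\<lambda>_. expo)) (PiM UNIV (\<lambda>_. expo))"
    if "K c \<subseteq> J" for c J
  proof (rule measurable_PiM_single')
    show "(\<lambda>f. f (c, k)) \<in> measurable (PiM J (\<lambda>_. expo)) expo" for k
      using that by (intro measurable_component_singleton) (auto simp: K_def)
  qed (auto simp: expo_def)
  have Ym: "Y c \<in> measurable (PiM J (\<lambda>_. expo)) pts" if "K c \<subseteq> J" for c J
    unfolding Y_def by (rule measurable_compose[OF cm[OF that] measurable_ringset])
  have "M.indep_vars (\<lambda>_. expo) (\<lambda>i x. x i) (?E \<times> UNIV)"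
    unfolding M by (rule PiM_indep_coordinates) (use ne prob_space_expo in auto)
  then have "M.indep_vars (\<lambda>c. PiM (K c) (\<lambda>_. expo)) (\<lambda>c x. restrict (\<lambda>i. x i) (K c)) ?E"
    by (rule M.indep_vars_restrict) (auto simp: K_def disjoint_family_on_def)
  then have "M.indep_vars (\<lambda>_. pts) (\<lambda>c x. Y c (restrict (\<lambda>i. x i) (K c))) ?E"
    by (rule M.indep_vars_compose2) (rule Ym, simp)
  then have iv: "M.indep_vars (\<lambda>_. pts) Y ?E" by (simp add: Y_def[abs_def] K_def restrict_def)
  have KE: "K c \<subseteq> ?E \<times> UNIV" if "c \<in> ?E" for c using that by (auto simp: K_def)
  have Yr: "Y c \<in> measurable ?M pts" if "c \<in> ?E" for c
    unfolding M by (rule Ym[OF KE[OF that]])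
  have marg: "distr ?M pts (Y c) = PP T" if c: "c \<in> ?E" for c
  proof -
    have "distr ?M (PiM UNIV (\<lambda>_. expo)) (\<lambda>\<omega>. \<lambda>n\<in>UNIV. \<omega> (c, n)) = PiM UNIV (\<lambda>_. expo)"
      unfolding M by (rule distr_PiM_reindex) (use c prob_space_expo in \<open>auto simp: inj_on_def\<close>)
    then have "distr ?M (PiM UNIV (\<lambda>_. expo)) (\<lambda>\<omega> n. \<omega> (c, n)) = PiM UNIV (\<lambda>_. expo)"
      by (simp add: restrict_UNIV)
    then have "PP T = distr (distr ?M (PiM UNIV (\<lambda>_. expo)) (\<lambda>\<omega> n. \<omega> (c, n))) pts (ringset T)"
      using distr_ringset[OF T] by simp
    also have "\<dots> = distr ?M pts (Y c)"
      unfolding M by (subst distr_distr[OF measurable_ringset cm[OF KE[OF c]]]) (simp add: Y_def[abs_def] comp_def)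
    finally show ?thesis by simp
  qed
  have bars: "bars d T = (\<lambda>x. \<lambda>c\<in>?E. Y c x)" by (simp add: bars_def Y_def fun_eq_iff)
  have sets: "sets (Om d T) = sets (PiM ?E (\<lambda>_. pts))" by (rule sets_Om)
  have "bars d T \<in> measurable ?M (PiM ?E (\<lambda>_. pts))"
    unfolding bars by (rule measurable_restrict) (rule Yr)
  then show "bars d T \<in> measurable ?M (Om d T)" by (simp cong: measurable_cong_sets add: sets)
  have "distr ?M (Om d T) (bars d T) = distr ?M (PiM ?E (\<lambda>_. pts)) (bars d T)"
    by (rule distr_cong) (simp_all add: sets)
  also have "\<dots> = (\<Pi>\<^sub>M c\<in>?E. distr ?M pts (Y c))"
    using iv unfolding bars by (subst (asm) M.indep_vars_iff_distr_eq_PiM'[OF ne Yr]) auto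
  also have "\<dots> = Om d T" unfolding Om_def by (rule PiM_cong) (auto simp: marg)
  finally show "distr ?M (Om d T) (bars d T) = Om d T" .
qed

section \<open>Cyclic hops versus steps of the stirring model\<close>

lemma incident_eq:
  assumes v: "v \<in> tree_verts d"
  shows "incident d v = (if v = [] then {} else {v}) \<union> (\<lambda>i. v @ [i]) ` {..<m}"
proof (intro set_eqI iffI)
  fix c assume "c \<in> incident d v"
  then have c: "c \<in> tree_edges d" "v = c \<or> v = butlast c" by (auto simp: incident_def)
  show "c \<in> (if v = [] then {} else {v}) \<union> (\<lambda>i. v @ [i]) ` {..<m}"
  proof (cases "v = c")
    case False
    have ne: "c \<noteq> []" using c by (simp add: tree_edges_def)
    have "c = v @ [last c]" "last c < m"
      using c False ne last_in_set[OF ne] by (auto simp: tree_edges_def tree_verts_def)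
    then show ?thesis by blast
  qed (use c in \<open>auto simp: tree_edges_def\<close>)
next
  fix c assume "c \<in> (if v = [] then {} else {v}) \<union> (\<lambda>i. v @ [i]) ` {..<m}"
  then show "c \<in> incident d v"
    using v edge_child[OF v] by (auto simp: incident_def tree_edges_def split: if_splits)
qed

lemma incident_edges: "incident d v \<subseteq> tree_edges d"
  by (auto simp: incident_def)

lemma finite_incident: "v \<in> tree_verts d \<Longrightarrow> finite (incident d v)"
  by (simp add: incident_eq)

lemma across_vert: "c \<in> incident d v \<Longrightarrow> across c v \<in> tree_verts d"
  by (auto simp: incident_def across_def tree_edges_def tree_verts_def dest: in_set_butlastD)

lemma across_cases:
  assumes "v \<in> tree_verts d" "c \<in> incident d v"
  obtains "c = v" "v \<noteq> []" "across c v = butlast v" | i where "i < m" "c = v @ [i]" "across c v = v @ [i]"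
  using assms by (auto simp: incident_eq across_def split: if_splits)

text \<open>Common ground for the recursive \<open>ret\<close> and the linear
  \<open>stir_step\<close>: cross whichever incident bar comes next on the time circle.\<close>

definition hop :: "(vert \<Rightarrow> real set) \<Rightarrow> vert \<times> real \<Rightarrow> vert \<times> real \<Rightarrow> bool" where
  "hop w p q \<longleftrightarrow> (\<exists>c\<in>incident d (fst p). snd q \<in> w c \<and> fst q = across c (fst p) \<and>
     (\<forall>c'\<in>incident d (fst p). \<forall>b\<in>w c'. cd T (snd p) (snd q) \<le> cd T (snd p) b))"

text \<open>Unrolls the recursion into single hops. Returns are carried along with escapes because
  all excursions before the last one are spliced in as hop sequences.
  \<open>w v \<subseteq> E\<close> puts every bar incident to \<open>v\<close> among the
  competitors.\<close>

lemma ret_hop: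
  assumes r: "regular w" and v: "v \<in> tree_edges d" and e: "entry m T w v E" and E: "w v \<subseteq> E" and s: "s \<in> E"
  shows "(ret m n w v E s = -1 \<longrightarrow> (\<exists>u t. length u = n \<and> (hop w)\<^sup>*\<^sup>* (v, s) (v @ u, t))) \<and>
    (ret m n w v E s \<in> w v \<longrightarrow> (hop w)\<^sup>*\<^sup>* (v, s) (butlast v, ret m n w v E s))"
  using v e E s
proof (induction n arbitrary: v E s)
  case 0
  have "(hop w)\<^sup>*\<^sup>* (v, s) (v @ [], s)" by simp
  moreover have "-1 \<notin> w v" using regular_range[OF r 0(1), of "-1"] by auto
  ultimately show ?case by auto
next
  case (Suc n)
  note vt = edge_vert[OF Suc.prems(1)]
  note reg = regular_reg[OF r vt]
  interpret pole T E "{..<m}" "\<lambda>i. w (v @ [i])" "crho m n w v"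
    by (rule ret_pole[OF reg Suc.prems(2)])
  have vne: "v \<noteq> []" using Suc.prems(1) by (simp add: tree_edges_def)
  have ret: "ret m (Suc n) w v E s = pexit E S (crho m n w v) s" unfolding S_def ret.simps ..
  have Sw: "b \<in> S" if "c \<in> incident d v" "b \<in> w c" for b c
    using that Suc.prems(3) unfolding incident_eq[OF vt] S_def by (auto split: if_splits)
  have hop: "hop w (v, t) (across c v, nxt S t)" if "t \<in> S" "c \<in> incident d v" "nxt S t \<in> w c" for t c
    unfolding hop_def using that nxtS(2)[OF that(1)] Sw by auto
  have kid: "\<exists>i<m. nxt S t \<in> w (v @ [i]) \<and> child_at w v (nxt S t) = v @ [i] \<and> hop w (v, t) (v @ [i], nxt S t)"
    if t: "t \<in> S" "nxt S t \<notin> E" for t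
  proof -
    obtain i where i: "i < m" "nxt S t \<in> w (v @ [i])" using S_cases[OF nxtS(1)[OF t(1)] t(2)] by auto
    moreover have "v @ [i] \<in> incident d v" "across (v @ [i]) v = v @ [i]"
      using i by (auto simp: incident_eq[OF vt] across_def)
    ultimately show ?thesis using hop[OF t(1), of "v @ [i]"] child_at_eq[OF reg i] by auto
  qed
  have IH: "(crho m n w v b = -1 \<longrightarrow> (\<exists>u t. length u = n \<and> (hop w)\<^sup>*\<^sup>* (v @ [i], b) ((v @ [i]) @ u, t))) \<and>
     (crho m n w v b \<in> w (v @ [i]) \<longrightarrow> (hop w)\<^sup>*\<^sup>* (v @ [i], b) (v, crho m n w v b))"
    if "i < m" "child_at w v b = v @ [i]" "b \<in> w (v @ [i])" for i b
    using Suc.IH[OF edge_child[OF vt that(1)] reg_child(2)[OF reg that(1)] subset_refl that(3)] that(2) by simp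
  have walk: "(hop w)\<^sup>*\<^sup>* (v, s) (v, u s k)" if "moving s k" "0 \<le> u s k" for k
    using that
  proof (induction k)
    case (Suc k)
    have mk: "moving s k" and uk: "0 \<le> u s k" and nE: "nxt S (u s k) \<notin> E"
      using moving_SucD[OF Suc.prems(1)] by blast+
    note uS = u_nonneg[OF \<open>s \<in> E\<close> uk]
    obtain i where i: "i < m" "nxt S (u s k) \<in> w (v @ [i])" "child_at w v (nxt S (u s k)) = v @ [i]"
      "hop w (v, u s k) (v @ [i], nxt S (u s k))" using kid[OF uS nE] by blast
    have eq: "u s (Suc k) = crho m n w v (nxt S (u s k))" by (rule moving_Suc[OF Suc.prems(1)])
    have "crho m n w v (nxt S (u s k)) = -1 \<or> crho m n w v (nxt S (u s k)) \<in> w (v @ [i])"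
      unfolding i(3) by (rule ret_range[OF reg_child[OF reg i(1)] i(2)])
    moreover have "crho m n w v (nxt S (u s k)) \<noteq> -1" using Suc.prems(2) unfolding eq by linarith
    ultimately have "crho m n w v (nxt S (u s k)) \<in> w (v @ [i])" by blast
    then have "(hop w)\<^sup>*\<^sup>* (v @ [i], nxt S (u s k)) (v, u s (Suc k))"
      using IH[OF i(1,3,2)] unfolding eq by blast
    with Suc.IH[OF mk uk] i(4) show ?case by (meson converse_rtranclp_into_rtranclp rtranclp_trans)
  next
    case 0
    show ?case unfolding u_0 by (rule rtranclp.rtrancl_refl)
  qed
  show ?case
  proof (intro conjI impI)
    assume "ret m (Suc n) w v E s = -1"
    then obtain k where k: "moving s k" "u s k = -1"
      using pexit_success_iff[OF Suc.prems(4)] unfolding ret by blast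
    have "s \<noteq> -1" using Suc.prems(4) range by auto
    then have "k \<noteq> 0" using k(2) u_0 by metis
    then obtain j where j: "k = Suc j" using not0_implies_Suc by blast
    have mj: "moving s j" and uj: "0 \<le> u s j" and nE: "nxt S (u s j) \<notin> E"
      using moving_SucD[OF k(1)[unfolded j]] by blast+
    obtain i where i: "i < m" "nxt S (u s j) \<in> w (v @ [i])" "child_at w v (nxt S (u s j)) = v @ [i]"
      "hop w (v, u s j) (v @ [i], nxt S (u s j))" using kid[OF u_nonneg[OF Suc.prems(4) uj] nE] by blast
    have "crho m n w v (nxt S (u s j)) = -1" using moving_Suc[OF k(1)[unfolded j]] k(2) unfolding j by argo
    then obtain z t where z: "length z = n" "(hop w)\<^sup>*\<^sup>* (v @ [i], nxt S (u s j)) ((v @ [i]) @ z, t)"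
      using IH[OF i(1,3,2)] by blast
    have "(hop w)\<^sup>*\<^sup>* (v, s) (v @ (i # z), t)"
      using walk[OF mj uj] i(4) z(2) by (simp add: rtranclp_trans[OF rtranclp.rtrancl_into_rtrancl])
    then show "\<exists>u t. length u = Suc n \<and> (hop w)\<^sup>*\<^sup>* (v, s) (v @ u, t)"
      using z(1) by (metis length_Cons)
  next
    assume rt: "ret m (Suc n) w v E s \<in> w v"
    define y where "y = ret m (Suc n) w v E s"
    have y: "y \<in> w v" using rt unfolding y_def .
    have "-1 \<notin> w v" using regular_range[OF r Suc.prems(1), of "-1"] by auto
    with y have "y \<noteq> -1" by blast
    then obtain k where k: "moving s k" "0 \<le> u s k" "nxt S (u s k) = y" "u s k \<in> S"
      using pexit_returnE[OF Suc.prems(4)] unfolding y_def ret by blast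
    have "v \<in> incident d v" "across v v = butlast v" using vne by (auto simp: incident_eq[OF vt] across_def)
    then have "hop w (v, u s k) (butlast v, y)" using hop[OF k(4), of v] y unfolding k(3) by argo
    with walk[OF k(1,2)] show "(hop w)\<^sup>*\<^sup>* (v, s) (butlast v, ret m (Suc n) w v E s)"
      unfolding y_def by (rule rtranclp.rtrancl_into_rtrancl)
  qed
qed

text \<open>By regularity the earliest ring time belongs to a single edge, so the choice made by
  \<open>SOME\<close> cannot affect the new state.\<close>

lemma stir_step_eq:
  assumes r: "regular (bars d T \<omega>0)" and s: "0 \<le> s" and c: "c \<in> incident d v" and b: "b \<in> bars d T \<omega>0 c" "s < b"
    and least: "\<And>c' b'. c' \<in> incident d v \<Longrightarrow> b' \<in> bars d T \<omega>0 c' \<Longrightarrow> s < b' \<Longrightarrow> b \<le> b'"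
  shows "stir_step d \<omega>0 T (v, s) = (across c v, b)"
proof -
  let ?C = "candidates d \<omega>0 T v s"
  let ?f = "\<lambda>p. p \<in> ?C \<and> (\<forall>q\<in>?C. ring_time \<omega>0 (fst p) (snd p) \<le> ring_time \<omega>0 (fst q) (snd q))"
  have C: "(c', k) \<in> ?C \<longleftrightarrow> c' \<in> incident d v \<and> ring_time \<omega>0 c' k \<in> bars d T \<omega>0 c' \<and> s < ring_time \<omega>0 c' k" for c' k
    using s mem_bars[of c' d "ring_time \<omega>0 c' k" T \<omega>0] subsetD[OF incident_edges, of c' v] unfolding candidates_def by auto
  obtain k where k: "b = ring_time \<omega>0 c k" using b mem_bars[of c d b T \<omega>0] incident_edges[of v] c by auto
  have "(c, k) \<in> ?C" using c b unfolding C k by blast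
  moreover have "ring_time \<omega>0 c k \<le> ring_time \<omega>0 (fst q) (snd q)" if "q \<in> ?C" for q
    using least[of "fst q" "ring_time \<omega>0 (fst q) (snd q)"] that C[of "fst q" "snd q"] unfolding k by simp
  ultimately have ck: "?f (c, k)" by simp
  have "ring_time \<omega>0 (fst p) (snd p) = b \<and> fst p = c" if p: "?f p" for p
  proof -
    obtain c' k' where p': "p = (c', k')" by (cases p)
    have "ring_time \<omega>0 c' k' = b" using p ck unfolding p' k by (auto intro!: antisym)
    moreover have "c' = c"
    proof (rule ccontr)
      assume "c' \<noteq> c"
      moreover have "c' \<in> tree_edges d" "c \<in> tree_edges d" "b \<in> bars d T \<omega>0 c'"
        using p c incident_edges[of v] \<open>ring_time \<omega>0 c' k' = b\<close> C unfolding p' by auto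
      ultimately show False using regular_disj[OF r, of c' c] b(1) by auto
    qed
    ultimately show ?thesis by (simp add: p')
  qed
  moreover have "?f (SOME p. ?f p)" by (rule someI[of ?f, OF ck])
  ultimately have "ring_time \<omega>0 (fst (SOME p. ?f p)) (snd (SOME p. ?f p)) = b" "fst (SOME p. ?f p) = c" by blast+
  then show ?thesis using ck unfolding stir_step_def Let_def fst_conv snd_conv by (subst if_P) auto
qed

lemma stir_step_stay:
  assumes s: "0 \<le> s" and none: "\<And>c b. c \<in> incident d v \<Longrightarrow> b \<in> bars d T \<omega>0 c \<Longrightarrow> b \<le> s"
  shows "stir_step d \<omega>0 T (v, s) = (v, s)"
proof -
  have "candidates d \<omega>0 T v s = {}"
    using none s mem_bars[of _ d _ T \<omega>0] incident_edges[of v] unfolding candidates_def by (force simp: not_less)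
  then show ?thesis by (simp add: stir_step_def)
qed

lemma stir_step_cases:
  assumes r: "regular (bars d T \<omega>0)" and v: "v \<in> tree_verts d" and s: "0 \<le> s"
  obtains "stir_step d \<omega>0 T (v, s) = (v, s)" "\<And>c b. c \<in> incident d v \<Longrightarrow> b \<in> bars d T \<omega>0 c \<Longrightarrow> b \<le> s"
  | c b where "c \<in> incident d v" "b \<in> bars d T \<omega>0 c" "s < b" "stir_step d \<omega>0 T (v, s) = (across c v, b)"
proof (cases "\<exists>c\<in>incident d v. \<exists>b\<in>bars d T \<omega>0 c. s < b")
  case True
  define B where "B = (\<Union>c\<in>incident d v. bars d T \<omega>0 c) \<inter> {s<..}"
  have fin: "finite B" unfolding B_def
    using finite_incident[OF v] regular_finite[OF r] incident_edges[of v] by blast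
  have ne: "B \<noteq> {}" using True by (auto simp: B_def)
  have "Min B \<in> B" by (rule Min_in[OF fin ne])
  then obtain c where c: "c \<in> incident d v" "Min B \<in> bars d T \<omega>0 c" "s < Min B" by (auto simp: B_def)
  have "stir_step d \<omega>0 T (v, s) = (across c v, Min B)"
  proof (rule stir_step_eq[OF r s c])
    fix c' b' assume "c' \<in> incident d v" "b' \<in> bars d T \<omega>0 c'" "s < b'"
    then have "b' \<in> B" by (auto simp: B_def)
    then show "Min B \<le> b'" by (rule Min_le[OF fin])
  qed
  then show ?thesis using that(2) c by blast
next
  case False
  then show ?thesis using that(1) stir_step_stay[OF s] by (meson not_less)
qed

text \<open>A hop that wraps past time \<open>T\<close> is the end of one lap, where
  \<open>stir_step\<close> is stationary, followed by the first step of a new lap from time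
  0.\<close>

lemma hop_stir_step:
  assumes r: "regular (bars d T \<omega>0)" and v: "v \<in> tree_verts d" and t: "0 \<le> t" and h: "hop (bars d T \<omega>0) (v, t) q"
  shows "q = stir_step d \<omega>0 T (v, t) \<or> stir_step d \<omega>0 T (v, t) = (v, t) \<and> q = stir_step d \<omega>0 T (v, 0)"
proof -
  obtain c b where c: "c \<in> incident d v" "b \<in> bars d T \<omega>0 c" "q = (across c v, b)"
    and le: "\<And>c' b'. c' \<in> incident d v \<Longrightarrow> b' \<in> bars d T \<omega>0 c' \<Longrightarrow> cd T t b \<le> cd T t b'"
    using h unfolding hop_def by (metis fst_conv prod.exhaust_sel snd_conv)
  have rng: "0 < b' \<and> b' < T" if "c' \<in> incident d v" "b' \<in> bars d T \<omega>0 c'" for c' b'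
    using regular_range[OF r] that incident_edges[of v] by blast
  show ?thesis
  proof (cases "t < b")
    case True
    have "stir_step d \<omega>0 T (v, t) = (across c v, b)"
      by (rule stir_step_eq[OF r t c(1,2) True]) (use le True in \<open>fastforce simp: cd_def\<close>)
    then show ?thesis using c(3) by simp
  next
    case False
    have all: "b' \<le> t" if "c' \<in> incident d v" "b' \<in> bars d T \<omega>0 c'" for c' b'
      using le[OF that] rng[OF that] rng[OF c(1,2)] False by (auto simp: cd_def split: if_splits)
    have "stir_step d \<omega>0 T (v, 0) = (across c v, b)"
      by (rule stir_step_eq[OF r _ c(1,2)]) (use le all False rng[OF c(1,2)] in \<open>fastforce simp: cd_def\<close>)+
    then show ?thesis using stir_step_stay[OF t all] c(3) by simp
  qed
qed

end

lemma incseq_nat_eventually_const: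
  fixes g :: "nat \<Rightarrow> nat"
  assumes "incseq g" "\<And>k. g k \<le> N"
  shows "\<exists>k0. \<forall>k\<ge>k0. g k = g k0"
proof -
  have fin: "finite (range g)" by (rule finite_subset[of _ "{..N}"]) (use assms(2) in auto)
  have "Max (range g) \<in> range g" by (rule Max_in[OF fin]) simp
  then obtain k0 where k0: "Max (range g) = g k0" by (rule rangeE)
  have "g k = g k0" if "k0 \<le> k" for k
  proof (rule antisym)
    show "g k \<le> g k0" unfolding k0[symmetric] by (rule Max_ge[OF fin]) simp
    show "g k0 \<le> g k" by (rule incseqD[OF assms(1) that])
  qed
  then show ?thesis by blast
qed

section \<open>No explosion within one lap\<close>

context stirring
begin

definition subcritical :: "real \<Rightarrow> (vert \<Rightarrow> real set) \<Rightarrow> bool" where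
  "subcritical h w \<longleftrightarrow> (\<forall>v\<in>tree_verts d. \<forall>i. \<exists>n. \<forall>u. length u = n \<and> set u \<subseteq> {..<m} \<longrightarrow>
    (\<exists>k\<in>{1..n}. w (v @ take k u) \<inter> slot h i = {}))"

lemma AE_subcritical:
  assumes h: "0 < h" "real m * h \<le> 1 / 2"
  shows "AE w in Om d T. subcritical h w"
  unfolding subcritical_def
  by (subst AE_ball_countable, simp) (intro ballI AE_all_countable[THEN iffD2] allI AE_slot_cluster h)

lemma stir_steps_range:
  assumes r: "regular (bars d T \<omega>0)" and y: "y \<in> tree_verts d"
  shows "fst ((stir_step d \<omega>0 T ^^ k) (y, 0)) \<in> tree_verts d \<and> 0 \<le> snd ((stir_step d \<omega>0 T ^^ k) (y, 0)) \<and>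
    snd ((stir_step d \<omega>0 T ^^ k) (y, 0)) \<le> T"
proof (induction k)
  case (Suc k)
  obtain v s where p: "(stir_step d \<omega>0 T ^^ k) (y, 0) = (v, s)" by fastforce
  then have v: "v \<in> tree_verts d" "0 \<le> s" "s \<le> T" using Suc.IH by auto
  show ?case
  proof (rule stir_step_cases[OF r v(1,2)])
    assume "stir_step d \<omega>0 T (v, s) = (v, s)"
    then show ?thesis using p v by simp
  next
    fix c b assume c: "c \<in> incident d v" "b \<in> bars d T \<omega>0 c" "s < b" "stir_step d \<omega>0 T (v, s) = (across c v, b)"
    then have "b < T" using regular_range[OF r] incident_edges[of v] by blast
    then show ?thesis using p v c across_vert[OF c(1)] by simp
  qed
qed (use y T in simp)

text \<open>If the particle kept jumping, its increasing times would end up in one slot. From then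
  on it would stay in a finite cluster of edges that ring in this slot, whose finitely many bars
  cannot supply infinitely many jump times.\<close>

lemma stir_stabilises:
  assumes r: "regular (bars d T \<omega>0)" and y: "y \<in> tree_verts d" and h: "0 < h" and sub: "subcritical h (bars d T \<omega>0)"
  shows "\<exists>k. (stir_step d \<omega>0 T ^^ Suc k) (y, 0) = (stir_step d \<omega>0 T ^^ k) (y, 0)"
proof (rule ccontr)
  let ?w = "bars d T \<omega>0"
  define v where "v k = fst ((stir_step d \<omega>0 T ^^ k) (y, 0))" for k
  define t where "t k = snd ((stir_step d \<omega>0 T ^^ k) (y, 0))" for k
  have vt: "(stir_step d \<omega>0 T ^^ k) (y, 0) = (v k, t k)" for k by (simp add: v_def t_def)
  assume ns: "\<nexists>k. (stir_step d \<omega>0 T ^^ Suc k) (y, 0) = (stir_step d \<omega>0 T ^^ k) (y, 0)"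
  have rng: "v k \<in> tree_verts d" "0 \<le> t k" "t k \<le> T" for k
    using stir_steps_range[OF r y, of k] by (auto simp: v_def t_def)
  have step: "\<exists>c\<in>incident d (v k). t (Suc k) \<in> ?w c \<and> t k < t (Suc k) \<and> v (Suc k) = across c (v k)" for k
  proof (rule stir_step_cases[OF r rng(1,2)[of k]])
    assume "stir_step d \<omega>0 T (v k, t k) = (v k, t k)"
    then have "(stir_step d \<omega>0 T ^^ Suc k) (y, 0) = (stir_step d \<omega>0 T ^^ k) (y, 0)" by (simp add: vt)
    then show ?thesis using ns by blast
  next
    fix c b assume c: "c \<in> incident d (v k)" "b \<in> ?w c" "t k < b" "stir_step d \<omega>0 T (v k, t k) = (across c (v k), b)"
    then have "(v (Suc k), t (Suc k)) = (across c (v k), b)" using vt[of "Suc k"] vt[of k] by simp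
    then show ?thesis using c by auto
  qed
  have sm: "strict_mono t" using step by (intro strict_monoI_Suc) blast
  define g where "g k = nat \<lfloor>t k / h\<rfloor>" for k
  have inc: "incseq g" unfolding g_def
    using sm h by (intro incseq_SucI nat_mono floor_mono divide_right_mono) (auto simp: strict_mono_Suc_iff less_imp_le)
  have bd: "g k \<le> nat \<lfloor>T / h\<rfloor>" for k unfolding g_def
    using rng(3)[of k] h by (intro nat_mono floor_mono divide_right_mono) auto
  obtain k0 where k0: "\<And>k. k0 \<le> k \<Longrightarrow> g k = g k0" using incseq_nat_eventually_const[OF inc bd] by blast
  have slot: "t k \<in> slot h (g k0)" if "k0 \<le> k" for k
  proof -
    have "real (g k0) = of_int \<lfloor>t k / h\<rfloor>"
      using rng(2)[of k] h unfolding k0[OF that, symmetric] by (simp add: g_def)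
    then have "real (g k0) \<le> t k / h" "t k / h < real (g k0) + 1" by linarith+
    then show ?thesis using h by (simp add: slot_def field_simps)
  qed
  \<comment> \<open>A vertex of least depth visited during the last slot; the particle never steps
    above it again, so all later vertices are its descendants.\<close>
  obtain k1 where k1: "k0 \<le> k1" "\<And>k. k0 \<le> k \<Longrightarrow> length (v k1) \<le> length (v k)"
    using ex_has_least_nat[of "\<lambda>k. k0 \<le> k" k0 "\<lambda>k. length (v k)"] by blast
  let ?a = "v k1"
  obtain n where n: "\<And>u. length u = n \<Longrightarrow> set u \<subseteq> {..<m} \<Longrightarrow> \<exists>k\<in>{1..n}. ?w (?a @ take k u) \<inter> slot h (g k0) = {}"
    using sub rng(1) unfolding subcritical_def by meson
  have desc: "\<exists>u. v (k1 + j) = ?a @ u \<and> set u \<subseteq> {..<m} \<and> (\<forall>k\<in>{1..length u}. ?w (?a @ take k u) \<inter> slot h (g k0) \<noteq> {})" for j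
  proof (induction j)
    case 0
    show ?case by (rule exI[of _ "[]"]) simp
  next
    case (Suc j)
    then obtain u where u: "v (k1 + j) = ?a @ u" "set u \<subseteq> {..<m}"
      "\<And>k. 1 \<le> k \<Longrightarrow> k \<le> length u \<Longrightarrow> ?w (?a @ take k u) \<inter> slot h (g k0) \<noteq> {}" by auto
    obtain c where c: "c \<in> incident d (v (k1 + j))" "t (k1 + Suc j) \<in> ?w c" "v (k1 + Suc j) = across c (v (k1 + j))"
      using step[of "k1 + j"] by auto
    have ts: "t (k1 + Suc j) \<in> slot h (g k0)" using k1(1) by (intro slot) simp
    show ?case
    proof (rule across_cases[OF rng(1) c(1)])
      assume a: "c = v (k1 + j)" "v (k1 + j) \<noteq> []" "across c (v (k1 + j)) = butlast (v (k1 + j))"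
      have "u \<noteq> []"
      proof
        assume "u = []"
        then have "length (v (k1 + Suc j)) < length ?a" using a c(3) u(1) by simp
        then show False using k1(2)[of "k1 + Suc j"] k1(1) by simp
      qed
      then have "v (k1 + Suc j) = ?a @ butlast u" using a c(3) u(1) by (simp add: butlast_append)
      moreover have "set (butlast u) \<subseteq> {..<m}" using u(2) by (meson in_set_butlastD subset_iff)
      moreover have "?w (?a @ take k (butlast u)) \<inter> slot h (g k0) \<noteq> {}" if "k \<in> {1..length (butlast u)}" for k
      proof -
        have "take k (butlast u) = take k u" using that by (simp add: butlast_conv_take min_absorb1)
        moreover have "1 \<le> k" "k \<le> length u" using that by auto
        ultimately show ?thesis using u(3)[of k] by simp
      qed
      ultimately show ?thesis by blast
    next
      fix i assume a: "i < m" "c = v (k1 + j) @ [i]" "across c (v (k1 + j)) = v (k1 + j) @ [i]"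
      have "?w (?a @ take k (u @ [i])) \<inter> slot h (g k0) \<noteq> {}" if "k \<in> {1..length (u @ [i])}" for k
      proof (cases "k \<le> length u")
        case True
        then show ?thesis using u(3)[of k] that by simp
      next
        case False
        then have "?a @ take k (u @ [i]) = c" using a u(1) by simp
        then show ?thesis using c(2) ts by blast
      qed
      then show ?thesis using a u(1,2) c(3) by (intro exI[of _ "u @ [i]"]) auto
    qed
  qed
  define F where "F = {?a @ u | u. set u \<subseteq> {..<m} \<and> length u \<le> n}"
  have "finite F"
  proof -
    have "F = (\<lambda>u. ?a @ u) ` {u. set u \<subseteq> {..<m} \<and> length u \<le> n}" by (auto simp: F_def)
    then show ?thesis using finite_lists_length_le[of "{..<m}" n] by simp
  qed
  have vF: "v (k1 + j) \<in> F" for j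
  proof -
    obtain u where u: "v (k1 + j) = ?a @ u" "set u \<subseteq> {..<m}"
      "\<And>k. 1 \<le> k \<Longrightarrow> k \<le> length u \<Longrightarrow> ?w (?a @ take k u) \<inter> slot h (g k0) \<noteq> {}" using desc[of j] by auto
    have "length u \<le> n"
    proof (rule ccontr)
      assume "\<not> length u \<le> n"
      then have l: "length (take n u) = n" by simp
      have "set (take n u) \<subseteq> {..<m}" using u(2) set_take_subset[of n u] by blast
      then obtain k where k: "1 \<le> k" "k \<le> n" "?w (?a @ take k (take n u)) \<inter> slot h (g k0) = {}"
        using n[OF l] by auto
      then show False using u(3)[of k] \<open>\<not> length u \<le> n\<close> by (simp add: min_absorb1)
    qed
    then show ?thesis using u by (auto simp: F_def)
  qed
  let ?B = "\<Union>x\<in>F \<inter> tree_verts d. \<Union>c\<in>incident d x. ?w c"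
  have "finite ?B"
  proof (rule finite_UN_I)
    fix x assume "x \<in> F \<inter> tree_verts d"
    then have "finite (incident d x)" by (simp add: finite_incident)
    then show "finite (\<Union>c\<in>incident d x. ?w c)"
      by (rule finite_UN_I) (rule regular_finite[OF r subsetD[OF incident_edges]])
  qed (use \<open>finite F\<close> in simp)
  moreover have "range (\<lambda>j. t (Suc (k1 + j))) \<subseteq> ?B"
  proof (rule image_subsetI)
    fix j
    obtain c where "c \<in> incident d (v (k1 + j))" "t (Suc (k1 + j)) \<in> ?w c" using step[of "k1 + j"] by blast
    moreover have "v (k1 + j) \<in> F \<inter> tree_verts d" using vF rng(1) by simp
    ultimately show "t (Suc (k1 + j)) \<in> ?B" by (intro UN_I)
  qed
  ultimately have "finite (range (\<lambda>j. t (Suc (k1 + j))))" by (rule finite_subset[rotated])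
  moreover have "inj (\<lambda>j. t (Suc (k1 + j)))" using strict_mono_eq[OF sm] by (auto simp: inj_def)
  ultimately show False using finite_imageD by blast
qed

text \<open>\<open>R\<close> collects the states of all laps started from the orbit of
  \<open>x\<close> under the permutation, and it is closed under hops. A finite orbit would have
  finitely many laps, each finite, hence bounded depth, against the escape of
  \<open>x\<close>.\<close>

lemma infinite_cycle:
  assumes r: "regular (bars d T \<omega>0)" and h: "0 < h" and sub: "subcritical h (bars d T \<omega>0)"
    and x: "x \<in> tree_edges d" and esc: "escapes (bars d T \<omega>0) x"
    and ent: "\<forall>i<m. 0 \<notin> bars d T \<omega>0 (x @ [i])"
  shows "has_infinite_cycle (tree_verts d) (stir_perm d \<omega>0 T)"
proof -
  let ?w = "bars d T \<omega>0"
  define f where "f y k = (stir_step d \<omega>0 T ^^ k) (y, 0)" for y k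
  let ?\<sigma> = "stir_perm d \<omega>0 T"
  define O' where "O' = range (\<lambda>n. (?\<sigma> ^^ n) x)"
  have xv: "x \<in> tree_verts d" by (rule edge_vert[OF x])
  have f0: "f y 0 = (y, 0)" for y by (simp add: f_def)
  have fS: "f y (Suc k) = stir_step d \<omega>0 T (f y k)" for y k by (simp add: f_def)
  have const: "f y (k + j) = f y k" if "f y (Suc k) = f y k" for y k j
    by (induction j) (use that in \<open>simp_all add: fS\<close>)
  have perm: "?\<sigma> y = fst (f y k)" if "f y (Suc k) = f y k" for y k
  proof -
    define n where "n = (LEAST n. f y (Suc n) = f y n)"
    have n: "f y (Suc n) = f y n" "n \<le> k" unfolding n_def using that by (auto intro: LeastI Least_le)
    have "?\<sigma> y = fst (f y n)" unfolding stir_perm_def n_def f_def using that f_def by auto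
    then show ?thesis using const[OF n(1), of "k - n"] n(2) by simp
  qed
  have stab: "\<exists>k. f y (Suc k) = f y k" if "y \<in> tree_verts d" for y
    using stir_stabilises[OF r that h sub] by (simp add: f_def)
  have rng: "fst (f y k) \<in> tree_verts d" "0 \<le> snd (f y k)" if "y \<in> tree_verts d" for y k
    using stir_steps_range[OF r that, of k] by (auto simp: f_def)
  have Ov: "O' \<subseteq> tree_verts d"
  proof -
    have "(?\<sigma> ^^ n) x \<in> tree_verts d" for n
    proof (induction n)
      case (Suc n)
      obtain k where "f ((?\<sigma> ^^ n) x) (Suc k) = f ((?\<sigma> ^^ n) x) k" using stab[OF Suc.IH] by blast
      from perm[OF this] show ?case using rng(1)[OF Suc.IH] by simp
    qed (use xv in simp)
    then show ?thesis by (auto simp: O'_def)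
  qed
  have O\<sigma>: "?\<sigma> y \<in> O'" if "y \<in> O'" for y
  proof -
    obtain n where "y = (?\<sigma> ^^ n) x" using \<open>y \<in> O'\<close> by (auto simp: O'_def)
    then have "?\<sigma> y = (?\<sigma> ^^ Suc n) x" by simp
    then show ?thesis unfolding O'_def by blast
  qed
  define R where "R = (\<Union>y\<in>O'. range (f y))"
  have close: "q \<in> R" if p: "p \<in> R" and "hop ?w p q" for p q
  proof -
    obtain y k where y: "y \<in> O'" "p = f y k" using p by (auto simp: R_def)
    then have yv: "y \<in> tree_verts d" using Ov by blast
    \<comment> \<open>Second case: the lap has ended, the particle sits at the image of
      \<open>y\<close>, and \<open>q\<close> is the first state of the lap from there.\<close>
    consider "q = f y (Suc k)" | "f y (Suc k) = f y k" "q = stir_step d \<omega>0 T (fst p, 0)"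
      using hop_stir_step[OF r rng(1)[OF yv, of k] rng(2)[OF yv, of k], of q] \<open>hop ?w p q\<close>
      by (auto simp: y(2) fS)
    then show ?thesis
    proof cases
      case 1
      then show ?thesis using y(1) by (auto simp: R_def)
    next
      case 2
      have "q = f (?\<sigma> y) 1" using 2 perm[OF 2(1)] by (simp add: y(2) fS f0)
      then show ?thesis using O\<sigma>[OF y(1)] by (auto simp: R_def)
    qed
  qed
  have reach: "q \<in> R" if "(hop ?w)\<^sup>*\<^sup>* (x, 0) q" for q
    using that
  proof (induction rule: rtranclp_induct)
    case base
    have "x \<in> O'" unfolding O'_def by (rule range_eqI[of _ _ 0]) simp
    then show ?case using f0[of x] by (metis (no_types, lifting) R_def UN_iff rangeI)
  qed (rule close)
  have "infinite O'"
  proof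
    assume "finite O'"
    moreover have "finite (range (f y))" if y: "y \<in> O'" for y
    proof -
      obtain k where k: "f y (Suc k) = f y k" using stab[OF subsetD[OF Ov y]] by blast
      have "f y j \<in> f y ` {..k}" for j
      proof (cases "j \<le> k")
        case False
        then show ?thesis using const[OF k, of "j - k"] by auto
      qed simp
      then show ?thesis by (meson finite_atMost finite_imageI finite_subset image_subsetI)
    qed
    ultimately have "finite (length ` fst ` R)" by (simp add: R_def)
    then obtain N where N: "\<And>l. l \<in> length ` fst ` R \<Longrightarrow> l \<le> N" by (meson finite_nat_set_iff_bounded_le)
    have "\<exists>n\<ge>Suc N. ret m n ?w x {0} 0 = -1" using esc unfolding escapes_def by blast
    then obtain n where n: "n \<ge> Suc N" "ret m n ?w x {0} 0 = -1" by blast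
    have "entry m T ?w x {0}" using T ent by (simp add: entry_def)
    moreover have "?w x \<subseteq> {0}" using esc by (simp add: escapes_def)
    ultimately obtain u t where u: "length u = n" "(hop ?w)\<^sup>*\<^sup>* (x, 0) (x @ u, t)"
      using ret_hop[OF r x, of "{0}" 0 n] n(2) by blast
    then have "length (x @ u) \<in> length ` fst ` R" using reach[OF u(2)] by force
    then show False using N[of "length (x @ u)"] u(1) n(1) by simp
  qed
  then show ?thesis using xv unfolding has_infinite_cycle_def O'_def by blast
qed

theorem infinite_cycles_AE:
  assumes m2: "2 \<le> m" and b: "0 < \<beta>"
    and low: "\<And>n x. x \<in> tree_edges d \<Longrightarrow> ennreal \<beta> \<le> (\<integral>\<^sup>+w. of_bool (ret m n w x {0} 0 = -1) \<partial>Om d T)"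
  shows "AE \<omega>0 in stirring_space d. has_infinite_cycle (tree_verts d) (stir_perm d \<omega>0 T)"
proof -
  define h where "h = 1 / (2 * real m)"
  have h: "0 < h" "real m * h \<le> 1 / 2" using m2 by (auto simp: h_def)
  have esc: "AE w in Om d T. \<exists>x\<in>tree_edges d. escapes w x"
    by (rule AE_escapes[OF m2 b]) (rule low)
  have z: "AE w in Om d T. \<forall>x\<in>tree_edges d. \<forall>i<m. 0 \<notin> w (x @ [i])"
    by (subst AE_ball_countable, simp) (use AE_notin_children edge_vert in blast)
  have "AE w in Om d T. regular w \<and> subcritical h w \<and> (\<exists>x\<in>tree_edges d. escapes w x) \<and>
      (\<forall>x\<in>tree_edges d. \<forall>i<m. 0 \<notin> w (x @ [i]))"
    using AE_regular AE_subcritical[OF h] esc z by eventually_elim blast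
  then have "AE w in distr (stirring_space d) (Om d T) (bars d T). regular w \<and> subcritical h w \<and>
      (\<exists>x\<in>tree_edges d. escapes w x) \<and> (\<forall>x\<in>tree_edges d. \<forall>i<m. 0 \<notin> w (x @ [i]))"
    using m2 by (subst distr_bars(2)) auto
  then have "AE \<omega>0 in stirring_space d. regular (bars d T \<omega>0) \<and> subcritical h (bars d T \<omega>0) \<and>
      (\<exists>x\<in>tree_edges d. escapes (bars d T \<omega>0) x) \<and> (\<forall>x\<in>tree_edges d. \<forall>i<m. 0 \<notin> bars d T \<omega>0 (x @ [i]))"
    using m2 by (intro AE_distrD[OF distr_bars(1)]) auto
  then show ?thesis
    by eventually_elim (use infinite_cycle h(1) in blast)
qed

end

section \<open>The range of parameters\<close>

text \<open>Uses exp (-T) \<ge> 1 - T and T = y / M; the product of the two factors is at least 1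
  minus the sum of their losses T and y^2 / (6 M).\<close>

lemma growth_rate_lower:
  fixes M y T :: real
  assumes M: "1286 \<le> M" and T: "0 < T" and y: "y = M * T" "y \<le> 30"
  shows "y * (1 - (y + y ^ 2 / 6) / M) \<le> M * exp (- T) * (T - (M - 1) * T ^ 3 / 6)"
proof -
  have y0: "0 < y" using M T y(1) by simp
  have "M * T \<le> M * 1" using y M by linarith
  moreover have "0 < M" using M by simp
  ultimately have T1: "T \<le> 1" by (rule mult_left_le_imp_le)
  have "y ^ 2 \<le> 30 ^ 2" using y0 y(2) by (intro power_mono) auto
  then have q: "0 \<le> 1 - y ^ 2 / (6 * M)" using M by (simp add: field_simps)
  have yM: "y / M = T" using M y(1) by simp
  have "y * (1 - (y + y ^ 2 / 6) / M) \<le> y * ((1 - T) * (1 - y ^ 2 / (6 * M)))"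
  proof (rule mult_left_mono)
    have "(y + y ^ 2 / 6) / M = T + y ^ 2 / (6 * M)" using M by (simp add: yM add_divide_distrib)
    moreover have "0 \<le> T * (y ^ 2 / (6 * M))" using T M by simp
    moreover have "(1 - T) * (1 - q) = 1 - (T + q) + T * q" for q by (simp add: algebra_simps)
    ultimately show "1 - (y + y ^ 2 / 6) / M \<le> (1 - T) * (1 - y ^ 2 / (6 * M))" by simp
  qed (use y0 in simp)
  also have "\<dots> = M * ((1 - T) * (T * (1 - y ^ 2 / (6 * M))))" by (simp add: y(1))
  also have "\<dots> \<le> M * (exp (- T) * (T - (M - 1) * T ^ 3 / 6))"
  proof (intro mult_left_mono mult_mono)
    show "1 - T \<le> exp (- T)" using exp_ge_add_one_self[of "- T"] by simp
    have "T * (1 - y ^ 2 / (6 * M)) = T - M * T ^ 3 / 6"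
      using M by (simp add: y(1) field_simps power2_eq_square power3_eq_cube)
    also have "\<dots> \<le> T - (M - 1) * T ^ 3 / 6" using T by (simp add: field_simps)
    finally show "T * (1 - y ^ 2 / (6 * M)) \<le> T - (M - 1) * T ^ 3 / 6" .
    show "0 \<le> T * (1 - y ^ 2 / (6 * M))" using q T by simp
  qed (use M T1 in auto)
  finally show ?thesis by (simp add: mult.assoc)
qed

text \<open>For y \<ge> 2 a crude bound is enough. Below 2 the convex function y^2 + y^3 / 6 is
  bounded by its chord from 1 to 2, which starts at 7/6 and has slope 25/6; both constants in the
  condition on \<open>c\<close> stem from it.\<close>

lemma growth_rate_gt_1:
  fixes M y c :: real
  assumes M: "1286 \<le> M" and y: "y \<le> 30" "M * (y - 1) \<ge> c" and c: "0 < c" "7 / 6 < c * (1 - 25 / (6 * M))"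
  shows "1 < y * (1 - (y + y ^ 2 / 6) / M)"
proof (cases "2 \<le> y")
  case True
  have "y ^ 2 \<le> 30 ^ 2" using True y(1) by (intro power_mono) auto
  \<comment> \<open>At \<open>y = 30\<close> the numerator is 180.\<close>
  then have "(y + y ^ 2 / 6) / M \<le> 1 / 4" using M y(1) by (simp add: field_simps)
  then have "2 * (3 / 4) \<le> y * (1 - (y + y ^ 2 / 6) / M)" using True by (intro mult_mono) auto
  then show ?thesis by (rule less_le_trans[rotated]) simp
next
  case False
  define z where "z = y - 1"
  have z: "z \<le> 1" "c \<le> M * z" using False y(2) by (auto simp: z_def)
  then have z0: "0 < z" using c(1) M by (metis less_le_trans zero_less_mult_pos order_less_le_trans zero_less_numeral)
  have "7 / 6 < c * (1 - 25 / (6 * M))" by (rule c(2))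
  also have "\<dots> \<le> M * z * (1 - 25 / (6 * M))" using z(2) M by (intro mult_right_mono) (auto simp: field_simps)
  also have "\<dots> = M * z - 25 / 6 * z" using M by (simp add: field_simps)
  finally have "7 / 6 + 25 / 6 * z < M * z" by simp
  moreover have "y ^ 2 + y ^ 3 / 6 \<le> 7 / 6 + 25 / 6 * z"
  proof -
    have "z * z \<le> 1" using z(1) z0 by (intro mult_le_one) auto
    then have "0 \<le> z * (5 / 3 - 3 / 2 * z - z * z / 6)" using z0 z(1) by (intro mult_nonneg_nonneg) auto
    also have "\<dots> = 7 / 6 + 25 / 6 * z - ((1 + z) ^ 2 + (1 + z) ^ 3 / 6)"
      by (simp add: power2_eq_square power3_eq_cube field_simps)
    finally show ?thesis by (simp add: z_def)
  qed
  ultimately have "(y ^ 2 + y ^ 3 / 6) / M < z" using M by (simp add: divide_less_eq mult.commute)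
  moreover have "y * (1 - (y + y ^ 2 / 6) / M) = y - (y ^ 2 + y ^ 3 / 6) / M"
    by (simp add: algebra_simps power2_eq_square power3_eq_cube add_divide_distrib)
  ultimately show ?thesis by (simp add: z_def)
qed

text \<open>At \<open>k = 9/10\<close> two attempts succeed with probability 0.41875. After the
  factor 0.99 for exp (-h), the loss of at most 1/160 for bad returns, and the factors 0.98 and 0.9,
  more than 0.34 is left, which exceeds 1/4.\<close>

lemma retry_bound:
  fixes h k :: real
  assumes h: "0 \<le> h" "h \<le> 1 / 200" and k: "9 / 10 \<le> k" "k \<le> 1"
  defines "a \<equiv> 1 / 4" and "g \<equiv> 2 * h + (exp h - 1)"
  shows "a \<le> exp (- 2 * h) * (exp (- h) * (k * a + (1 - k * a) * a) - k * a * g) * k"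
    and "0 \<le> exp (- h) * (k * a + (1 - k * a) * a) - k * a * g"
proof -
  have "exp h \<le> 1 + h + h ^ 2" using h by (intro exp_bound) auto
  moreover have "h ^ 2 \<le> h * 1" unfolding power2_eq_square using h by (intro mult_left_mono) auto
  ultimately have g: "g \<le> 1 / 40" "0 \<le> g" using h by (auto simp: g_def)
  have e1: "99 / 100 \<le> exp (- h)" using exp_ge_add_one_self[of "- h"] h by simp
  have e2: "98 / 100 \<le> exp (- 2 * h)" using exp_ge_add_one_self[of "- 2 * h"] h by simp
  let ?C = "exp (- h) * (k * a + (1 - k * a) * a) - k * a * g"
  have "99 / 100 * (41 / 100) \<le> exp (- h) * (k * a + (1 - k * a) * a)"
    using k e1 by (intro mult_mono) (auto simp: a_def field_simps)
  moreover have "k * a * g \<le> 1 / 4 * (1 / 40)" using k g by (intro mult_mono) (auto simp: a_def)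
  ultimately have C: "39 / 100 \<le> ?C" by simp
  then show "0 \<le> ?C" by simp
  have "98 / 100 * (39 / 100) * (9 / 10) \<le> exp (- 2 * h) * ?C * k"
    using k e2 C by (intro mult_mono) auto
  then show "a \<le> exp (- 2 * h) * ?C * k" by (simp add: a_def)
qed

lemma (in stirring) escape_bound:
  assumes d: "1287 \<le> d" and c: "0 < c" "7 / 6 < c * (1 - 25 / (6 * real m))" "c \<le> real m * (real m * T - 1)"
  shows "\<exists>\<beta>>0. \<forall>n. \<forall>x\<in>tree_edges d. ennreal \<beta> \<le> (\<integral>\<^sup>+w. of_bool (ret m n w x {0} 0 = -1) \<partial>Om d T)"
proof (cases "real m * T \<le> 30")
  case True
  have M: "1286 \<le> real m" using d by simp
  define G where "G = real m * exp (- T) * (T - real (m - 1) * T ^ 3 / 6)"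
  have "real (m - 1) = real m - 1" using d by (simp add: of_nat_diff)
  then have "real m * T * (1 - (real m * T + (real m * T) ^ 2 / 6) / real m) \<le> G"
    unfolding G_def by (simp only:) (rule growth_rate_lower[OF M T refl True])
  moreover have "1 < real m * T * (1 - (real m * T + (real m * T) ^ 2 / 6) / real m)"
    by (rule growth_rate_gt_1[OF M True c(3,1,2)])
  ultimately have G: "1 < G" by linarith
  \<comment> \<open>This choice makes the quadratic Bonferroni loss at most \<open>\<beta>\<close>
    times the surplus \<open>G - 1\<close>. It depends on \<open>m\<close> and \<open>T\<close>, but
    not on \<open>n\<close>.\<close>
  define \<beta> where "\<beta> = min 1 (2 * (G - 1) / (real m) ^ 2)"
  have m0: "0 < real m" using M by linarith
  have b: "0 < \<beta>" using G m0 by (simp add: \<beta>_def)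
  have b1: "\<beta> \<le> 1" by (simp add: \<beta>_def)
  have "\<beta> \<le> 2 * (G - 1) / (real m) ^ 2" by (simp add: \<beta>_def)
  then have b2: "\<beta> * (real m) ^ 2 \<le> 2 * (G - 1)" using m0 by (simp add: pos_le_divide_eq)
  have gr: "1 + (G - 1) \<le> real m * exp (- T) * (T - real (m - 1) * T ^ 3 / 6)" by (simp only: G_def)
  have "ennreal \<beta> \<le> (\<integral>\<^sup>+w. of_bool (ret m n w x {0} 0 = -1) \<partial>Om d T)" if "x \<in> tree_edges d" for n x
    by (rule low_regime[OF less_imp_le[OF b] b1 gr b2 edge_vert[OF that] order_refl T])
  then show ?thesis using b by blast
next
  case False
  have M: "1286 \<le> real m" using d by simp
  have m2: "2 \<le> m" using d by simp
  \<comment> \<open>Long enough for (m - 1) h \<ge> 4, hence a bar is met with probability at least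
    9/10, and short enough for the losses of order \<open>h\<close>; \<open>2 * h \<le> T\<close>
    amounts to m T \<ge> 10.\<close>
  define h where "h = 5 / real m"
  have h: "0 \<le> h" "h \<le> 1 / 200" using M by (auto simp: h_def field_simps)
  have hT: "2 * h \<le> T" using False M by (simp add: h_def field_simps)
  have mh: "4 \<le> real (m - 1) * h" using M m2 by (simp add: h_def of_nat_diff field_simps)
  \<comment> \<open>The Taylor bound gives exp 4 \<ge> 13, more than the 10 that is
    required.\<close>
  have "1 + 4 + 4 ^ 2 / 2 \<le> exp (4 :: real)" by (rule exp_lower_Taylor_quadratic) simp
  also have "\<dots> \<le> exp (real (m - 1) * h)" using mh by (simp only: exp_le_cancel_iff)
  finally have "exp (- (real (m - 1) * h)) \<le> 1 / 10" by (simp add: exp_minus field_simps)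
  then have k: "9 / 10 \<le> 1 - exp (- real (m - 1) * h)" "1 - exp (- real (m - 1) * h) \<le> 1" by auto
  have "ennreal (1 / 4) \<le> (\<integral>\<^sup>+w. of_bool (ret m n w x {0} 0 = -1) \<partial>Om d T)" if "x \<in> tree_edges d" for n x
    by (rule high_regime[OF m2 h(1) hT _ _ retry_bound[OF h k] that order_refl T]) auto
  then show ?thesis by (intro exI[of _ "1 / 4"]) simp
qed

text \<open>At the left end of the interval m (m T - 1) equals \<open>c\<close>, and it increases
  with \<open>T\<close>. For large \<open>d\<close> the value \<open>c\<close> is close to a - 1, so
  the requirement becomes a > 1 + 7/6.\<close>

lemma mem_inf_cycle_params:
  fixes d :: nat and a T :: real
  defines "c \<equiv> (1 - 1 / real d) * (a - 1 - a / real d)"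
  assumes d: "1287 \<le> d" and a: "0 \<le> a" and c: "0 < c" "7 / 6 < c * (1 - 5 / real d)"
    and ge: "1 / real d + a / (real d)\<^sup>2 \<le> T"
  shows "T \<in> inf_cycle_params d"
proof -
  have d0: "0 < real d" using d by simp
  have md: "real (d - 1) = real d - 1" using d by (simp add: of_nat_diff)
  have "0 < 1 / real d + a / (real d)\<^sup>2" using d0 a by (intro add_pos_nonneg) auto
  then have T0: "0 < T" using ge by linarith
  interpret stirring d T by standard (rule T0)
  have "c = real m * (real m * (1 / real d + a / (real d)\<^sup>2) - 1)"
    unfolding md c_def using d0 by (simp add: field_simps power2_eq_square)
  also have "\<dots> \<le> real m * (real m * T - 1)"
    by (intro mult_left_mono diff_right_mono ge) simp_all
  finally have cm: "c \<le> real m * (real m * T - 1)" .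
  have "25 / (6 * real m) \<le> 5 / real d" unfolding md using d by (simp add: field_simps)
  then have "c * (1 - 5 / real d) \<le> c * (1 - 25 / (6 * real m))" using c(1) by (intro mult_left_mono) auto
  with c(2) have c2: "7 / 6 < c * (1 - 25 / (6 * real m))" by (rule less_le_trans)
  obtain \<beta> where \<beta>: "0 < \<beta>"
    "\<And>n x. x \<in> tree_edges d \<Longrightarrow> ennreal \<beta> \<le> (\<integral>\<^sup>+w. of_bool (ret m n w x {0} 0 = -1) \<partial>Om d T)"
    using escape_bound[OF d c(1) c2 cm] by blast
  have "AE \<omega>0 in stirring_space d. has_infinite_cycle (tree_verts d) (stir_perm d \<omega>0 T)"
    by (rule infinite_cycles_AE[OF _ \<beta>(1)]) (use d \<beta>(2) in auto)
  then show ?thesis using T0 by (simp add: inf_cycle_params_def)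
qed

theorem theorem4:
  shows "(\<forall>d0::nat. d0 \<ge> 1287 \<longrightarrow>
            {1 / real d0 + 3 / (real d0)^2 ..} \<subseteq> inf_cycle_params d0)
       \<and> (\<forall>\<epsilon>::real. \<epsilon> > 0 \<longrightarrow> (\<exists>d0'::nat. \<forall>d0::nat. d0 \<ge> 2 \<longrightarrow> d0 \<ge> d0' \<longrightarrow>
            {1 / real d0 + (13/6 + \<epsilon>) / (real d0)^2 ..} \<subseteq> inf_cycle_params d0))"
proof (intro conjI allI impI)
  fix d0 :: nat assume d: "1287 \<le> d0"
  let ?c = "(1 - 1 / real d0) * (3 - 1 - 3 / real d0)"
  \<comment> \<open>Here \<open>a = 3\<close>, so \<open>c\<close> is close to 2 and 1.62 remains
    after the correction factor, above 7/6.\<close>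
  have "99 / 100 * (19 / 10) \<le> ?c" using d by (intro mult_mono) (auto simp: field_simps)
  then have c: "18 / 10 \<le> ?c" by simp
  have "18 / 10 * (9 / 10) \<le> ?c * (1 - 5 / real d0)"
    using c d by (intro mult_mono) (auto simp: field_simps)
  then show "{1 / real d0 + 3 / (real d0)\<^sup>2..} \<subseteq> inf_cycle_params d0"
    using mem_inf_cycle_params[OF d, of 3] c by auto
next
  fix \<epsilon> :: real assume e: "0 < \<epsilon>"
  let ?a = "13 / 6 + \<epsilon>"
  let ?c = "\<lambda>n. (1 - 1 / real n) * (?a - 1 - ?a / real n)"
  have i: "(\<lambda>n. x / real n) \<longlonglongrightarrow> 0" for x by (rule lim_const_over_n)
  have c: "?c \<longlonglongrightarrow> (1 - 0) * (?a - 1 - 0)" by (intro tendsto_intros i)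
  \<comment> \<open>The limit is 7/6 + \<epsilon>.\<close>
  have "(\<lambda>n. ?c n * (1 - 5 / real n)) \<longlonglongrightarrow> (1 - 0) * (?a - 1 - 0) * (1 - 0)" by (intro tendsto_intros i)
  then have "\<forall>\<^sub>F n in sequentially. 7 / 6 < ?c n * (1 - 5 / real n)"
    by (rule order_tendstoD) (use e in simp)
  moreover have "\<forall>\<^sub>F n in sequentially. 0 < ?c n"
    by (rule order_tendstoD(1)[OF c]) (use e in simp)
  moreover have "\<forall>\<^sub>F n in sequentially. 1287 \<le> n" by (rule eventually_ge_at_top)
  ultimately have "\<forall>\<^sub>F n in sequentially. {1 / real n + ?a / (real n)\<^sup>2..} \<subseteq> inf_cycle_params n"
  proof eventually_elim
    case (elim n)
    show ?case using mem_inf_cycle_params[OF elim(3) _ elim(2,1)] e by auto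
  qed
  then show "\<exists>d0'. \<forall>d0\<ge>2. d0' \<le> d0 \<longrightarrow> {1 / real d0 + (13 / 6 + \<epsilon>) / (real d0)\<^sup>2..} \<subseteq> inf_cycle_params d0"
    unfolding eventually_sequentially by blast
qed

end
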